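(* Let $n\ge 2$, let $R_2>R_1>0$, and let $d\ge 0$ be such that $\overline{B_{R_1}}\subset B_{R_2}(d)$. Put $\Omega_d=B_{R_2}(d)\setminus\overline{B_{R_1}}\subset\mathbb{R}^n$ and $\Omega_0=B_{R_2}\setminus\overline{B_{R_1}}$. Then $$\mu_1(\Omega_d)\le \mu_1(\Omega_0).$$
   Context: For $R>0$, $B_R$ denotes the open ball in $\mathbb{R}^n$ of radius $R$ centered at the origin, and $B_R(d)=y_d+B_R$ with $y_d=(0,\dots,0,d)\in\mathbb{R}^n$. For $\Omega_d=B_{R_2}(d)\setminus\overline{B_{R_1}}$, $\mu_1(\Omega_d)$ is the first non-zero Steklov--Neumann eigenvalue, with the Neumann condition on the inner sphere and the Steklov condition on the outer sphere: it is the smallest $\mu>0$ for which $$\Delta u=0 \text{ in }\Omega_d,\qquad \frac{\partial u}{\partial\nu}=0\text{ on }\partial B_{R_1},\qquad \frac{\partial u}{\partial\nu}=\mu u\text{ on }\partial B_{R_2}(d)$$ has a non-trivial (weak) solution, where $\nu$ is the outward unit normal. Equivalently, $$\mu_1(\Omega_d)=\inf\left\{\frac{\int_{\Omega_d}|\nabla u|^2\,dV}{\int_{\partial B_{R_2}(d)}u^2\,dS}:\ u\in H^1(\Omega_d),\ u\not\equiv 0 \text{ on }\partial B_{R_2}(d),\ \int_{\partial B_{R_2}(d)}u\,dS=0\right\}.$$ *)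

theory Defs
  imports "HOL-Analysis.Analysis"
begin

section \<open>Square-integrable functions\<close>

definition L2 :: "'a measure \<Rightarrow> ('a \<Rightarrow> 'b::euclidean_space) \<Rightarrow> bool" where
  "L2 M f \<longleftrightarrow> f \<in> borel_measurable M \<and> integrable M (\<lambda>x. (norm (f x))\<^sup>2)"

definition L2_tendsto ::
    "'a measure \<Rightarrow> (nat \<Rightarrow> 'a \<Rightarrow> 'b::euclidean_space) \<Rightarrow> ('a \<Rightarrow> 'b) \<Rightarrow> bool" where
  "L2_tendsto M f u \<longleftrightarrow> (\<forall>k. L2 M (f k)) \<and> L2 M u \<and>
     (\<lambda>k. LINT x|M. (norm (f k x - u x))\<^sup>2) \<longlonglongrightarrow> 0"


section \<open>Volume and surface measure\<close>

abbreviation volume_on :: "(real^'n) set \<Rightarrow> (real^'n) measure" where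
  "volume_on \<Omega> \<equiv> restrict_space lborel \<Omega>"

text \<open>
  The surface measure on the sphere of centre \<open>c\<close> and radius \<open>R > 0\<close>, as obtained from
  polar coordinates: a Borel set \<open>A\<close> of the sphere has area \<open>n / R\<close> times the volume of
  the cone \<open>{c + r (x - c) | x \<in> A, 0 < r < 1}\<close>. This cone is the preimage of \<open>A\<close> under
  the radial projection of the punctured ball. The measure lives on the sphere only, so
  measurability of a function with respect to it does not depend on values off the sphere.
\<close>

definition radial_proj :: "real^'n \<Rightarrow> real \<Rightarrow> real^'n \<Rightarrow> real^'n" where
  "radial_proj c R x = c + (R / norm (x - c)) *\<^sub>R (x - c)"

definition sphere_measure :: "real^'n \<Rightarrow> real \<Rightarrow> (real^'n) measure" where
  "sphere_measure c R =
     scale_measure (ennreal (real CARD('n) / R))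
       (distr (volume_on (ball c R - {c})) (restrict_space borel (sphere c R)) (radial_proj c R))"

lemma radial_proj_measurable:
  fixes c :: "real^'n"
  assumes "R > 0"
  shows "radial_proj c R \<in>
    measurable (volume_on (ball c R - {c})) (restrict_space borel (sphere c R))"
proof (rule measurable_restrict_space2)
  show "radial_proj c R \<in> space (volume_on (ball c R - {c})) \<rightarrow> sphere c R"
    using assms by (auto simp: radial_proj_def space_restrict_space dist_norm)
  show "radial_proj c R \<in> borel_measurable (volume_on (ball c R - {c}))"
    unfolding radial_proj_def by (rule measurable_restrict_space1) measurable
qed

lemma emeasure_sphere_measure:
  fixes c :: "real^'n"
  assumes "R > 0"
  shows "emeasure (sphere_measure c R) (sphere c R) =
    ennreal (real CARD('n) / R) * emeasure lborel (ball c R)"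
proof -
  have "radial_proj c R -` sphere c R \<inter> space (volume_on (ball c R - {c})) = ball c R - {c}"
    using measurable_space[OF radial_proj_measurable[OF assms, of c]]
    by (auto simp: space_restrict_space)
  moreover have "sphere c R \<in> sets (restrict_space borel (sphere c R))"
    by (simp add: sets_restrict_space_iff)
  moreover have "emeasure lborel (ball c R - {c}) = emeasure lborel (ball c R)"
    using assms by (subst emeasure_Diff) auto
  ultimately show ?thesis
    by (simp add: sphere_measure_def emeasure_distr radial_proj_measurable[OF assms]
        emeasure_restrict_space)
qed


section \<open>The Sobolev space \<open>H\<^sup>1\<close> and traces\<close>

text \<open>\<open>f\<close> is continuously differentiable on an open neighbourhood of \<open>S\<close>, with gradient \<open>g\<close>.\<close>

definition C1_near :: "(real^'n) set \<Rightarrow> (real^'n \<Rightarrow> real) \<Rightarrow> (real^'n \<Rightarrow> real^'n) \<Rightarrow> bool" where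
  "C1_near S f g \<longleftrightarrow>
     (\<exists>U. open U \<and> S \<subseteq> U \<and> (\<forall>x\<in>U. GDERIV f x :> g x) \<and> continuous_on U g)"

text \<open>
  The weak gradient, tested against the compactly supported \<open>C\<^sup>1\<close> functions on \<open>\<Omega>\<close>
  (extended by \<open>0\<close>).
\<close>

definition weak_gradient ::
    "(real^'n) set \<Rightarrow> (real^'n \<Rightarrow> real) \<Rightarrow> (real^'n \<Rightarrow> real^'n) \<Rightarrow> bool" where
  "weak_gradient \<Omega> u G \<longleftrightarrow>
     (\<forall>\<phi> g K. C1_near UNIV \<phi> g \<longrightarrow> compact K \<longrightarrow> K \<subseteq> \<Omega> \<longrightarrow> (\<forall>x. x \<notin> K \<longrightarrow> \<phi> x = 0) \<longrightarrow>
        (LINT x|volume_on \<Omega>. u x *\<^sub>R g x) = - (LINT x|volume_on \<Omega>. \<phi> x *\<^sub>R G x))"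

definition H1 :: "(real^'n) set \<Rightarrow> (real^'n \<Rightarrow> real) \<Rightarrow> (real^'n \<Rightarrow> real^'n) \<Rightarrow> bool" where
  "H1 \<Omega> u G \<longleftrightarrow> L2 (volume_on \<Omega>) u \<and> L2 (volume_on \<Omega>) G \<and> weak_gradient \<Omega> u G"

text \<open>
  \<open>t\<close> is the trace of \<open>u \<in> H\<^sup>1(\<Omega>)\<close> on a boundary sphere with surface measure \<open>S\<close>: the
  \<open>L\<^sup>2(S)\<close>-limit of the boundary values of functions in \<open>C\<^sup>1\<close> up to the boundary that converge
  to \<open>u\<close> in \<open>H\<^sup>1(\<Omega>)\<close>. On the domains considered below every \<open>H\<^sup>1\<close> function has exactly one
  trace, up to null sets.
\<close>

definition H1_trace :: "(real^'n) set \<Rightarrow> (real^'n) measure \<Rightarrow>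
    (real^'n \<Rightarrow> real) \<Rightarrow> (real^'n \<Rightarrow> real^'n) \<Rightarrow> (real^'n \<Rightarrow> real) \<Rightarrow> bool" where
  "H1_trace \<Omega> S u G t \<longleftrightarrow> H1 \<Omega> u G \<and>
     (\<exists>f g. (\<forall>k. C1_near (closure \<Omega>) (f k) (g k)) \<and>
        L2_tendsto (volume_on \<Omega>) f u \<and> L2_tendsto (volume_on \<Omega>) g G \<and> L2_tendsto S f t)"


section \<open>The Steklov--Neumann problem\<close>

definition annular_domain :: "real \<Rightarrow> real \<Rightarrow> real^'n \<Rightarrow> (real^'n) set" where
  "annular_domain R1 R2 y = ball y R2 - cball 0 R1"

text \<open>
  The weak form of \<open>\<Delta>u = 0\<close> in \<open>\<Omega>\<close>, \<open>\<partial>u/\<partial>\<nu> = 0\<close> on the inner sphere, \<open>\<partial>u/\<partial>\<nu> = \<mu> u\<close> on the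
  outer sphere. Since the test functions \<open>v\<close> are arbitrary on the inner sphere, the Neumann
  condition is the natural boundary condition there.
\<close>

definition steklov_neumann_solution :: "real \<Rightarrow> real \<Rightarrow> real^'n \<Rightarrow> real \<Rightarrow>
    (real^'n \<Rightarrow> real) \<Rightarrow> (real^'n \<Rightarrow> real^'n) \<Rightarrow> (real^'n \<Rightarrow> real) \<Rightarrow> bool" where
  "steklov_neumann_solution R1 R2 y \<mu> u G t \<longleftrightarrow>
     (let \<Omega> = annular_domain R1 R2 y; S = sphere_measure y R2 in
       H1_trace \<Omega> S u G t \<and>
       (\<forall>v H s. H1_trace \<Omega> S v H s \<longrightarrow>
          (LINT x|volume_on \<Omega>. G x \<bullet> H x) = \<mu> * (LINT x|S. t x * s x)))"

definition steklov_neumann_eigenvalue :: "real \<Rightarrow> real \<Rightarrow> real^'n \<Rightarrow> real \<Rightarrow> bool" where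
  "steklov_neumann_eigenvalue R1 R2 y \<mu> \<longleftrightarrow>
     (\<exists>u G t. steklov_neumann_solution R1 R2 y \<mu> u G t \<and>
        \<not> (AE x in volume_on (annular_domain R1 R2 y). u x = 0))"

definition mu1 :: "real \<Rightarrow> real \<Rightarrow> real^'n \<Rightarrow> real" where
  "mu1 R1 R2 y = (LEAST \<mu>. \<mu> > 0 \<and> steklov_neumann_eigenvalue R1 R2 y \<mu>)"

end

theory Submission
  imports Defs "HOL-Library.Diagonal_Subsequence" "HOL-Complex_Analysis.Great_Picard"
begin

text \<open>
  Write \<open>E\<close> for the Dirichlet energy of a function on the domain and
  \<open>N\<close> for the integral of its square over the outer sphere, and let
  \<open>\<beta> = (n - 1) (R2^n - R1^n) / (R2 ((n - 1) R2^n + R1^n))\<close>, which the proof writes as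
  \<open>steklov_weight R1 (n - 2) R2 / R2^(n - 1)\<close>. The eigenvalue of every admissible domain is the
  infimum of \<open>E / N\<close> over functions with mean zero on the outer sphere. For the concentric domain
  this infimum is at least \<open>\<beta>\<close>, for an eccentric one it is at most \<open>\<beta>\<close>.

  The lower bound is \<open>shell_inequality\<close>. On a shell the energy splits into a radial and a tangential
  part. The sharp Poincare inequality on spheres bounds the tangential part from below by the
  variance of the function on each sphere, with the factor \<open>(n - 1) / r^2\<close>. Expressing variances
  through differences of the function in two directions, one is left with an inequality on the
  interval of radii for each pair of directions; it follows from Picone's identity, since the
  weight \<open>steklov_weight\<close> solves the Riccati equation of the radial Steklov problem. The Poincare
  inequality on the sphere is obtained from two independent Gaussian vectors: the degree-one
  extension of the function is differentiated along the segment between them, and a rotation of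
  the pair turns each position on the segment into an explicit Gaussian average.

  The upper bound is \<open>rayleigh_inf_le_concentric\<close>. The first eigenfunctions of the concentric problem
  are \<open>x_i (1 + c / norm x ^ n)\<close> with \<open>c = R1^n / (n - 1)\<close>. The two summands have different natural
  centres in the eccentric domain, and the test functions \<open>(x - y)_i + c x_i / norm x ^ n\<close> respect both:
  the linear part is centred at the outer ball, the dipole at the hole. Summed over \<open>i\<close>, the squared
  gradients form a decreasing function of \<open>norm x\<close>, so moving the outer ball to the origin can only
  increase the energy. On the boundary side the sum of the variances is bounded below by
  projecting onto the coordinates, and the mixed term is the flux of a point charge at the origin
  through the outer sphere, given by Gauss's law. The two estimates combine to exactly \<open>\<beta>\<close>.

  That the eigenvalue is this infimum is \<open>mu1_eq_rayleigh_inf\<close>. Since \<open>mu1\<close> is a least element, the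
  infimum of the Rayleigh quotient has to be attained. A minimising sequence has bounded energy;
  traces of such sequences are compact in \<open>L\<^sup>2\<close> of the outer sphere (\<open>trace_compact\<close>), the
  parallelogram law makes the gradients converge as well, and the limit is a weak solution by the
  first-order condition. Testing the equation of an arbitrary eigenfunction with a constant and
  with itself shows that no positive eigenvalue is smaller. All inequalities are
  proved for functions that are \<open>C\<^sup>1\<close> up to the boundary and pass to limits by the definition of
  the trace.
\<close>


section \<open>Polar coordinates\<close>

text \<open>
  The surface measure of the unit sphere as a measure on the whole space, so that any Borel function
  can be integrated against it without regard to its domain. It is the cone measure of
  \<open>sphere_measure 0 1\<close>.
\<close>

definition sph :: "(real^'n) measure" where
  "sph = distr (density lborel (\<lambda>x. ennreal (real CARD('n)) * indicator (ball 0 1 - {0}) x))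
           borel (\<lambda>x. x /\<^sub>R norm x)"

lemma sets_sph [simp, measurable_cong]: "sets sph = sets borel"
  by (simp add: sph_def)

lemma space_sph [simp]: "space sph = UNIV"
  by (simp add: sph_def)

lemma measurable_sph_iff [simp]: "f \<in> sph \<rightarrow>\<^sub>M N \<longleftrightarrow> f \<in> borel \<rightarrow>\<^sub>M N"
  by (simp cong: measurable_cong_sets)

lemma nn_integral_sph:
  fixes F :: "real^'n \<Rightarrow> ennreal"
  assumes [measurable]: "F \<in> borel_measurable borel"
  shows "(\<integral>\<^sup>+w. F w \<partial>sph) =
    ennreal (real CARD('n)) * (\<integral>\<^sup>+x. F (x /\<^sub>R norm x) * indicator (ball 0 1 - {0}) x \<partial>lborel)"
proof -
  have [measurable]: "ball 0 1 - {0} \<in> sets (borel :: (real^'n) measure)" by simp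
  have "(\<integral>\<^sup>+w. F w \<partial>sph) = (\<integral>\<^sup>+x. ennreal (real CARD('n)) * indicator (ball 0 1 - {0}) x * F (x /\<^sub>R norm x) \<partial>lborel)"
    unfolding sph_def by (subst nn_integral_distr, simp, simp, subst nn_integral_density) auto
  also have "\<dots> = (\<integral>\<^sup>+x. ennreal (real CARD('n)) * (F (x /\<^sub>R norm x) * indicator (ball 0 1 - {0}) x) \<partial>lborel)"
    by (simp add: mult_ac)
  also have "\<dots> = ennreal (real CARD('n)) * (\<integral>\<^sup>+x. F (x /\<^sub>R norm x) * indicator (ball 0 1 - {0}) x \<partial>lborel)"
    by (rule nn_integral_cmult) auto
  finally show ?thesis .
qed

lemma AE_sph_norm: "AE w in (sph :: (real^'n) measure). norm w = 1"
  unfolding sph_def by (subst AE_distr_iff) (auto simp: AE_density indicator_def)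

lemma emeasure_sph: "emeasure (sph :: (real^'n) measure) UNIV = ennreal (real CARD('n)) * emeasure lborel (ball 0 1 :: (real^'n) set)"
proof -
  have "emeasure (sph :: (real^'n) measure) UNIV = (\<integral>\<^sup>+w. indicator UNIV w \<partial>(sph :: (real^'n) measure))"
    by simp
  also have "\<dots> = ennreal (real CARD('n)) * (\<integral>\<^sup>+x. indicator (ball 0 1 - {0}) x \<partial>(lborel :: (real^'n) measure))"
    by (subst nn_integral_sph) auto
  also have "(\<integral>\<^sup>+x. indicator (ball 0 1 - {0}) x \<partial>(lborel :: (real^'n) measure)) = emeasure lborel (ball 0 1 - {0} :: (real^'n) set)"
    by simp
  also have "\<dots> = emeasure lborel (ball 0 1 :: (real^'n) set)"
    by (subst emeasure_Diff) auto
  finally show ?thesis .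
qed

lemma finite_measure_sph: "finite_measure (sph :: (real^'n) measure)"
  by (rule finite_measureI)
     (use emeasure_lborel_ball_finite[of "0::real^'n" 1] in \<open>auto simp: emeasure_sph ennreal_mult_eq_top_iff\<close>)

interpretation sph: finite_measure "sph :: (real^'n) measure"
  by (rule finite_measure_sph)

definition sph_area :: "'n::finite itself \<Rightarrow> real" where
  "sph_area _ = measure (sph :: (real^'n) measure) UNIV"

lemma sph_area_pos: "sph_area TYPE('n::finite) > 0"
proof -
  have "emeasure (sph :: (real^'n) measure) UNIV \<noteq> 0"
    using content_ball_pos[of 1 "0 :: real^'n"] emeasure_lborel_ball_finite[of "0::real^'n" 1]
    by (auto simp: emeasure_sph measure_def)
  then show ?thesis
    by (auto simp: sph_area_def sph.emeasure_eq_measure zero_less_measure_iff)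
qed

lemma nn_integral_lborel_affine:
  fixes F :: "'a::euclidean_space \<Rightarrow> ennreal"
  assumes [measurable]: "F \<in> borel_measurable borel" and "c \<noteq> 0"
  shows "(\<integral>\<^sup>+x. F x \<partial>lborel) = ennreal (\<bar>c\<bar> ^ DIM('a)) * (\<integral>\<^sup>+x. F (t + c *\<^sub>R x) \<partial>lborel)"
  by (subst lborel_affine[OF \<open>c \<noteq> 0\<close>, of t])
     (simp add: nn_integral_density nn_integral_distr nn_integral_cmult ennreal_power)

lemma nn_integral_lborel_translate:
  fixes F :: "'a::euclidean_space \<Rightarrow> ennreal"
  assumes "F \<in> borel_measurable borel"
  shows "(\<integral>\<^sup>+x. F (t + x) \<partial>lborel) = (\<integral>\<^sup>+x. F x \<partial>lborel)"
  using nn_integral_lborel_affine[OF assms, of 1 t] by simp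

text \<open>
  Affine maps carry cones to cones, so the measure of a sphere of radius \<open>R\<close> scales like \<open>R^n / R\<close>.
\<close>

lemma nn_integral_sphere_measure:
  fixes F :: "real^'n \<Rightarrow> ennreal"
  assumes [measurable]: "F \<in> borel_measurable borel" and "R > 0"
  shows "(\<integral>\<^sup>+x. F x \<partial>sphere_measure c R) =
    ennreal (R ^ (CARD('n) - 1)) * (\<integral>\<^sup>+w. F (c + R *\<^sub>R w) \<partial>sph)"
proof -
  have [measurable]: "F \<in> borel_measurable (restrict_space borel (sphere c R))"
    by (rule measurable_restrict_space1) simp
  note [measurable] = radial_proj_measurable[OF \<open>R > 0\<close>, of c]
  have meas[measurable]: "radial_proj c R \<in> borel_measurable borel"
    unfolding radial_proj_def by measurable
  have "(\<integral>\<^sup>+x. F x \<partial>sphere_measure c R) = ennreal (real CARD('n) / R) *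
      (\<integral>\<^sup>+x. F (radial_proj c R x) * indicator (ball c R - {c}) x \<partial>lborel)"
    by (simp add: sphere_measure_def nn_integral_scale_measure nn_integral_distr nn_integral_restrict_space)
  also have "(\<integral>\<^sup>+x. F (radial_proj c R x) * indicator (ball c R - {c}) x \<partial>lborel) =
     ennreal (\<bar>R\<bar> ^ DIM(real^'n)) * (\<integral>\<^sup>+x. F (radial_proj c R (c + R *\<^sub>R x)) * indicator (ball c R - {c}) (c + R *\<^sub>R x) \<partial>lborel)"
  proof (rule nn_integral_lborel_affine)
    have [measurable]: "ball c R - {c} \<in> sets borel" by simp
    show "(\<lambda>x. F (radial_proj c R x) * indicator (ball c R - {c}) x) \<in> borel_measurable borel"
      by measurable
  qed (use \<open>R > 0\<close> in simp)
  also have "(\<integral>\<^sup>+x. F (radial_proj c R (c + R *\<^sub>R x)) * indicator (ball c R - {c}) (c + R *\<^sub>R x) \<partial>lborel) =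
      (\<integral>\<^sup>+x. F (c + R *\<^sub>R (x /\<^sub>R norm x)) * indicator (ball 0 1 - {0}) x \<partial>lborel)"
    using \<open>R > 0\<close>
    by (intro nn_integral_cong) (auto simp: radial_proj_def dist_norm indicator_def field_simps)
  also have "ennreal (real CARD('n) / R) * (ennreal (\<bar>R\<bar> ^ DIM(real^'n)) * \<dots>) =
     ennreal (R ^ (CARD('n) - 1)) * (ennreal (real CARD('n)) * \<dots>)"
  proof -
    obtain m where m: "CARD('n) = Suc m" using gr0_implies_Suc[of "CARD('n)"] by auto
    have "real CARD('n) / R * R ^ CARD('n) = R ^ (CARD('n) - 1) * real CARD('n)"
      using \<open>R > 0\<close> unfolding m by simp
    then show ?thesis
      using \<open>R > 0\<close> by (simp add: mult.assoc[symmetric] ennreal_mult[symmetric])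
  qed
  finally show ?thesis
    by (simp add: nn_integral_sph)
qed

lemma sphere_measure_eq_sph:
  fixes c :: "real^'n"
  assumes "R > 0"
  shows "distr (sphere_measure c R) borel (\<lambda>x. x) =
     density (distr sph borel (\<lambda>w. c + R *\<^sub>R w)) (\<lambda>_. ennreal (R ^ (CARD('n) - 1)))"
    (is "?A = ?B")
proof (rule measure_eqI)
  have id: "(\<lambda>x. x) \<in> sphere_measure c R \<rightarrow>\<^sub>M borel"
    by (simp add: sphere_measure_def measurable_cong_sets[OF sets_scale_measure refl] measurable_restrict_space1)
  fix A assume "A \<in> sets ?A"
  then have [measurable]: "A \<in> sets borel" by simp
  have "emeasure ?A A = (\<integral>\<^sup>+x. indicator A x \<partial>?A)"
    by (subst nn_integral_indicator) auto
  also have "\<dots> = (\<integral>\<^sup>+x. indicator A x \<partial>sphere_measure c R)"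
    by (rule nn_integral_distr[OF id]) simp
  also have "\<dots> = (\<integral>\<^sup>+x. indicator A x \<partial>?B)"
  proof -
    have aff: "(\<lambda>w. c + R *\<^sub>R w) \<in> sph \<rightarrow>\<^sub>M borel" by measurable
    have "(\<integral>\<^sup>+x. indicator A x \<partial>?B) = ennreal (R ^ (CARD('n) - 1)) * (\<integral>\<^sup>+x. indicator A x \<partial>distr sph borel (\<lambda>w. c + R *\<^sub>R w))"
      by (subst nn_integral_density) (simp_all add: nn_integral_cmult del: nn_integral_indicator)
    also have "(\<integral>\<^sup>+x. indicator A x \<partial>distr sph borel (\<lambda>w. c + R *\<^sub>R w)) = (\<integral>\<^sup>+w. indicator A (c + R *\<^sub>R w) \<partial>sph)"
      by (rule nn_integral_distr[OF aff]) simp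
    finally show ?thesis
      by (simp add: nn_integral_sphere_measure[OF _ assms])
  qed
  also have "\<dots> = emeasure ?B A"
    by (subst nn_integral_indicator) auto
  finally show "emeasure ?A A = emeasure ?B A" .
qed simp

lemma integral_sphere_measure:
  fixes F :: "real^'n \<Rightarrow> real"
  assumes [measurable]: "F \<in> borel_measurable borel" and "R > 0"
  shows "(LINT x|sphere_measure c R. F x) = R ^ (CARD('n) - 1) * (LINT w|sph. F (c + R *\<^sub>R w))"
proof -
  have id: "(\<lambda>x. x) \<in> sphere_measure c R \<rightarrow>\<^sub>M borel"
    by (simp add: sphere_measure_def measurable_cong_sets[OF sets_scale_measure refl] measurable_restrict_space1)
  have "(LINT x|sphere_measure c R. F x) = (LINT x|distr (sphere_measure c R) borel (\<lambda>x. x). F x)"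
    by (rule integral_distr[OF id, symmetric]) simp
  also have "\<dots> = R ^ (CARD('n) - 1) * (LINT w|sph. F (c + R *\<^sub>R w))"
  proof -
    have aff: "(\<lambda>w. c + R *\<^sub>R w) \<in> sph \<rightarrow>\<^sub>M borel" by measurable
    have "(LINT x|distr (sphere_measure c R) borel (\<lambda>x. x). F x) =
        (LINT x|distr sph borel (\<lambda>w. c + R *\<^sub>R w). R ^ (CARD('n) - 1) *\<^sub>R F x)"
      unfolding sphere_measure_eq_sph[OF \<open>R > 0\<close>] using \<open>R > 0\<close>
      by (intro integral_density) auto
    also have "\<dots> = (LINT w|sph. R ^ (CARD('n) - 1) *\<^sub>R F (c + R *\<^sub>R w))"
      by (rule integral_distr[OF aff]) simp
    finally show ?thesis by simp
  qed
  finally show ?thesis .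
qed

text \<open>
  By the layer-cake principle: the factor \<open>r^(n - 1)\<close> comes from rescaling the ball whose cones
  define the measure of the unit sphere, and Tonelli's theorem exchanges the radius of this ball with
  the distance from the centre.
\<close>

lemma nn_integral_polar:
  fixes F :: "real^'n \<Rightarrow> ennreal"
  assumes F[measurable]: "F \<in> borel_measurable borel"
  shows "(\<integral>\<^sup>+x. F x \<partial>lborel) =
    (\<integral>\<^sup>+r. (\<integral>\<^sup>+w. F (c + r *\<^sub>R w) \<partial>sph) * ennreal (r ^ (CARD('n) - 1)) * indicator {0<..} r \<partial>lborel)"
proof -
  let ?n = "CARD('n)"
  let ?b = "\<lambda>(x :: real^'n) r. (if norm x < r \<and> x \<noteq> 0 then 1 else 0 :: ennreal)"
  have n: "?n > 0" by simp
  have "(\<integral>\<^sup>+r. (\<integral>\<^sup>+w. F (c + r *\<^sub>R w) \<partial>sph) * ennreal (r ^ (?n - 1)) * indicator {0<..} r \<partial>lborel)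
     = (\<integral>\<^sup>+r. (\<integral>\<^sup>+x. ennreal ?n * (F (c + r *\<^sub>R (x /\<^sub>R norm x)) * ?b x 1 * ennreal (r ^ (?n - 1)) * indicator {0<..} r) \<partial>lborel) \<partial>lborel)"
  proof (rule nn_integral_cong, goal_cases)
    case (1 r)
    have "(\<integral>\<^sup>+w. F (c + r *\<^sub>R w) \<partial>sph) * ennreal (r ^ (?n - 1)) * indicator {0<..} r =
        (\<integral>\<^sup>+x. F (c + r *\<^sub>R (x /\<^sub>R norm x)) * ?b x 1 \<partial>lborel) * (ennreal ?n * (ennreal (r ^ (?n - 1)) * indicator {0<..} r))"
      by (subst nn_integral_sph) (auto simp: mult_ac indicator_def intro!: arg_cong2[where f="(*)"] nn_integral_cong)
    also have "\<dots> = (\<integral>\<^sup>+x. F (c + r *\<^sub>R (x /\<^sub>R norm x)) * ?b x 1 * (ennreal ?n * (ennreal (r ^ (?n - 1)) * indicator {0<..} r)) \<partial>lborel)"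
      by (rule nn_integral_multc[symmetric]) measurable
    finally show ?case by (simp add: mult_ac)
  qed
  also have "\<dots> = (\<integral>\<^sup>+x. (\<integral>\<^sup>+r. ennreal ?n * (F (c + r *\<^sub>R (x /\<^sub>R norm x)) * ?b x 1 * ennreal (r ^ (?n - 1)) * indicator {0<..} r) \<partial>lborel) \<partial>lborel)"
    by (rule lborel_pair.Fubini') measurable
  also have "\<dots> = (\<integral>\<^sup>+x. (\<integral>\<^sup>+r. ennreal ?n * (F (c + r *\<^sub>R x) * ?b x 1 * ennreal (norm x ^ ?n * r ^ (?n - 1)) * indicator {0<..} r) \<partial>lborel) \<partial>lborel)"
  proof (rule nn_integral_cong, goal_cases)
    case (1 x)
    show ?case
    proof (cases "x = 0")
      case False
      have "(\<integral>\<^sup>+r. ennreal ?n * (F (c + r *\<^sub>R (x /\<^sub>R norm x)) * ?b x 1 * ennreal (r ^ (?n - 1)) * indicator {0<..} r) \<partial>lborel)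
        = ennreal \<bar>norm x\<bar> * (\<integral>\<^sup>+r. ennreal ?n * (F (c + (0 + norm x * r) *\<^sub>R (x /\<^sub>R norm x)) * ?b x 1 * ennreal ((0 + norm x * r) ^ (?n - 1)) * indicator {0<..} (0 + norm x * r)) \<partial>lborel)"
        by (rule nn_integral_real_affine) (use False in auto)
      also have "\<dots> = (\<integral>\<^sup>+r. ennreal ?n * (F (c + r *\<^sub>R x) * ?b x 1 * ennreal (norm x ^ ?n * r ^ (?n - 1)) * indicator {0<..} r) \<partial>lborel)"
      proof (subst nn_integral_cmult[symmetric], simp, rule nn_integral_cong, goal_cases)
        case (1 r)
        have "norm x ^ ?n * r ^ (?n - 1) = norm x * (norm x * r) ^ (?n - 1)"
          by (simp add: power_eq_if[of _ ?n] power_mult_distrib)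
        then have "r > 0 \<Longrightarrow> ennreal (norm x ^ ?n * r ^ (?n - 1)) = ennreal (norm x) * ennreal ((norm x * r) ^ (?n - 1))"
          by (simp add: ennreal_mult)
        then show ?case
          using False by (auto simp: indicator_def zero_less_mult_iff mult_ac)
      qed
      finally show ?thesis .
    qed simp
  qed
  also have "\<dots> = (\<integral>\<^sup>+r. (\<integral>\<^sup>+x. ennreal ?n * (F (c + r *\<^sub>R x) * ?b x 1 * ennreal (norm x ^ ?n * r ^ (?n - 1)) * indicator {0<..} r) \<partial>lborel) \<partial>lborel)"
    by (rule lborel_pair.Fubini') measurable
  also have "\<dots> = (\<integral>\<^sup>+r. (\<integral>\<^sup>+x. ennreal ?n * (F (c + x) * ?b x r * ennreal (norm x ^ ?n / r ^ (?n + 1)) * indicator {0<..} r) \<partial>lborel) \<partial>lborel)"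
  proof (rule nn_integral_cong, goal_cases)
    case (1 r)
    show ?case
    proof (cases "r > 0")
      case True
      have "(\<integral>\<^sup>+x. ennreal ?n * (F (c + x) * ?b x r * ennreal (norm x ^ ?n / r ^ (?n + 1)) * indicator {0<..} r) \<partial>lborel)
        = ennreal (\<bar>r\<bar> ^ DIM(real^'n)) * (\<integral>\<^sup>+x. ennreal ?n * (F (c + (0 + r *\<^sub>R x)) * ?b (0 + r *\<^sub>R x) r * ennreal (norm (0 + r *\<^sub>R x) ^ ?n / r ^ (?n + 1)) * indicator {0<..} r) \<partial>lborel)"
        by (rule nn_integral_lborel_affine) (use True in auto)
      also have "\<dots> = (\<integral>\<^sup>+x. ennreal ?n * (F (c + r *\<^sub>R x) * ?b x 1 * ennreal (norm x ^ ?n * r ^ (?n - 1)) * indicator {0<..} r) \<partial>lborel)"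
      proof (subst nn_integral_cmult[symmetric], simp, rule nn_integral_cong, goal_cases)
        case (1 x)
        have "norm x ^ ?n * r ^ (?n - 1) = r ^ ?n * ((r * norm x) ^ ?n / r ^ (?n + 1))"
          using True by (simp add: power_eq_if[of _ ?n] power_mult_distrib)
        then have "ennreal (norm x ^ ?n * r ^ (?n - 1)) = ennreal (r ^ ?n) * ennreal ((r * norm x) ^ ?n / r ^ (?n + 1))"
          using True by (simp add: ennreal_mult[symmetric])
        then show ?case
          using True by (auto simp: indicator_def mult_ac)
      qed
      finally show ?thesis by simp
    qed simp
  qed
  also have "\<dots> = (\<integral>\<^sup>+x. (\<integral>\<^sup>+r. ennreal ?n * (F (c + x) * ?b x r * ennreal (norm x ^ ?n / r ^ (?n + 1)) * indicator {0<..} r) \<partial>lborel) \<partial>lborel)"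
    by (rule lborel_pair.Fubini') measurable
  also have "\<dots> = (\<integral>\<^sup>+x. F (c + x) \<partial>lborel)"
  proof (rule nn_integral_cong_AE)
    have "AE x in lborel. x \<noteq> (0::real^'n)"
      by (rule AE_lborel_singleton)
    then show "AE x in lborel. (\<integral>\<^sup>+r. ennreal ?n * (F (c + x) * ?b x r * ennreal (norm x ^ ?n / r ^ (?n + 1)) * indicator {0<..} r) \<partial>lborel) = F (c + x)"
    proof eventually_elim
      case (elim x)
      let ?a = "norm x"
      have a: "?a > 0" using elim by simp
      have "(\<integral>\<^sup>+r. ennreal ?n * (F (c + x) * ?b x r * ennreal (norm x ^ ?n / r ^ (?n + 1)) * indicator {0<..} r) \<partial>lborel)
        = (\<integral>\<^sup>+r. F (c + x) * (ennreal (real ?n * ?a ^ ?n / r ^ (?n + 1)) * indicator {?a..} r) \<partial>lborel)"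
      proof (rule nn_integral_cong_AE)
        have "AE r in lborel. r \<noteq> ?a" by (rule AE_lborel_singleton)
        then show "AE r in lborel. ennreal ?n * (F (c + x) * ?b x r * ennreal (norm x ^ ?n / r ^ (?n + 1)) * indicator {0<..} r)
          = F (c + x) * (ennreal (real ?n * ?a ^ ?n / r ^ (?n + 1)) * indicator {?a..} r)"
        proof eventually_elim
          case (elim r)
          show ?case
          proof (cases "?a < r")
            case True
            then have "ennreal (real ?n * ?a ^ ?n / r ^ (?n + 1)) = ennreal ?n * ennreal (?a ^ ?n / r ^ (?n + 1))"
              using a less_trans[OF a True] by (subst ennreal_mult[symmetric]) auto
            then show ?thesis using True a less_trans[OF a True] by (auto simp: indicator_def mult_ac)
          qed (use elim in \<open>auto simp: indicator_def\<close>)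
        qed
      qed
      also have "\<dots> = F (c + x) * (\<integral>\<^sup>+r. ennreal (real ?n * ?a ^ ?n / r ^ (?n + 1)) * indicator {?a..} r \<partial>lborel)"
        by (rule nn_integral_cmult) auto
      also have "(\<integral>\<^sup>+r. ennreal (real ?n * ?a ^ ?n / r ^ (?n + 1)) * indicator {?a..} r \<partial>lborel) = ennreal (0 - (- (?a ^ ?n * inverse (?a ^ ?n))))"
      proof (rule nn_integral_FTC_atLeast[where F="\<lambda>r. - (?a ^ ?n * inverse (r ^ ?n))" and T=0])
        show "DERIV (\<lambda>r. - (?a ^ ?n * inverse (r ^ ?n))) r :> real ?n * ?a ^ ?n / r ^ (?n + 1)" if "?a \<le> r" for r
        proof -
          have r: "r \<noteq> 0" using that a by auto
          obtain m where m: "?n = Suc m" using n gr0_implies_Suc by blast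
          have "((\<lambda>r. - (?a ^ ?n * inverse (r ^ ?n))) has_real_derivative
              - (?a ^ ?n * - (inverse (r ^ ?n) * (real ?n * r ^ (?n - 1)) * inverse (r ^ ?n)))) (at r)"
            using r by (auto intro!: derivative_eq_intros)
          moreover have "- (?a ^ ?n * - (inverse (r ^ ?n) * (real ?n * r ^ (?n - 1)) * inverse (r ^ ?n))) = real ?n * ?a ^ ?n / r ^ (?n + 1)"
            using r unfolding m by (simp add: field_simps)
          ultimately show ?thesis by simp
        qed
        show "0 \<le> real ?n * ?a ^ ?n / r ^ (?n + 1)" if "?a \<le> r" for r
          using that less_le_trans[OF a that] by auto
        have "((\<lambda>r::real. inverse (r ^ ?n)) \<longlongrightarrow> 0) at_top"
          using n by (intro tendsto_inverse_0_at_top filterlim_pow_at_top filterlim_ident)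
        from tendsto_mult_left[OF this, of "- (?a ^ ?n)"]
        show "((\<lambda>r. - (?a ^ ?n * inverse (r ^ ?n))) \<longlongrightarrow> 0) at_top"
          by simp
        show "(\<lambda>r. real ?n * ?a ^ ?n / r ^ (?n + 1)) \<in> borel_measurable borel"
          by measurable
      qed
      finally show ?case using a by simp
    qed
  qed
  also have "\<dots> = (\<integral>\<^sup>+x. F x \<partial>lborel)"
    by (rule nn_integral_lborel_translate) simp
  finally show ?thesis by simp
qed

section \<open>One-dimensional estimates and orthogonal invariance\<close>

text \<open>
  The Cauchy--Schwarz inequality for the fundamental theorem of calculus, obtained by expanding the
  square of the deviation of \<open>\<psi>\<close> from its mean.
\<close>

lemma increment_sq_le:
  fixes \<phi> \<psi> :: "real \<Rightarrow> real"
  assumes ab: "a \<le> b"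
    and der: "\<And>t. a \<le> t \<Longrightarrow> t \<le> b \<Longrightarrow> (\<phi> has_real_derivative \<psi> t) (at t within {a..b})"
    and cont: "continuous_on {a..b} \<psi>"
  shows "ennreal ((\<phi> b - \<phi> a)\<^sup>2) \<le> ennreal (b - a) * (\<integral>\<^sup>+t. ennreal ((\<psi> t)\<^sup>2) * indicator {a..b} t \<partial>lborel)"
proof (cases "a = b")
  case False
  then have ab': "a < b" using ab by simp
  let ?h = "\<lambda>t. indicator {a..b} t *\<^sub>R \<psi> t"
  let ?m = "(\<phi> b - \<phi> a) / (b - a)"
  have h: "integrable lborel ?h"
    using borel_integrable_compact[OF _ cont] by auto
  have h2: "integrable lborel (\<lambda>t. indicator {a..b} t *\<^sub>R (\<psi> t)\<^sup>2)"
    by (rule borel_integrable_compact) (auto intro!: continuous_intros cont)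
  have i1: "integrable lborel (\<lambda>t. indicator {a..b} t :: real)"
    by (rule integrable_real_indicator) (auto simp: emeasure_lborel_Icc_eq)
  have I: "(LINT t|lborel. ?h t) = \<phi> b - \<phi> a"
    by (rule integral_FTC_Icc[OF ab _ cont]) (use der in \<open>auto simp: has_real_derivative_iff_has_vector_derivative\<close>)
  have m: "2 * ?m * (\<phi> b - \<phi> a) - ?m\<^sup>2 * (b - a) = (\<phi> b - \<phi> a)\<^sup>2 / (b - a)"
    using ab' by (simp add: power2_eq_square)
  have "0 \<le> (LINT t|lborel. indicator {a..b} t *\<^sub>R (\<psi> t - ?m)\<^sup>2)"
    by (rule integral_nonneg_AE) (auto simp: indicator_def)
  also have "\<dots> = (LINT t|lborel. indicator {a..b} t *\<^sub>R (\<psi> t)\<^sup>2 - 2 * ?m * ?h t + ?m\<^sup>2 * indicator {a..b} t)"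
    by (rule Bochner_Integration.integral_cong) (auto simp: indicator_def power2_eq_square algebra_simps)
  also have "\<dots> = (LINT t|lborel. indicator {a..b} t *\<^sub>R (\<psi> t)\<^sup>2) - 2 * ?m * (\<phi> b - \<phi> a) + ?m\<^sup>2 * (b - a)"
    using h h2 i1 ab I
    by (subst Bochner_Integration.integral_add, simp, simp, subst Bochner_Integration.integral_diff, simp, simp)
       (simp add: measure_def)
  finally have "(\<phi> b - \<phi> a)\<^sup>2 / (b - a) \<le> (LINT t|lborel. indicator {a..b} t *\<^sub>R (\<psi> t)\<^sup>2)"
    using m by linarith
  then have "(\<phi> b - \<phi> a)\<^sup>2 \<le> (b - a) * (LINT t|lborel. indicator {a..b} t *\<^sub>R (\<psi> t)\<^sup>2)"
    using ab' by (simp add: field_simps)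
  then have "ennreal ((\<phi> b - \<phi> a)\<^sup>2) \<le> ennreal (b - a) * ennreal (LINT t|lborel. indicator {a..b} t *\<^sub>R (\<psi> t)\<^sup>2)"
    using ab' by (simp add: ennreal_mult'[symmetric] ennreal_leI)
  also have "ennreal (LINT t|lborel. indicator {a..b} t *\<^sub>R (\<psi> t)\<^sup>2) = (\<integral>\<^sup>+t. ennreal ((\<psi> t)\<^sup>2) * indicator {a..b} t \<partial>lborel)"
    by (subst nn_integral_eq_integral[symmetric, OF h2])
       (auto simp: indicator_def intro!: nn_integral_cong)
  finally show ?thesis .
qed simp

lemma Basis_real_vec: "(Basis :: (real^'n) set) = range (\<lambda>i. axis i 1)"
  by (auto simp: Basis_vec_def)

lemma prod_Basis_real_vec: "(\<Prod>b\<in>(Basis :: (real^'n) set). f b) = (\<Prod>i\<in>UNIV. f (axis i 1))"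
  unfolding Basis_real_vec by (subst prod.reindex) (auto simp: inj_on_def axis_eq_axis)

text \<open>
  Signed permutations have enough symmetry to determine the second moments of the sphere, and they map
  boxes to boxes.
\<close>

lemma lborel_signed_permutation:
  fixes s :: "'n::finite \<Rightarrow> real" and \<pi> :: "'n \<Rightarrow> 'n"
  assumes s: "\<And>i. \<bar>s i\<bar> = 1" and \<pi>: "bij \<pi>"
  defines "T \<equiv> \<lambda>x :: real^'n. \<chi> i. s i * x $ \<pi> i"
  shows "T \<in> borel_measurable borel" and "distr lborel borel T = lborel"
proof -
  have "continuous_on UNIV T"
    unfolding T_def by (intro continuous_intros)
  then show [measurable]: "T \<in> borel_measurable borel"
    by (rule borel_measurable_continuous_onI)
  have s': "s i = 1 \<or> s i = -1" for i
    using s[of i] by linarith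
  show "distr lborel borel T = lborel"
  proof (rule lborel_eqI[symmetric])
    fix l u :: "real^'n" assume le: "\<And>b. b \<in> Basis \<Longrightarrow> l \<bullet> b \<le> u \<bullet> b"
    have le': "l $ i \<le> u $ i" for i
      using le[of "axis i 1"] by (simp add: inner_axis)
    define l' where "l' = (\<chi> j. let i = inv \<pi> j in if s i = 1 then l $ i else - u $ i)"
    define u' where "u' = (\<chi> j. let i = inv \<pi> j in if s i = 1 then u $ i else - l $ i)"
    have inv: "inv \<pi> (\<pi> i) = i" for i
      using \<pi> by (simp add: bij_is_inj)
    have "x \<in> T -` box l u \<longleftrightarrow> x \<in> box l' u'" for x
    proof -
      have "x \<in> box l' u' \<longleftrightarrow> (\<forall>i. l' $ \<pi> i < x $ \<pi> i \<and> x $ \<pi> i < u' $ \<pi> i)"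
        unfolding mem_box_cart using \<pi> by (metis bij_pointE)
      also have "\<dots> \<longleftrightarrow> (\<forall>i. l $ i < s i * x $ \<pi> i \<and> s i * x $ \<pi> i < u $ i)"
      proof (rule all_cong1, goal_cases)
        case (1 i)
        show ?case using s'[of i] by (auto simp: l'_def u'_def inv)
      qed
      also have "\<dots> \<longleftrightarrow> x \<in> T -` box l u"
        by (simp add: T_def mem_box_cart)
      finally show ?thesis by simp
    qed
    then have pre: "T -` box l u = box l' u'" by blast
    have "emeasure (distr lborel borel T) (box l u) = emeasure lborel (box l' u')"
      by (subst emeasure_distr) (auto simp: pre)
    also have "\<dots> = (\<Prod>b\<in>Basis. (u' - l') \<bullet> b)"
    proof -
      have "l' \<bullet> b \<le> u' \<bullet> b" if "b \<in> Basis" for b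
        using that le' by (auto simp: Basis_real_vec inner_axis l'_def u'_def Let_def)
      then show ?thesis by (rule emeasure_lborel_box)
    qed
    also have "(\<Prod>b\<in>Basis. (u' - l') \<bullet> b) = (\<Prod>j\<in>UNIV. (u - l) $ inv \<pi> j)"
      unfolding prod_Basis_real_vec by (rule prod.cong) (auto simp: inner_axis l'_def u'_def Let_def)
    also have "\<dots> = (\<Prod>i\<in>UNIV. (u - l) $ i)"
      by (rule prod.reindex_bij_betw) (use \<pi> bij_imp_bij_inv in blast)
    also have "\<dots> = (\<Prod>b\<in>Basis. (u - l) \<bullet> b)"
      unfolding prod_Basis_real_vec by (rule prod.cong) (auto simp: inner_axis)
    finally show "emeasure (distr lborel borel T) (box l u) = (\<Prod>b\<in>Basis. (u - l) \<bullet> b)" .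
  qed simp
qed

lemma distr_sph_signed_permutation:
  fixes s :: "'n::finite \<Rightarrow> real" and \<pi> :: "'n \<Rightarrow> 'n"
  assumes s: "\<And>i. \<bar>s i\<bar> = 1" and \<pi>: "bij \<pi>"
  defines "T \<equiv> \<lambda>x :: real^'n. \<chi> i. s i * x $ \<pi> i"
  shows "distr sph borel T = sph"
proof (rule measure_eqI)
  have T: "T \<in> borel_measurable borel" "distr lborel borel T = lborel"
    unfolding T_def by (rule lborel_signed_permutation[OF s \<pi>])+
  note [measurable] = T(1)
  have norm: "norm (T x) = norm x" for x
  proof -
    have "(\<Sum>i\<in>UNIV. (s i * x $ \<pi> i)\<^sup>2) = (\<Sum>i\<in>UNIV. (x $ \<pi> i)\<^sup>2)"
    proof (rule sum.cong)
      fix i show "(s i * x $ \<pi> i)\<^sup>2 = (x $ \<pi> i)\<^sup>2"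
        using s[of i] by (metis abs_mult mult_1 power2_abs)
    qed simp
    also have "\<dots> = (\<Sum>i\<in>UNIV. (x $ i)\<^sup>2)"
      by (rule sum.reindex_bij_betw[OF \<pi>])
    finally show ?thesis by (simp add: norm_vec_def L2_set_def T_def)
  qed
  have T0: "T x = 0 \<longleftrightarrow> x = 0" for x
    by (metis norm norm_eq_zero)
  have Tsc: "T (x /\<^sub>R norm x) = T x /\<^sub>R norm (T x)" for x
    unfolding norm by (simp add: T_def vec_eq_iff)
  fix A :: "(real^'n) set" assume "A \<in> sets (distr sph borel T)"
  then have [measurable]: "A \<in> sets borel" by simp
  let ?F = "\<lambda>x. indicator A (x /\<^sub>R norm x) * indicator (ball 0 1 - {0}) x :: ennreal"
  have F: "?F \<in> borel_measurable borel"
    by (intro borel_measurable_times_ennreal borel_measurable_indicator) auto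
  have TS: "T \<in> sph \<rightarrow>\<^sub>M borel" unfolding measurable_sph_iff by (rule T(1))
  have "emeasure (distr sph borel T) A = (\<integral>\<^sup>+w. indicator A w \<partial>distr sph borel T)"
    by (subst nn_integral_indicator) auto
  also have "\<dots> = (\<integral>\<^sup>+w. indicator A (T w) \<partial>sph)"
    by (rule nn_integral_distr[OF TS]) simp
  also have "\<dots> = ennreal (real CARD('n)) * (\<integral>\<^sup>+x. ?F (T x) \<partial>lborel)"
    by (subst nn_integral_sph) (auto simp: Tsc norm T0 indicator_def intro!: arg_cong2[where f="(*)"] nn_integral_cong)
  also have "(\<integral>\<^sup>+x. ?F (T x) \<partial>lborel) = (\<integral>\<^sup>+x. ?F x \<partial>distr lborel borel T)"
    by (rule nn_integral_distr[symmetric]) (use F in auto)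
  also have "ennreal (real CARD('n)) * \<dots> = (\<integral>\<^sup>+w. indicator A w \<partial>sph)"
    unfolding T(2) by (subst nn_integral_sph) auto
  finally show "emeasure (distr sph borel T) A = emeasure sph A" by simp
qed simp

lemma integral_sph_signed_permutation:
  fixes s :: "'n::finite \<Rightarrow> real" and \<pi> :: "'n \<Rightarrow> 'n" and F :: "real^'n \<Rightarrow> real"
  assumes s: "\<And>i. \<bar>s i\<bar> = 1" and \<pi>: "bij \<pi>" and [measurable]: "F \<in> borel_measurable borel"
  shows "(LINT w|sph. F (\<chi> i. s i * w $ \<pi> i)) = (LINT w|sph. F w)"
proof -
  let ?T = "\<lambda>x :: real^'n. \<chi> i. s i * x $ \<pi> i"
  have TS: "?T \<in> sph \<rightarrow>\<^sub>M borel"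
    using lborel_signed_permutation(1)[OF s \<pi>] by (simp only: measurable_sph_iff)
  have "(LINT w|distr sph borel ?T. F w) = (LINT w|sph. F (?T w))"
    by (rule integral_distr[OF TS]) simp
  then show ?thesis
    unfolding distr_sph_signed_permutation[OF s \<pi>] by (rule sym)
qed

lemma integrable_sph_bounded:
  fixes F :: "real^'n \<Rightarrow> real"
  assumes "F \<in> borel_measurable borel" and "\<And>w. norm w = 1 \<Longrightarrow> \<bar>F w\<bar> \<le> B"
  shows "integrable sph F"
proof (rule sph.integrable_const_bound)
  show "AE w in sph. norm (F w) \<le> B"
    using AE_sph_norm by eventually_elim (use assms(2) in auto)
qed (use assms(1) in auto)

lemma abs_nth_le_1: "norm w = 1 \<Longrightarrow> \<bar>w $ i\<bar> \<le> 1" for w :: "real^'n"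
  using component_le_norm_cart[of w i] by simp

text \<open>
  The second moments of the uniform distribution on the sphere are isotropic: mixed moments vanish
  because a coordinate may change its sign, the others agree because coordinates may be swapped.
\<close>

lemma integral_sph_coord: "(LINT w|sph. (w :: real^'n) $ i) = 0"
  using integral_sph_signed_permutation[OF _ bij_id, of "\<lambda>_. -1" "\<lambda>w :: real^'n. w $ i"] by simp

lemma integral_sph_coord_coord:
  "(LINT w|sph. (w :: real^'n) $ i * w $ j) = (if i = j then sph_area TYPE('n) / real CARD('n) else 0)"
proof (cases "i = j")
  case False
  have "(LINT w|sph. - ((w :: real^'n) $ i * w $ j)) = (LINT w|sph. (w :: real^'n) $ i * w $ j)"
    using integral_sph_signed_permutation[OF _ bij_id, of "\<lambda>k. if k = i then -1 else 1" "\<lambda>w :: real^'n. w $ i * w $ j"]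
      False by simp
  then show ?thesis using False by simp
next
  case True
  let ?q = "\<lambda>i. LINT w|sph. ((w :: real^'n) $ i)\<^sup>2"
  have int: "integrable sph (\<lambda>w :: real^'n. (w $ i)\<^sup>2)" for i
    by (rule integrable_sph_bounded[of _ 1]) (auto simp: abs_square_le_1 abs_nth_le_1)
  have same: "?q k = ?q i" for k
  proof -
    have "(LINT w|sph. ((\<chi> j. 1 * w $ Transposition.transpose i k j :: real^'n) $ i)\<^sup>2) = ?q i"
      using integral_sph_signed_permutation[of "\<lambda>_. 1" "Transposition.transpose i k" "\<lambda>w :: real^'n. (w $ i)\<^sup>2"]
      by simp
    then show ?thesis by simp
  qed
  have "real CARD('n) * ?q i = (\<Sum>k\<in>UNIV. ?q k)"
    by (subst sum.cong[OF refl same]) simp_all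
  also have "\<dots> = (LINT w|sph. (\<Sum>k\<in>UNIV. ((w :: real^'n) $ k)\<^sup>2))"
    by (rule Bochner_Integration.integral_sum[symmetric]) (rule int)
  also have "\<dots> = (LINT w|(sph :: (real^'n) measure). 1)"
  proof (rule integral_cong_AE)
    show "AE w in sph. (\<Sum>k\<in>UNIV. ((w :: real^'n) $ k)\<^sup>2) = 1"
      using AE_sph_norm by eventually_elim (simp add: norm_vec_def L2_set_def)
  qed auto
  also have "\<dots> = sph_area TYPE('n)"
    by (simp add: sph_area_def)
  finally show ?thesis
    using True by (simp add: power2_eq_square field_simps)
qed

lemma nn_integral_sph_inner_sq:
  fixes p :: "real^'n"
  shows "(\<integral>\<^sup>+w. ennreal ((p \<bullet> w)\<^sup>2) \<partial>sph) = ennreal ((norm p)\<^sup>2 * sph_area TYPE('n) / real CARD('n))"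
proof -
  have int: "integrable sph (\<lambda>w :: real^'n. (p $ i * p $ j) * (w $ i * w $ j))" for i j
    by (rule integrable_mult_right, rule integrable_sph_bounded[of _ 1])
       (auto simp: abs_mult intro!: mult_le_one abs_nth_le_1)
  have eq: "(p \<bullet> w)\<^sup>2 = (\<Sum>i\<in>UNIV. \<Sum>j\<in>UNIV. (p $ i * p $ j) * (w $ i * w $ j))" for w
    unfolding power2_eq_square inner_vec_def sum_product by (simp add: mult_ac)
  have "(\<integral>\<^sup>+w. ennreal ((p \<bullet> w)\<^sup>2) \<partial>sph) = ennreal (LINT w|sph. (p \<bullet> w)\<^sup>2)"
  proof (rule nn_integral_eq_integral)
    show "integrable sph (\<lambda>w. (p \<bullet> w)\<^sup>2)"
      unfolding eq by (intro Bochner_Integration.integrable_sum int)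
  qed auto
  also have "(LINT w|sph. (p \<bullet> w)\<^sup>2) = (\<Sum>i\<in>UNIV. \<Sum>j\<in>UNIV. (p $ i * p $ j) * (LINT w|sph. w $ i * w $ j))"
    unfolding eq by (subst Bochner_Integration.integral_sum, (intro Bochner_Integration.integrable_sum int),
        rule sum.cong, simp, subst Bochner_Integration.integral_sum, rule int, simp)
  also have "\<dots> = (\<Sum>i\<in>UNIV. (p $ i)\<^sup>2 * (sph_area TYPE('n) / real CARD('n)))"
    by (simp add: integral_sph_coord_coord power2_eq_square if_distrib cong: if_cong)
  also have "\<dots> = (norm p)\<^sup>2 * sph_area TYPE('n) / real CARD('n)"
    by (simp add: norm_vec_def L2_set_def sum_nonneg sum_distrib_right sum_divide_distrib)
  finally show ?thesis .
qed

section \<open>Functions that are continuously differentiable near a set\<close>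

lemma C1_near_subset: "C1_near T f g \<Longrightarrow> S \<subseteq> T \<Longrightarrow> C1_near S f g"
  unfolding C1_near_def by blast

lemma C1_near_continuous:
  assumes "C1_near S f g"
  shows "continuous_on S f" "continuous_on S g"
proof -
  obtain U where U: "open U" "S \<subseteq> U" "\<forall>x\<in>U. GDERIV f x :> g x" "continuous_on U g"
    using assms unfolding C1_near_def by blast
  have "continuous_on U f"
  proof (rule continuous_at_imp_continuous_on, rule ballI)
    fix x assume "x \<in> U"
    then have "(f has_derivative (\<lambda>h. h \<bullet> g x)) (at x)"
      using U(3) by (simp add: gderiv_def)
    then show "isCont f x" by (rule has_derivative_continuous)
  qed
  then show "continuous_on S f" "continuous_on S g"
    using U continuous_on_subset by blast+
qed

lemma C1_near_line:
  assumes "C1_near S f g" and "a + t *\<^sub>R v \<in> S"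
  shows "((\<lambda>s. f (a + s *\<^sub>R v)) has_real_derivative (g (a + t *\<^sub>R v) \<bullet> v)) (at t within X)"
proof -
  have "(f has_derivative (\<lambda>h. h \<bullet> g (a + t *\<^sub>R v))) (at (a + t *\<^sub>R v))"
    using assms unfolding C1_near_def gderiv_def by blast
  moreover have "((\<lambda>s. a + s *\<^sub>R v) has_derivative (\<lambda>s. s *\<^sub>R v)) (at t within X)"
    by (auto intro!: derivative_eq_intros)
  ultimately have "((\<lambda>s. f (a + s *\<^sub>R v)) has_derivative (\<lambda>s. (s *\<^sub>R v) \<bullet> g (a + t *\<^sub>R v))) (at t within X)"
    by (rule has_derivative_compose[rotated])
  then show ?thesis
    unfolding has_field_derivative_def
    by (rule has_derivative_eq_rhs) (auto simp: inner_commute)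
qed

lemma C1_near_lincomb:
  assumes "C1_near S f g" "C1_near S f' g'"
  shows "C1_near S (\<lambda>x. a * f x + b * f' x) (\<lambda>x. a *\<^sub>R g x + b *\<^sub>R g' x)"
proof -
  obtain U where U: "open U" "S \<subseteq> U" "\<forall>x\<in>U. GDERIV f x :> g x" "continuous_on U g"
    using assms unfolding C1_near_def by blast
  obtain U' where U': "open U'" "S \<subseteq> U'" "\<forall>x\<in>U'. GDERIV f' x :> g' x" "continuous_on U' g'"
    using assms unfolding C1_near_def by blast
  have "GDERIV (\<lambda>x. a * f x + b * f' x) x :> a *\<^sub>R g x + b *\<^sub>R g' x" if "x \<in> U \<inter> U'" for x
  proof -
    have "(f has_derivative (\<lambda>h. h \<bullet> g x)) (at x)" "(f' has_derivative (\<lambda>h. h \<bullet> g' x)) (at x)"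
      using U U' that by (auto simp: gderiv_def)
    then show ?thesis
      unfolding gderiv_def by (auto intro!: derivative_eq_intros simp: inner_simps)
  qed
  moreover have "continuous_on (U \<inter> U') (\<lambda>x. a *\<^sub>R g x + b *\<^sub>R g' x)"
    by (intro continuous_intros continuous_on_subset[OF U(4)] continuous_on_subset[OF U'(4)]) auto
  ultimately show ?thesis
    unfolding C1_near_def using U U' by (intro exI[of _ "U \<inter> U'"]) auto
qed

lemma C1_near_const: "C1_near S (\<lambda>x. c) (\<lambda>x. 0)"
  unfolding C1_near_def by (intro exI[of _ UNIV]) (auto simp: GDERIV_const)

section \<open>Gaussian integrals\<close>

lemma power_le_fact_exp: "0 \<le> x \<Longrightarrow> x ^ N \<le> fact N * exp (x::real)"
proof -
  assume x: "0 \<le> x"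
  have "(\<Sum>i\<in>{N}. x ^ i /\<^sub>R fact i) \<le> (\<Sum>i. x ^ i /\<^sub>R fact i)"
    by (rule sum_le_suminf) (use x summable_exp_generic[of x] in auto)
  then have "x ^ N / fact N \<le> exp x"
    by (simp add: exp_def divide_inverse mult.commute)
  then show ?thesis by (simp add: field_simps)
qed

text \<open>
  Only the finiteness and positivity of the radial moments enter: they cancel in the end.
\<close>

lemma gauss_radial_moment:
  obtains m :: real where "m > 0"
    "(\<integral>\<^sup>+r. ennreal (r ^ N * exp (- r\<^sup>2 / 2)) * indicator {0<..} r \<partial>lborel) = ennreal m"
proof -
  let ?I = "\<integral>\<^sup>+r. ennreal (r ^ N * exp (- r\<^sup>2 / 2)) * indicator {0<..} r \<partial>lborel"
  let ?C = "2 ^ N * fact N * exp (1/2) :: real"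
  have "?I \<le> (\<integral>\<^sup>+r. ennreal (?C * exp (- r / 2)) * indicator {0..} r \<partial>lborel)"
  proof (rule nn_integral_mono)
    fix r :: real
    have "r ^ N * exp (- r\<^sup>2 / 2) \<le> ?C * exp (- r / 2)" if r: "r > 0"
    proof -
      have "r ^ N = 2 ^ N * (r / 2) ^ N" by (simp add: power_divide)
      also have "\<dots> \<le> 2 ^ N * (fact N * exp (r / 2))"
        using power_le_fact_exp[of "r / 2" N] r by (intro mult_left_mono) auto
      finally have 1: "r ^ N \<le> 2 ^ N * fact N * exp (r / 2)" by simp
      have "0 \<le> (r - 1)\<^sup>2" by simp
      then have "- r\<^sup>2 / 2 \<le> 1/2 - r" by (simp add: power2_eq_square algebra_simps)
      then have "r ^ N * exp (- r\<^sup>2 / 2) \<le> (2 ^ N * fact N * exp (r / 2)) * exp (1/2 - r)"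
        using 1 r by (intro mult_mono) auto
      also have "\<dots> = ?C * exp (- r / 2)"
        by (simp add: mult_exp_exp field_simps)
      finally show ?thesis .
    qed
    then show "ennreal (r ^ N * exp (- r\<^sup>2 / 2)) * indicator {0<..} r \<le> ennreal (?C * exp (- r / 2)) * indicator {0..} r"
      by (auto simp: indicator_def intro!: ennreal_leI)
  qed
  also have "\<dots> = ennreal (0 - (- 2 * ?C * exp (- 0 / 2)))"
  proof (rule nn_integral_FTC_atLeast[where F="\<lambda>r. - 2 * ?C * exp (- r / 2)" and T=0])
    show "((\<lambda>r. - 2 * ?C * exp (- r / 2)) has_real_derivative ?C * exp (- r / 2)) (at r)" for r
      by (auto intro!: derivative_eq_intros)
    have "LIM r at_top. - r / 2 :> (at_bot :: real filter)"
      using filterlim_tendsto_neg_mult_at_bot[OF tendsto_const[of "-1/2::real"] _ filterlim_ident[of at_top]] by simp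
    then have "((\<lambda>r::real. exp (- r / 2)) \<longlongrightarrow> 0) at_top"
      by (rule filterlim_compose[OF exp_at_bot])
    from tendsto_mult_left[OF this, of "- 2 * ?C"]
    show "((\<lambda>r. - 2 * ?C * exp (- r / 2)) \<longlongrightarrow> 0) at_top" by simp
  qed auto
  also have "\<dots> < \<infinity>" by simp
  finally have fin: "?I < \<infinity>" .
  have "?I \<noteq> 0"
  proof
    assume "?I = 0"
    then have "AE r in lborel. ennreal (r ^ N * exp (- r\<^sup>2 / 2)) * indicator {0<..} r = (0 :: ennreal)"
      by (subst (asm) nn_integral_0_iff_AE) auto
    then have "AE r in lborel. (r::real) \<notin> {0<..<1}"
      by eventually_elim (auto simp: indicator_def ennreal_eq_0_iff mult_le_0_iff split: if_splits dest: zero_less_power[of _ N])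
    then have "emeasure lborel {0<..<1::real} = 0"
      by (subst (asm) AE_iff_measurable[of "{0<..<1::real}"]) auto
    then show False by simp
  qed
  then show ?thesis
    using that[of "enn2real ?I"] fin by (simp add: enn2real_positive_iff less_top zero_less_iff_neq_zero)
qed

text \<open>
  A function of the direction and a function of the radius are independent under the Gaussian
  measure.
\<close>

lemma nn_integral_gauss_polar:
  fixes H :: "real^'n \<Rightarrow> ennreal"
  assumes [measurable]: "H \<in> borel_measurable borel"
  shows "(\<integral>\<^sup>+x. ennreal (norm x ^ j * exp (- (norm x)\<^sup>2 / 2)) * H (x /\<^sub>R norm x) \<partial>lborel) =
    (\<integral>\<^sup>+r. ennreal (r ^ (CARD('n) - 1 + j) * exp (- r\<^sup>2 / 2)) * indicator {0<..} r \<partial>lborel) * (\<integral>\<^sup>+w. H w \<partial>sph)"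
proof -
  have "(\<integral>\<^sup>+x. ennreal (norm x ^ j * exp (- (norm x)\<^sup>2 / 2)) * H (x /\<^sub>R norm x) \<partial>lborel) =
    (\<integral>\<^sup>+r. (\<integral>\<^sup>+w. ennreal (norm (0 + r *\<^sub>R w) ^ j * exp (- (norm (0 + r *\<^sub>R w))\<^sup>2 / 2)) * H ((0 + r *\<^sub>R w) /\<^sub>R norm (0 + r *\<^sub>R w)) \<partial>sph)
      * ennreal (r ^ (CARD('n) - 1)) * indicator {0<..} r \<partial>lborel)"
    by (rule nn_integral_polar) measurable
  also have "\<dots> = (\<integral>\<^sup>+r. ennreal (r ^ (CARD('n) - 1 + j) * exp (- r\<^sup>2 / 2)) * indicator {0<..} r * (\<integral>\<^sup>+w. H w \<partial>sph) \<partial>lborel)"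
  proof (rule nn_integral_cong)
    fix r :: real
    show "(\<integral>\<^sup>+w. ennreal (norm (0 + r *\<^sub>R w) ^ j * exp (- (norm (0 + r *\<^sub>R w))\<^sup>2 / 2)) * H ((0 + r *\<^sub>R w) /\<^sub>R norm (0 + r *\<^sub>R w)) \<partial>sph)
      * ennreal (r ^ (CARD('n) - 1)) * indicator {0<..} r = ennreal (r ^ (CARD('n) - 1 + j) * exp (- r\<^sup>2 / 2)) * indicator {0<..} r * (\<integral>\<^sup>+w. H w \<partial>sph)"
    proof (cases "r > 0")
      case True
      have "(\<integral>\<^sup>+w. ennreal (norm (0 + r *\<^sub>R w) ^ j * exp (- (norm (0 + r *\<^sub>R w))\<^sup>2 / 2)) * H ((0 + r *\<^sub>R w) /\<^sub>R norm (0 + r *\<^sub>R w)) \<partial>sph)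
        = (\<integral>\<^sup>+w. ennreal (r ^ j * exp (- r\<^sup>2 / 2)) * H w \<partial>sph)"
      proof (rule nn_integral_cong_AE)
        show "AE w in sph. ennreal (norm (0 + r *\<^sub>R w) ^ j * exp (- (norm (0 + r *\<^sub>R w))\<^sup>2 / 2)) * H ((0 + r *\<^sub>R w) /\<^sub>R norm (0 + r *\<^sub>R w))
          = ennreal (r ^ j * exp (- r\<^sup>2 / 2)) * H w"
          using AE_sph_norm by eventually_elim (use True in simp)
      qed
      also have "\<dots> = ennreal (r ^ j * exp (- r\<^sup>2 / 2)) * (\<integral>\<^sup>+w. H w \<partial>sph)"
        by (rule nn_integral_cmult) simp
      finally show ?thesis
        using True by (simp only: power_add) (simp add: ennreal_mult mult_ac)
    qed simp
  qed
  also have "\<dots> = (\<integral>\<^sup>+r. ennreal (r ^ (CARD('n) - 1 + j) * exp (- r\<^sup>2 / 2)) * indicator {0<..} r \<partial>lborel) * (\<integral>\<^sup>+w. H w \<partial>sph)"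
    by (rule nn_integral_multc) simp
  finally show ?thesis .
qed

text \<open>
  A rotation of the plane, acting on pairs of vectors, is a composition of two shears with reciprocal
  scalings, and these change one vector of the pair at a time.
\<close>

lemma nn_integral_pair_rotation:
  fixes h :: "real^'n \<Rightarrow> real^'n \<Rightarrow> ennreal"
  assumes [measurable]: "case_prod h \<in> borel_measurable borel"
    and ab: "a\<^sup>2 + b\<^sup>2 = 1" "a \<noteq> 0"
  shows "(\<integral>\<^sup>+X. \<integral>\<^sup>+Y. h X Y \<partial>lborel \<partial>lborel) =
    (\<integral>\<^sup>+Z. \<integral>\<^sup>+D. h (a *\<^sub>R Z - b *\<^sub>R D) (b *\<^sub>R Z + a *\<^sub>R D) \<partial>lborel \<partial>lborel)"
proof -
  let ?n = "DIM(real^'n)"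
  have hm[measurable (raw)]: "(\<lambda>x. h (f x) (g x)) \<in> borel_measurable N"
    if "f \<in> borel_measurable N" "g \<in> borel_measurable N" for f g and N :: "'b measure"
    using measurable_compose[OF borel_measurable_Pair[OF that] assms(1)] by simp
  have "(\<integral>\<^sup>+Z. \<integral>\<^sup>+D. h (a *\<^sub>R Z - b *\<^sub>R D) (b *\<^sub>R Z + a *\<^sub>R D) \<partial>lborel \<partial>lborel)
    = (\<integral>\<^sup>+D. \<integral>\<^sup>+Z. h (a *\<^sub>R Z - b *\<^sub>R D) (b *\<^sub>R Z + a *\<^sub>R D) \<partial>lborel \<partial>lborel)"
    by (rule lborel_pair.Fubini') measurable
  also have "\<dots> = (\<integral>\<^sup>+D. ennreal (\<bar>1 / a\<bar> ^ ?n) * (\<integral>\<^sup>+X. h X ((b / a) *\<^sub>R X + (1 / a) *\<^sub>R D) \<partial>lborel) \<partial>lborel)"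
  proof (rule nn_integral_cong)
    fix D :: "real^'n"
    have "(\<integral>\<^sup>+Z. h (a *\<^sub>R Z - b *\<^sub>R D) (b *\<^sub>R Z + a *\<^sub>R D) \<partial>lborel) = ennreal (\<bar>1 / a\<bar> ^ ?n) *
      (\<integral>\<^sup>+X. h (a *\<^sub>R ((b / a) *\<^sub>R D + (1 / a) *\<^sub>R X) - b *\<^sub>R D) (b *\<^sub>R ((b / a) *\<^sub>R D + (1 / a) *\<^sub>R X) + a *\<^sub>R D) \<partial>lborel)"
      by (rule nn_integral_lborel_affine) (use ab in auto)
    also have "(\<integral>\<^sup>+X. h (a *\<^sub>R ((b / a) *\<^sub>R D + (1 / a) *\<^sub>R X) - b *\<^sub>R D) (b *\<^sub>R ((b / a) *\<^sub>R D + (1 / a) *\<^sub>R X) + a *\<^sub>R D) \<partial>lborel)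
      = (\<integral>\<^sup>+X. h X ((b / a) *\<^sub>R X + (1 / a) *\<^sub>R D) \<partial>lborel)"
    proof (rule nn_integral_cong)
      fix X
      have "b * b / a + a = 1 / a"
        using ab by (simp add: field_simps power2_eq_square)
      then have "b *\<^sub>R ((b / a) *\<^sub>R D + (1 / a) *\<^sub>R X) + a *\<^sub>R D = (b / a) *\<^sub>R X + (1 / a) *\<^sub>R D"
        by (simp add: scaleR_add_right scaleR_add_left[symmetric] add.commute add.left_commute)
      moreover have "a *\<^sub>R ((b / a) *\<^sub>R D + (1 / a) *\<^sub>R X) - b *\<^sub>R D = X"
        using ab by (simp add: scaleR_add_right)
      ultimately show "h (a *\<^sub>R ((b / a) *\<^sub>R D + (1 / a) *\<^sub>R X) - b *\<^sub>R D) (b *\<^sub>R ((b / a) *\<^sub>R D + (1 / a) *\<^sub>R X) + a *\<^sub>R D) = h X ((b / a) *\<^sub>R X + (1 / a) *\<^sub>R D)"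
        by simp
    qed
    finally show "(\<integral>\<^sup>+Z. h (a *\<^sub>R Z - b *\<^sub>R D) (b *\<^sub>R Z + a *\<^sub>R D) \<partial>lborel) = ennreal (\<bar>1 / a\<bar> ^ ?n) * (\<integral>\<^sup>+X. h X ((b / a) *\<^sub>R X + (1 / a) *\<^sub>R D) \<partial>lborel)" .
  qed
  also have "\<dots> = ennreal (\<bar>1 / a\<bar> ^ ?n) * (\<integral>\<^sup>+D. \<integral>\<^sup>+X. h X ((b / a) *\<^sub>R X + (1 / a) *\<^sub>R D) \<partial>lborel \<partial>lborel)"
    by (rule nn_integral_cmult) measurable
  also have "(\<integral>\<^sup>+D. \<integral>\<^sup>+X. h X ((b / a) *\<^sub>R X + (1 / a) *\<^sub>R D) \<partial>lborel \<partial>lborel) = (\<integral>\<^sup>+X. \<integral>\<^sup>+D. h X ((b / a) *\<^sub>R X + (1 / a) *\<^sub>R D) \<partial>lborel \<partial>lborel)"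
    by (rule lborel_pair.Fubini') measurable
  also have "\<dots> = (\<integral>\<^sup>+X. ennreal (\<bar>a\<bar> ^ ?n) * (\<integral>\<^sup>+Y. h X Y \<partial>lborel) \<partial>lborel)"
  proof (rule nn_integral_cong)
    fix X :: "real^'n"
    have "(\<integral>\<^sup>+D. h X ((b / a) *\<^sub>R X + (1 / a) *\<^sub>R D) \<partial>lborel) = ennreal (\<bar>a\<bar> ^ ?n) *
      (\<integral>\<^sup>+Y. h X ((b / a) *\<^sub>R X + (1 / a) *\<^sub>R ((- b) *\<^sub>R X + a *\<^sub>R Y)) \<partial>lborel)"
      by (rule nn_integral_lborel_affine) (use ab in auto)
    also have "(\<integral>\<^sup>+Y. h X ((b / a) *\<^sub>R X + (1 / a) *\<^sub>R ((- b) *\<^sub>R X + a *\<^sub>R Y)) \<partial>lborel) = (\<integral>\<^sup>+Y. h X Y \<partial>lborel)"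
    proof (rule nn_integral_cong)
      fix Y
      have "(b / a) *\<^sub>R X + (1 / a) *\<^sub>R ((- b) *\<^sub>R X + a *\<^sub>R Y) = Y"
        using ab by (simp add: scaleR_diff_right scaleR_add_right)
      then show "h X ((b / a) *\<^sub>R X + (1 / a) *\<^sub>R ((- b) *\<^sub>R X + a *\<^sub>R Y)) = h X Y" by simp
    qed
    finally show "(\<integral>\<^sup>+D. h X ((b / a) *\<^sub>R X + (1 / a) *\<^sub>R D) \<partial>lborel) = ennreal (\<bar>a\<bar> ^ ?n) * (\<integral>\<^sup>+Y. h X Y \<partial>lborel)" .
  qed
  also have "\<dots> = ennreal (\<bar>a\<bar> ^ ?n) * (\<integral>\<^sup>+X. \<integral>\<^sup>+Y. h X Y \<partial>lborel \<partial>lborel)"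
    by (rule nn_integral_cmult) measurable
  also have "ennreal (\<bar>1 / a\<bar> ^ ?n) * (ennreal (\<bar>a\<bar> ^ ?n) * (\<integral>\<^sup>+X. \<integral>\<^sup>+Y. h X Y \<partial>lborel \<partial>lborel)) = (\<integral>\<^sup>+X. \<integral>\<^sup>+Y. h X Y \<partial>lborel \<partial>lborel)"
    using ab by (simp add: mult.assoc[symmetric] ennreal_mult[symmetric] power_mult_distrib[symmetric])
  finally show ?thesis by simp
qed

section \<open>The sharp Poincare inequality on the sphere\<close>

locale sphere_function =
  fixes F :: "real^'n \<Rightarrow> real" and G :: "real^'n \<Rightarrow> real^'n"
  assumes C1: "C1_near (sphere 0 1) F G"
    and F_borel [measurable]: "F \<in> borel_measurable borel"
    and G_borel [measurable]: "G \<in> borel_measurable borel"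
    and dim: "2 \<le> CARD('n)"
begin

text \<open>
  The extension of \<open>F\<close> that is homogeneous of degree one; its gradient away from the origin is \<open>P\<close>,
  which depends on the direction only.
\<close>

definition U :: "real^'n \<Rightarrow> real" where
  "U x = norm x * F (x /\<^sub>R norm x)"

definition P :: "real^'n \<Rightarrow> real^'n" where
  "P x = (F (x /\<^sub>R norm x) - G (x /\<^sub>R norm x) \<bullet> (x /\<^sub>R norm x)) *\<^sub>R (x /\<^sub>R norm x) + G (x /\<^sub>R norm x)"

lemma U_borel [measurable]: "U \<in> borel_measurable borel"
  unfolding U_def by measurable

lemma P_borel [measurable]: "P \<in> borel_measurable borel"
  unfolding P_def by measurable

lemma P_inner: "P x \<bullet> x = U x"
proof -
  define w where "w = x /\<^sub>R norm x"
  have x: "x = norm x *\<^sub>R w" by (cases "x = 0") (simp_all add: w_def)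
  have "P x = (F w - G w \<bullet> w) *\<^sub>R w + G w" by (simp add: P_def w_def)
  then have "P x \<bullet> x = norm x * ((F w - G w \<bullet> w) * (w \<bullet> w) + G w \<bullet> w)"
    by (subst (2) x) (simp add: inner_add_left)
  moreover have "w \<bullet> w = 1" if "x \<noteq> 0"
  proof -
    have "norm w = 1" using that by (simp add: w_def)
    then show ?thesis by (simp only: norm_eq_1)
  qed
  ultimately show ?thesis by (cases "x = 0") (simp_all add: U_def w_def)
qed

text \<open>
  The radial part of the gradient of \<open>U\<close> is \<open>F\<close>, the tangential part that of \<open>F\<close>.
\<close>

lemma norm_P: "norm w = 1 \<Longrightarrow> (norm (P w))\<^sup>2 = (F w)\<^sup>2 + ((norm (G w))\<^sup>2 - (G w \<bullet> w)\<^sup>2)"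
proof -
  assume w1: "norm w = 1"
  then have w: "w \<bullet> w = 1" by (simp add: norm_eq_1)
  have Pw: "P w = (F w - G w \<bullet> w) *\<^sub>R w + G w" using w1 by (simp add: P_def)
  have "P w \<bullet> P w = (F w)\<^sup>2 + (G w \<bullet> G w - (G w \<bullet> w)\<^sup>2)"
    by (simp add: Pw inner_add_left inner_add_right w inner_commute[of w "G w"] power2_eq_square algebra_simps)
  then show ?thesis by (simp add: power2_norm_eq_inner)
qed

lemma P_dir: "P (x /\<^sub>R norm x) = P x"
proof (cases "x = 0")
  case False
  then have "(x /\<^sub>R norm x) /\<^sub>R norm (x /\<^sub>R norm x) = x /\<^sub>R norm x" by simp
  then show ?thesis unfolding P_def by (simp only:)
qed simp

lemma P_scale: "c > 0 \<Longrightarrow> P (c *\<^sub>R x) = P x"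
proof -
  assume c: "c > 0"
  then have "(c *\<^sub>R x) /\<^sub>R norm (c *\<^sub>R x) = x /\<^sub>R norm x" by simp
  then show ?thesis unfolding P_def by (simp only:)
qed

lemma U_deriv:
  assumes "z \<noteq> 0"
  shows "(U has_derivative (\<lambda>h. h \<bullet> P z)) (at z)"
proof -
  define w where "w = z /\<^sub>R norm z"
  have zw: "inverse (norm z) *\<^sub>R z = w" by (simp add: w_def)
  have ww: "norm w = 1" using assms by (simp add: w_def)
  have n: "(norm has_derivative (\<lambda>h. h \<bullet> w)) (at z)"
  proof -
    have "sgn z = w" by (simp only: sgn_div_norm w_def)
    then show ?thesis using has_derivative_norm[OF assms] by (simp only:)
  qed
  have "((\<lambda>x. x /\<^sub>R norm x) has_derivative (\<lambda>h. inverse (norm z) *\<^sub>R h + (- (inverse (norm z) * (h \<bullet> w) * inverse (norm z))) *\<^sub>R z)) (at z)"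
    by (rule has_derivative_scaleR[OF Deriv.has_derivative_inverse[OF _ n] has_derivative_ident]) (use assms in simp)
  moreover have "inverse (norm z) *\<^sub>R h + (- (inverse (norm z) * (h \<bullet> w) * inverse (norm z))) *\<^sub>R z = inverse (norm z) *\<^sub>R (h - (h \<bullet> w) *\<^sub>R w)" for h
    unfolding zw[symmetric, unfolded w_def] by (simp add: scaleR_diff_right zw[symmetric])
  ultimately have wd: "((\<lambda>x. x /\<^sub>R norm x) has_derivative (\<lambda>h. inverse (norm z) *\<^sub>R (h - (h \<bullet> w) *\<^sub>R w))) (at z)"
    by (simp only:)
  have "(F has_derivative (\<lambda>h. h \<bullet> G w)) (at w)"
    using C1 ww unfolding C1_near_def gderiv_def by (auto simp: subset_iff)
  then have Fw: "(F has_derivative (\<lambda>h. h \<bullet> G w)) (at (z /\<^sub>R norm z))"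
    by (simp only: w_def)
  have Fd: "((\<lambda>x. F (x /\<^sub>R norm x)) has_derivative (\<lambda>h. (inverse (norm z) *\<^sub>R (h - (h \<bullet> w) *\<^sub>R w)) \<bullet> G w)) (at z)"
    by (rule has_derivative_compose[OF wd Fw])
  have "(U has_derivative (\<lambda>h. norm z * ((inverse (norm z) *\<^sub>R (h - (h \<bullet> w) *\<^sub>R w)) \<bullet> G w) + (h \<bullet> w) * F (z /\<^sub>R norm z))) (at z)"
    unfolding U_def[abs_def] by (rule has_derivative_mult[OF n Fd])
  moreover have "norm z * ((inverse (norm z) *\<^sub>R (h - (h \<bullet> w) *\<^sub>R w)) \<bullet> G w) + (h \<bullet> w) * F (z /\<^sub>R norm z) = h \<bullet> P z" for h
  proof -
    have "norm z * ((inverse (norm z) *\<^sub>R (h - (h \<bullet> w) *\<^sub>R w)) \<bullet> G w) = (h - (h \<bullet> w) *\<^sub>R w) \<bullet> G w"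
      using assms by simp
    moreover have "h \<bullet> P z = (F w - G w \<bullet> w) * (h \<bullet> w) + h \<bullet> G w"
      unfolding P_def w_def[symmetric] by (simp only: inner_add_right inner_scaleR_right)
    ultimately show ?thesis
      unfolding w_def[symmetric] by (simp add: inner_diff_left inner_commute algebra_simps)
  qed
  ultimately show ?thesis by (simp only:)
qed

lemma P_continuous: "continuous_on (- {0}) P"
proof -
  have dir: "continuous_on (- {0}) (\<lambda>x::real^'n. x /\<^sub>R norm x)"
    by (intro continuous_on_scaleR continuous_on_inverse continuous_on_norm continuous_on_id) (simp add: norm_eq_zero)
  have "norm (x /\<^sub>R norm x) = 1" if "x \<noteq> 0" for x :: "real^'n"
    using that by simp
  then have im: "(\<lambda>x::real^'n. x /\<^sub>R norm x) ` (- {0}) \<subseteq> sphere 0 1"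
    by (simp only: image_subset_iff Compl_iff singleton_iff mem_sphere_0) blast
  note FG = C1_near_continuous[OF C1]
  show ?thesis
    unfolding P_def
    by (intro continuous_intros continuous_on_compose2[OF FG(1) dir im] continuous_on_compose2[OF FG(2) dir im]) auto
qed

text \<open>
  A segment that misses the origin stays where \<open>U\<close> is differentiable.
\<close>

lemma chord:
  assumes "X \<noteq> 0" "Y \<notin> span {X}"
  shows "ennreal ((U Y - U X)\<^sup>2) \<le>
    (\<integral>\<^sup>+s. ennreal ((P ((1 - s) *\<^sub>R X + s *\<^sub>R Y) \<bullet> (Y - X))\<^sup>2) * indicator {0..1} s \<partial>lborel)"
proof -
  let ?z = "\<lambda>s. X + s *\<^sub>R (Y - X)"
  have z: "?z s = (1 - s) *\<^sub>R X + s *\<^sub>R Y" for s by (simp add: algebra_simps)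
  have nz: "?z s \<noteq> 0" for s
  proof
    assume "?z s = 0"
    then have e: "s *\<^sub>R Y = (s - 1) *\<^sub>R X" by (simp add: algebra_simps)
    have s: "s \<noteq> 0" using e assms(1) by auto
    have "Y = (1 / s) *\<^sub>R (s *\<^sub>R Y)" using s by simp
    also have "\<dots> = ((s - 1) / s) *\<^sub>R X" unfolding e by simp
    finally have "Y \<in> span {X}" by (simp add: span_base span_scale)
    then show False using assms(2) by simp
  qed
  have "ennreal ((U (?z 1) - U (?z 0))\<^sup>2) \<le> ennreal (1 - 0) * (\<integral>\<^sup>+s. ennreal ((P (?z s) \<bullet> (Y - X))\<^sup>2) * indicator {0..1} s \<partial>lborel)"
  proof (rule increment_sq_le)
    fix s :: real
    have "(?z has_derivative (\<lambda>t. t *\<^sub>R (Y - X))) (at s within {0..1})"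
      by (auto intro!: derivative_eq_intros)
    from has_derivative_compose[OF this U_deriv[OF nz]]
    have "((\<lambda>s. U (?z s)) has_derivative (\<lambda>t. (t *\<^sub>R (Y - X)) \<bullet> P (?z s))) (at s within {0..1})" .
    then show "((\<lambda>s. U (?z s)) has_real_derivative P (?z s) \<bullet> (Y - X)) (at s within {0..1})"
      unfolding has_field_derivative_def
      by (rule has_derivative_eq_rhs) (auto simp: inner_commute)
    have "continuous_on {0..1} (\<lambda>s. P (?z s))"
      by (rule continuous_on_compose2[OF P_continuous]) (use nz in \<open>auto intro!: continuous_intros\<close>)
    then show "continuous_on {0..1} (\<lambda>s. P (?z s) \<bullet> (Y - X))"
      by (intro continuous_intros)
  qed simp
  then show ?thesis unfolding z by simp
qed

lemma AE_not_in_span: "AE Y in lborel. Y \<notin> span {X :: real^'n}"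
proof -
  have "dim (span {X}) \<le> 1"
    using dim_le_card'[of "{X}"] by (simp add: dim_span)
  then have "dim (span {X}) < DIM(real^'n)" using dim by simp
  then have "negligible (span {X})" by (rule negligible_lowdim)
  then have "span {X} \<in> null_sets lebesgue" by (simp add: negligible_iff_null_sets)
  moreover have "span {X} \<in> sets borel"
    by (simp add: closed_span borel_closed)
  ultimately have "span {X} \<in> null_sets lborel"
    by (auto simp: null_sets_def)
  then show ?thesis by (rule AE_not_in)
qed

lemma bounded_sphere:
  obtains B where "B \<ge> 0" "\<And>w. norm w = 1 \<Longrightarrow> \<bar>F w\<bar> \<le> B" "\<And>w. norm w = 1 \<Longrightarrow> norm (G w) \<le> B"
proof -
  have c: "compact (sphere 0 1 :: (real^'n) set)" by simp
  have "bounded (F ` sphere 0 1)" "bounded (G ` sphere 0 1)"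
    by (rule compact_imp_bounded, rule compact_continuous_image, rule C1_near_continuous[OF C1], rule c)+
  then obtain a b where ab: "\<forall>x\<in>F ` sphere 0 1. norm x \<le> a" "\<forall>x\<in>G ` sphere 0 1. norm x \<le> b"
    unfolding bounded_iff by blast
  have a: "\<bar>F w\<bar> \<le> a" and b: "norm (G w) \<le> b" if "norm w = 1" for w
    using ab that by auto
  show ?thesis
    by (rule that[of "max 0 (max a b)"]) (use a b in \<open>auto simp: le_max_iff_disj\<close>)
qed

lemma integrable_F2: "integrable sph (\<lambda>w. (F w)\<^sup>2)"
proof -
  obtain B where B: "B \<ge> 0" "\<And>w. norm w = 1 \<Longrightarrow> \<bar>F w\<bar> \<le> B" "\<And>w. norm w = 1 \<Longrightarrow> norm (G w) \<le> B"
    using bounded_sphere by blast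
  show ?thesis
  proof (rule integrable_sph_bounded)
    fix w :: "real^'n" assume "norm w = 1"
    then show "\<bar>(F w)\<^sup>2\<bar> \<le> B\<^sup>2" using B(2)[of w] B(1) by (simp add: abs_le_square_iff[symmetric])
  qed simp
qed

lemma integrable_F: "integrable sph F"
proof -
  obtain B where B: "B \<ge> 0" "\<And>w. norm w = 1 \<Longrightarrow> \<bar>F w\<bar> \<le> B" "\<And>w. norm w = 1 \<Longrightarrow> norm (G w) \<le> B"
    using bounded_sphere by blast
  show ?thesis
    by (rule integrable_sph_bounded[of _ B]) (use B in auto)
qed

lemma tangential_nonneg: "norm w = 1 \<Longrightarrow> 0 \<le> (norm (G w))\<^sup>2 - (G w \<bullet> w)\<^sup>2"
  using Cauchy_Schwarz_ineq[of "G w" w] by (simp add: power2_norm_eq_inner norm_eq_1)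

lemma integrable_tangential: "integrable sph (\<lambda>w. (norm (G w))\<^sup>2 - (G w \<bullet> w)\<^sup>2)"
proof -
  obtain B where B: "B \<ge> 0" "\<And>w. norm w = 1 \<Longrightarrow> \<bar>F w\<bar> \<le> B" "\<And>w. norm w = 1 \<Longrightarrow> norm (G w) \<le> B"
    using bounded_sphere by blast
  show ?thesis
  proof (rule integrable_sph_bounded)
    fix w :: "real^'n" assume w: "norm w = 1"
    have "(norm (G w))\<^sup>2 \<le> B\<^sup>2" using B(3)[OF w] by (simp add: power_mono)
    then show "\<bar>(norm (G w))\<^sup>2 - (G w \<bullet> w)\<^sup>2\<bar> \<le> B\<^sup>2"
      using tangential_nonneg[OF w] zero_le_power2[of "G w \<bullet> w"] by linarith
  qed simp
qed

text \<open>
  Let \<open>X\<close>, \<open>Y\<close> be independent Gaussian vectors and \<open>D = Y - X\<close>, \<open>Z = X + s D\<close>. By \<open>chord\<close>,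
  \<open>(U Y - U X)^2\<close> is at most the integral of \<open>(P Z \<bullet> D)^2\<close> over \<open>s \<in> [0, 1]\<close>. With
  \<open>v = (1 - s)^2 + s^2\<close> the vector \<open>Z\<close> is \<open>sqrt v\<close> times a Gaussian vector, and \<open>D\<close> is
  \<open>(2 s - 1) / v\<close> times \<open>Z\<close> plus an independent Gaussian vector of variance \<open>1 / v\<close>. Because
  \<open>P Z \<bullet> Z = U Z\<close>, the expectation is explicit for each \<open>s\<close>: writing \<open>A\<close> and \<open>T\<close> for the integrals of
  \<open>F^2\<close> and of the squared tangential gradient, one gets, up to a common factor,
  \<open>2 A \<le> \<integral> ((2 s - 1)^2 / v) A + (A + T) / (n v)\<close>. Since \<open>(2 s - 1)^2 = 2 v - 1\<close>, the right side is
  \<open>2 A\<close> plus the integral of \<open>((A + T) / n - A) / v\<close>. If \<open>(A + T) / n\<close> were less than \<open>A\<close>, then this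
  integral would be negative, because \<open>0 < v \<le> 1\<close>.
\<close>

lemma poincare_mean_zero:
  assumes mean: "(LINT w|sph. F w) = 0"
  shows "(real CARD('n) - 1) * (LINT w|sph. (F w)\<^sup>2) \<le> (LINT w|sph. (norm (G w))\<^sup>2 - (G w \<bullet> w)\<^sup>2)"
proof -
  let ?n = "real CARD('n)"
  let ?S = "sph_area TYPE('n)"
  define \<gamma> where "\<gamma> x = exp (- (norm x)\<^sup>2 / 2)" for x :: "real^'n"
  have \<gamma>0: "0 \<le> \<gamma> x" for x by (simp add: \<gamma>_def)
  have [measurable]: "\<gamma> \<in> borel_measurable borel" unfolding \<gamma>_def by measurable
  have n: "?n \<ge> 2" using dim by simp
  have S: "?S > 0" by (rule sph_area_pos)
  define A where "A = (LINT w|sph. (F w)\<^sup>2)"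
  define T where "T = (LINT w|sph. (norm (G w))\<^sup>2 - (G w \<bullet> w)\<^sup>2)"
  have A0: "0 \<le> A" unfolding A_def by (rule integral_nonneg_AE) auto
  have tang: "AE w in sph. 0 \<le> (norm (G w))\<^sup>2 - (G w \<bullet> w)\<^sup>2"
    using AE_sph_norm by eventually_elim (rule tangential_nonneg)
  then have T0: "0 \<le> T" unfolding T_def by (rule integral_nonneg_AE)
  obtain m0 where m0: "m0 > 0" "(\<integral>\<^sup>+r. ennreal (r ^ (CARD('n) - 1 + 0) * exp (- r\<^sup>2 / 2)) * indicator {0<..} r \<partial>lborel) = ennreal m0"
    by (rule gauss_radial_moment)
  obtain m2 where m2: "m2 > 0" "(\<integral>\<^sup>+r. ennreal (r ^ (CARD('n) - 1 + 2) * exp (- r\<^sup>2 / 2)) * indicator {0<..} r \<partial>lborel) = ennreal m2"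
    by (rule gauss_radial_moment)
  define \<kappa> where "\<kappa> = m0 * m2 * ?S"
  have \<kappa>: "\<kappa> > 0" using m0 m2 S by (simp add: \<kappa>_def)
  have iA: "(\<integral>\<^sup>+w. ennreal ((F w)\<^sup>2) \<partial>sph) = ennreal A"
    unfolding A_def by (rule nn_integral_eq_integral[OF integrable_F2]) simp
  have iP: "(\<integral>\<^sup>+w. ennreal ((norm (P w))\<^sup>2) \<partial>sph) = ennreal (A + T)"
  proof -
    have "(\<integral>\<^sup>+w. ennreal ((norm (P w))\<^sup>2) \<partial>sph) = (\<integral>\<^sup>+w. ennreal ((F w)\<^sup>2 + ((norm (G w))\<^sup>2 - (G w \<bullet> w)\<^sup>2)) \<partial>sph)"
      by (rule nn_integral_cong_AE) (use AE_sph_norm in \<open>eventually_elim, simp add: norm_P\<close>)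
    also have "\<dots> = ennreal (LINT w|sph. (F w)\<^sup>2 + ((norm (G w))\<^sup>2 - (G w \<bullet> w)\<^sup>2))"
    proof (rule nn_integral_eq_integral)
      show "AE w in sph. 0 \<le> (F w)\<^sup>2 + ((norm (G w))\<^sup>2 - (G w \<bullet> w)\<^sup>2)"
        using tang by eventually_elim (rule add_nonneg_nonneg, simp)
    qed (intro Bochner_Integration.integrable_add integrable_F2 integrable_tangential)
    also have "(LINT w|sph. (F w)\<^sup>2 + ((norm (G w))\<^sup>2 - (G w \<bullet> w)\<^sup>2)) = A + T"
      unfolding A_def T_def by (rule Bochner_Integration.integral_add[OF integrable_F2 integrable_tangential])
    finally show ?thesis .
  qed
  have ia: "(\<integral>\<^sup>+D. ennreal ((p \<bullet> D)\<^sup>2 * \<gamma> D) \<partial>lborel) = ennreal (m2 * ((norm p)\<^sup>2 * ?S / ?n))" for p :: "real^'n"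
  proof -
    have "(\<integral>\<^sup>+D. ennreal ((p \<bullet> D)\<^sup>2 * \<gamma> D) \<partial>lborel) = (\<integral>\<^sup>+x. ennreal (norm x ^ 2 * exp (- (norm x)\<^sup>2 / 2)) * ennreal ((p \<bullet> (x /\<^sub>R norm x))\<^sup>2) \<partial>lborel)"
    proof (rule nn_integral_cong)
      fix x :: "real^'n"
      have "(p \<bullet> x)\<^sup>2 * \<gamma> x = norm x ^ 2 * exp (- (norm x)\<^sup>2 / 2) * (p \<bullet> (x /\<^sub>R norm x))\<^sup>2"
        by (cases "x = 0") (simp_all add: \<gamma>_def power_mult_distrib field_simps)
      then show "ennreal ((p \<bullet> x)\<^sup>2 * \<gamma> x) = ennreal (norm x ^ 2 * exp (- (norm x)\<^sup>2 / 2)) * ennreal ((p \<bullet> (x /\<^sub>R norm x))\<^sup>2)"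
        by (simp only: ennreal_mult'' zero_le_power2)
    qed
    also have "\<dots> = ennreal m2 * (\<integral>\<^sup>+w. ennreal ((p \<bullet> w)\<^sup>2) \<partial>sph)"
      unfolding m2(2)[symmetric] by (rule nn_integral_gauss_polar) measurable
    also have "\<dots> = ennreal (m2 * ((norm p)\<^sup>2 * ?S / ?n))"
      unfolding nn_integral_sph_inner_sq by (rule ennreal_mult[symmetric]) (use m2 S in auto)
    finally show ?thesis .
  qed
  have ib: "(\<integral>\<^sup>+D. ennreal (\<gamma> D) \<partial>lborel) = ennreal (m0 * ?S)"
  proof -
    have "(\<integral>\<^sup>+D. ennreal (\<gamma> D) \<partial>lborel) = (\<integral>\<^sup>+x. ennreal (norm x ^ 0 * exp (- (norm x)\<^sup>2 / 2)) * (\<lambda>_. 1) (x /\<^sub>R norm x) \<partial>(lborel :: (real^'n) measure))"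
      by (simp add: \<gamma>_def)
    also have "\<dots> = ennreal m0 * (\<integral>\<^sup>+w. 1 \<partial>(sph :: (real^'n) measure))"
      unfolding m0(2)[symmetric] by (rule nn_integral_gauss_polar) measurable
    also have "(\<integral>\<^sup>+w. 1 \<partial>(sph :: (real^'n) measure)) = ennreal ?S"
      by (simp add: sph_area_def sph.emeasure_eq_measure)
    finally show ?thesis using m0 S by (simp add: ennreal_mult)
  qed
  have ic: "(\<integral>\<^sup>+Z. ennreal ((U Z)\<^sup>2 * \<gamma> Z) \<partial>lborel) = ennreal (m2 * A)"
  proof -
    have "(\<integral>\<^sup>+Z. ennreal ((U Z)\<^sup>2 * \<gamma> Z) \<partial>lborel) = (\<integral>\<^sup>+x. ennreal (norm x ^ 2 * exp (- (norm x)\<^sup>2 / 2)) * ennreal ((F (x /\<^sub>R norm x))\<^sup>2) \<partial>lborel)"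
      by (rule nn_integral_cong) (simp add: \<gamma>_def U_def power_mult_distrib ennreal_mult mult_ac)
    also have "\<dots> = ennreal m2 * (\<integral>\<^sup>+w. ennreal ((F w)\<^sup>2) \<partial>sph)"
      unfolding m2(2)[symmetric] by (rule nn_integral_gauss_polar) measurable
    finally show ?thesis using m2 A0 by (simp add: iA ennreal_mult[symmetric])
  qed
  have id: "(\<integral>\<^sup>+Z. ennreal ((norm (P Z))\<^sup>2 * \<gamma> Z) \<partial>lborel) = ennreal (m0 * (A + T))"
  proof -
    have "(\<integral>\<^sup>+Z. ennreal ((norm (P Z))\<^sup>2 * \<gamma> Z) \<partial>lborel) = (\<integral>\<^sup>+x. ennreal (norm x ^ 0 * exp (- (norm x)\<^sup>2 / 2)) * ennreal ((norm (P (x /\<^sub>R norm x)))\<^sup>2) \<partial>lborel)"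
      unfolding P_dir by (rule nn_integral_cong) (simp add: \<gamma>_def ennreal_mult mult_ac)
    also have "\<dots> = ennreal m0 * (\<integral>\<^sup>+w. ennreal ((norm (P w))\<^sup>2) \<partial>sph)"
      unfolding m0(2)[symmetric] by (rule nn_integral_gauss_polar) measurable
    also have "\<dots> = ennreal (m0 * (A + T))"
      unfolding iP by (rule ennreal_mult[symmetric]) (use m0 A0 T0 in auto)
    finally show ?thesis .
  qed
  \<comment> \<open>The cross term is odd in \<open>D\<close>, so averaging over \<open>D\<close> and \<open>-D\<close> removes it.\<close>
  have ie: "(\<integral>\<^sup>+D. ennreal ((u + p \<bullet> D)\<^sup>2 * \<gamma> D) \<partial>lborel) = ennreal (u\<^sup>2 * (m0 * ?S) + m2 * ((norm p)\<^sup>2 * ?S / ?n))" for u and p :: "real^'n"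
  proof -
    let ?I = "\<integral>\<^sup>+D. ennreal ((u + p \<bullet> D)\<^sup>2 * \<gamma> D) \<partial>lborel"
    have neg: "?I = (\<integral>\<^sup>+D. ennreal ((u - p \<bullet> D)\<^sup>2 * \<gamma> D) \<partial>lborel)"
      by (subst nn_integral_lborel_affine[of _ "-1" 0]) (simp_all add: \<gamma>_def)
    have "2 * ?I = ?I + (\<integral>\<^sup>+D. ennreal ((u - p \<bullet> D)\<^sup>2 * \<gamma> D) \<partial>lborel)"
      unfolding neg[symmetric] by (simp add: mult_2)
    also have "\<dots> = (\<integral>\<^sup>+D. ennreal ((u + p \<bullet> D)\<^sup>2 * \<gamma> D) + ennreal ((u - p \<bullet> D)\<^sup>2 * \<gamma> D) \<partial>lborel)"
      by (rule nn_integral_add[symmetric]) measurable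
    also have "\<dots> = (\<integral>\<^sup>+D. ennreal (2 * u\<^sup>2) * ennreal (\<gamma> D) + 2 * ennreal ((p \<bullet> D)\<^sup>2 * \<gamma> D) \<partial>lborel)"
    proof (rule nn_integral_cong)
      fix D :: "real^'n"
      have e: "(u + p \<bullet> D)\<^sup>2 * \<gamma> D + (u - p \<bullet> D)\<^sup>2 * \<gamma> D = 2 * u\<^sup>2 * \<gamma> D + 2 * ((p \<bullet> D)\<^sup>2 * \<gamma> D)"
        by (simp add: power2_eq_square algebra_simps)
      have "ennreal ((u + p \<bullet> D)\<^sup>2 * \<gamma> D) + ennreal ((u - p \<bullet> D)\<^sup>2 * \<gamma> D) = ennreal (2 * u\<^sup>2 * \<gamma> D + 2 * ((p \<bullet> D)\<^sup>2 * \<gamma> D))"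
        unfolding e[symmetric] by (rule ennreal_plus[symmetric]) (use \<gamma>0 in auto)
      also have "\<dots> = ennreal (2 * u\<^sup>2 * \<gamma> D) + ennreal (2 * ((p \<bullet> D)\<^sup>2 * \<gamma> D))"
        by (rule ennreal_plus) (use \<gamma>0 in auto)
      also have "ennreal (2 * u\<^sup>2 * \<gamma> D) = ennreal (2 * u\<^sup>2) * ennreal (\<gamma> D)"
        by (rule ennreal_mult) (use \<gamma>0 in auto)
      also have "ennreal (2 * ((p \<bullet> D)\<^sup>2 * \<gamma> D)) = 2 * ennreal ((p \<bullet> D)\<^sup>2 * \<gamma> D)"
        by (subst ennreal_mult) (use \<gamma>0 in auto)
      finally show "ennreal ((u + p \<bullet> D)\<^sup>2 * \<gamma> D) + ennreal ((u - p \<bullet> D)\<^sup>2 * \<gamma> D) = ennreal (2 * u\<^sup>2) * ennreal (\<gamma> D) + 2 * ennreal ((p \<bullet> D)\<^sup>2 * \<gamma> D)" .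
    qed
    also have "\<dots> = ennreal (2 * u\<^sup>2) * ennreal (m0 * ?S) + 2 * ennreal (m2 * ((norm p)\<^sup>2 * ?S / ?n))"
      by (subst nn_integral_add) (simp_all add: nn_integral_cmult ia ib)
    also have "\<dots> = ennreal (2 * u\<^sup>2 * (m0 * ?S)) + ennreal (2 * (m2 * ((norm p)\<^sup>2 * ?S / ?n)))"
    proof -
      have "ennreal (2 * u\<^sup>2 * (m0 * ?S)) = ennreal (2 * u\<^sup>2) * ennreal (m0 * ?S)"
        by (rule ennreal_mult) (use m0 S in auto)
      moreover have "ennreal (2 * (m2 * ((norm p)\<^sup>2 * ?S / ?n))) = 2 * ennreal (m2 * ((norm p)\<^sup>2 * ?S / ?n))"
        by (subst ennreal_mult) (use m2 S in auto)
      ultimately show ?thesis by simp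
    qed
    also have "\<dots> = ennreal (2 * u\<^sup>2 * (m0 * ?S) + 2 * (m2 * ((norm p)\<^sup>2 * ?S / ?n)))"
      by (rule ennreal_plus[symmetric]) (use m0 m2 S in auto)
    also have "\<dots> = ennreal (2 * (u\<^sup>2 * (m0 * ?S) + m2 * ((norm p)\<^sup>2 * ?S / ?n)))"
      by (simp add: algebra_simps)
    also have "\<dots> = 2 * ennreal (u\<^sup>2 * (m0 * ?S) + m2 * ((norm p)\<^sup>2 * ?S / ?n))"
      by (subst ennreal_mult) (use m0 m2 S in auto)
    finally show ?thesis
      by (simp add: ennreal_mult_cancel_left)
  qed
  have iL: "(\<integral>\<^sup>+Y. ennreal ((U Y - u)\<^sup>2 * \<gamma> Y) \<partial>lborel) = ennreal (A * m2 + u\<^sup>2 * ?S * m0)" for u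
  proof -
    have "(\<integral>\<^sup>+Y. ennreal ((U Y - u)\<^sup>2 * \<gamma> Y) \<partial>lborel) =
       (\<integral>\<^sup>+r. (\<integral>\<^sup>+w. ennreal ((U (0 + r *\<^sub>R w) - u)\<^sup>2 * \<gamma> (0 + r *\<^sub>R w)) \<partial>sph) * ennreal (r ^ (CARD('n) - 1)) * indicator {0<..} r \<partial>lborel)"
      by (rule nn_integral_polar) measurable
    also have "\<dots> = (\<integral>\<^sup>+r. ennreal A * (ennreal (r ^ (CARD('n) - 1 + 2) * exp (- r\<^sup>2 / 2)) * indicator {0<..} r) +
        ennreal (u\<^sup>2 * ?S) * (ennreal (r ^ (CARD('n) - 1 + 0) * exp (- r\<^sup>2 / 2)) * indicator {0<..} r) \<partial>lborel)"
    proof (rule nn_integral_cong)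
      fix r :: real
      show "(\<integral>\<^sup>+w. ennreal ((U (0 + r *\<^sub>R w) - u)\<^sup>2 * \<gamma> (0 + r *\<^sub>R w)) \<partial>sph) * ennreal (r ^ (CARD('n) - 1)) * indicator {0<..} r
        = ennreal A * (ennreal (r ^ (CARD('n) - 1 + 2) * exp (- r\<^sup>2 / 2)) * indicator {0<..} r) +
        ennreal (u\<^sup>2 * ?S) * (ennreal (r ^ (CARD('n) - 1 + 0) * exp (- r\<^sup>2 / 2)) * indicator {0<..} r)"
      proof (cases "r > 0")
        case True
        let ?e = "exp (- r\<^sup>2 / 2)"
        have "(\<integral>\<^sup>+w. ennreal ((U (0 + r *\<^sub>R w) - u)\<^sup>2 * \<gamma> (0 + r *\<^sub>R w)) \<partial>sph)
          = (\<integral>\<^sup>+w. ennreal ((r * F w - u)\<^sup>2 * ?e) \<partial>sph)"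
          by (rule nn_integral_cong_AE)
             (use AE_sph_norm in \<open>eventually_elim, use True in \<open>simp add: U_def \<gamma>_def\<close>\<close>)
        also have "\<dots> = ennreal (LINT w|sph. (r * F w - u)\<^sup>2 * ?e)"
        proof (rule nn_integral_eq_integral)
          have "(\<lambda>w. (r * F w - u)\<^sup>2 * ?e) = (\<lambda>w. (r\<^sup>2 * ?e) * (F w)\<^sup>2 - (2 * r * u * ?e) * F w + u\<^sup>2 * ?e)"
            by (simp add: fun_eq_iff power2_eq_square algebra_simps)
          then show "integrable sph (\<lambda>w. (r * F w - u)\<^sup>2 * ?e)"
            using integrable_F2 integrable_F by simp
        qed auto
        also have "(LINT w|sph. (r * F w - u)\<^sup>2 * ?e) = (LINT w|sph. (r\<^sup>2 * ?e) * (F w)\<^sup>2 - (2 * r * u * ?e) * F w + u\<^sup>2 * ?e)"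
          by (rule Bochner_Integration.integral_cong) (auto simp: power2_eq_square algebra_simps)
        also have "\<dots> = (r\<^sup>2 * ?e) * A + u\<^sup>2 * ?e * ?S"
          using integrable_F2 integrable_F mean by (simp add: A_def sph_area_def)
        also have "ennreal ((r\<^sup>2 * ?e) * A + u\<^sup>2 * ?e * ?S) * ennreal (r ^ (CARD('n) - 1)) =
          ennreal (((r\<^sup>2 * ?e) * A + u\<^sup>2 * ?e * ?S) * r ^ (CARD('n) - 1))"
          using True A0 S by (intro ennreal_mult[symmetric]) auto
        also have "((r\<^sup>2 * ?e) * A + u\<^sup>2 * ?e * ?S) * r ^ (CARD('n) - 1) = A * (r ^ (CARD('n) - 1 + 2) * ?e) + u\<^sup>2 * ?S * (r ^ (CARD('n) - 1 + 0) * ?e)"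
          by (simp only: power_add) (simp add: algebra_simps)
        also have "ennreal \<dots> = ennreal A * ennreal (r ^ (CARD('n) - 1 + 2) * ?e) + ennreal (u\<^sup>2 * ?S) * ennreal (r ^ (CARD('n) - 1 + 0) * ?e)"
          using True A0 S by (subst ennreal_plus) (auto simp: ennreal_mult)
        finally show ?thesis using True by simp
      qed simp
    qed
    also have "\<dots> = ennreal A * ennreal m2 + ennreal (u\<^sup>2 * ?S) * ennreal m0"
    proof (subst nn_integral_add)
      show "(\<integral>\<^sup>+r. ennreal A * (ennreal (r ^ (CARD('n) - 1 + 2) * exp (- r\<^sup>2 / 2)) * indicator {0<..} r) \<partial>lborel) +
        (\<integral>\<^sup>+r. ennreal (u\<^sup>2 * ?S) * (ennreal (r ^ (CARD('n) - 1 + 0) * exp (- r\<^sup>2 / 2)) * indicator {0<..} r) \<partial>lborel)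
        = ennreal A * ennreal m2 + ennreal (u\<^sup>2 * ?S) * ennreal m0"
        unfolding m0(2)[symmetric] m2(2)[symmetric]
        by (intro arg_cong2[where f="(+)"] nn_integral_cmult) measurable
    qed measurable
    also have "\<dots> = ennreal (A * m2 + u\<^sup>2 * ?S * m0)"
      using m0 m2 A0 S by (simp add: ennreal_mult ennreal_plus)
    finally show ?thesis .
  qed
  have L: "(\<integral>\<^sup>+X. \<integral>\<^sup>+Y. ennreal ((U Y - U X)\<^sup>2 * (\<gamma> X * \<gamma> Y)) \<partial>lborel \<partial>lborel) = ennreal (2 * (\<kappa> * A))"
  proof -
    have "(\<integral>\<^sup>+X. \<integral>\<^sup>+Y. ennreal ((U Y - U X)\<^sup>2 * (\<gamma> X * \<gamma> Y)) \<partial>lborel \<partial>lborel) =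
       (\<integral>\<^sup>+X. ennreal (A * m2) * ennreal (\<gamma> X) + ennreal (?S * m0) * ennreal ((U X)\<^sup>2 * \<gamma> X) \<partial>lborel)"
    proof (rule nn_integral_cong)
      fix X :: "real^'n"
      have "(\<integral>\<^sup>+Y. ennreal ((U Y - U X)\<^sup>2 * (\<gamma> X * \<gamma> Y)) \<partial>lborel) = (\<integral>\<^sup>+Y. ennreal (\<gamma> X) * ennreal ((U Y - U X)\<^sup>2 * \<gamma> Y) \<partial>lborel)"
        using \<gamma>0 by (simp add: ennreal_mult[symmetric] mult_ac)
      also have "\<dots> = ennreal (\<gamma> X) * ennreal (A * m2 + (U X)\<^sup>2 * ?S * m0)"
        unfolding iL[symmetric] by (rule nn_integral_cmult) measurable
      also have "\<dots> = ennreal (A * m2 * \<gamma> X + ?S * m0 * ((U X)\<^sup>2 * \<gamma> X))"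
        using \<gamma>0 A0 m0 m2 S by (simp add: ennreal_mult[symmetric] algebra_simps)
      also have "\<dots> = ennreal (A * m2) * ennreal (\<gamma> X) + ennreal (?S * m0) * ennreal ((U X)\<^sup>2 * \<gamma> X)"
        using \<gamma>0 A0 m0 m2 S by (subst ennreal_plus) (auto simp: ennreal_mult)
      finally show "(\<integral>\<^sup>+Y. ennreal ((U Y - U X)\<^sup>2 * (\<gamma> X * \<gamma> Y)) \<partial>lborel) = ennreal (A * m2) * ennreal (\<gamma> X) + ennreal (?S * m0) * ennreal ((U X)\<^sup>2 * \<gamma> X)" .
    qed
    also have "\<dots> = ennreal (A * m2) * ennreal (m0 * ?S) + ennreal (?S * m0) * ennreal (m2 * A)"
      by (subst nn_integral_add) (simp_all add: nn_integral_cmult ib ic)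
    also have "\<dots> = ennreal (A * m2 * (m0 * ?S) + ?S * m0 * (m2 * A))"
      using A0 m0 m2 S by (subst ennreal_plus) (auto simp: ennreal_mult)
    finally show ?thesis by (simp add: \<kappa>_def algebra_simps)
  qed
  define J where "J s = (\<integral>\<^sup>+X. \<integral>\<^sup>+Y. ennreal ((P ((1 - s) *\<^sub>R X + s *\<^sub>R Y) \<bullet> (Y - X))\<^sup>2 * (\<gamma> X * \<gamma> Y)) \<partial>lborel \<partial>lborel)" for s
  have J: "J s = ennreal ((1 / ((1 - s)\<^sup>2 + s\<^sup>2)) * ((2 * s - 1)\<^sup>2 * (\<kappa> * A) + \<kappa> / ?n * (A + T)))"
    if s: "0 \<le> s" "s < 1" for s
  proof -
    define v where "v = (1 - s)\<^sup>2 + s\<^sup>2"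
    have v: "v > 0" using s by (auto simp: v_def intro!: add_pos_nonneg)
    define c where "c = sqrt v"
    have c: "c > 0" "c\<^sup>2 = v" using v by (auto simp: c_def)
    let ?a = "(1 - s) / c" and ?b = "s / c" and ?t = "2 * s - 1"
    have ab: "?a\<^sup>2 + ?b\<^sup>2 = 1" "?a \<noteq> 0"
      using c v s by (simp_all add: power_divide add_divide_distrib[symmetric] v_def)
    have "J s = (\<integral>\<^sup>+Z. \<integral>\<^sup>+D. ennreal ((P ((1 - s) *\<^sub>R (?a *\<^sub>R Z - ?b *\<^sub>R D) + s *\<^sub>R (?b *\<^sub>R Z + ?a *\<^sub>R D)) \<bullet> ((?b *\<^sub>R Z + ?a *\<^sub>R D) - (?a *\<^sub>R Z - ?b *\<^sub>R D)))\<^sup>2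
        * (\<gamma> (?a *\<^sub>R Z - ?b *\<^sub>R D) * \<gamma> (?b *\<^sub>R Z + ?a *\<^sub>R D))) \<partial>lborel \<partial>lborel)"
      unfolding J_def by (rule nn_integral_pair_rotation[OF _ ab]) (unfold borel_prod[symmetric] split_beta, measurable)
    also have "\<dots> = (\<integral>\<^sup>+Z. \<integral>\<^sup>+D. ennreal (1 / v * \<gamma> Z) * ennreal ((?t * U Z + P Z \<bullet> D)\<^sup>2 * \<gamma> D) \<partial>lborel \<partial>lborel)"
    proof (intro nn_integral_cong)
      fix Z D :: "real^'n"
      have "(1 - s) * ?a + s * ?b = v / c" by (simp add: v_def power2_eq_square add_divide_distrib)
      also have "\<dots> = c" using c by (simp add: power2_eq_square field_simps)
      finally have cc: "(1 - s) * ?a + s * ?b = c" .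
      have "(1 - s) *\<^sub>R (?a *\<^sub>R Z - ?b *\<^sub>R D) + s *\<^sub>R (?b *\<^sub>R Z + ?a *\<^sub>R D) = ((1 - s) * ?a + s * ?b) *\<^sub>R Z + (s * ?a - (1 - s) * ?b) *\<^sub>R D"
        by (simp add: scaleR_diff_right scaleR_add_right scaleR_add_left scaleR_diff_left)
      also have "\<dots> = c *\<^sub>R Z" unfolding cc by simp
      finally have 1: "P ((1 - s) *\<^sub>R (?a *\<^sub>R Z - ?b *\<^sub>R D) + s *\<^sub>R (?b *\<^sub>R Z + ?a *\<^sub>R D)) = P Z"
        using P_scale[OF c(1)] by simp
      have "(?b *\<^sub>R Z + ?a *\<^sub>R D) - (?a *\<^sub>R Z - ?b *\<^sub>R D) = (?b - ?a) *\<^sub>R Z + (?a + ?b) *\<^sub>R D"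
        by (simp add: scaleR_add_left scaleR_diff_left)
      also have "?b - ?a = ?t / c" by (simp add: diff_divide_distrib[symmetric])
      also have "?a + ?b = 1 / c" by (simp add: add_divide_distrib[symmetric])
      finally have 2: "P Z \<bullet> ((?b *\<^sub>R Z + ?a *\<^sub>R D) - (?a *\<^sub>R Z - ?b *\<^sub>R D)) = (?t * U Z + P Z \<bullet> D) / c"
        by (simp add: inner_add_right P_inner add_divide_distrib)
      have "(norm (a *\<^sub>R Z - b *\<^sub>R D))\<^sup>2 + (norm (b *\<^sub>R Z + a *\<^sub>R D))\<^sup>2 = (a\<^sup>2 + b\<^sup>2) * (norm Z)\<^sup>2 + (a\<^sup>2 + b\<^sup>2) * (norm D)\<^sup>2" for a b
        unfolding power2_norm_eq_inner
        by (simp add: inner_diff_left inner_diff_right inner_add_left inner_add_right inner_commute[of D Z] power2_eq_square algebra_simps)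
      from this[of ?a ?b]
      have "(norm (?a *\<^sub>R Z - ?b *\<^sub>R D))\<^sup>2 + (norm (?b *\<^sub>R Z + ?a *\<^sub>R D))\<^sup>2 = (?a\<^sup>2 + ?b\<^sup>2) * (norm Z)\<^sup>2 + (?a\<^sup>2 + ?b\<^sup>2) * (norm D)\<^sup>2" .
      then have "- (norm (?a *\<^sub>R Z - ?b *\<^sub>R D))\<^sup>2 / 2 + - (norm (?b *\<^sub>R Z + ?a *\<^sub>R D))\<^sup>2 / 2 = - (norm Z)\<^sup>2 / 2 + - (norm D)\<^sup>2 / 2"
        unfolding ab by simp
      then have 3: "\<gamma> (?a *\<^sub>R Z - ?b *\<^sub>R D) * \<gamma> (?b *\<^sub>R Z + ?a *\<^sub>R D) = \<gamma> Z * \<gamma> D"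
        unfolding \<gamma>_def exp_add[symmetric] by (rule arg_cong)
      have "((?t * U Z + P Z \<bullet> D) / c)\<^sup>2 * (\<gamma> Z * \<gamma> D) = (1 / v * \<gamma> Z) * ((?t * U Z + P Z \<bullet> D)\<^sup>2 * \<gamma> D)"
        by (simp add: power_divide c)
      then show "ennreal ((P ((1 - s) *\<^sub>R (?a *\<^sub>R Z - ?b *\<^sub>R D) + s *\<^sub>R (?b *\<^sub>R Z + ?a *\<^sub>R D)) \<bullet> ((?b *\<^sub>R Z + ?a *\<^sub>R D) - (?a *\<^sub>R Z - ?b *\<^sub>R D)))\<^sup>2
        * (\<gamma> (?a *\<^sub>R Z - ?b *\<^sub>R D) * \<gamma> (?b *\<^sub>R Z + ?a *\<^sub>R D))) = ennreal (1 / v * \<gamma> Z) * ennreal ((?t * U Z + P Z \<bullet> D)\<^sup>2 * \<gamma> D)"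
        unfolding 1 2 3 using v \<gamma>0 by (simp only: ennreal_mult'' zero_le_power2 mult_nonneg_nonneg)
    qed
    also have "\<dots> = (\<integral>\<^sup>+Z. ennreal (1 / v * \<gamma> Z) * ennreal ((?t * U Z)\<^sup>2 * (m0 * ?S) + m2 * ((norm (P Z))\<^sup>2 * ?S / ?n)) \<partial>lborel)"
      unfolding ie[symmetric] by (rule nn_integral_cong, rule nn_integral_cmult) measurable
    also have "\<dots> = (\<integral>\<^sup>+Z. ennreal (1 / v * ?t\<^sup>2 * (m0 * ?S)) * ennreal ((U Z)\<^sup>2 * \<gamma> Z) + ennreal (1 / v * m2 * ?S / ?n) * ennreal ((norm (P Z))\<^sup>2 * \<gamma> Z) \<partial>lborel)"
    proof (rule nn_integral_cong)
      fix Z :: "real^'n"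
      have "ennreal (1 / v * \<gamma> Z) * ennreal ((?t * U Z)\<^sup>2 * (m0 * ?S) + m2 * ((norm (P Z))\<^sup>2 * ?S / ?n))
        = ennreal ((1 / v * \<gamma> Z) * ((?t * U Z)\<^sup>2 * (m0 * ?S) + m2 * ((norm (P Z))\<^sup>2 * ?S / ?n)))"
        using v \<gamma>0 m0 m2 S by (intro ennreal_mult[symmetric]) auto
      also have "(1 / v * \<gamma> Z) * ((?t * U Z)\<^sup>2 * (m0 * ?S) + m2 * ((norm (P Z))\<^sup>2 * ?S / ?n)) =
         (1 / v * ?t\<^sup>2 * (m0 * ?S)) * ((U Z)\<^sup>2 * \<gamma> Z) + (1 / v * m2 * ?S / ?n) * ((norm (P Z))\<^sup>2 * \<gamma> Z)"
        by (simp only: power_mult_distrib) (simp only: ring_distribs divide_inverse mult_ac mult_1_left)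
      also have "ennreal \<dots> = ennreal (1 / v * ?t\<^sup>2 * (m0 * ?S)) * ennreal ((U Z)\<^sup>2 * \<gamma> Z) + ennreal (1 / v * m2 * ?S / ?n) * ennreal ((norm (P Z))\<^sup>2 * \<gamma> Z)"
      proof -
        have "0 \<le> 1 / v * ?t\<^sup>2 * (m0 * ?S)" "0 \<le> (U Z)\<^sup>2 * \<gamma> Z" "0 \<le> 1 / v * m2 * ?S / ?n" "0 \<le> (norm (P Z))\<^sup>2 * \<gamma> Z"
          using v \<gamma>0[of Z] m0 m2 S by auto
        then show ?thesis by (simp only: ennreal_mult[symmetric] ennreal_plus[symmetric] mult_nonneg_nonneg)
      qed
      finally show "ennreal (1 / v * \<gamma> Z) * ennreal ((?t * U Z)\<^sup>2 * (m0 * ?S) + m2 * ((norm (P Z))\<^sup>2 * ?S / ?n)) = ennreal (1 / v * ?t\<^sup>2 * (m0 * ?S)) * ennreal ((U Z)\<^sup>2 * \<gamma> Z) + ennreal (1 / v * m2 * ?S / ?n) * ennreal ((norm (P Z))\<^sup>2 * \<gamma> Z)" .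
    qed
    also have "\<dots> = ennreal (1 / v * ?t\<^sup>2 * (m0 * ?S)) * ennreal (m2 * A) + ennreal (1 / v * m2 * ?S / ?n) * ennreal (m0 * (A + T))"
    proof (subst nn_integral_add)
      show "(\<integral>\<^sup>+Z. ennreal (1 / v * ?t\<^sup>2 * (m0 * ?S)) * ennreal ((U Z)\<^sup>2 * \<gamma> Z) \<partial>lborel) + (\<integral>\<^sup>+Z. ennreal (1 / v * m2 * ?S / ?n) * ennreal ((norm (P Z))\<^sup>2 * \<gamma> Z) \<partial>lborel)
        = ennreal (1 / v * ?t\<^sup>2 * (m0 * ?S)) * ennreal (m2 * A) + ennreal (1 / v * m2 * ?S / ?n) * ennreal (m0 * (A + T))"
        unfolding ic[symmetric] id[symmetric] by (intro arg_cong2[where f="(+)"] nn_integral_cmult) measurable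
    qed measurable
    also have "\<dots> = ennreal ((1 / v * ?t\<^sup>2 * (m0 * ?S)) * (m2 * A) + (1 / v * m2 * ?S / ?n) * (m0 * (A + T)))"
    proof -
      have "0 \<le> 1 / v * ?t\<^sup>2 * (m0 * ?S)" "0 \<le> m2 * A" "0 \<le> 1 / v * m2 * ?S / ?n" "0 \<le> m0 * (A + T)"
        using v m0 m2 S A0 T0 by auto
      then show ?thesis by (simp only: ennreal_mult[symmetric] ennreal_plus[symmetric] mult_nonneg_nonneg)
    qed
    also have "(1 / v * ?t\<^sup>2 * (m0 * ?S)) * (m2 * A) + (1 / v * m2 * ?S / ?n) * (m0 * (A + T)) = (1 / v) * (?t\<^sup>2 * (\<kappa> * A) + \<kappa> / ?n * (A + T))"
      by (simp only: \<kappa>_def ring_distribs divide_inverse mult_ac mult_1_left)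
    finally show ?thesis by (simp only: v_def)
  qed
  have "ennreal (2 * (\<kappa> * A)) \<le> (\<integral>\<^sup>+X. \<integral>\<^sup>+Y. \<integral>\<^sup>+s. ennreal ((P ((1 - s) *\<^sub>R X + s *\<^sub>R Y) \<bullet> (Y - X))\<^sup>2 * (\<gamma> X * \<gamma> Y)) * indicator {0..1} s \<partial>lborel \<partial>lborel \<partial>lborel)"
    unfolding L[symmetric]
  proof (rule nn_integral_mono_AE)
    have "AE X in lborel. X \<noteq> (0 :: real^'n)" by (rule AE_lborel_singleton)
    then show "AE X in lborel. (\<integral>\<^sup>+Y. ennreal ((U Y - U X)\<^sup>2 * (\<gamma> X * \<gamma> Y)) \<partial>lborel) \<le>
      (\<integral>\<^sup>+Y. \<integral>\<^sup>+s. ennreal ((P ((1 - s) *\<^sub>R X + s *\<^sub>R Y) \<bullet> (Y - X))\<^sup>2 * (\<gamma> X * \<gamma> Y)) * indicator {0..1} s \<partial>lborel \<partial>lborel)"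
    proof eventually_elim
      case (elim X)
      show ?case
      proof (rule nn_integral_mono_AE)
        show "AE Y in lborel. ennreal ((U Y - U X)\<^sup>2 * (\<gamma> X * \<gamma> Y)) \<le>
          (\<integral>\<^sup>+s. ennreal ((P ((1 - s) *\<^sub>R X + s *\<^sub>R Y) \<bullet> (Y - X))\<^sup>2 * (\<gamma> X * \<gamma> Y)) * indicator {0..1} s \<partial>lborel)"
          using AE_not_in_span[of X]
        proof eventually_elim
          case (elim Y)
          have "ennreal ((U Y - U X)\<^sup>2 * (\<gamma> X * \<gamma> Y)) = ennreal (\<gamma> X * \<gamma> Y) * ennreal ((U Y - U X)\<^sup>2)"
            using \<gamma>0 by (simp add: ennreal_mult[symmetric] mult_ac)
          also have "\<dots> \<le> ennreal (\<gamma> X * \<gamma> Y) * (\<integral>\<^sup>+s. ennreal ((P ((1 - s) *\<^sub>R X + s *\<^sub>R Y) \<bullet> (Y - X))\<^sup>2) * indicator {0..1} s \<partial>lborel)"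
            by (intro mult_left_mono chord[OF \<open>X \<noteq> 0\<close> elim]) simp
          also have "\<dots> = (\<integral>\<^sup>+s. ennreal (\<gamma> X * \<gamma> Y) * (ennreal ((P ((1 - s) *\<^sub>R X + s *\<^sub>R Y) \<bullet> (Y - X))\<^sup>2) * indicator {0..1} s) \<partial>lborel)"
            by (rule nn_integral_cmult[symmetric]) measurable
          also have "\<dots> = (\<integral>\<^sup>+s. ennreal ((P ((1 - s) *\<^sub>R X + s *\<^sub>R Y) \<bullet> (Y - X))\<^sup>2 * (\<gamma> X * \<gamma> Y)) * indicator {0..1} s \<partial>lborel)"
            by (rule nn_integral_cong) (use \<gamma>0 in \<open>simp add: ennreal_mult mult_ac\<close>)
          finally show ?case .
        qed
      qed
    qed
  qed
  also have "\<dots> = (\<integral>\<^sup>+X. \<integral>\<^sup>+s. \<integral>\<^sup>+Y. ennreal ((P ((1 - s) *\<^sub>R X + s *\<^sub>R Y) \<bullet> (Y - X))\<^sup>2 * (\<gamma> X * \<gamma> Y)) * indicator {0..1} s \<partial>lborel \<partial>lborel \<partial>lborel)"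
    by (rule nn_integral_cong, rule lborel_pair.Fubini') measurable
  also have "\<dots> = (\<integral>\<^sup>+s. \<integral>\<^sup>+X. \<integral>\<^sup>+Y. ennreal ((P ((1 - s) *\<^sub>R X + s *\<^sub>R Y) \<bullet> (Y - X))\<^sup>2 * (\<gamma> X * \<gamma> Y)) * indicator {0..1} s \<partial>lborel \<partial>lborel \<partial>lborel)"
    by (rule lborel_pair.Fubini') measurable
  also have "\<dots> = (\<integral>\<^sup>+s. J s * indicator {0..1} s \<partial>lborel)"
    unfolding J_def by (intro nn_integral_cong) (auto simp: indicator_def)
  finally have main: "ennreal (2 * (\<kappa> * A)) \<le> (\<integral>\<^sup>+s. J s * indicator {0..1} s \<partial>lborel)" .
  have "(?n - 1) * A \<le> T"
  proof (rule ccontr)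
    assume "\<not> (?n - 1) * A \<le> T"
    then have lt: "(A + T) / ?n < A" using n by (simp add: field_simps)
    have "(\<integral>\<^sup>+s. J s * indicator {0..1} s \<partial>lborel) \<le> (\<integral>\<^sup>+s. ennreal (\<kappa> * (A + (A + T) / ?n)) * indicator {0..1::real} s \<partial>lborel)"
    proof (rule nn_integral_mono_AE)
      have "AE s in lborel. s \<noteq> (1::real)" by (rule AE_lborel_singleton)
      then show "AE s in lborel. J s * indicator {0..1} s \<le> ennreal (\<kappa> * (A + (A + T) / ?n)) * indicator {0..1::real} s"
      proof eventually_elim
        case (elim s)
        show ?case
        proof (cases "s \<in> {0..1}")
          case True
          then have s: "0 \<le> s" "s < 1" using elim by auto
          define v where "v = (1 - s)\<^sup>2 + s\<^sup>2"
          have v: "v > 0" using s by (auto simp: v_def intro!: add_pos_nonneg)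
          have tv: "(2 * s - 1)\<^sup>2 = 2 * v - 1" by (simp add: v_def power2_eq_square algebra_simps)
          have "0 \<le> s * (1 - s)" using s by simp
          then have v1: "v \<le> 1" by (simp add: v_def power2_eq_square algebra_simps)
          have "(1 / v) * ((2 * s - 1)\<^sup>2 * (\<kappa> * A) + \<kappa> / ?n * (A + T)) = \<kappa> * (2 * A - (A - (A + T) / ?n) / v)"
            unfolding tv using v n by (simp add: field_simps)
          also have "\<dots> \<le> \<kappa> * (2 * A - (A - (A + T) / ?n))"
          proof -
            have "A - (A + T) / ?n \<le> (A - (A + T) / ?n) / v"
              using v v1 lt by (simp add: pos_le_divide_eq mult_left_le)
            then show ?thesis using \<kappa> by (intro mult_left_mono) auto
          qed
          finally have "(1 / v) * ((2 * s - 1)\<^sup>2 * (\<kappa> * A) + \<kappa> / ?n * (A + T)) \<le> \<kappa> * (A + (A + T) / ?n)"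
            by (simp add: algebra_simps)
          then show ?thesis using True by (simp add: J[OF s] v_def ennreal_leI)
        qed simp
      qed
    qed
    also have "\<dots> = ennreal (\<kappa> * (A + (A + T) / ?n))"
      by (subst nn_integral_cmult) simp_all
    finally have "ennreal (2 * (\<kappa> * A)) \<le> ennreal (\<kappa> * (A + (A + T) / ?n))"
      using main by (rule order_trans[rotated])
    moreover have "0 \<le> \<kappa> * (A + (A + T) / ?n)" using \<kappa> A0 T0 by simp
    ultimately have "2 * (\<kappa> * A) \<le> \<kappa> * (A + (A + T) / ?n)" by (simp add: ennreal_le_iff)
    moreover have "\<kappa> * ((A + T) / ?n) < \<kappa> * A" using lt \<kappa> by (rule mult_strict_left_mono)
    ultimately show False by (simp add: algebra_simps)
  qed
  then show ?thesis by (simp add: A_def T_def)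
qed

end

text \<open>
  Subtracting the mean removes the hypothesis on the mean value and replaces the square integral by
  the variance.
\<close>

theorem sphere_poincare:
  fixes F :: "real^'n \<Rightarrow> real"
  assumes "C1_near (sphere 0 1) F G" "F \<in> borel_measurable borel" "G \<in> borel_measurable borel" "2 \<le> CARD('n)"
  shows "(real CARD('n) - 1) * (sph_area TYPE('n) * (LINT w|sph. (F w)\<^sup>2) - (LINT w|sph. F w)\<^sup>2)
    \<le> sph_area TYPE('n) * (LINT w|sph. (norm (G w))\<^sup>2 - (G w \<bullet> w)\<^sup>2)"
proof -
  let ?S = "sph_area TYPE('n)"
  interpret sphere_function F G using assms by unfold_locales
  define m where "m = (LINT w|sph. F w) / ?S"
  have S: "?S > 0" by (rule sph_area_pos)
  have "C1_near (sphere 0 1) (\<lambda>x. 1 * F x + (- m) * 1) (\<lambda>x. 1 *\<^sub>R G x + (- m) *\<^sub>R 0)"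
    by (rule C1_near_lincomb[OF C1 C1_near_const])
  then interpret M: sphere_function "\<lambda>x. F x - m" G
    using assms by unfold_locales auto
  have "(LINT w|sph. F w - m) = (LINT w|sph. F w) - m * ?S"
    using integrable_F by (simp add: sph_area_def)
  also have "\<dots> = 0" using S by (simp add: m_def)
  finally have mean: "(LINT w|sph. F w - m) = 0" .
  have "(LINT w|sph. (F w - m)\<^sup>2) = (LINT w|sph. (F w)\<^sup>2 - 2 * m * F w + m\<^sup>2)"
    by (rule Bochner_Integration.integral_cong) (auto simp: power2_eq_square algebra_simps)
  also have "\<dots> = (LINT w|sph. (F w)\<^sup>2) - 2 * m * (LINT w|sph. F w) + m\<^sup>2 * ?S"
    using integrable_F integrable_F2 by (simp add: sph_area_def)
  also have "\<dots> = (LINT w|sph. (F w)\<^sup>2) - (LINT w|sph. F w)\<^sup>2 / ?S"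
    using S by (simp add: m_def power2_eq_square field_simps)
  finally have eq: "?S * (LINT w|sph. (F w - m)\<^sup>2) = ?S * (LINT w|sph. (F w)\<^sup>2) - (LINT w|sph. F w)\<^sup>2"
    using S by (simp add: right_diff_distrib)
  have "?S * ((real CARD('n) - 1) * (LINT w|sph. (F w - m)\<^sup>2)) \<le> ?S * (LINT w|sph. (norm (G w))\<^sup>2 - (G w \<bullet> w)\<^sup>2)"
    using M.poincare_mean_zero[OF mean] S by (intro mult_left_mono) auto
  then show ?thesis unfolding eq[symmetric] by (simp only: mult.left_commute)
qed

section \<open>The Steklov--Neumann inequality on a concentric shell\<close>

text \<open>
  Nothing is known about a function off the neighbourhood on which it is differentiable; cutting it
  off there makes it a Borel function on the whole space.
\<close>

lemma C1_near_borel: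
  assumes "C1_near S f g"
  obtains f0 g0 where "C1_near S f0 g0" "f0 \<in> borel_measurable borel" "g0 \<in> borel_measurable borel"
    "\<And>x. x \<in> S \<Longrightarrow> f0 x = f x" "\<And>x. x \<in> S \<Longrightarrow> g0 x = g x"
proof -
  obtain U where U: "open U" "S \<subseteq> U" "\<forall>x\<in>U. GDERIV f x :> g x" "continuous_on U g"
    using assms unfolding C1_near_def by blast
  have cf: "continuous_on U f"
    by (rule C1_near_continuous(1)[of U f g]) (use U in \<open>auto simp: C1_near_def\<close>)
  let ?f = "\<lambda>x. indicator U x *\<^sub>R f x" and ?g = "\<lambda>x. indicator U x *\<^sub>R g x"
  have "GDERIV ?f x :> ?g x" if x: "x \<in> U" for x
  proof -
    have "(f has_derivative (\<lambda>h. h \<bullet> g x)) (at x)" using U(3) x by (simp add: gderiv_def)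
    then have "(?f has_derivative (\<lambda>h. h \<bullet> g x)) (at x)"
      by (rule has_derivative_transform_within_open[OF _ U(1) x]) simp
    then show ?thesis using x by (simp add: gderiv_def)
  qed
  moreover have "continuous_on U ?g"
    using U(4) by (rule continuous_on_eq) simp
  ultimately have "C1_near S ?f ?g"
    using U unfolding C1_near_def by blast
  moreover have "?f \<in> borel_measurable borel" "?g \<in> borel_measurable borel"
    by (rule borel_measurable_continuous_on_indicator; use U cf in simp)+
  ultimately show ?thesis
    by (rule that) (use U(2) in auto)
qed

subsection \<open>The one-dimensional inequality\<close>

text \<open>
  The flux \<open>r^(m + 1) \<phi>' / \<phi>\<close> of the radial profile \<open>\<phi> r = r + a^n / ((n - 1) r^(n - 1))\<close> with
  \<open>n = m + 2\<close>, for which \<open>\<phi> (norm x) x_i / norm x\<close> is harmonic with vanishing normal derivative at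
  \<open>norm x = a\<close>.
\<close>

definition steklov_weight :: "real \<Rightarrow> nat \<Rightarrow> real \<Rightarrow> real" where
  "steklov_weight a m r = real (m + 1) * r ^ m * (r ^ (m + 2) - a ^ (m + 2)) / (real (m + 1) * r ^ (m + 2) + a ^ (m + 2))"

lemma steklov_weight_denominator_pos: "0 < a \<Longrightarrow> 0 < r \<Longrightarrow> 0 < real (m + 1) * r ^ (m + 2) + a ^ (m + 2)"
  by (intro add_pos_pos mult_pos_pos zero_less_power) auto

lemma steklov_weight_pos: "0 < a \<Longrightarrow> a < r \<Longrightarrow> 0 < steklov_weight a m r"
  unfolding steklov_weight_def
  by (intro divide_pos_pos steklov_weight_denominator_pos mult_pos_pos) (auto intro!: power_strict_mono simp del: power_Suc)

text \<open>
  The logarithmic derivative of a solution of a linear second-order equation solves a Riccati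
  equation.
\<close>

lemma steklov_weight_riccati:
  assumes a: "0 < a" and r: "0 < r"
  shows "(steklov_weight a m has_real_derivative
    real (m + 1) * r ^ (m + 1) / r\<^sup>2 - (steklov_weight a m r)\<^sup>2 / r ^ (m + 1)) (at r)"
proof -
  define p where "p = r ^ m"
  define A where "A = a ^ (m + 2)"
  define M where "M = real m"
  define X where "X = p * r\<^sup>2"
  have p: "p > 0" using r by (simp add: p_def)
  have p1: "r ^ (m + 1) = p * r" and p2: "r ^ (m + 2) = X"
    by (simp_all add: p_def X_def power_add power2_eq_square)
  define q where "q = (M + 1) * X + A"
  have q: "q > 0"
    using steklov_weight_denominator_pos[OF a r, of m] by (simp add: q_def M_def p2[symmetric] A_def add.commute)
  have M1: "real (m + 1) = M + 1" by (simp add: M_def)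
  have d0: "((\<lambda>r. r ^ m) has_real_derivative M * p / r) (at r)"
  proof (cases m)
    case (Suc k)
    have "((\<lambda>r. r ^ m) has_real_derivative real m * r ^ (m - 1)) (at r)"
      using DERIV_pow[of m r] by simp
    moreover have "real m * r ^ (m - 1) = M * p / r" using r by (simp add: Suc p_def M_def)
    ultimately show ?thesis by (simp only:)
  qed (simp add: M_def)
  have d2: "((\<lambda>r. r ^ (m + 2)) has_real_derivative (M + 2) * (p * r)) (at r)"
  proof -
    have "((\<lambda>r. r ^ (m + 2)) has_real_derivative real (m + 2) * r ^ (m + 2 - 1)) (at r)"
      using DERIV_pow[of "m + 2" r] by simp
    moreover have "real (m + 2) * r ^ (m + 2 - 1) = (M + 2) * (p * r)" by (simp add: p_def M_def)
    ultimately show ?thesis by (simp only:)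
  qed
  have dn: "((\<lambda>r. (M + 1) * r ^ m * (r ^ (m + 2) - A)) has_real_derivative
      (M + 1) * ((M * p / r) * (X - A) + p * ((M + 2) * (p * r)))) (at r)"
    by (rule DERIV_cong[OF DERIV_mult[OF DERIV_cmult[OF d0, of "M + 1"] DERIV_diff[OF d2 DERIV_const]]])
       (simp only: p_def[symmetric] p2, simp add: algebra_simps)
  have dq: "((\<lambda>r. (M + 1) * r ^ (m + 2) + A) has_real_derivative (M + 1) * ((M + 2) * (p * r))) (at r)"
    by (rule DERIV_cong[OF DERIV_add[OF DERIV_cmult[OF d2, of "M + 1"] DERIV_const]]) simp
  have q': "(M + 1) * r ^ (m + 2) + A = q" by (simp only: p2 q_def)
  have B: "steklov_weight a m r = (M + 1) * p * (X - A) / q"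
    unfolding steklov_weight_def M1 p2 A_def[symmetric] p_def[symmetric] q_def ..
  have "(steklov_weight a m has_real_derivative
      (((M + 1) * ((M * p / r) * (X - A) + p * ((M + 2) * (p * r)))) * q
        - ((M + 1) * p * (X - A)) * ((M + 1) * ((M + 2) * (p * r)))) / (q * q)) (at r)"
  proof -
    have "(M + 1) * r ^ (m + 2) + A \<noteq> 0" using q q' by simp
    from DERIV_divide[OF dn dq this] show ?thesis
      unfolding steklov_weight_def[abs_def] M1 A_def[symmetric] by (simp only: p2 p_def[symmetric] q_def[symmetric])
  qed
  moreover have "(((M + 1) * ((M * p / r) * (X - A) + p * ((M + 2) * (p * r)))) * q
        - ((M + 1) * p * (X - A)) * ((M + 1) * ((M + 2) * (p * r)))) / (q * q)
     = (M + 1) * (p * r) / r\<^sup>2 - ((M + 1) * p * (X - A) / q)\<^sup>2 / (p * r)"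
  proof -
    have key: "(M * (X - A) + (M + 2) * X) * q - (M + 1) * (M + 2) * X * (X - A) = q\<^sup>2 - (M + 1) * (X - A)\<^sup>2"
      unfolding q_def by (simp add: power2_eq_square algebra_simps)
    have l: "((M + 1) * ((M * p / r) * (X - A) + p * ((M + 2) * (p * r)))) * q
        - ((M + 1) * p * (X - A)) * ((M + 1) * ((M + 2) * (p * r))) =
        (M + 1) * p / r * ((M * (X - A) + (M + 2) * X) * q - (M + 1) * (M + 2) * X * (X - A))"
      using r unfolding X_def by (simp add: field_simps power2_eq_square)
    have rr: "(M + 1) * (p * r) / r\<^sup>2 - ((M + 1) * p * (X - A) / q)\<^sup>2 / (p * r) = (M + 1) * p / r * (q\<^sup>2 - (M + 1) * (X - A)\<^sup>2) / (q * q)"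
      using r p q by (simp add: field_simps power2_eq_square)
    show ?thesis unfolding l key rr by simp
  qed
  ultimately show ?thesis unfolding B p1 M1 by simp
qed

text \<open>
  Picone's identity: the weight solves a Riccati equation, so the integrand exceeds the derivative
  of \<open>steklov_weight a m r * (\<phi> r)\<^sup>2\<close> by a square.
\<close>

lemma picone_inequality:
  fixes \<phi> \<psi> :: "real \<Rightarrow> real"
  assumes a: "0 < a" "a \<le> R"
    and der: "\<And>r. a \<le> r \<Longrightarrow> r \<le> R \<Longrightarrow> (\<phi> has_real_derivative \<psi> r) (at r within {a..R})"
    and cont: "continuous_on {a..R} \<psi>"
  shows "ennreal (steklov_weight a m R * (\<phi> R)\<^sup>2) \<le>
    (\<integral>\<^sup>+r. ennreal (r ^ (m + 1) * (\<psi> r)\<^sup>2 + real (m + 1) * r ^ (m + 1) / r\<^sup>2 * (\<phi> r)\<^sup>2) * indicator {a..R} r \<partial>lborel)"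
proof -
  let ?B = "steklov_weight a m"
  let ?h = "\<lambda>r. (real (m + 1) * r ^ (m + 1) / r\<^sup>2 - (?B r)\<^sup>2 / r ^ (m + 1)) * (\<phi> r)\<^sup>2 + ?B r * (2 * \<phi> r * \<psi> r)"
  let ?k = "\<lambda>r. r ^ (m + 1) * (\<psi> r)\<^sup>2 + real (m + 1) * r ^ (m + 1) / r\<^sup>2 * (\<phi> r)\<^sup>2"
  have c\<phi>: "continuous_on {a..R} \<phi>"
    by (rule DERIV_continuous_on) (use der in auto)
  have cB: "continuous_on {a..R} ?B"
    by (rule DERIV_continuous_on[where D="\<lambda>r. real (m + 1) * r ^ (m + 1) / r\<^sup>2 - (?B r)\<^sup>2 / r ^ (m + 1)"])
       (use a steklov_weight_riccati[of a _ m] in \<open>auto intro: has_field_derivative_at_within\<close>)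
  have ch: "continuous_on {a..R} ?h" and ck: "continuous_on {a..R} ?k"
    by (intro continuous_intros cB c\<phi> cont; use a in auto)+
  have "(LINT r|lborel. indicator {a..R} r *\<^sub>R ?h r) = ?B R * (\<phi> R)\<^sup>2 - ?B a * (\<phi> a)\<^sup>2"
  proof (rule integral_FTC_Icc[OF a(2) _ ch])
    fix r assume r: "a \<le> r" "r \<le> R"
    have "(?B has_real_derivative real (m + 1) * r ^ (m + 1) / r\<^sup>2 - (?B r)\<^sup>2 / r ^ (m + 1)) (at r within {a..R})"
      by (rule has_field_derivative_at_within[OF steklov_weight_riccati]) (use a r in auto)
    moreover have "((\<lambda>r. (\<phi> r)\<^sup>2) has_real_derivative 2 * \<phi> r * \<psi> r) (at r within {a..R})"
      by (rule DERIV_cong[OF DERIV_power[OF der[OF r], of 2]]) simp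
    ultimately have "((\<lambda>r. ?B r * (\<phi> r)\<^sup>2) has_real_derivative ?h r) (at r within {a..R})"
      by (rule DERIV_cong[OF DERIV_mult]) simp
    then show "((\<lambda>r. ?B r * (\<phi> r)\<^sup>2) has_vector_derivative ?h r) (at r within {a..R})"
      by (simp only: has_real_derivative_iff_has_vector_derivative)
  qed
  moreover have "?B a = 0" by (simp add: steklov_weight_def)
  ultimately have eq: "?B R * (\<phi> R)\<^sup>2 = (LINT r|lborel. indicator {a..R} r *\<^sub>R ?h r)" by simp
  have ik: "integrable lborel (\<lambda>r. indicator {a..R} r *\<^sub>R ?k r)"
    by (rule borel_integrable_compact[OF _ ck]) simp
  have ih: "integrable lborel (\<lambda>r. indicator {a..R} r *\<^sub>R ?h r)"
    by (rule borel_integrable_compact[OF _ ch]) simp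
  have hk: "?h r \<le> ?k r" if "a \<le> r" for r
  proof -
    have r: "r ^ (m + 1) > 0" "r \<noteq> 0" using a that by auto
    have "?k r - ?h r = r ^ (m + 1) * (\<psi> r - ?B r * \<phi> r / r ^ (m + 1))\<^sup>2"
      using r by (simp add: power2_eq_square field_simps del: power_Suc)
    also have "\<dots> \<ge> 0" using r(1) by simp
    finally show ?thesis by simp
  qed
  have "?B R * (\<phi> R)\<^sup>2 \<le> (LINT r|lborel. indicator {a..R} r *\<^sub>R ?k r)"
    unfolding eq by (rule integral_mono[OF ih ik]) (use hk in \<open>auto simp: indicator_def\<close>)
  then have "ennreal (?B R * (\<phi> R)\<^sup>2) \<le> ennreal (LINT r|lborel. indicator {a..R} r *\<^sub>R ?k r)"
    by (rule ennreal_leI)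
  also have "\<dots> = (\<integral>\<^sup>+r. ennreal (indicator {a..R} r *\<^sub>R ?k r) \<partial>lborel)"
    by (rule nn_integral_eq_integral[symmetric, OF ik]) (use a in \<open>auto simp: indicator_def\<close>)
  also have "\<dots> = (\<integral>\<^sup>+r. ennreal (?k r) * indicator {a..R} r \<partial>lborel)"
    by (rule nn_integral_cong) (simp add: indicator_def)
  finally show ?thesis .
qed

subsection \<open>Integration over all pairs of directions\<close>

lemma sph_pair_sigma_finite: "pair_sigma_finite (sph :: (real^'n) measure) (lborel :: real measure)"
  by (intro pair_sigma_finite.intro sph.sigma_finite_measure_axioms sigma_finite_lborel)

text \<open>
  Differences over all pairs of directions measure the variance and vary with a single curve for each
  pair, so that the one-dimensional inequality applies to them.
\<close>

lemma nn_integral_sph_pair_sq: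
  fixes h :: "real^'n \<Rightarrow> real"
  assumes [measurable]: "h \<in> borel_measurable borel" and b: "\<And>w. norm w = 1 \<Longrightarrow> \<bar>h w\<bar> \<le> b"
  shows "(\<integral>\<^sup>+w. \<integral>\<^sup>+w'. ennreal ((h w - h w')\<^sup>2) \<partial>sph \<partial>sph) =
    ennreal (2 * (sph_area TYPE('n) * (LINT w|sph. (h w)\<^sup>2) - (LINT w|sph. h w)\<^sup>2))"
proof -
  let ?S = "sph_area TYPE('n)"
  have i1: "integrable sph h" by (rule integrable_sph_bounded[OF _ b]) simp
  have i2: "integrable sph (\<lambda>w. (h w)\<^sup>2)"
  proof (rule integrable_sph_bounded)
    fix w :: "real^'n" assume "norm w = 1"
    then have "\<bar>h w\<bar>\<^sup>2 \<le> b\<^sup>2" using b[of w] by (intro power_mono) auto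
    then show "\<bar>(h w)\<^sup>2\<bar> \<le> b\<^sup>2" by simp
  qed simp
  let ?I = "LINT w|sph. h w" and ?Q = "LINT w|sph. (h w)\<^sup>2"
  have e: "(u - h w')\<^sup>2 = u\<^sup>2 - 2 * u * h w' + (h w')\<^sup>2" for u w'
    by (simp add: power2_eq_square algebra_simps)
  have inner: "(\<integral>\<^sup>+w'. ennreal ((u - h w')\<^sup>2) \<partial>sph) = ennreal (u\<^sup>2 * ?S - 2 * u * ?I + ?Q)" for u
  proof -
    have "(\<integral>\<^sup>+w'. ennreal ((u - h w')\<^sup>2) \<partial>sph) = ennreal (LINT w'|sph. (u - h w')\<^sup>2)"
    proof (rule nn_integral_eq_integral)
      show "integrable sph (\<lambda>w'. (u - h w')\<^sup>2)" unfolding e using i1 i2 by simp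
    qed simp
    also have "(LINT w'|sph. (u - h w')\<^sup>2) = u\<^sup>2 * ?S - 2 * u * ?I + ?Q"
      unfolding e using i1 i2 by (simp add: sph_area_def)
    finally show ?thesis .
  qed
  have nn: "0 \<le> u\<^sup>2 * ?S - 2 * u * ?I + ?Q" for u
  proof -
    have "0 \<le> (LINT w'|sph. (u - h w')\<^sup>2)" by (rule integral_nonneg_AE) auto
    also have "(LINT w'|sph. (u - h w')\<^sup>2) = u\<^sup>2 * ?S - 2 * u * ?I + ?Q"
      unfolding e using i1 i2 by (simp add: sph_area_def)
    finally show ?thesis .
  qed
  have "(\<integral>\<^sup>+w. \<integral>\<^sup>+w'. ennreal ((h w - h w')\<^sup>2) \<partial>sph \<partial>sph) = (\<integral>\<^sup>+w. ennreal ((h w)\<^sup>2 * ?S - 2 * h w * ?I + ?Q) \<partial>sph)"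
    unfolding inner ..
  also have "\<dots> = (\<integral>\<^sup>+w. ennreal (?S * (h w)\<^sup>2 - (2 * ?I) * h w + ?Q) \<partial>sph)"
    by (simp only: mult_ac)
  also have "\<dots> = ennreal (LINT w|sph. ?S * (h w)\<^sup>2 - (2 * ?I) * h w + ?Q)"
  proof (rule nn_integral_eq_integral)
    show "AE w in sph. 0 \<le> ?S * (h w)\<^sup>2 - (2 * ?I) * h w + ?Q"
      using nn by (simp add: mult_ac)
  qed (use i1 i2 in simp)
  also have "(LINT w|sph. ?S * (h w)\<^sup>2 - (2 * ?I) * h w + ?Q) = ?S * ?Q - (2 * ?I) * ?I + ?Q * ?S"
    using i1 i2 by (simp add: sph_area_def)
  also have "\<dots> = 2 * (?S * ?Q - ?I\<^sup>2)"
    by (simp add: power2_eq_square)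
  finally show ?thesis .
qed

lemma nn_integral_shell:
  fixes h :: "real^'n \<Rightarrow> ennreal"
  assumes [measurable]: "h \<in> borel_measurable borel" and "0 \<le> a"
  shows "(\<integral>\<^sup>+x. h x * indicator (ball c R - cball c a) x \<partial>lborel) =
    (\<integral>\<^sup>+r. (\<integral>\<^sup>+w. h (c + r *\<^sub>R w) \<partial>sph) * ennreal (r ^ (CARD('n) - 1)) * indicator {a<..<R} r \<partial>lborel)"
proof -
  have [measurable]: "ball c R - cball c a \<in> sets borel" by simp
  have "(\<integral>\<^sup>+x. h x * indicator (ball c R - cball c a) x \<partial>lborel) =
    (\<integral>\<^sup>+r. (\<integral>\<^sup>+w. h (c + r *\<^sub>R w) * indicator (ball c R - cball c a) (c + r *\<^sub>R w) \<partial>sph) * ennreal (r ^ (CARD('n) - 1)) * indicator {0<..} r \<partial>lborel)"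
    by (rule nn_integral_polar) measurable
  also have "\<dots> = (\<integral>\<^sup>+r. (\<integral>\<^sup>+w. h (c + r *\<^sub>R w) \<partial>sph) * ennreal (r ^ (CARD('n) - 1)) * indicator {a<..<R} r \<partial>lborel)"
  proof (rule nn_integral_cong)
    fix r :: real
    have "(\<integral>\<^sup>+w. h (c + r *\<^sub>R w) * indicator (ball c R - cball c a) (c + r *\<^sub>R w) \<partial>sph) =
      (\<integral>\<^sup>+w. h (c + r *\<^sub>R w) * indicator {a<..<R} r \<partial>sph)" if r: "r > 0"
    proof (rule nn_integral_cong_AE)
      show "AE w in sph. h (c + r *\<^sub>R w) * indicator (ball c R - cball c a) (c + r *\<^sub>R w) = h (c + r *\<^sub>R w) * indicator {a<..<R} r"
        using AE_sph_norm by eventually_elim (use r in \<open>auto simp: indicator_def dist_norm\<close>)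
    qed
    also have "(\<integral>\<^sup>+w. h (c + r *\<^sub>R w) * indicator {a<..<R} r \<partial>sph) = (\<integral>\<^sup>+w. h (c + r *\<^sub>R w) \<partial>sph) * indicator {a<..<R} r"
      by (rule nn_integral_multc) measurable
    finally show "(\<integral>\<^sup>+w. h (c + r *\<^sub>R w) * indicator (ball c R - cball c a) (c + r *\<^sub>R w) \<partial>sph) * ennreal (r ^ (CARD('n) - 1)) * indicator {0<..} r =
      (\<integral>\<^sup>+w. h (c + r *\<^sub>R w) \<partial>sph) * ennreal (r ^ (CARD('n) - 1)) * indicator {a<..<R} r"
      using \<open>0 \<le> a\<close> by (cases "r > 0") (auto simp: mult_ac indicator_def)
  qed
  finally show ?thesis .
qed

text \<open>
  \<open>picone_inequality\<close> is applied, for each pair of directions, to the difference of \<open>f\<close> along the two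
  rays. Averaged over the pairs, the first term is at most twice the radial energy, as a variance is
  at most the second moment; the second term is twice the variance on the sphere of radius \<open>r\<close>, which
  \<open>sphere_poincare\<close> bounds by the tangential energy.
\<close>

theorem shell_inequality:
  fixes f :: "real^'n \<Rightarrow> real"
  assumes a: "0 < a" "a < R" and n: "2 \<le> CARD('n)"
    and C1: "C1_near (cball c R - ball c a) f g"
    and [measurable]: "f \<in> borel_measurable borel" "g \<in> borel_measurable borel"
    and mean: "(LINT w|sph. f (c + R *\<^sub>R w)) = 0"
  shows "ennreal (steklov_weight a (CARD('n) - 2) R * (LINT w|sph. (f (c + R *\<^sub>R w))\<^sup>2)) \<le>
    (\<integral>\<^sup>+x. ennreal ((norm (g x))\<^sup>2) * indicator (ball c R - cball c a) x \<partial>lborel)"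
proof -
  let ?S = "sph_area TYPE('n)" and ?K = "cball c R - ball c a"
  define m where "m = CARD('n) - 2"
  have m1: "CARD('n) - 1 = m + 1" and m1': "real CARD('n) - 1 = real (m + 1)" using n by (auto simp: m_def)
  let ?B = "steklov_weight a m R"
  have S: "?S > 0" by (rule sph_area_pos)
  have B: "?B > 0" using a by (rule steklov_weight_pos)
  have cK: "compact ?K" by (intro compact_diff) auto
  have "bounded (f ` ?K)" "bounded (g ` ?K)"
    by (rule compact_imp_bounded, rule compact_continuous_image, rule C1_near_continuous[OF C1], rule cK)+
  then obtain b1 b2 where b1: "\<forall>x\<in>f ` ?K. norm x \<le> b1" and b2: "\<forall>x\<in>g ` ?K. norm x \<le> b2"
    unfolding bounded_iff by blast
  have inK: "c + r *\<^sub>R w \<in> ?K" if "a \<le> r" "r \<le> R" "norm w = 1" for r w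
    using that a by (simp add: dist_norm)
  have bf: "\<bar>f (c + r *\<^sub>R w)\<bar> \<le> b1" and bg: "norm (g (c + r *\<^sub>R w)) \<le> b2" if "a \<le> r" "r \<le> R" "norm w = 1" for r w
    using b1 b2 inK[OF that] by auto
  have bgw: "\<bar>g (c + r *\<^sub>R w) \<bullet> w\<bar> \<le> b2" if "a \<le> r" "r \<le> R" "norm w = 1" for r w
    using Cauchy_Schwarz_ineq2[of "g (c + r *\<^sub>R w)" w] bg[OF that] that by simp
  let ?k = "\<lambda>r w w'. r ^ (m + 1) * (g (c + r *\<^sub>R w) \<bullet> w - g (c + r *\<^sub>R w') \<bullet> w')\<^sup>2
      + real (m + 1) * r ^ (m + 1) / r\<^sup>2 * (f (c + r *\<^sub>R w) - f (c + r *\<^sub>R w'))\<^sup>2"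
  have "ennreal (?B * (2 * (?S * (LINT w|sph. (f (c + R *\<^sub>R w))\<^sup>2)))) =
    ennreal ?B * (\<integral>\<^sup>+w. \<integral>\<^sup>+w'. ennreal ((f (c + R *\<^sub>R w) - f (c + R *\<^sub>R w'))\<^sup>2) \<partial>sph \<partial>sph)"
    by (subst nn_integral_sph_pair_sq[where b=b1]) (use B a bf[of R] mean in \<open>auto simp: ennreal_mult'\<close>)
  also have "\<dots> = (\<integral>\<^sup>+w. \<integral>\<^sup>+w'. ennreal ?B * ennreal ((f (c + R *\<^sub>R w) - f (c + R *\<^sub>R w'))\<^sup>2) \<partial>sph \<partial>sph)"
    by (simp add: nn_integral_cmult)
  also have "\<dots> \<le> (\<integral>\<^sup>+w. \<integral>\<^sup>+w'. \<integral>\<^sup>+r. ennreal (?k r w w') * indicator {a..R} r \<partial>lborel \<partial>sph \<partial>sph)"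
  proof (rule nn_integral_mono_AE)
    show "AE w in sph. (\<integral>\<^sup>+w'. ennreal ?B * ennreal ((f (c + R *\<^sub>R w) - f (c + R *\<^sub>R w'))\<^sup>2) \<partial>sph)
       \<le> (\<integral>\<^sup>+w'. \<integral>\<^sup>+r. ennreal (?k r w w') * indicator {a..R} r \<partial>lborel \<partial>sph)"
      using AE_sph_norm
    proof eventually_elim
      case w: (elim w)
      show ?case
      proof (rule nn_integral_mono_AE)
        show "AE w' in sph. ennreal ?B * ennreal ((f (c + R *\<^sub>R w) - f (c + R *\<^sub>R w'))\<^sup>2)
           \<le> (\<integral>\<^sup>+r. ennreal (?k r w w') * indicator {a..R} r \<partial>lborel)"
          using AE_sph_norm
        proof eventually_elim
          case w': (elim w')
          have ray: "continuous_on {a..R} (\<lambda>r. g (c + r *\<^sub>R w))" if "norm w = 1" for w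
            by (rule continuous_on_compose2[OF C1_near_continuous(2)[OF C1]])
               (use that inK in \<open>auto intro!: continuous_intros\<close>)
          have "ennreal (?B * (f (c + R *\<^sub>R w) - f (c + R *\<^sub>R w'))\<^sup>2) \<le> (\<integral>\<^sup>+r. ennreal (?k r w w') * indicator {a..R} r \<partial>lborel)"
          proof (rule picone_inequality)
            fix r assume r: "a \<le> r" "r \<le> R"
            show "((\<lambda>r. f (c + r *\<^sub>R w) - f (c + r *\<^sub>R w')) has_real_derivative g (c + r *\<^sub>R w) \<bullet> w - g (c + r *\<^sub>R w') \<bullet> w') (at r within {a..R})"
              by (intro DERIV_diff C1_near_line[OF C1] inK r w w')
          next
            show "continuous_on {a..R} (\<lambda>r. g (c + r *\<^sub>R w) \<bullet> w - g (c + r *\<^sub>R w') \<bullet> w')"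
              by (intro continuous_intros ray w w')
          qed (use a in auto)
          then show ?case using B by (simp add: ennreal_mult')
        qed
      qed
    qed
  qed
  also have "\<dots> = (\<integral>\<^sup>+w. \<integral>\<^sup>+r. \<integral>\<^sup>+w'. ennreal (?k r w w') * indicator {a..R} r \<partial>sph \<partial>lborel \<partial>sph)"
    by (rule nn_integral_cong, rule pair_sigma_finite.Fubini'[OF sph_pair_sigma_finite, symmetric]) measurable
  also have "\<dots> = (\<integral>\<^sup>+r. \<integral>\<^sup>+w. \<integral>\<^sup>+w'. ennreal (?k r w w') * indicator {a..R} r \<partial>sph \<partial>sph \<partial>lborel)"
    by (rule pair_sigma_finite.Fubini'[OF sph_pair_sigma_finite, symmetric]) measurable
  also have "\<dots> \<le> (\<integral>\<^sup>+r. ennreal (2 * ?S) * ((\<integral>\<^sup>+w. ennreal ((norm (g (c + r *\<^sub>R w)))\<^sup>2) \<partial>sph) * ennreal (r ^ (CARD('n) - 1)) * indicator {a<..<R} r) \<partial>lborel)"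
  proof (rule nn_integral_mono_AE)
    have "AE r in lborel. r \<noteq> a \<and> r \<noteq> (R::real)"
      by (intro AE_conjI AE_lborel_singleton)
    then show "AE r in lborel. (\<integral>\<^sup>+w. \<integral>\<^sup>+w'. ennreal (?k r w w') * indicator {a..R} r \<partial>sph \<partial>sph) \<le>
      ennreal (2 * ?S) * ((\<integral>\<^sup>+w. ennreal ((norm (g (c + r *\<^sub>R w)))\<^sup>2) \<partial>sph) * ennreal (r ^ (CARD('n) - 1)) * indicator {a<..<R} r)"
    proof eventually_elim
      case (elim r)
      show ?case
      proof (cases "a \<le> r \<and> r \<le> R")
        case True
        then have r: "a \<le> r" "r \<le> R" and r0: "r > 0" and ind: "r \<in> {a<..<R}" using a elim by auto
        let ?p = "r ^ (m + 1)"
        have p: "?p > 0" using r0 by simp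
        let ?F = "\<lambda>w. f (c + r *\<^sub>R w)" and ?g = "\<lambda>w. g (c + r *\<^sub>R w)"
        have C1F: "C1_near (sphere 0 1) ?F (\<lambda>w. r *\<^sub>R ?g w)"
        proof -
          obtain V where V: "open V" "?K \<subseteq> V" "\<forall>x\<in>V. GDERIV f x :> g x" "continuous_on V g"
            using C1 unfolding C1_near_def by blast
          let ?T = "\<lambda>w :: real^'n. c + r *\<^sub>R w"
          have oV: "open (?T -` V)" by (rule open_vimage[OF V(1)]) (auto intro!: continuous_intros)
          have "GDERIV ?F w :> r *\<^sub>R ?g w" if "w \<in> ?T -` V" for w
          proof -
            have fd: "(f has_derivative (\<lambda>h. h \<bullet> ?g w)) (at (?T w))" using V(3) that by (simp add: gderiv_def)
            have Td: "(?T has_derivative (\<lambda>h. r *\<^sub>R h)) (at w)" by (auto intro!: derivative_eq_intros)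
            show ?thesis
              unfolding gderiv_def by (rule has_derivative_eq_rhs[OF has_derivative_compose[OF Td fd]]) simp
          qed
          moreover have "continuous_on (?T -` V) (\<lambda>w. r *\<^sub>R ?g w)"
            by (intro continuous_intros continuous_on_compose2[OF V(4)]) auto
          moreover have "sphere 0 1 \<subseteq> ?T -` V"
          proof
            fix w :: "real^'n" assume "w \<in> sphere 0 1"
            then have "?T w \<in> ?K" by (intro inK r) simp
            then show "w \<in> ?T -` V" using V(2) by blast
          qed
          ultimately show ?thesis using oV unfolding C1_near_def by blast
        qed
        define QF where "QF = (LINT w|sph. (?F w)\<^sup>2)"
        define IF where "IF = (LINT w|sph. ?F w)"
        define Qn where "Qn = (LINT w|sph. (?g w \<bullet> w)\<^sup>2)"
        define In where "In = (LINT w|sph. ?g w \<bullet> w)"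
        define E where "E = (LINT w|sph. (norm (?g w))\<^sup>2)"
        have intE: "integrable sph (\<lambda>w. (norm (?g w))\<^sup>2)"
        proof (rule integrable_sph_bounded)
          fix w :: "real^'n" assume "norm w = 1"
          then show "\<bar>(norm (?g w))\<^sup>2\<bar> \<le> b2\<^sup>2" using bg[OF r] by (simp add: power_mono)
        qed measurable
        have intQ: "integrable sph (\<lambda>w. (?g w \<bullet> w)\<^sup>2)"
        proof (rule integrable_sph_bounded)
          fix w :: "real^'n" assume "norm w = 1"
          then have "\<bar>?g w \<bullet> w\<bar>\<^sup>2 \<le> b2\<^sup>2" using bgw[OF r] by (intro power_mono) auto
          then show "\<bar>(?g w \<bullet> w)\<^sup>2\<bar> \<le> b2\<^sup>2" by simp
        qed measurable
        have "real (m + 1) * (?S * QF - IF\<^sup>2) \<le> ?S * (LINT w|sph. (norm (r *\<^sub>R ?g w))\<^sup>2 - (r *\<^sub>R ?g w \<bullet> w)\<^sup>2)"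
          unfolding QF_def IF_def m1'[symmetric] by (rule sphere_poincare[OF C1F _ _ n]) measurable
        also have "(LINT w|sph. (norm (r *\<^sub>R ?g w))\<^sup>2 - (r *\<^sub>R ?g w \<bullet> w)\<^sup>2) = (LINT w|sph. r\<^sup>2 * (norm (?g w))\<^sup>2 - r\<^sup>2 * (?g w \<bullet> w)\<^sup>2)"
          by (rule Bochner_Integration.integral_cong) (auto simp: power_mult_distrib)
        also have "\<dots> = r\<^sup>2 * (E - Qn)"
          using intE intQ by (simp add: E_def Qn_def right_diff_distrib)
        finally have "real (m + 1) * (?S * QF - IF\<^sup>2) \<le> r\<^sup>2 * (?S * (E - Qn))" by (simp add: mult.left_commute)
        then have poin: "real (m + 1) / r\<^sup>2 * (?S * QF - IF\<^sup>2) \<le> ?S * (E - Qn)"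
          using r0 by (simp add: field_simps)
        have pF: "(\<integral>\<^sup>+w. \<integral>\<^sup>+w'. ennreal ((?F w - ?F w')\<^sup>2) \<partial>sph \<partial>sph) = ennreal (2 * (?S * QF - IF\<^sup>2))"
          unfolding QF_def IF_def by (rule nn_integral_sph_pair_sq[where b=b1]) (use bf[OF r] in auto)
        have pG: "(\<integral>\<^sup>+w. \<integral>\<^sup>+w'. ennreal ((?g w \<bullet> w - ?g w' \<bullet> w')\<^sup>2) \<partial>sph \<partial>sph) = ennreal (2 * (?S * Qn - In\<^sup>2))"
          unfolding Qn_def In_def by (rule nn_integral_sph_pair_sq[where b=b2]) (use bgw[OF r] in auto)
        let ?z = "real (m + 1) * ?p / r\<^sup>2"
        have z: "?z > 0" using p r0 by simp
        have "(\<integral>\<^sup>+w. \<integral>\<^sup>+w'. ennreal (?k r w w') * indicator {a..R} r \<partial>sph \<partial>sph) =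
          (\<integral>\<^sup>+w. \<integral>\<^sup>+w'. ennreal ?p * ennreal ((?g w \<bullet> w - ?g w' \<bullet> w')\<^sup>2) + ennreal ?z * ennreal ((?F w - ?F w')\<^sup>2) \<partial>sph \<partial>sph)"
        proof (intro nn_integral_cong)
          fix w w'
          have "ennreal (?k r w w') = ennreal ?p * ennreal ((?g w \<bullet> w - ?g w' \<bullet> w')\<^sup>2) + ennreal ?z * ennreal ((?F w - ?F w')\<^sup>2)"
            using p z by (simp only: ennreal_mult[symmetric] ennreal_plus[symmetric] mult_nonneg_nonneg less_imp_le zero_le_power2)
          then show "ennreal (?k r w w') * indicator {a..R} r = ennreal ?p * ennreal ((?g w \<bullet> w - ?g w' \<bullet> w')\<^sup>2) + ennreal ?z * ennreal ((?F w - ?F w')\<^sup>2)"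
            using r by (simp only: indicator_def atLeastAtMost_iff) simp
        qed
        also have "\<dots> = ennreal ?p * (\<integral>\<^sup>+w. \<integral>\<^sup>+w'. ennreal ((?g w \<bullet> w - ?g w' \<bullet> w')\<^sup>2) \<partial>sph \<partial>sph)
            + ennreal ?z * (\<integral>\<^sup>+w. \<integral>\<^sup>+w'. ennreal ((?F w - ?F w')\<^sup>2) \<partial>sph \<partial>sph)"
          by (simp add: nn_integral_add nn_integral_cmult del: power_Suc)
        also have "\<dots> = ennreal (?p * (2 * (?S * Qn - In\<^sup>2))) + ennreal (?z * (2 * (?S * QF - IF\<^sup>2)))"
          unfolding pF pG using p z by (simp only: ennreal_mult' less_imp_le)
        also have "\<dots> \<le> ennreal (?p * (2 * (?S * Qn))) + ennreal (?p * (2 * (?S * (E - Qn))))"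
        proof (intro add_mono ennreal_leI)
          show "?p * (2 * (?S * Qn - In\<^sup>2)) \<le> ?p * (2 * (?S * Qn))"
            using p by (intro mult_left_mono) auto
          have "?z * (2 * (?S * QF - IF\<^sup>2)) = ?p * (2 * (real (m + 1) / r\<^sup>2 * (?S * QF - IF\<^sup>2)))"
            by simp
          also have "\<dots> \<le> ?p * (2 * (?S * (E - Qn)))"
            using p poin by (intro mult_left_mono) auto
          finally show "?z * (2 * (?S * QF - IF\<^sup>2)) \<le> ?p * (2 * (?S * (E - Qn)))" .
        qed
        also have "\<dots> = ennreal (?p * (2 * (?S * Qn)) + ?p * (2 * (?S * (E - Qn))))"
        proof (rule ennreal_plus[symmetric])
          have Qn0: "0 \<le> Qn" unfolding Qn_def by (rule integral_nonneg_AE) auto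
          have "Qn \<le> E" unfolding Qn_def E_def
          proof (rule integral_mono_AE[OF intQ intE])
            show "AE w in sph. (?g w \<bullet> w)\<^sup>2 \<le> (norm (?g w))\<^sup>2"
              using AE_sph_norm
            proof eventually_elim
              case (elim w)
              then show ?case using Cauchy_Schwarz_ineq[of "?g w" w]
                by (simp add: power2_norm_eq_inner norm_eq_1)
            qed
          qed
          then show "0 \<le> ?p * (2 * (?S * (E - Qn)))" using p S by simp
          show "0 \<le> ?p * (2 * (?S * Qn))" using p S Qn0 by simp
        qed
        also have "?p * (2 * (?S * Qn)) + ?p * (2 * (?S * (E - Qn))) = 2 * ?S * (E * ?p)"
          by (simp only: ring_distribs) (simp add: mult_ac)
        also have "ennreal (2 * ?S * (E * ?p)) = ennreal (2 * ?S) * (ennreal E * ennreal ?p)"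
        proof -
          have "0 \<le> E" unfolding E_def by (rule integral_nonneg_AE) auto
          then show ?thesis using S p by (simp only: ennreal_mult mult_nonneg_nonneg less_imp_le)
        qed
        also have "ennreal E = (\<integral>\<^sup>+w. ennreal ((norm (?g w))\<^sup>2) \<partial>sph)"
          unfolding E_def by (rule nn_integral_eq_integral[symmetric, OF intE]) simp
        finally show ?thesis using ind by (simp only: m1) simp
      qed (auto simp: indicator_def)
    qed
  qed
  also have "\<dots> = ennreal (2 * ?S) * (\<integral>\<^sup>+r. (\<integral>\<^sup>+w. ennreal ((norm (g (c + r *\<^sub>R w)))\<^sup>2) \<partial>sph) * ennreal (r ^ (CARD('n) - 1)) * indicator {a<..<R} r \<partial>lborel)"
    by (rule nn_integral_cmult) measurable
  also have "\<dots> = ennreal (2 * ?S) * (\<integral>\<^sup>+x. ennreal ((norm (g x))\<^sup>2) * indicator (ball c R - cball c a) x \<partial>lborel)"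
    by (subst nn_integral_shell) (use a in auto)
  finally have fin: "ennreal (?B * (2 * (?S * (LINT w|sph. (f (c + R *\<^sub>R w))\<^sup>2)))) \<le>
     ennreal (2 * ?S) * (\<integral>\<^sup>+x. ennreal ((norm (g x))\<^sup>2) * indicator (ball c R - cball c a) x \<partial>lborel)" .
  have "ennreal (?B * (2 * (?S * (LINT w|sph. (f (c + R *\<^sub>R w))\<^sup>2)))) = ennreal (2 * ?S) * ennreal (?B * (LINT w|sph. (f (c + R *\<^sub>R w))\<^sup>2))"
    using S B by (subst ennreal_mult'[symmetric]) (auto simp: mult_ac)
  with fin have "ennreal (2 * ?S) * ennreal (?B * (LINT w|sph. (f (c + R *\<^sub>R w))\<^sup>2)) \<le>
     ennreal (2 * ?S) * (\<integral>\<^sup>+x. ennreal ((norm (g x))\<^sup>2) * indicator (ball c R - cball c a) x \<partial>lborel)"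
    by simp
  then show ?thesis
    using S by (subst (asm) ennreal_mult_le_mult_iff) (auto simp: m_def)
qed

section \<open>Convergence in \<open>L\<^sup>2\<close>\<close>

text \<open>
  The source of the Cauchy--Schwarz inequality and of the first-order condition at a minimum.
\<close>

lemma quadratic_nonneg_discriminant:
  fixes A B C :: real
  assumes "\<And>t. 0 \<le> A + 2 * t * C + t\<^sup>2 * B"
  shows "C\<^sup>2 \<le> A * B"
proof (cases "B = 0")
  case True
  have "C = 0"
  proof (rule ccontr)
    assume "C \<noteq> 0"
    then show False using assms[of "- (A + 1) / (2 * C)"] True by (simp add: field_simps)
  qed
  then show ?thesis using True by simp
next
  case False
  have "B \<ge> 0"
  proof (rule ccontr)
    assume "\<not> B \<ge> 0"
    then have B: "B < 0" by simp
    define t where "t = 1 + (\<bar>A\<bar> + 2 * \<bar>C\<bar>) / - B"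
    have t1: "1 \<le> t" using B by (simp add: t_def divide_nonneg_neg)
    have tB: "t * B = B - (\<bar>A\<bar> + 2 * \<bar>C\<bar>)" using B by (simp add: t_def field_simps)
    have "A + 2 * t * C + t\<^sup>2 * B = A + t * (2 * C + t * B)" by (simp add: power2_eq_square algebra_simps)
    also have "\<dots> = A + t * (2 * C + B - (\<bar>A\<bar> + 2 * \<bar>C\<bar>))" unfolding tB by simp
    also have "\<dots> \<le> A + t * (B - \<bar>A\<bar>)" using t1 by (intro add_left_mono mult_left_mono) auto
    also have "\<dots> \<le> A + 1 * (B - \<bar>A\<bar>)"
      using mult_right_mono_neg[OF t1, of "B - \<bar>A\<bar>"] B by simp
    also have "\<dots> < 0" using B by simp
    finally show False using assms[of t] by simp
  qed
  then have "B > 0" using False by simp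
  then show ?thesis using assms[of "- C / B"] by (simp add: power2_eq_square field_simps)
qed

lemma L2_borel: "L2 M a \<Longrightarrow> a \<in> borel_measurable M"
  by (simp add: L2_def)

lemma L2_integrable_sq: "L2 M a \<Longrightarrow> integrable M (\<lambda>x. (norm (a x))\<^sup>2)"
  by (simp add: L2_def)

lemma L2_integrable_inner:
  assumes "L2 M a" "L2 M b"
  shows "integrable M (\<lambda>x. a x \<bullet> b x)"
proof (rule Bochner_Integration.integrable_bound)
  show "integrable M (\<lambda>x. (norm (a x))\<^sup>2 + (norm (b x))\<^sup>2)"
    using assms by (intro Bochner_Integration.integrable_add L2_integrable_sq)
  show "(\<lambda>x. a x \<bullet> b x) \<in> borel_measurable M"
    using assms by (intro borel_measurable_inner L2_borel)
  show "AE x in M. norm (a x \<bullet> b x) \<le> norm ((norm (a x))\<^sup>2 + (norm (b x))\<^sup>2)"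
  proof (rule AE_I2)
    fix x
    have "\<bar>a x \<bullet> b x\<bar> \<le> norm (a x) * norm (b x)" by (rule Cauchy_Schwarz_ineq2)
    also have "\<dots> \<le> (norm (a x))\<^sup>2 + (norm (b x))\<^sup>2"
    proof -
      have "2 * (norm (a x) * norm (b x)) \<le> (norm (a x))\<^sup>2 + (norm (b x))\<^sup>2"
        using sum_squares_bound[of "norm (a x)" "norm (b x)"] by (simp add: mult.assoc)
      moreover have "0 \<le> norm (a x) * norm (b x)" by simp
      ultimately show ?thesis by linarith
    qed
    finally show "norm (a x \<bullet> b x) \<le> norm ((norm (a x))\<^sup>2 + (norm (b x))\<^sup>2)" by simp
  qed
qed

lemma L2_add_scaled:
  assumes "L2 M a" "L2 M b"
  shows "L2 M (\<lambda>x. a x + t *\<^sub>R b x)"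
    and "(LINT x|M. (norm (a x + t *\<^sub>R b x))\<^sup>2) =
      (LINT x|M. (norm (a x))\<^sup>2) + 2 * t * (LINT x|M. a x \<bullet> b x) + t\<^sup>2 * (LINT x|M. (norm (b x))\<^sup>2)"
proof -
  have e: "(norm (a x + t *\<^sub>R b x))\<^sup>2 = (norm (a x))\<^sup>2 + 2 * t * (a x \<bullet> b x) + t\<^sup>2 * (norm (b x))\<^sup>2" for x
    unfolding power2_norm_eq_inner
    by (simp add: inner_add_left inner_add_right inner_commute[of "b x" "a x"] power2_eq_square algebra_simps)
  note i = L2_integrable_sq[OF assms(1)] L2_integrable_sq[OF assms(2)] L2_integrable_inner[OF assms]
  show "L2 M (\<lambda>x. a x + t *\<^sub>R b x)"
    unfolding L2_def e using i assms by (auto simp: L2_borel intro!: borel_measurable_add borel_measurable_scaleR)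
  show "(LINT x|M. (norm (a x + t *\<^sub>R b x))\<^sup>2) =
      (LINT x|M. (norm (a x))\<^sup>2) + 2 * t * (LINT x|M. a x \<bullet> b x) + t\<^sup>2 * (LINT x|M. (norm (b x))\<^sup>2)"
    unfolding e using i by simp
qed

lemma L2_diff: "L2 M a \<Longrightarrow> L2 M b \<Longrightarrow> L2 M (\<lambda>x. a x - b x)"
  using L2_add_scaled(1)[of M a b "-1"] by simp

lemma L2_Cauchy_Schwarz:
  assumes "L2 M a" "L2 M b"
  shows "(LINT x|M. a x \<bullet> b x)\<^sup>2 \<le> (LINT x|M. (norm (a x))\<^sup>2) * (LINT x|M. (norm (b x))\<^sup>2)"
proof (rule quadratic_nonneg_discriminant)
  fix t
  have "0 \<le> (LINT x|M. (norm (a x + t *\<^sub>R b x))\<^sup>2)" by (rule integral_nonneg_AE) simp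
  then show "0 \<le> (LINT x|M. (norm (a x))\<^sup>2) + 2 * t * (LINT x|M. a x \<bullet> b x) + t\<^sup>2 * (LINT x|M. (norm (b x))\<^sup>2)"
    unfolding L2_add_scaled(2)[OF assms] .
qed

lemma L2_tendsto_const: "L2 M v \<Longrightarrow> L2_tendsto M (\<lambda>k. v) v"
  by (simp add: L2_tendsto_def)

lemma tendsto_inner_zero:
  assumes a: "\<And>k. L2 M (a k)" and b: "\<And>k. L2 M (b k)"
    and "(\<lambda>k. LINT x|M. (norm (a k x))\<^sup>2) \<longlonglongrightarrow> 0"
    and "(\<lambda>k. LINT x|M. (norm (b k x))\<^sup>2) \<longlonglongrightarrow> c"
  shows "(\<lambda>k. LINT x|M. a k x \<bullet> b k x) \<longlonglongrightarrow> 0"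
proof -
  have "(\<lambda>k. (LINT x|M. (norm (a k x))\<^sup>2) * (LINT x|M. (norm (b k x))\<^sup>2)) \<longlonglongrightarrow> 0 * c"
    by (intro tendsto_mult assms)
  then have "(\<lambda>k. (LINT x|M. (norm (a k x))\<^sup>2) * (LINT x|M. (norm (b k x))\<^sup>2)) \<longlonglongrightarrow> 0" by simp
  then have "(\<lambda>k. (LINT x|M. a k x \<bullet> b k x)\<^sup>2) \<longlonglongrightarrow> 0"
    by (rule Lim_null_comparison[rotated]) (use L2_Cauchy_Schwarz[OF a b] in auto)
  then have "(\<lambda>k. sqrt ((LINT x|M. a k x \<bullet> b k x)\<^sup>2)) \<longlonglongrightarrow> sqrt 0"
    by (rule tendsto_real_sqrt)
  then show ?thesis by (simp add: tendsto_rabs_zero_iff)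
qed

text \<open>
  Each factor is exchanged in turn; the error terms vanish by the Cauchy--Schwarz inequality.
\<close>

lemma L2_tendsto_inner:
  assumes f: "L2_tendsto M f u" and h: "L2_tendsto M h v"
  shows "(\<lambda>k. LINT x|M. f k x \<bullet> h k x) \<longlonglongrightarrow> (LINT x|M. u x \<bullet> v x)"
proof -
  have L: "L2 M (f k)" "L2 M u" "L2 M (h k)" "L2 M v" for k
    using f h by (auto simp: L2_tendsto_def)
  have z: "(\<lambda>k. LINT x|M. (norm (f k x - u x))\<^sup>2) \<longlonglongrightarrow> 0" "(\<lambda>k. LINT x|M. (norm (h k x - v x))\<^sup>2) \<longlonglongrightarrow> 0"
    using f h by (auto simp: L2_tendsto_def)
  have eq: "(LINT x|M. f k x \<bullet> h k x) = (LINT x|M. (f k x - u x) \<bullet> (h k x - v x)) + (LINT x|M. (f k x - u x) \<bullet> v x)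
      + (LINT x|M. (h k x - v x) \<bullet> u x) + (LINT x|M. u x \<bullet> v x)" for k
  proof -
    have "(LINT x|M. f k x \<bullet> h k x) = (LINT x|M. (f k x - u x) \<bullet> (h k x - v x) + (f k x - u x) \<bullet> v x + (h k x - v x) \<bullet> u x + u x \<bullet> v x)"
      by (rule Bochner_Integration.integral_cong) (auto simp: inner_simps inner_commute)
    also have "\<dots> = (LINT x|M. (f k x - u x) \<bullet> (h k x - v x)) + (LINT x|M. (f k x - u x) \<bullet> v x)
      + (LINT x|M. (h k x - v x) \<bullet> u x) + (LINT x|M. u x \<bullet> v x)"
      by (simp only: Bochner_Integration.integral_add Bochner_Integration.integrable_add L2_integrable_inner L2_diff L)
    finally show ?thesis .
  qed
  have "(\<lambda>k. (LINT x|M. (f k x - u x) \<bullet> (h k x - v x)) + (LINT x|M. (f k x - u x) \<bullet> v x)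
      + (LINT x|M. (h k x - v x) \<bullet> u x) + (LINT x|M. u x \<bullet> v x)) \<longlonglongrightarrow> 0 + 0 + 0 + (LINT x|M. u x \<bullet> v x)"
    by (intro tendsto_add tendsto_const tendsto_inner_zero[OF _ _ z(1) z(2)] tendsto_inner_zero[OF _ _ z(1) tendsto_const]
        tendsto_inner_zero[OF _ _ z(2) tendsto_const] L2_diff L)
  then show ?thesis unfolding eq by simp
qed

lemma L2_tendsto_sq:
  assumes "L2_tendsto M f u"
  shows "(\<lambda>k. LINT x|M. (norm (f k x))\<^sup>2) \<longlonglongrightarrow> (LINT x|M. (norm (u x))\<^sup>2)"
  using L2_tendsto_inner[OF assms assms] by (simp add: power2_norm_eq_inner)

text \<open>
  Riesz and Fischer: along a subsequence whose consecutive distances decay geometrically the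
  functions converge almost everywhere, and Fatou's lemma turns this into convergence in \<open>L\<^sup>2\<close>.
\<close>

lemma L2_complete:
  fixes f :: "nat \<Rightarrow> 'a \<Rightarrow> 'b::euclidean_space"
  assumes L: "\<And>k. L2 M (f k)"
    and C: "\<And>e. e > 0 \<Longrightarrow> \<exists>N. \<forall>i\<ge>N. \<forall>j\<ge>N. (LINT x|M. (norm (f i x - f j x))\<^sup>2) < e"
  shows "\<exists>u. L2_tendsto M f u"
proof -
  note [measurable] = L2_borel[OF L]
  have nn: "(\<integral>\<^sup>+x. ennreal ((norm (f i x - f j x))\<^sup>2) \<partial>M) = ennreal (LINT x|M. (norm (f i x - f j x))\<^sup>2)" for i j
    by (rule nn_integral_eq_integral[OF L2_integrable_sq[OF L2_diff[OF L L]]]) simp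
  have "\<exists>N. \<forall>i\<ge>N. \<forall>j\<ge>N. (LINT x|M. (norm (f i x - f j x))\<^sup>2) < (1/8) ^ k" for k
    by (rule C) simp
  then obtain N where N: "\<And>k i j. i \<ge> N k \<Longrightarrow> j \<ge> N k \<Longrightarrow> (LINT x|M. (norm (f i x - f j x))\<^sup>2) < (1/8) ^ k"
    by metis
  define s where "s k = (\<Sum>i\<le>k. N i) + k" for k
  have sN: "s k \<ge> N k" and sk: "s k \<ge> k" for k
    using member_le_sum[of k "{..k}" N] by (auto simp: s_def)
  have ss: "s (Suc k) \<ge> N k" for k
    using member_le_sum[of k "{..k}" N] by (simp add: s_def)
  define d where "d k x = (norm (f (s (Suc k)) x - f (s k) x))\<^sup>2" for k x
  have [measurable]: "d k \<in> borel_measurable M" for k unfolding d_def by measurable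
  have "(\<integral>\<^sup>+x. (\<Sum>k. ennreal (4 ^ k * d k x)) \<partial>M) = (\<Sum>k. \<integral>\<^sup>+x. ennreal (4 ^ k * d k x) \<partial>M)"
    by (rule nn_integral_suminf) measurable
  also have "\<dots> \<le> (\<Sum>k. ennreal ((1/2) ^ k))"
  proof (rule suminf_le)
    fix k
    have "(\<integral>\<^sup>+x. ennreal (4 ^ k * d k x) \<partial>M) = ennreal (4 ^ k) * (\<integral>\<^sup>+x. ennreal (d k x) \<partial>M)"
      by (subst nn_integral_cmult[symmetric]) (auto simp: ennreal_mult d_def)
    also have "(\<integral>\<^sup>+x. ennreal (d k x) \<partial>M) \<le> ennreal ((1/8) ^ k)"
      unfolding d_def nn by (rule ennreal_leI) (use N[OF ss sN] in \<open>auto intro: less_imp_le\<close>)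
    also have "ennreal (4 ^ k) * ennreal ((1/8) ^ k) = ennreal ((1/2) ^ k)"
      by (subst ennreal_mult[symmetric]) (auto simp: power_mult_distrib[symmetric])
    finally show "(\<integral>\<^sup>+x. ennreal (4 ^ k * d k x) \<partial>M) \<le> ennreal ((1/2) ^ k)"
      by (simp add: mult_left_mono)
  qed auto
  also have "\<dots> < \<infinity>"
    by (subst suminf_ennreal2) (auto simp: summable_geometric)
  finally have "(\<integral>\<^sup>+x. (\<Sum>k. ennreal (4 ^ k * d k x)) \<partial>M) \<noteq> \<infinity>" by simp
  then have "AE x in M. (\<Sum>k. ennreal (4 ^ k * d k x)) \<noteq> \<infinity>"
    by (rule nn_integral_noteq_infinite[rotated]) measurable
  then have conv: "AE x in M. convergent (\<lambda>k. f (s k) x)"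
  proof eventually_elim
    case (elim x)
    have d0: "0 \<le> d k x" for k by (simp add: d_def)
    have "summable (\<lambda>k. 4 ^ k * d k x)"
      by (rule summable_suminf_not_top) (use elim d0 in auto)
    then have "(\<lambda>k. 4 ^ k * d k x) \<longlonglongrightarrow> 0" by (rule summable_LIMSEQ_zero)
    then have "Bseq (\<lambda>k. 4 ^ k * d k x)" by (intro convergent_imp_Bseq convergentI)
    then obtain B where B: "B > 0" "\<And>k. norm (4 ^ k * d k x) \<le> B" unfolding Bseq_def by auto
    have "summable (\<lambda>k. norm (f (s (Suc k)) x - f (s k) x))"
    proof (rule summable_comparison_test')
      show "summable (\<lambda>k. sqrt B * (1/2) ^ k)" by (intro summable_mult summable_geometric) simp
      fix k :: nat assume "0 \<le> k"
      have "(2 ^ k * norm (f (s (Suc k)) x - f (s k) x))\<^sup>2 = 4 ^ k * d k x"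
        by (simp add: d_def power_mult_distrib power_mult[symmetric] mult.commute[of k] power_mult)
      also have "\<dots> \<le> B" using B(2)[of k] by simp
      finally have "2 ^ k * norm (f (s (Suc k)) x - f (s k) x) \<le> sqrt B" by (rule real_le_rsqrt)
      then show "norm (norm (f (s (Suc k)) x - f (s k) x)) \<le> sqrt B * (1/2) ^ k"
        by (simp add: power_divide field_simps)
    qed
    then have "summable (\<lambda>k. f (s (Suc k)) x - f (s k) x)" by (rule summable_norm_cancel)
    then have "convergent (\<lambda>n. \<Sum>k<n. f (s (Suc k)) x - f (s k) x)"
      by (simp add: summable_iff_convergent)
    then have "convergent (\<lambda>n. f (s n) x - f (s 0) x)"
      using sum_lessThan_telescope[of "\<lambda>n. f (s n) x"] by simp
    then have "convergent (\<lambda>n. (f (s n) x - f (s 0) x) + f (s 0) x)"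
      by (intro convergent_add convergent_const)
    then show ?case by simp
  qed
  define u where "u x = lim (\<lambda>k. f (s k) x)" for x
  have u[measurable]: "u \<in> borel_measurable M"
    unfolding u_def by measurable
  have lim: "AE x in M. (\<lambda>k. f (s k) x) \<longlonglongrightarrow> u x"
    using conv by eventually_elim (simp add: u_def convergent_LIMSEQ_iff)
  have fatou: "(\<integral>\<^sup>+x. ennreal ((norm (f i x - u x))\<^sup>2) \<partial>M) \<le> ennreal e"
    if e: "e > 0" and i: "\<And>j. j \<ge> n \<Longrightarrow> (LINT x|M. (norm (f i x - f j x))\<^sup>2) < e" for i e n
  proof -
    have "(\<integral>\<^sup>+x. ennreal ((norm (f i x - u x))\<^sup>2) \<partial>M) = (\<integral>\<^sup>+x. liminf (\<lambda>k. ennreal ((norm (f i x - f (s k) x))\<^sup>2)) \<partial>M)"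
    proof (rule nn_integral_cong_AE)
      show "AE x in M. ennreal ((norm (f i x - u x))\<^sup>2) = liminf (\<lambda>k. ennreal ((norm (f i x - f (s k) x))\<^sup>2))"
        using lim
      proof eventually_elim
        case (elim x)
        have "(\<lambda>k. ennreal ((norm (f i x - f (s k) x))\<^sup>2)) \<longlonglongrightarrow> ennreal ((norm (f i x - u x))\<^sup>2)"
          by (intro tendsto_ennrealI tendsto_intros elim)
        then show ?case by (intro lim_imp_Liminf[symmetric]) simp_all
      qed
    qed
    also have "\<dots> \<le> liminf (\<lambda>k. \<integral>\<^sup>+x. ennreal ((norm (f i x - f (s k) x))\<^sup>2) \<partial>M)"
      by (rule nn_integral_liminf) measurable
    also have "\<dots> \<le> ennreal e"
    proof (rule Liminf_le)
      show "eventually (\<lambda>k. (\<integral>\<^sup>+x. ennreal ((norm (f i x - f (s k) x))\<^sup>2) \<partial>M) \<le> ennreal e) sequentially"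
        unfolding nn
      proof (rule eventually_sequentiallyI[of n])
        fix k assume "n \<le> k"
        then have "s k \<ge> n" using sk[of k] by simp
        then show "ennreal (LINT x|M. (norm (f i x - f (s k) x))\<^sup>2) \<le> ennreal e"
          by (intro ennreal_leI order.strict_implies_order[OF i])
      qed
    qed simp
    finally show ?thesis .
  qed
  obtain n1 where n1: "\<forall>i\<ge>n1. \<forall>j\<ge>n1. (LINT x|M. (norm (f i x - f j x))\<^sup>2) < 1"
    using C[of 1] by auto
  have du: "L2 M (\<lambda>x. f n1 x - u x)"
    unfolding L2_def
  proof (intro conjI integrableI_nonneg)
    have "(\<integral>\<^sup>+x. ennreal ((norm (f n1 x - u x))\<^sup>2) \<partial>M) \<le> ennreal 1"
      by (rule fatou[of _ n1]) (use n1 in auto)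
    also have "\<dots> < \<infinity>" by simp
    finally show "(\<integral>\<^sup>+x. ennreal ((norm (f n1 x - u x))\<^sup>2) \<partial>M) < \<infinity>" .
  qed (auto intro!: AE_I2)
  have Lu: "L2 M u"
    using L2_diff[OF L[of n1] du] by simp
  have "(\<lambda>i. LINT x|M. (norm (f i x - u x))\<^sup>2) \<longlonglongrightarrow> 0"
  proof (rule LIMSEQ_I)
    fix e :: real assume e: "e > 0"
    then obtain n where n: "\<forall>i\<ge>n. \<forall>j\<ge>n. (LINT x|M. (norm (f i x - f j x))\<^sup>2) < e / 2"
      using C[of "e / 2"] by auto
    have "norm ((LINT x|M. (norm (f i x - u x))\<^sup>2) - 0) < e" if i: "i \<ge> n" for i
    proof -
      have "ennreal (LINT x|M. (norm (f i x - u x))\<^sup>2) = (\<integral>\<^sup>+x. ennreal ((norm (f i x - u x))\<^sup>2) \<partial>M)"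
        by (rule nn_integral_eq_integral[symmetric, OF L2_integrable_sq[OF L2_diff[OF L Lu]]]) simp
      also have "\<dots> \<le> ennreal (e / 2)"
        by (rule fatou[of _ n]) (use n i e in auto)
      finally have "(LINT x|M. (norm (f i x - u x))\<^sup>2) \<le> e / 2"
        using e by (simp add: ennreal_le_iff)
      moreover have "0 \<le> (LINT x|M. (norm (f i x - u x))\<^sup>2)" by (rule integral_nonneg_AE) simp
      ultimately show ?thesis using e by simp
    qed
    then show "\<exists>no. \<forall>i\<ge>no. norm ((LINT x|M. (norm (f i x - u x))\<^sup>2) - 0) < e" by blast
  qed
  then have "L2_tendsto M f u" using L Lu by (simp add: L2_tendsto_def)
  then show ?thesis by blast
qed

section \<open>Weak gradients\<close>

text \<open>
  The increment of \<open>w\<close> along a fixed vector has integral zero, by translation invariance. It is also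
  the integral of the directional derivative along the segment, and by Fubini's theorem every point of
  the segment contributes the same amount.
\<close>

lemma integral_gradient_compact_support:
  fixes w :: "real^'n \<Rightarrow> real" and W :: "real^'n \<Rightarrow> real^'n"
  assumes D: "\<And>x. GDERIV w x :> W x" and cW: "continuous_on UNIV W"
    and K: "compact K" and w0: "\<And>x. x \<notin> K \<Longrightarrow> w x = 0" and W0: "\<And>x. x \<notin> K \<Longrightarrow> W x = 0"
  shows "integrable lborel W" "(LINT x|lborel. W x) = 0"
proof -
  have hd: "(w has_derivative (\<lambda>h. h \<bullet> W x)) (at x)" for x
    using D by (simp add: gderiv_def)
  have cw: "continuous_on UNIV w"
    by (intro continuous_at_imp_continuous_on ballI has_derivative_continuous[OF hd])
  have ind: "(\<lambda>x. indicator K x *\<^sub>R w x) = w" "(\<lambda>x. indicator K x *\<^sub>R W x) = W"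
    using w0 W0 by (auto simp: indicator_def fun_eq_iff)
  have iw: "integrable lborel w"
    using borel_integrable_compact[OF K continuous_on_subset[OF cw subset_UNIV]] unfolding ind .
  show iW: "integrable lborel W"
    using borel_integrable_compact[OF K continuous_on_subset[OF cW subset_UNIV]] unfolding ind .
  have tr: "(LINT x|lborel. h (x + t)) = (LINT x|lborel. h x)" "integrable lborel h \<Longrightarrow> integrable lborel (\<lambda>x. h (x + t))"
    if [measurable]: "h \<in> borel_measurable borel" for h :: "real^'n \<Rightarrow> real" and t
  proof -
    have e: "lborel = distr lborel borel ((+) t)" by (rule lborel_distr_plus[symmetric])
    show "(LINT x|lborel. h (x + t)) = (LINT x|lborel. h x)"
      by (subst (2) e, subst integral_distr) (auto simp: add.commute)
    show "integrable lborel (\<lambda>x. h (x + t))" if "integrable lborel h"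
    proof -
      have "integrable (distr lborel borel ((+) t)) h" using that e by simp
      then show ?thesis by (subst (asm) integrable_distr_eq) (auto simp: add.commute)
    qed
  qed
  have mw: "w \<in> borel_measurable borel" and mW: "W \<in> borel_measurable borel"
    using cw cW by (auto intro: borel_measurable_continuous_onI)
  have zero: "(LINT x|lborel. W x \<bullet> e) = 0" for e
  proof -
    let ?K2 = "(\<lambda>(s, x). x - s *\<^sub>R e) ` ({0..1} \<times> K)"
    let ?F = "\<lambda>(s::real, x). indicator {0..1} s *\<^sub>R (W (x + s *\<^sub>R e) \<bullet> e)"
    have cK2: "compact ({0..1::real} \<times> ?K2)"
      by (intro compact_Times compact_Icc compact_continuous_image) (auto intro!: continuous_intros K simp: split_beta)
    have cF: "continuous_on ({0..1::real} \<times> ?K2) (\<lambda>(s, x). W (x + s *\<^sub>R e) \<bullet> e)"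
      unfolding split_beta by (intro continuous_intros continuous_on_compose2[OF cW]) auto
    have "integrable lborel (\<lambda>p. indicator ({0..1::real} \<times> ?K2) p *\<^sub>R (case p of (s, x) \<Rightarrow> W (x + s *\<^sub>R e) \<bullet> e))"
      by (rule borel_integrable_compact[OF cK2 cF])
    moreover have "indicator ({0..1::real} \<times> ?K2) p *\<^sub>R (case p of (s, x) \<Rightarrow> W (x + s *\<^sub>R e) \<bullet> e) = ?F p" for p
    proof (cases p)
      case (Pair s x)
      have "W (x + s *\<^sub>R e) = 0" if "0 \<le> s" "s \<le> 1" "x \<notin> ?K2"
      proof (rule W0)
        show "x + s *\<^sub>R e \<notin> K"
        proof
          assume "x + s *\<^sub>R e \<in> K"
          then have "(\<lambda>(s, x). x - s *\<^sub>R e) (s, x + s *\<^sub>R e) \<in> ?K2" using that by (intro imageI) auto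
          then show False using that(3) by simp
        qed
      qed
      then show ?thesis by (auto simp: Pair indicator_def)
    qed
    ultimately have iF: "integrable (lborel \<Otimes>\<^sub>M lborel) ?F" by (simp add: lborel_prod)
    have "0 = (LINT x|lborel. w (x + e)) - (LINT x|lborel. w x)" by (simp add: tr(1)[OF mw])
    also have "\<dots> = (LINT x|lborel. w (x + e) - w x)"
      using iw tr(2)[OF mw iw] by simp
    also have "\<dots> = (LINT x|lborel. LINT s|lborel. indicator {0..1} s *\<^sub>R (W (x + s *\<^sub>R e) \<bullet> e))"
    proof (rule Bochner_Integration.integral_cong[OF refl])
      fix x :: "real^'n"
      have "(LINT s|lborel. indicator {0..1} s *\<^sub>R (W (x + s *\<^sub>R e) \<bullet> e)) = w (x + 1 *\<^sub>R e) - w (x + 0 *\<^sub>R e)"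
      proof (rule integral_FTC_Icc)
        fix s :: real
        have "C1_near UNIV w W" unfolding C1_near_def using D cW by blast
        then show "((\<lambda>s. w (x + s *\<^sub>R e)) has_vector_derivative W (x + s *\<^sub>R e) \<bullet> e) (at s within {0..1})"
          unfolding has_real_derivative_iff_has_vector_derivative[symmetric] by (rule C1_near_line) simp
        show "continuous_on {0..1} (\<lambda>s. W (x + s *\<^sub>R e) \<bullet> e)"
          by (intro continuous_intros continuous_on_compose2[OF cW]) auto
      qed simp
      then show "w (x + e) - w x = (LINT s|lborel. indicator {0..1} s *\<^sub>R (W (x + s *\<^sub>R e) \<bullet> e))" by simp
    qed
    also have "\<dots> = (LINT s|lborel. LINT x|lborel. indicator {0..1} s *\<^sub>R (W (x + s *\<^sub>R e) \<bullet> e))"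
      using lborel_pair.Fubini_integral[of "\<lambda>s x. indicator {0..1} s *\<^sub>R (W (x + s *\<^sub>R e) \<bullet> e)"] iF by simp
    also have "\<dots> = (LINT s|lborel. indicator {0..1::real} s * (LINT x|lborel. W x \<bullet> e))"
      using tr(1)[of "\<lambda>x. W x \<bullet> e"] mW by simp
    also have "\<dots> = (LINT x|lborel. W x \<bullet> e)"
      by (simp add: measure_def)
    finally show ?thesis by simp
  qed
  show "(LINT x|lborel. W x) = 0"
  proof (rule euclidean_eqI)
    fix b :: "real^'n"
    have "(LINT x|lborel. W x \<bullet> b) = (LINT x|lborel. W x) \<bullet> b"
      by (rule integral_inner_left) (use iW in simp)
    then show "(LINT x|lborel. W x) \<bullet> b = 0 \<bullet> b"
      using zero[of b] by simp
  qed
qed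

text \<open>
  The product of \<open>f\<close> with a compactly supported test function, extended by zero, is \<open>C\<^sup>1\<close> on the whole
  space, so its gradient integrates to zero.
\<close>

lemma weak_gradient_C1:
  fixes f :: "real^'n \<Rightarrow> real"
  assumes C1: "C1_near \<Omega> f g" and \<Omega>: "open \<Omega>"
  shows "weak_gradient \<Omega> f g"
  unfolding weak_gradient_def
proof (intro allI impI)
  fix \<phi> :: "real^'n \<Rightarrow> real" and g' K
  assume \<phi>: "C1_near UNIV \<phi> g'" and K: "compact K" "K \<subseteq> \<Omega>" and z: "\<forall>x. x \<notin> K \<longrightarrow> \<phi> x = 0"
  have D\<phi>: "(\<phi> has_derivative (\<lambda>h. h \<bullet> g' x)) (at x)" for x
    using \<phi> unfolding C1_near_def gderiv_def by blast
  have cg': "continuous_on UNIV g'" using C1_near_continuous[OF \<phi>] by simp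
  have oK: "open (- K)" using K(1) by (simp add: compact_imp_closed open_Compl)
  have g'0: "g' x = 0" if x: "x \<notin> K" for x
  proof -
    have "(\<phi> has_derivative (\<lambda>h. 0)) (at x)"
      by (rule has_derivative_transform_within_open[OF has_derivative_const[of 0] oK]) (use x z in auto)
    then have "(\<lambda>h. h \<bullet> g' x) = (\<lambda>h. 0)"
      using D\<phi>[of x] has_derivative_unique by blast
    then have "g' x \<bullet> g' x = 0" by meson
    then show ?thesis by simp
  qed
  have Df: "(f has_derivative (\<lambda>h. h \<bullet> g x)) (at x)" if "x \<in> \<Omega>" for x
    using C1 that unfolding C1_near_def gderiv_def by blast
  let ?w = "\<lambda>x. if x \<in> \<Omega> then f x * \<phi> x else 0"
  let ?W = "\<lambda>x. if x \<in> \<Omega> then f x *\<^sub>R g' x + \<phi> x *\<^sub>R g x else 0"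
  have W0: "?W x = 0" and w0: "?w x = 0" if "x \<notin> K" for x
    using that z g'0 by auto
  have "GDERIV ?w x :> ?W x" for x
  proof (cases "x \<in> \<Omega>")
    case True
    have "((\<lambda>x. f x * \<phi> x) has_derivative (\<lambda>h. h \<bullet> ?W x)) (at x)"
      by (rule has_derivative_eq_rhs[OF has_derivative_mult[OF Df[OF True] D\<phi>]]) (use True in \<open>auto simp: inner_simps\<close>)
    then show ?thesis unfolding gderiv_def
      by (rule has_derivative_transform_within_open[OF _ \<Omega> True]) simp
  next
    case False
    then have x: "x \<in> - K" using K by auto
    have "((\<lambda>x. 0) has_derivative (\<lambda>h. h \<bullet> ?W x)) (at x)" using W0[of x] x by auto
    then show ?thesis unfolding gderiv_def
      by (rule has_derivative_transform_within_open[OF _ oK x]) (use w0 in auto)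
  qed
  moreover have cont: "continuous_on UNIV ?W"
  proof -
    have "continuous_on \<Omega> ?W"
    proof (rule continuous_on_eq)
      show "continuous_on \<Omega> (\<lambda>x. f x *\<^sub>R g' x + \<phi> x *\<^sub>R g x)"
        by (intro continuous_intros C1_near_continuous[OF C1] continuous_on_subset[OF cg']
            continuous_on_subset[OF C1_near_continuous(1)[OF \<phi>]]) auto
    qed simp
    moreover have "continuous_on (- K) ?W"
      by (rule continuous_on_eq[OF continuous_on_const[of _ 0]]) (use W0 in auto)
    ultimately have "continuous_on (\<Omega> \<union> - K) ?W" by (rule continuous_on_open_Un[OF \<Omega> oK])
    moreover have "\<Omega> \<union> - K = UNIV" using K by auto
    ultimately show ?thesis by simp
  qed
  ultimately have *: "integrable lborel ?W" "(LINT x|lborel. ?W x) = 0"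
    using integral_gradient_compact_support[of ?w ?W K] K(1) w0 W0 by auto
  let ?V = "volume_on \<Omega>"
  have sO: "\<Omega> \<inter> space lborel \<in> sets lborel" using \<Omega> by simp
  have iK: "integrable lborel (\<lambda>x. indicator K x *\<^sub>R h x)" if "continuous_on \<Omega> h" for h :: "real^'n \<Rightarrow> real^'n"
    by (rule borel_integrable_compact[OF K(1) continuous_on_subset[OF that K(2)]])
  have iV: "integrable ?V h" "(LINT x|?V. h x) = (LINT x|lborel. indicator K x *\<^sub>R h x)"
    if c: "continuous_on \<Omega> h" and h0: "\<And>x. x \<notin> K \<Longrightarrow> h x = 0" for h :: "real^'n \<Rightarrow> real^'n"
  proof -
    have e: "(\<lambda>x. indicator \<Omega> x *\<^sub>R h x) = (\<lambda>x. indicator K x *\<^sub>R h x)"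
      using h0 K(2) by (auto simp: indicator_def fun_eq_iff)
    show "integrable ?V h" unfolding integrable_restrict_space[OF sO] e by (rule iK[OF c])
    show "(LINT x|?V. h x) = (LINT x|lborel. indicator K x *\<^sub>R h x)"
      unfolding integral_restrict_space[OF sO] e ..
  qed
  have c1: "continuous_on \<Omega> (\<lambda>x. f x *\<^sub>R g' x)" and c2: "continuous_on \<Omega> (\<lambda>x. \<phi> x *\<^sub>R g x)"
    by (intro continuous_intros C1_near_continuous[OF C1] continuous_on_subset[OF cg']
            continuous_on_subset[OF C1_near_continuous(1)[OF \<phi>]]; simp)+
  have "(LINT x|?V. f x *\<^sub>R g' x) + (LINT x|?V. \<phi> x *\<^sub>R g x) = (LINT x|lborel. indicator K x *\<^sub>R (f x *\<^sub>R g' x)) + (LINT x|lborel. indicator K x *\<^sub>R (\<phi> x *\<^sub>R g x))"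
    using iV(2)[OF c1] iV(2)[OF c2] g'0 z by simp
  also have "\<dots> = (LINT x|lborel. indicator K x *\<^sub>R (f x *\<^sub>R g' x) + indicator K x *\<^sub>R (\<phi> x *\<^sub>R g x))"
    by (rule Bochner_Integration.integral_add[symmetric, OF iK[OF c1] iK[OF c2]])
  also have "\<dots> = (LINT x|lborel. ?W x)"
    by (rule Bochner_Integration.integral_cong) (use K z g'0 in \<open>auto simp: indicator_def\<close>)
  finally have "(LINT x|?V. f x *\<^sub>R g' x) + (LINT x|?V. \<phi> x *\<^sub>R g x) = 0" using * by simp
  then show "(LINT x|?V. f x *\<^sub>R g' x) = - (LINT x|?V. \<phi> x *\<^sub>R g x)"
    by (simp add: add_eq_0_iff)
qed

section \<open>Estimates along rays\<close>

lemma nn_integral_polar_rays: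
  fixes F :: "real^'n \<Rightarrow> ennreal"
  assumes [measurable]: "F \<in> borel_measurable borel"
  shows "(\<integral>\<^sup>+x. F x \<partial>lborel) =
    (\<integral>\<^sup>+w. \<integral>\<^sup>+r. F (c + r *\<^sub>R w) * ennreal (r ^ (CARD('n) - 1)) * indicator {0<..} r \<partial>lborel \<partial>sph)"
proof -
  have "(\<integral>\<^sup>+x. F x \<partial>lborel) =
    (\<integral>\<^sup>+r. (\<integral>\<^sup>+w. F (c + r *\<^sub>R w) \<partial>sph) * (ennreal (r ^ (CARD('n) - 1)) * indicator {0<..} r) \<partial>lborel)"
    by (subst nn_integral_polar[of F c]) (simp_all add: mult_ac)
  also have "\<dots> = (\<integral>\<^sup>+r. \<integral>\<^sup>+w. F (c + r *\<^sub>R w) * (ennreal (r ^ (CARD('n) - 1)) * indicator {0<..} r) \<partial>sph \<partial>lborel)"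
    by (intro nn_integral_cong nn_integral_multc[symmetric]) measurable
  also have "\<dots> = (\<integral>\<^sup>+w. \<integral>\<^sup>+r. F (c + r *\<^sub>R w) * (ennreal (r ^ (CARD('n) - 1)) * indicator {0<..} r) \<partial>lborel \<partial>sph)"
    by (rule pair_sigma_finite.Fubini'[OF sph_pair_sigma_finite]) measurable
  finally show ?thesis by (simp add: mult.assoc)
qed

lemma nn_integral_shell_rays:
  fixes h :: "real^'n \<Rightarrow> ennreal"
  assumes [measurable]: "h \<in> borel_measurable borel" and "0 \<le> a"
  shows "(\<integral>\<^sup>+x. h x * indicator (ball c R - cball c a) x \<partial>lborel) =
    (\<integral>\<^sup>+w. \<integral>\<^sup>+r. h (c + r *\<^sub>R w) * ennreal (r ^ (CARD('n) - 1)) * indicator {a..R} r \<partial>lborel \<partial>sph)"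
proof -
  have "(\<integral>\<^sup>+x. h x * indicator (ball c R - cball c a) x \<partial>lborel) =
    (\<integral>\<^sup>+r. (\<integral>\<^sup>+w. h (c + r *\<^sub>R w) \<partial>sph) * (ennreal (r ^ (CARD('n) - 1)) * indicator {a<..<R} r) \<partial>lborel)"
    by (subst nn_integral_shell[OF assms]) (simp add: mult_ac)
  also have "\<dots> = (\<integral>\<^sup>+r. (\<integral>\<^sup>+w. h (c + r *\<^sub>R w) \<partial>sph) * (ennreal (r ^ (CARD('n) - 1)) * indicator {a..R} r) \<partial>lborel)"
  proof (rule nn_integral_cong_AE)
    have "AE r in lborel. r \<noteq> a \<and> r \<noteq> (R::real)"
      by (intro AE_conjI AE_lborel_singleton)
    then show "AE r in lborel. (\<integral>\<^sup>+w. h (c + r *\<^sub>R w) \<partial>sph) * (ennreal (r ^ (CARD('n) - 1)) * indicator {a<..<R} r) =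
        (\<integral>\<^sup>+w. h (c + r *\<^sub>R w) \<partial>sph) * (ennreal (r ^ (CARD('n) - 1)) * indicator {a..R} r)"
      by eventually_elim (auto simp: indicator_def)
  qed
  also have "\<dots> = (\<integral>\<^sup>+r. \<integral>\<^sup>+w. h (c + r *\<^sub>R w) * (ennreal (r ^ (CARD('n) - 1)) * indicator {a..R} r) \<partial>sph \<partial>lborel)"
    by (intro nn_integral_cong nn_integral_multc[symmetric]) measurable
  also have "\<dots> = (\<integral>\<^sup>+w. \<integral>\<^sup>+r. h (c + r *\<^sub>R w) * (ennreal (r ^ (CARD('n) - 1)) * indicator {a..R} r) \<partial>lborel \<partial>sph)"
    by (rule pair_sigma_finite.Fubini'[OF sph_pair_sigma_finite]) measurable
  finally show ?thesis by (simp add: mult.assoc)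
qed

text \<open>
  On a ray that stays away from the centre the polar weight is bounded below.
\<close>

lemma nn_integral_interval_le_weighted:
  assumes "0 < a" and [measurable]: "q \<in> borel_measurable borel"
  shows "(\<integral>\<^sup>+r. q r * indicator {a..b} r \<partial>lborel) \<le>
    ennreal (1 / a ^ N) * (\<integral>\<^sup>+r. q r * ennreal (r ^ N) * indicator {a..b} r \<partial>lborel)"
proof -
  have "(\<integral>\<^sup>+r. q r * indicator {a..b} r \<partial>lborel) \<le> (\<integral>\<^sup>+r. ennreal (1 / a ^ N) * (q r * ennreal (r ^ N) * indicator {a..b} r) \<partial>lborel)"
  proof (rule nn_integral_mono)
    fix r :: real
    show "q r * indicator {a..b} r \<le> ennreal (1 / a ^ N) * (q r * ennreal (r ^ N) * indicator {a..b} r)"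
    proof (cases "r \<in> {a..b}")
      case True
      then have "a ^ N \<le> r ^ N" using \<open>0 < a\<close> by (intro power_mono) auto
      then have "1 \<le> 1 / a ^ N * r ^ N" using \<open>0 < a\<close> by simp
      then have "ennreal 1 \<le> ennreal (1 / a ^ N * r ^ N)" by (rule ennreal_leI)
      also have "\<dots> = ennreal (1 / a ^ N) * ennreal (r ^ N)"
        using \<open>0 < a\<close> True by (intro ennreal_mult) auto
      finally have "q r * 1 \<le> q r * (ennreal (1 / a ^ N) * ennreal (r ^ N))"
        by (intro mult_left_mono) auto
      then show ?thesis using True by (simp add: mult_ac)
    qed simp
  qed
  also have "\<dots> = ennreal (1 / a ^ N) * (\<integral>\<^sup>+r. q r * ennreal (r ^ N) * indicator {a..b} r \<partial>lborel)"
    by (rule nn_integral_cmult) measurable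
  finally show ?thesis .
qed

lemma sq_le_other_point:
  fixes \<phi> \<psi> :: "real \<Rightarrow> real"
  assumes st: "a \<le> s" "s \<le> b" "a \<le> t" "t \<le> b"
    and der: "\<And>r. a \<le> r \<Longrightarrow> r \<le> b \<Longrightarrow> (\<phi> has_real_derivative \<psi> r) (at r within {a..b})"
    and cont: "continuous_on {a..b} \<psi>"
  shows "ennreal ((\<phi> s)\<^sup>2) \<le> ennreal 2 * ennreal ((\<phi> t)\<^sup>2) +
    ennreal (2 * (b - a)) * (\<integral>\<^sup>+r. ennreal ((\<psi> r)\<^sup>2) * indicator {a..b} r \<partial>lborel)"
proof -
  let ?I = "\<integral>\<^sup>+r. ennreal ((\<psi> r)\<^sup>2) * indicator {a..b} r \<partial>lborel"
  have inc: "ennreal ((\<phi> q - \<phi> p)\<^sup>2) \<le> ennreal (b - a) * ?I" if "a \<le> p" "p \<le> q" "q \<le> b" for p q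
  proof -
    have "ennreal ((\<phi> q - \<phi> p)\<^sup>2) \<le> ennreal (q - p) * (\<integral>\<^sup>+r. ennreal ((\<psi> r)\<^sup>2) * indicator {p..q} r \<partial>lborel)"
    proof (rule increment_sq_le[OF that(2)])
      show "(\<phi> has_real_derivative \<psi> r) (at r within {p..q})" if "p \<le> r" "r \<le> q" for r
        by (rule DERIV_subset[OF der]) (use \<open>a \<le> p\<close> \<open>q \<le> b\<close> that in auto)
      show "continuous_on {p..q} \<psi>"
        by (rule continuous_on_subset[OF cont]) (use that in auto)
    qed
    also have "\<dots> \<le> ennreal (b - a) * ?I"
      using that by (intro mult_mono ennreal_leI nn_integral_mono) (auto simp: indicator_def)
    finally show ?thesis .
  qed
  have d: "ennreal ((\<phi> s - \<phi> t)\<^sup>2) \<le> ennreal (b - a) * ?I"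
    using inc[of t s] inc[of s t] st by (cases "t \<le> s") (auto simp: power2_commute)
  have "(\<phi> s)\<^sup>2 \<le> 2 * (\<phi> t)\<^sup>2 + 2 * (\<phi> s - \<phi> t)\<^sup>2"
  proof -
    have "2 * (\<phi> t)\<^sup>2 + 2 * (\<phi> s - \<phi> t)\<^sup>2 - (\<phi> s)\<^sup>2 = (\<phi> s - 2 * \<phi> t)\<^sup>2"
      by (simp add: power2_eq_square algebra_simps)
    then show ?thesis by (metis diff_ge_0_iff_ge zero_le_power2)
  qed
  then have "ennreal ((\<phi> s)\<^sup>2) \<le> ennreal (2 * (\<phi> t)\<^sup>2 + 2 * (\<phi> s - \<phi> t)\<^sup>2)" by (rule ennreal_leI)
  also have "\<dots> = ennreal 2 * ennreal ((\<phi> t)\<^sup>2) + ennreal 2 * ennreal ((\<phi> s - \<phi> t)\<^sup>2)"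
    by (simp only: ennreal_mult[symmetric] ennreal_plus[symmetric] mult_nonneg_nonneg zero_le_power2 zero_le_numeral)
  also have "\<dots> \<le> ennreal 2 * ennreal ((\<phi> t)\<^sup>2) + ennreal 2 * (ennreal (b - a) * ?I)"
    by (intro add_left_mono mult_left_mono d) simp
  also have "ennreal 2 * (ennreal (b - a) * ?I) = ennreal (2 * (b - a)) * ?I"
    using st by (subst ennreal_mult) (auto simp: mult.assoc)
  finally show ?thesis .
qed

lemma sq_le_average:
  fixes \<phi> \<psi> :: "real \<Rightarrow> real"
  assumes s: "a \<le> s" "s \<le> b" and cd: "a \<le> c" "c < d" "d \<le> b"
    and der: "\<And>r. a \<le> r \<Longrightarrow> r \<le> b \<Longrightarrow> (\<phi> has_real_derivative \<psi> r) (at r within {a..b})"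
    and cont: "continuous_on {a..b} \<psi>"
    and [measurable]: "\<phi> \<in> borel_measurable borel"
  shows "ennreal ((\<phi> s)\<^sup>2) \<le> ennreal (2 / (d - c)) * (\<integral>\<^sup>+r. ennreal ((\<phi> r)\<^sup>2) * indicator {c..d} r \<partial>lborel) +
    ennreal (2 * (b - a)) * (\<integral>\<^sup>+r. ennreal ((\<psi> r)\<^sup>2) * indicator {a..b} r \<partial>lborel)"
proof -
  let ?I = "\<integral>\<^sup>+r. ennreal ((\<psi> r)\<^sup>2) * indicator {a..b} r \<partial>lborel"
  let ?k = "ennreal (1 / (d - c))"
  have one: "?k * (\<integral>\<^sup>+t. v * indicator {c..d} t \<partial>lborel) = v" for v
  proof -
    have "?k * (\<integral>\<^sup>+t. v * indicator {c..d} t \<partial>lborel) = ?k * ennreal (d - c) * v"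
      using cd by (subst nn_integral_cmult) (auto simp: mult_ac)
    also have "?k * ennreal (d - c) = 1" using cd by (subst ennreal_mult[symmetric]) auto
    finally show ?thesis by simp
  qed
  have "ennreal ((\<phi> s)\<^sup>2) = ?k * (\<integral>\<^sup>+t. ennreal ((\<phi> s)\<^sup>2) * indicator {c..d} t \<partial>lborel)"
    by (rule one[symmetric])
  also have "\<dots> \<le> ?k * (\<integral>\<^sup>+t. ennreal 2 * (ennreal ((\<phi> t)\<^sup>2) * indicator {c..d} t) + (ennreal (2 * (b - a)) * ?I) * indicator {c..d} t \<partial>lborel)"
  proof (intro mult_left_mono nn_integral_mono)
    fix t :: real
    show "ennreal ((\<phi> s)\<^sup>2) * indicator {c..d} t \<le> ennreal 2 * (ennreal ((\<phi> t)\<^sup>2) * indicator {c..d} t) + (ennreal (2 * (b - a)) * ?I) * indicator {c..d} t"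
    proof (cases "t \<in> {c..d}")
      case True
      then have "a \<le> t" "t \<le> b" using cd by auto
      from sq_le_other_point[OF s this der cont] show ?thesis using True by simp
    qed simp
  qed simp
  also have "\<dots> = ?k * (\<integral>\<^sup>+t. ennreal 2 * (ennreal ((\<phi> t)\<^sup>2) * indicator {c..d} t) \<partial>lborel) + ?k * (\<integral>\<^sup>+t. (ennreal (2 * (b - a)) * ?I) * indicator {c..d} t \<partial>lborel)"
    by (subst nn_integral_add) (auto simp: distrib_left)
  also have "?k * (\<integral>\<^sup>+t. (ennreal (2 * (b - a)) * ?I) * indicator {c..d} t \<partial>lborel) = ennreal (2 * (b - a)) * ?I"
    by (rule one)
  also have "?k * (\<integral>\<^sup>+t. ennreal 2 * (ennreal ((\<phi> t)\<^sup>2) * indicator {c..d} t) \<partial>lborel) = ?k * ennreal 2 * (\<integral>\<^sup>+r. ennreal ((\<phi> r)\<^sup>2) * indicator {c..d} r \<partial>lborel)"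
    by (subst nn_integral_cmult) (simp_all add: mult.assoc)
  also have "?k * ennreal 2 = ennreal (2 / (d - c))"
    using cd by (subst ennreal_mult[symmetric]) auto
  finally show ?thesis .
qed

text \<open>
  The trace on the outer sphere is controlled by the values in the inner half of a collar, with
  an arbitrarily small multiple of the energy when the collar is thin.
\<close>

lemma shell_trace_inequality:
  fixes f :: "real^'n \<Rightarrow> real"
  assumes a: "0 < a" "a < R" and C1: "C1_near (cball c R - ball c a) f g"
    and [measurable]: "f \<in> borel_measurable borel" "g \<in> borel_measurable borel"
  shows "(\<integral>\<^sup>+w. ennreal ((f (c + R *\<^sub>R w))\<^sup>2) \<partial>sph) \<le>
     ennreal (4 / (R - a)) * (ennreal (1 / a ^ (CARD('n) - 1)) * (\<integral>\<^sup>+x. ennreal ((f x)\<^sup>2) * indicator (ball c ((a + R) / 2) - cball c a) x \<partial>lborel))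
   + ennreal (2 * (R - a)) * (ennreal (1 / a ^ (CARD('n) - 1)) * (\<integral>\<^sup>+x. ennreal ((norm (g x))\<^sup>2) * indicator (ball c R - cball c a) x \<partial>lborel))"
proof -
  let ?N = "CARD('n) - 1" and ?m = "(a + R) / 2"
  have rK: "c + r *\<^sub>R w \<in> cball c R - ball c a" if "a \<le> r" "r \<le> R" "norm w = 1" for r w
    using that a by (simp add: dist_norm)
  have "(\<integral>\<^sup>+w. ennreal ((f (c + R *\<^sub>R w))\<^sup>2) \<partial>sph) \<le>
    (\<integral>\<^sup>+w. ennreal (4 / (R - a)) * (ennreal (1 / a ^ ?N) * (\<integral>\<^sup>+r. ennreal ((f (c + r *\<^sub>R w))\<^sup>2) * ennreal (r ^ ?N) * indicator {a..?m} r \<partial>lborel))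
      + ennreal (2 * (R - a)) * (ennreal (1 / a ^ ?N) * (\<integral>\<^sup>+r. ennreal ((norm (g (c + r *\<^sub>R w)))\<^sup>2) * ennreal (r ^ ?N) * indicator {a..R} r \<partial>lborel)) \<partial>sph)"
  proof (rule nn_integral_mono_AE)
    show "AE w in sph. ennreal ((f (c + R *\<^sub>R w))\<^sup>2) \<le>
      ennreal (4 / (R - a)) * (ennreal (1 / a ^ ?N) * (\<integral>\<^sup>+r. ennreal ((f (c + r *\<^sub>R w))\<^sup>2) * ennreal (r ^ ?N) * indicator {a..?m} r \<partial>lborel))
      + ennreal (2 * (R - a)) * (ennreal (1 / a ^ ?N) * (\<integral>\<^sup>+r. ennreal ((norm (g (c + r *\<^sub>R w)))\<^sup>2) * ennreal (r ^ ?N) * indicator {a..R} r \<partial>lborel))"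
      using AE_sph_norm
    proof eventually_elim
      case w: (elim w)
      let ?\<phi> = "\<lambda>r. f (c + r *\<^sub>R w)" and ?\<psi> = "\<lambda>r. g (c + r *\<^sub>R w) \<bullet> w"
      have A: "ennreal ((?\<phi> R)\<^sup>2) \<le> ennreal (2 / (?m - a)) * (\<integral>\<^sup>+r. ennreal ((?\<phi> r)\<^sup>2) * indicator {a..?m} r \<partial>lborel) +
        ennreal (2 * (R - a)) * (\<integral>\<^sup>+r. ennreal ((?\<psi> r)\<^sup>2) * indicator {a..R} r \<partial>lborel)"
      proof (rule sq_le_average)
        show "(?\<phi> has_real_derivative ?\<psi> r) (at r within {a..R})" if "a \<le> r" "r \<le> R" for r
          by (rule C1_near_line[OF C1 rK[OF that w]])
        show "continuous_on {a..R} ?\<psi>"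
          by (intro continuous_intros continuous_on_compose2[OF C1_near_continuous(2)[OF C1]]) (use rK w in auto)
      qed (use a in auto)
      have m: "2 / (?m - a) = 4 / (R - a)" using a by (simp add: field_simps)
      have B: "(\<integral>\<^sup>+r. ennreal ((?\<phi> r)\<^sup>2) * indicator {a..?m} r \<partial>lborel) \<le> ennreal (1 / a ^ ?N) * (\<integral>\<^sup>+r. ennreal ((?\<phi> r)\<^sup>2) * ennreal (r ^ ?N) * indicator {a..?m} r \<partial>lborel)"
        by (rule nn_integral_interval_le_weighted[OF a(1)]) measurable
      have "(\<integral>\<^sup>+r. ennreal ((?\<psi> r)\<^sup>2) * indicator {a..R} r \<partial>lborel) \<le> (\<integral>\<^sup>+r. ennreal ((norm (g (c + r *\<^sub>R w)))\<^sup>2) * indicator {a..R} r \<partial>lborel)"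
      proof (intro nn_integral_mono mult_right_mono ennreal_leI)
        fix r
        show "(?\<psi> r)\<^sup>2 \<le> (norm (g (c + r *\<^sub>R w)))\<^sup>2"
          using Cauchy_Schwarz_ineq[of "g (c + r *\<^sub>R w)" w] w by (simp add: power2_norm_eq_inner norm_eq_1)
      qed simp
      also have "\<dots> \<le> ennreal (1 / a ^ ?N) * (\<integral>\<^sup>+r. ennreal ((norm (g (c + r *\<^sub>R w)))\<^sup>2) * ennreal (r ^ ?N) * indicator {a..R} r \<partial>lborel)"
        by (rule nn_integral_interval_le_weighted[OF a(1)]) measurable
      finally show ?case
        by (intro order_trans[OF A[unfolded m]] add_mono mult_left_mono B) simp_all
    qed
  qed
  also have "\<dots> = ennreal (4 / (R - a)) * (ennreal (1 / a ^ ?N) * (\<integral>\<^sup>+w. \<integral>\<^sup>+r. ennreal ((f (c + r *\<^sub>R w))\<^sup>2) * ennreal (r ^ ?N) * indicator {a..?m} r \<partial>lborel \<partial>sph))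
     + ennreal (2 * (R - a)) * (ennreal (1 / a ^ ?N) * (\<integral>\<^sup>+w. \<integral>\<^sup>+r. ennreal ((norm (g (c + r *\<^sub>R w)))\<^sup>2) * ennreal (r ^ ?N) * indicator {a..R} r \<partial>lborel \<partial>sph))"
    by (subst nn_integral_add) (measurable, simp add: nn_integral_cmult)
  also have "(\<integral>\<^sup>+w. \<integral>\<^sup>+r. ennreal ((f (c + r *\<^sub>R w))\<^sup>2) * ennreal (r ^ ?N) * indicator {a..?m} r \<partial>lborel \<partial>sph)
     = (\<integral>\<^sup>+x. ennreal ((f x)\<^sup>2) * indicator (ball c ?m - cball c a) x \<partial>lborel)"
    by (rule nn_integral_shell_rays[symmetric]) (use a in auto)
  also have "(\<integral>\<^sup>+w. \<integral>\<^sup>+r. ennreal ((norm (g (c + r *\<^sub>R w)))\<^sup>2) * ennreal (r ^ ?N) * indicator {a..R} r \<partial>lborel \<partial>sph)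
     = (\<integral>\<^sup>+x. ennreal ((norm (g x))\<^sup>2) * indicator (ball c R - cball c a) x \<partial>lborel)"
    by (rule nn_integral_shell_rays[symmetric]) (use a in auto)
  finally show ?thesis .
qed

text \<open>
  Along each ray of the shell the function is controlled by its value on the outer sphere.
\<close>

lemma shell_L2_inequality:
  fixes f :: "real^'n \<Rightarrow> real"
  assumes a: "0 < a" "a < R" and C1: "C1_near (cball c R - ball c a) f g"
    and [measurable]: "f \<in> borel_measurable borel" "g \<in> borel_measurable borel"
  shows "(\<integral>\<^sup>+x. ennreal ((f x)\<^sup>2) * indicator (ball c R - cball c a) x \<partial>lborel) \<le>
     ennreal (R ^ (CARD('n) - 1) * (R - a)) * (ennreal 2 * (\<integral>\<^sup>+w. ennreal ((f (c + R *\<^sub>R w))\<^sup>2) \<partial>sph)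
   + ennreal (2 * (R - a)) * (ennreal (1 / a ^ (CARD('n) - 1)) * (\<integral>\<^sup>+x. ennreal ((norm (g x))\<^sup>2) * indicator (ball c R - cball c a) x \<partial>lborel)))"
proof -
  let ?N = "CARD('n) - 1"
  have rK: "c + r *\<^sub>R w \<in> cball c R - ball c a" if "a \<le> r" "r \<le> R" "norm w = 1" for r w
    using that a by (simp add: dist_norm)
  let ?X = "\<lambda>w. ennreal 2 * ennreal ((f (c + R *\<^sub>R w))\<^sup>2) + ennreal (2 * (R - a)) * (ennreal (1 / a ^ ?N) * (\<integral>\<^sup>+r. ennreal ((norm (g (c + r *\<^sub>R w)))\<^sup>2) * ennreal (r ^ ?N) * indicator {a..R} r \<partial>lborel))"
  have "(\<integral>\<^sup>+x. ennreal ((f x)\<^sup>2) * indicator (ball c R - cball c a) x \<partial>lborel) =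
    (\<integral>\<^sup>+w. \<integral>\<^sup>+r. ennreal ((f (c + r *\<^sub>R w))\<^sup>2) * ennreal (r ^ ?N) * indicator {a..R} r \<partial>lborel \<partial>sph)"
    by (rule nn_integral_shell_rays) (use a in auto)
  also have "\<dots> \<le> (\<integral>\<^sup>+w. ennreal (R ^ ?N * (R - a)) * ?X w \<partial>sph)"
  proof (rule nn_integral_mono_AE)
    show "AE w in sph. (\<integral>\<^sup>+r. ennreal ((f (c + r *\<^sub>R w))\<^sup>2) * ennreal (r ^ ?N) * indicator {a..R} r \<partial>lborel) \<le> ennreal (R ^ ?N * (R - a)) * ?X w"
      using AE_sph_norm
    proof eventually_elim
      case w: (elim w)
      let ?\<phi> = "\<lambda>r. f (c + r *\<^sub>R w)" and ?\<psi> = "\<lambda>r. g (c + r *\<^sub>R w) \<bullet> w"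
      have pt: "ennreal ((?\<phi> s)\<^sup>2) \<le> ?X w" if s: "a \<le> s" "s \<le> R" for s
      proof -
        have A: "ennreal ((?\<phi> s)\<^sup>2) \<le> ennreal 2 * ennreal ((?\<phi> R)\<^sup>2) +
          ennreal (2 * (R - a)) * (\<integral>\<^sup>+r. ennreal ((?\<psi> r)\<^sup>2) * indicator {a..R} r \<partial>lborel)"
        proof (rule sq_le_other_point[where \<phi>="?\<phi>" and \<psi>="?\<psi>" and s=s and t=R])
          show "(?\<phi> has_real_derivative ?\<psi> r) (at r within {a..R})" if "a \<le> r" "r \<le> R" for r
            by (rule C1_near_line[OF C1 rK[OF that w]])
          show "continuous_on {a..R} ?\<psi>"
            by (intro continuous_intros continuous_on_compose2[OF C1_near_continuous(2)[OF C1]]) (use rK w in auto)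
        qed (use a s in auto)
        have "(\<integral>\<^sup>+r. ennreal ((?\<psi> r)\<^sup>2) * indicator {a..R} r \<partial>lborel) \<le> (\<integral>\<^sup>+r. ennreal ((norm (g (c + r *\<^sub>R w)))\<^sup>2) * indicator {a..R} r \<partial>lborel)"
        proof (intro nn_integral_mono mult_right_mono ennreal_leI)
          fix r
          show "(?\<psi> r)\<^sup>2 \<le> (norm (g (c + r *\<^sub>R w)))\<^sup>2"
            using Cauchy_Schwarz_ineq[of "g (c + r *\<^sub>R w)" w] w by (simp add: power2_norm_eq_inner norm_eq_1)
        qed simp
        also have "\<dots> \<le> ennreal (1 / a ^ ?N) * (\<integral>\<^sup>+r. ennreal ((norm (g (c + r *\<^sub>R w)))\<^sup>2) * ennreal (r ^ ?N) * indicator {a..R} r \<partial>lborel)"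
          by (rule nn_integral_interval_le_weighted[OF a(1)]) measurable
        finally show ?thesis
          by (intro order_trans[OF A] add_mono mult_left_mono) simp_all
      qed
      have "(\<integral>\<^sup>+r. ennreal ((?\<phi> r)\<^sup>2) * ennreal (r ^ ?N) * indicator {a..R} r \<partial>lborel) \<le> (\<integral>\<^sup>+r. ?X w * ennreal (R ^ ?N) * indicator {a..R} r \<partial>lborel)"
      proof (rule nn_integral_mono)
        fix r :: real
        show "ennreal ((?\<phi> r)\<^sup>2) * ennreal (r ^ ?N) * indicator {a..R} r \<le> ?X w * ennreal (R ^ ?N) * indicator {a..R} r"
        proof (cases "r \<in> {a..R}")
          case True
          then have "ennreal ((?\<phi> r)\<^sup>2) * ennreal (r ^ ?N) \<le> ?X w * ennreal (R ^ ?N)"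
            using a by (intro mult_mono pt ennreal_leI power_mono) auto
          then show ?thesis using True by simp
        qed simp
      qed
      also have "\<dots> = ?X w * ennreal (R ^ ?N) * ennreal (R - a)"
        using a by (subst nn_integral_cmult) auto
      also have "\<dots> = ennreal (R ^ ?N * (R - a)) * ?X w"
        using a by (subst ennreal_mult) (auto simp: mult_ac)
      finally show ?case .
    qed
  qed
  also have "\<dots> = ennreal (R ^ ?N * (R - a)) * (\<integral>\<^sup>+w. ?X w \<partial>sph)"
    by (rule nn_integral_cmult) measurable
  also have "(\<integral>\<^sup>+w. ?X w \<partial>sph) = ennreal 2 * (\<integral>\<^sup>+w. ennreal ((f (c + R *\<^sub>R w))\<^sup>2) \<partial>sph)
    + ennreal (2 * (R - a)) * (ennreal (1 / a ^ ?N) * (\<integral>\<^sup>+w. \<integral>\<^sup>+r. ennreal ((norm (g (c + r *\<^sub>R w)))\<^sup>2) * ennreal (r ^ ?N) * indicator {a..R} r \<partial>lborel \<partial>sph))"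
    by (subst nn_integral_add) (measurable, simp add: nn_integral_cmult)
  also have "(\<integral>\<^sup>+w. \<integral>\<^sup>+r. ennreal ((norm (g (c + r *\<^sub>R w)))\<^sup>2) * ennreal (r ^ ?N) * indicator {a..R} r \<partial>lborel \<partial>sph)
     = (\<integral>\<^sup>+x. ennreal ((norm (g x))\<^sup>2) * indicator (ball c R - cball c a) x \<partial>lborel)"
    by (rule nn_integral_shell_rays[symmetric]) (use a in auto)
  finally show ?thesis .
qed

section \<open>A ball with an eccentric hole\<close>

locale pierced_ball =
  fixes R1 R2 :: real and y :: "real^'n"
  assumes R1: "0 < R1" and inside: "norm y + R1 < R2" and dim: "2 \<le> CARD('n)"
begin

abbreviation "\<Omega> \<equiv> annular_domain R1 R2 y"
abbreviation "K \<equiv> cball y R2 - ball 0 R1"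

lemma R2: "0 < R2"
  using R1 inside norm_ge_zero[of y] by linarith

lemma \<Omega>_subset_K: "\<Omega> \<subseteq> K"
  by (auto simp: annular_domain_def)

lemma open_\<Omega>: "open \<Omega>"
  unfolding annular_domain_def by (intro open_Diff) auto

lemma \<Omega>_borel [measurable]: "\<Omega> \<in> sets borel"
  using open_\<Omega> by simp

lemma compact_K: "compact K"
  by (intro compact_diff) auto

lemma norm_ge_dist: "dist y x - norm y \<le> norm x"
  using norm_triangle_ineq4[of y x] by (simp add: dist_norm)

lemma collar_subset: "R1 + norm y \<le> a \<Longrightarrow> ball y R2 - cball y a \<subseteq> \<Omega>"
proof
  fix x assume "R1 + norm y \<le> a" "x \<in> ball y R2 - cball y a"
  then show "x \<in> \<Omega>" using norm_ge_dist[of x] by (simp add: annular_domain_def)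
qed

lemma collar_subset_K: "R1 + norm y \<le> a \<Longrightarrow> cball y R2 - ball y a \<subseteq> K"
proof
  fix x assume "R1 + norm y \<le> a" "x \<in> cball y R2 - ball y a"
  then show "x \<in> K" using norm_ge_dist[of x] by simp
qed

text \<open>
  The distance at which the ray from the origin in direction \<open>w\<close> leaves the outer ball, as the larger
  root of a quadratic equation.
\<close>

definition exit :: "real^'n \<Rightarrow> real" where
  "exit w = w \<bullet> y + sqrt ((w \<bullet> y)\<^sup>2 + (R2\<^sup>2 - (norm y)\<^sup>2))"

lemma exit_iff:
  assumes w: "norm w = 1" and t: "0 \<le> t"
  shows "norm (t *\<^sub>R w - y) < R2 \<longleftrightarrow> t < exit w" and "norm (t *\<^sub>R w - y) = R2 \<longleftrightarrow> t = exit w"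
proof -
  define b where "b = w \<bullet> y"
  define D where "D = b\<^sup>2 + (R2\<^sup>2 - (norm y)\<^sup>2)"
  have yR: "norm y < R2" using R1 inside by simp
  then have "(norm y)\<^sup>2 < R2\<^sup>2" by (simp add: power_strict_mono)
  then have D: "b\<^sup>2 < D" by (simp add: D_def)
  then have "\<bar>b\<bar> < sqrt D" by (metis real_sqrt_abs real_sqrt_less_iff)
  then have sD: "- sqrt D < t - b" "0 < sqrt D" using t abs_ge_zero[of b] by linarith+
  have D0: "0 \<le> D" using D zero_le_power2[of b] by linarith
  have e: "exit w = b + sqrt D" by (simp add: exit_def b_def D_def)
  have "(norm (t *\<^sub>R w - y))\<^sup>2 = t\<^sup>2 - 2 * t * b + (norm y)\<^sup>2"
  proof -
    have "w \<bullet> w = 1" using w by (simp only: norm_eq_1)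
    then show ?thesis
      unfolding power2_norm_eq_inner b_def
      by (simp add: inner_diff_left inner_diff_right inner_commute[of y w] power2_eq_square algebra_simps)
  qed
  then have sq: "(norm (t *\<^sub>R w - y))\<^sup>2 - R2\<^sup>2 = (t - b)\<^sup>2 - (sqrt D)\<^sup>2"
    using D0 by (simp add: D_def power2_eq_square algebra_simps)
  have fac: "(t - b)\<^sup>2 - (sqrt D)\<^sup>2 = (t - b - sqrt D) * (t - b + sqrt D)"
    by (simp add: power2_eq_square algebra_simps)
  have pos: "t - b + sqrt D > 0" using sD by simp
  have "norm (t *\<^sub>R w - y) < R2 \<longleftrightarrow> (norm (t *\<^sub>R w - y))\<^sup>2 < R2\<^sup>2"
    using R2 power_strict_mono[of "norm (t *\<^sub>R w - y)" R2 2] power2_less_imp_less[of "norm (t *\<^sub>R w - y)" R2] by auto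
  also have "\<dots> \<longleftrightarrow> (t - b - sqrt D) * (t - b + sqrt D) < 0" using sq fac by linarith
  also have "\<dots> \<longleftrightarrow> t < exit w" using pos by (auto simp: mult_less_0_iff e)
  finally show "norm (t *\<^sub>R w - y) < R2 \<longleftrightarrow> t < exit w" .
  have "norm (t *\<^sub>R w - y) = R2 \<longleftrightarrow> (norm (t *\<^sub>R w - y))\<^sup>2 = R2\<^sup>2"
    using R2 by (simp add: power2_eq_iff_nonneg)
  also have "\<dots> \<longleftrightarrow> (t - b - sqrt D) * (t - b + sqrt D) = 0" using sq fac by linarith
  also have "\<dots> \<longleftrightarrow> t = exit w" using pos by (auto simp: e)
  finally show "norm (t *\<^sub>R w - y) = R2 \<longleftrightarrow> t = exit w" .
qed

lemma exit_bounds: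
  assumes w: "norm w = 1"
  shows "R2 - norm y \<le> exit w" "exit w \<le> 2 * R2"
proof -
  show ge: "R2 - norm y \<le> exit w"
  proof (rule ccontr)
    assume "\<not> R2 - norm y \<le> exit w"
    define t where "t = max 0 (exit w)"
    have t: "0 \<le> t" "t < R2 - norm y"
      using \<open>\<not> R2 - norm y \<le> exit w\<close> R1 inside by (auto simp: t_def)
    have "norm (t *\<^sub>R w - y) \<le> t + norm y"
      using norm_triangle_ineq4[of "t *\<^sub>R w" y] w t by simp
    then have "t < exit w" using exit_iff(1)[OF w t(1)] t by simp
    then show False by (simp add: t_def)
  qed
  have e0: "0 \<le> exit w" using ge R1 inside by simp
  have "norm (exit w *\<^sub>R w - y) = R2" using exit_iff(2)[OF w e0] by simp
  moreover have "exit w = norm (exit w *\<^sub>R w)" using w e0 by simp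
  moreover have "norm (exit w *\<^sub>R w) \<le> norm (exit w *\<^sub>R w - y) + norm y"
    using norm_triangle_ineq[of "exit w *\<^sub>R w - y" y] by simp
  ultimately show "exit w \<le> 2 * R2" using R1 inside by simp
qed

lemma ray_in_\<Omega>:
  assumes "norm w = 1" "0 < t"
  shows "t *\<^sub>R w \<in> \<Omega> \<longleftrightarrow> R1 < t \<and> t < exit w"
  using exit_iff(1)[OF assms(1), of t] assms
  by (auto simp: annular_domain_def dist_norm norm_minus_commute)

lemma ray_in_K:
  assumes "norm w = 1" "R1 \<le> t" "t \<le> exit w"
  shows "t *\<^sub>R w \<in> K"
proof -
  have t: "0 \<le> t" using R1 assms by simp
  have "norm (t *\<^sub>R w - y) \<le> R2"
    using exit_iff[OF assms(1) t] assms(3) by (cases "t = exit w") auto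
  then show ?thesis using assms t by (simp add: dist_norm norm_minus_commute)
qed

text \<open>
  Every point of the domain lies on a segment, contained in the domain and pointing away from the
  origin, that ends in the collar; so values in the collar and the energy control the function.
\<close>

lemma L2_le_collar:
  assumes \<delta>: "0 < \<delta>" "\<delta> \<le> R2 - norm y - R1"
    and C1: "C1_near K f g"
    and [measurable]: "f \<in> borel_measurable borel" "g \<in> borel_measurable borel"
  shows "(\<integral>\<^sup>+x. ennreal ((f x)\<^sup>2) * indicator \<Omega> x \<partial>lborel) \<le>
     ennreal ((2 * R2) ^ CARD('n)) * (ennreal (2 / \<delta>) * (ennreal (1 / R1 ^ (CARD('n) - 1)) * (\<integral>\<^sup>+x. ennreal ((f x)\<^sup>2) * indicator (ball y R2 - cball y (R2 - \<delta>)) x \<partial>lborel))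
   + ennreal (4 * R2) * (ennreal (1 / R1 ^ (CARD('n) - 1)) * (\<integral>\<^sup>+x. ennreal ((norm (g x))\<^sup>2) * indicator \<Omega> x \<partial>lborel)))"
proof -
  let ?N = "CARD('n) - 1" and ?D = "2 * R2" and ?A = "ball y R2 - cball y (R2 - \<delta>)"
  have [measurable]: "?A \<in> sets borel" by simp
  have N: "CARD('n) = Suc ?N" using dim by simp
  let ?If = "\<lambda>w. \<integral>\<^sup>+r. (ennreal ((f (0 + r *\<^sub>R w))\<^sup>2) * indicator ?A (0 + r *\<^sub>R w)) * ennreal (r ^ ?N) * indicator {0<..} r \<partial>lborel"
  let ?Ig = "\<lambda>w. \<integral>\<^sup>+r. (ennreal ((norm (g (0 + r *\<^sub>R w)))\<^sup>2) * indicator \<Omega> (0 + r *\<^sub>R w)) * ennreal (r ^ ?N) * indicator {0<..} r \<partial>lborel"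
  let ?X = "\<lambda>w. ennreal (2 / \<delta>) * (ennreal (1 / R1 ^ ?N) * ?If w) + ennreal (4 * R2) * (ennreal (1 / R1 ^ ?N) * ?Ig w)"
  have "(\<integral>\<^sup>+x. ennreal ((f x)\<^sup>2) * indicator \<Omega> x \<partial>lborel) =
    (\<integral>\<^sup>+w. \<integral>\<^sup>+r. (ennreal ((f (0 + r *\<^sub>R w))\<^sup>2) * indicator \<Omega> (0 + r *\<^sub>R w)) * ennreal (r ^ ?N) * indicator {0<..} r \<partial>lborel \<partial>sph)"
    by (rule nn_integral_polar_rays) measurable
  also have "\<dots> \<le> (\<integral>\<^sup>+w. ennreal (?D ^ CARD('n)) * ?X w \<partial>sph)"
  proof (rule nn_integral_mono_AE)
    show "AE w in sph. (\<integral>\<^sup>+r. (ennreal ((f (0 + r *\<^sub>R w))\<^sup>2) * indicator \<Omega> (0 + r *\<^sub>R w)) * ennreal (r ^ ?N) * indicator {0<..} r \<partial>lborel) \<le> ennreal (?D ^ CARD('n)) * ?X w"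
      using AE_sph_norm
    proof eventually_elim
      case w: (elim w)
      let ?\<phi> = "\<lambda>r. f (0 + r *\<^sub>R w)" and ?\<psi> = "\<lambda>r. g (0 + r *\<^sub>R w) \<bullet> w"
      let ?\<rho> = "exit w"
      have \<rho>: "R1 \<le> ?\<rho> - \<delta>" "?\<rho> \<le> ?D" using exit_bounds[OF w] \<delta> by auto
      have r\<rho>: "R1 < ?\<rho>" using \<rho> \<delta> by simp
      have pt: "ennreal ((?\<phi> s)\<^sup>2) \<le> ?X w" if s: "R1 \<le> s" "s \<le> ?\<rho>" for s
      proof -
        have A: "ennreal ((?\<phi> s)\<^sup>2) \<le> ennreal (2 / (?\<rho> - (?\<rho> - \<delta>))) * (\<integral>\<^sup>+r. ennreal ((?\<phi> r)\<^sup>2) * indicator {?\<rho> - \<delta>..?\<rho>} r \<partial>lborel) +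
          ennreal (2 * (?\<rho> - R1)) * (\<integral>\<^sup>+r. ennreal ((?\<psi> r)\<^sup>2) * indicator {R1..?\<rho>} r \<partial>lborel)"
        proof (rule sq_le_average)
          show "(?\<phi> has_real_derivative ?\<psi> r) (at r within {R1..?\<rho>})" if "R1 \<le> r" "r \<le> ?\<rho>" for r
            by (rule C1_near_line[OF C1]) (use ray_in_K[OF w that] in simp)
          show "continuous_on {R1..?\<rho>} ?\<psi>"
            by (intro continuous_intros continuous_on_compose2[OF C1_near_continuous(2)[OF C1]]) (use ray_in_K[OF w] in auto)
        qed (use \<rho> s \<delta> in auto)
        have \<delta>': "?\<rho> - (?\<rho> - \<delta>) = \<delta>" by simp
        have B: "(\<integral>\<^sup>+r. ennreal ((?\<phi> r)\<^sup>2) * indicator {?\<rho> - \<delta>..?\<rho>} r \<partial>lborel) \<le> ennreal (1 / R1 ^ ?N) * ?If w"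
        proof -
          have "(\<integral>\<^sup>+r. ennreal ((?\<phi> r)\<^sup>2) * indicator {?\<rho> - \<delta>..?\<rho>} r \<partial>lborel) \<le> (\<integral>\<^sup>+r. (ennreal ((?\<phi> r)\<^sup>2) * indicator ?A (0 + r *\<^sub>R w)) * indicator {R1..?\<rho>} r \<partial>lborel)"
          proof (rule nn_integral_mono_AE)
            have "AE r in lborel. r \<noteq> ?\<rho> - \<delta> \<and> r \<noteq> ?\<rho>" by (intro AE_conjI AE_lborel_singleton)
            then show "AE r in lborel. ennreal ((?\<phi> r)\<^sup>2) * indicator {?\<rho> - \<delta>..?\<rho>} r \<le> (ennreal ((?\<phi> r)\<^sup>2) * indicator ?A (0 + r *\<^sub>R w)) * indicator {R1..?\<rho>} r"
            proof eventually_elim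
              case (elim r)
              show ?case
              proof (cases "r \<in> {?\<rho> - \<delta>..?\<rho>}")
                case True
                then have r: "?\<rho> - \<delta> < r" "r < ?\<rho>" using elim by auto
                then have r1: "R1 \<le> r" using \<rho> by simp
                then have r0: "0 \<le> r" using R1 by simp
                have "norm (r *\<^sub>R w - y) < R2" using exit_iff(1)[OF w r0] r by simp
                moreover have "norm (r *\<^sub>R w - y) > R2 - \<delta>"
                proof -
                  have "R2 = norm (?\<rho> *\<^sub>R w - y)" using exit_iff(2)[OF w, of ?\<rho>] r r0 by simp
                  also have "?\<rho> *\<^sub>R w - y = (r *\<^sub>R w - y) + (?\<rho> - r) *\<^sub>R w" by (simp add: algebra_simps)
                  also have "norm \<dots> \<le> norm (r *\<^sub>R w - y) + (?\<rho> - r)"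
                    using norm_triangle_ineq[of "r *\<^sub>R w - y" "(?\<rho> - r) *\<^sub>R w"] w r by simp
                  finally show ?thesis using r by simp
                qed
                ultimately have "r *\<^sub>R w \<in> ?A" by (simp add: dist_norm norm_minus_commute)
                then show ?thesis using True r1 by simp
              qed simp
            qed
          qed
          also have "\<dots> \<le> ennreal (1 / R1 ^ ?N) * (\<integral>\<^sup>+r. (ennreal ((?\<phi> r)\<^sup>2) * indicator ?A (0 + r *\<^sub>R w)) * ennreal (r ^ ?N) * indicator {R1..?\<rho>} r \<partial>lborel)"
            by (rule nn_integral_interval_le_weighted[OF R1]) measurable
          also have "\<dots> \<le> ennreal (1 / R1 ^ ?N) * ?If w"
            using R1 by (intro mult_left_mono nn_integral_mono) (auto simp: indicator_def)
          finally show ?thesis .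
        qed
        have C: "(\<integral>\<^sup>+r. ennreal ((?\<psi> r)\<^sup>2) * indicator {R1..?\<rho>} r \<partial>lborel) \<le> ennreal (1 / R1 ^ ?N) * ?Ig w"
        proof -
          have "(\<integral>\<^sup>+r. ennreal ((?\<psi> r)\<^sup>2) * indicator {R1..?\<rho>} r \<partial>lborel) \<le> (\<integral>\<^sup>+r. (ennreal ((norm (g (0 + r *\<^sub>R w)))\<^sup>2) * indicator \<Omega> (0 + r *\<^sub>R w)) * indicator {R1..?\<rho>} r \<partial>lborel)"
          proof (rule nn_integral_mono_AE)
            have "AE r in lborel. r \<noteq> R1 \<and> r \<noteq> ?\<rho>" by (intro AE_conjI AE_lborel_singleton)
            then show "AE r in lborel. ennreal ((?\<psi> r)\<^sup>2) * indicator {R1..?\<rho>} r \<le> (ennreal ((norm (g (0 + r *\<^sub>R w)))\<^sup>2) * indicator \<Omega> (0 + r *\<^sub>R w)) * indicator {R1..?\<rho>} r"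
            proof eventually_elim
              case (elim r)
              show ?case
              proof (cases "r \<in> {R1..?\<rho>}")
                case True
                then have r: "R1 < r" "r < ?\<rho>" using elim by auto
                then have "r *\<^sub>R w \<in> \<Omega>" using ray_in_\<Omega>[OF w, of r] R1 by simp
                moreover have "(?\<psi> r)\<^sup>2 \<le> (norm (g (0 + r *\<^sub>R w)))\<^sup>2"
                  using Cauchy_Schwarz_ineq[of "g (0 + r *\<^sub>R w)" w] w by (simp add: power2_norm_eq_inner norm_eq_1)
                ultimately show ?thesis using True by (simp add: ennreal_leI)
              qed simp
            qed
          qed
          also have "\<dots> \<le> ennreal (1 / R1 ^ ?N) * (\<integral>\<^sup>+r. (ennreal ((norm (g (0 + r *\<^sub>R w)))\<^sup>2) * indicator \<Omega> (0 + r *\<^sub>R w)) * ennreal (r ^ ?N) * indicator {R1..?\<rho>} r \<partial>lborel)"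
            by (rule nn_integral_interval_le_weighted[OF R1]) measurable
          also have "\<dots> \<le> ennreal (1 / R1 ^ ?N) * ?Ig w"
            using R1 by (intro mult_left_mono nn_integral_mono) (auto simp: indicator_def)
          finally show ?thesis .
        qed
        have D: "ennreal (2 * (?\<rho> - R1)) \<le> ennreal (4 * R2)" using \<rho> R1 by (intro ennreal_leI) simp
        show ?thesis
          by (intro order_trans[OF A[unfolded \<delta>']] add_mono mult_left_mono B mult_mono[OF D C]) simp_all
      qed
      have "(\<integral>\<^sup>+r. (ennreal ((?\<phi> r)\<^sup>2) * indicator \<Omega> (0 + r *\<^sub>R w)) * ennreal (r ^ ?N) * indicator {0<..} r \<partial>lborel) \<le>
         (\<integral>\<^sup>+r. (?X w * ennreal (?D ^ ?N)) * indicator {0..?D} r \<partial>lborel)"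
      proof (rule nn_integral_mono)
        fix r :: real
        show "(ennreal ((?\<phi> r)\<^sup>2) * indicator \<Omega> (0 + r *\<^sub>R w)) * ennreal (r ^ ?N) * indicator {0<..} r \<le> (?X w * ennreal (?D ^ ?N)) * indicator {0..?D} r"
        proof (cases "0 < r \<and> r *\<^sub>R w \<in> \<Omega>")
          case True
          then have r: "R1 \<le> r" "r \<le> ?\<rho>" "0 \<le> r" "r \<le> ?D" using ray_in_\<Omega>[OF w, of r] \<rho> by auto
          then have "ennreal ((?\<phi> r)\<^sup>2) * ennreal (r ^ ?N) \<le> ?X w * ennreal (?D ^ ?N)"
            by (intro mult_mono pt ennreal_leI power_mono) auto
          then show ?thesis using True r by simp
        qed (auto simp: indicator_def)
      qed
      also have "\<dots> = (?X w * ennreal (?D ^ ?N)) * ennreal ?D"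
        using R2 by (subst nn_integral_cmult) auto
      also have "\<dots> = ennreal (?D ^ CARD('n)) * ?X w"
      proof -
        have "ennreal (?D ^ CARD('n)) = ennreal (?D ^ ?N) * ennreal ?D"
        proof -
          have "?D ^ Suc ?N = ?D ^ ?N * ?D" by (rule power_Suc2)
          then have "?D ^ CARD('n) = ?D ^ ?N * ?D" unfolding N[symmetric] .
          then show ?thesis using R2 by (simp only:) (rule ennreal_mult; simp)
        qed
        then show ?thesis by (simp only: mult_ac)
      qed
      finally show ?case .
    qed
  qed
  also have "\<dots> = ennreal (?D ^ CARD('n)) * (\<integral>\<^sup>+w. ?X w \<partial>sph)"
    by (rule nn_integral_cmult) measurable
  also have "(\<integral>\<^sup>+w. ?X w \<partial>sph) = ennreal (2 / \<delta>) * (ennreal (1 / R1 ^ ?N) * (\<integral>\<^sup>+w. ?If w \<partial>sph)) + ennreal (4 * R2) * (ennreal (1 / R1 ^ ?N) * (\<integral>\<^sup>+w. ?Ig w \<partial>sph))"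
    by (subst nn_integral_add) (measurable, simp add: nn_integral_cmult)
  also have "(\<integral>\<^sup>+w. ?If w \<partial>sph) = (\<integral>\<^sup>+x. ennreal ((f x)\<^sup>2) * indicator ?A x \<partial>lborel)"
    by (rule nn_integral_polar_rays[symmetric]) measurable
  also have "(\<integral>\<^sup>+w. ?Ig w \<partial>sph) = (\<integral>\<^sup>+x. ennreal ((norm (g x))\<^sup>2) * indicator \<Omega> x \<partial>lborel)"
    by (rule nn_integral_polar_rays[symmetric]) measurable
  finally show ?thesis .
qed

end

section \<open>Inequalities between boundary values and energy\<close>

lemma L2_bounded:
  assumes "finite_measure M" and [measurable]: "h \<in> borel_measurable M" and "\<And>x. x \<in> space M \<Longrightarrow> norm (h x) \<le> b"
  shows "L2 M h"
  unfolding L2_def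
proof
  show "integrable M (\<lambda>x. (norm (h x))\<^sup>2)"
  proof (rule finite_measure.integrable_const_bound[OF assms(1)])
    show "AE x in M. norm ((norm (h x))\<^sup>2) \<le> b\<^sup>2"
      by (rule AE_I2) (use assms(3) in \<open>simp add: power_mono\<close>)
  qed measurable
qed measurable

lemma average_sq_le:
  fixes u :: "real^'n \<Rightarrow> real"
  assumes L: "L2 (volume_on B) u" and B: "B \<in> sets borel" "emeasure lborel B < \<infinity>" "0 < measure lborel B"
  shows "ennreal (((LINT z|volume_on B. u z) / measure lborel B)\<^sup>2) \<le>
    ennreal (1 / measure lborel B) * (\<integral>\<^sup>+z. ennreal ((u z)\<^sup>2) * indicator B z \<partial>lborel)"
proof -
  let ?v = "measure lborel B"
  have sB: "B \<inter> space lborel \<in> sets lborel" using B by simp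
  have fm: "finite_measure (volume_on B)"
    by (rule finite_measureI) (use B in \<open>simp add: emeasure_restrict_space space_restrict_space\<close>)
  have L1: "L2 (volume_on B) (\<lambda>_. 1 :: real)"
    by (rule L2_bounded[OF fm]) auto
  have one: "(LINT z|volume_on B. (norm (1::real))\<^sup>2) = ?v"
    using B by (simp add: measure_restrict_space space_restrict_space)
  have "(LINT z|volume_on B. u z \<bullet> 1)\<^sup>2 \<le> (LINT z|volume_on B. (norm (u z))\<^sup>2) * (LINT z|volume_on B. (norm (1::real))\<^sup>2)"
    by (rule L2_Cauchy_Schwarz[OF L L1])
  then have "(LINT z|volume_on B. u z)\<^sup>2 \<le> (LINT z|volume_on B. (u z)\<^sup>2) * ?v"
    unfolding one by simp
  then have "((LINT z|volume_on B. u z) / ?v)\<^sup>2 \<le> 1 / ?v * (LINT z|volume_on B. (u z)\<^sup>2)"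
    using B(3) by (simp add: power_divide field_simps power2_eq_square)
  then have "ennreal (((LINT z|volume_on B. u z) / ?v)\<^sup>2) \<le> ennreal (1 / ?v * (LINT z|volume_on B. (u z)\<^sup>2))"
    by (rule ennreal_leI)
  also have "\<dots> = ennreal (1 / ?v) * ennreal (LINT z|volume_on B. (u z)\<^sup>2)"
    using B(3) by (intro ennreal_mult integral_nonneg_AE) auto
  also have "ennreal (LINT z|volume_on B. (u z)\<^sup>2) = (\<integral>\<^sup>+z. ennreal ((u z)\<^sup>2) \<partial>volume_on B)"
    using L2_integrable_sq[OF L] by (intro nn_integral_eq_integral[symmetric]) auto
  also have "\<dots> = (\<integral>\<^sup>+z. ennreal ((u z)\<^sup>2) * indicator B z \<partial>lborel)"
    by (rule nn_integral_restrict_space[OF sB])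
  finally show ?thesis .
qed

context pierced_ball
begin

abbreviation "V \<equiv> volume_on \<Omega>"
abbreviation "S \<equiv> sphere_measure y R2"
abbreviation "a0 \<equiv> norm y + R1"

lemma a0: "0 < a0" "a0 < R2"
  using R1 inside norm_ge_zero[of y] by linarith+

text \<open>
  Points on the boundary are limits along their own ray from the origin.
\<close>

lemma closure_\<Omega>: "closure \<Omega> = K"
proof
  show "closure \<Omega> \<subseteq> K"
    by (rule closure_minimal[OF \<Omega>_subset_K]) (intro closed_Diff; simp)
  show "K \<subseteq> closure \<Omega>"
  proof
    fix x assume x: "x \<in> K"
    define t where "t = norm x"
    define w where "w = x /\<^sub>R t"
    have t: "R1 \<le> t" using x by (simp add: t_def)
    then have w: "norm w = 1" and xw: "x = t *\<^sub>R w" using R1 by (auto simp: w_def t_def field_simps)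
    have "norm (t *\<^sub>R w - y) \<le> R2" using x by (simp add: xw[symmetric] dist_norm norm_minus_commute)
    then have te: "t \<le> exit w" using exit_iff[OF w, of t] t R1 by (auto simp: le_less)
    have lt: "R1 < exit w" using exit_bounds(1)[OF w] inside by simp
    have "(\<lambda>t. t *\<^sub>R w) ` closure {R1<..<exit w} \<subseteq> closure \<Omega>"
    proof (rule image_closure_subset)
      show "(\<lambda>t. t *\<^sub>R w) ` {R1<..<exit w} \<subseteq> closure \<Omega>"
        using ray_in_\<Omega>[OF w] R1 closure_subset[of \<Omega>] by fastforce
    qed (auto intro!: continuous_intros)
    moreover have "t \<in> closure {R1<..<exit w}"
      using lt t te by simp
    ultimately show "x \<in> closure \<Omega>" unfolding xw by blast
  qed
qed

lemma sphere_subset_K: "sphere y R2 \<subseteq> K"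
proof
  fix x assume "x \<in> sphere y R2"
  then show "x \<in> K" using norm_ge_dist[of x] inside by simp
qed

lemma space_V: "space V = \<Omega>"
  by (simp add: space_restrict_space)

lemma space_S: "space S = sphere y R2"
  by (simp add: sphere_measure_def space_scale_measure space_restrict_space)

lemma finite_V: "finite_measure V"
proof (rule finite_measureI)
  have "emeasure lborel \<Omega> \<le> emeasure lborel (ball y R2)"
    by (rule emeasure_mono) (auto simp: annular_domain_def)
  also have "\<dots> < \<infinity>" by (rule emeasure_lborel_ball_finite)
  finally show "emeasure V (space V) \<noteq> \<infinity>"
    using \<Omega>_borel by (simp add: emeasure_restrict_space space_V)
qed

lemma finite_S: "finite_measure S"
proof (rule finite_measureI)
  show "emeasure S (space S) \<noteq> \<infinity>"
    using emeasure_lborel_ball_finite[of y R2] R2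
    by (auto simp: space_S emeasure_sphere_measure ennreal_mult_eq_top_iff)
qed

lemma measurable_restrict_space_lborel:
  "borel_measurable (restrict_space lborel A) = borel_measurable (restrict_space borel A)"
  by (rule measurable_cong_sets) (simp_all add: sets_restrict_space)

lemma borel_V: "continuous_on K h \<Longrightarrow> h \<in> borel_measurable V"
  unfolding measurable_restrict_space_lborel
  by (rule borel_measurable_continuous_on_restrict[OF continuous_on_subset[OF _ \<Omega>_subset_K]])

lemma borel_S: "continuous_on K h \<Longrightarrow> h \<in> borel_measurable S"
  using borel_measurable_continuous_on_restrict[OF continuous_on_subset[OF _ sphere_subset_K]]
  by (simp add: sphere_measure_def cong: measurable_cong_sets)

lemma bounded_K:
  fixes h :: "real^'n \<Rightarrow> 'b::euclidean_space"
  assumes "continuous_on K h"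
  obtains b where "\<And>x. x \<in> K \<Longrightarrow> norm (h x) \<le> b"
proof -
  have "bounded (h ` K)"
    by (rule compact_imp_bounded, rule compact_continuous_image, rule assms, rule compact_K)
  then show ?thesis using that unfolding bounded_iff by blast
qed

lemma L2_V:
  fixes h :: "real^'n \<Rightarrow> 'b::euclidean_space"
  assumes "continuous_on K h" shows "L2 V h"
proof -
  obtain b where "\<And>x. x \<in> K \<Longrightarrow> norm (h x) \<le> b" using bounded_K[OF assms] by blast
  then show ?thesis using \<Omega>_subset_K by (intro L2_bounded[OF finite_V borel_V[OF assms], of b]) (auto simp: space_V)
qed

lemma L2_S:
  fixes h :: "real^'n \<Rightarrow> 'b::euclidean_space"
  assumes "continuous_on K h" shows "L2 S h"
proof -
  obtain b where "\<And>x. x \<in> K \<Longrightarrow> norm (h x) \<le> b" using bounded_K[OF assms] by blast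
  then show ?thesis using sphere_subset_K by (intro L2_bounded[OF finite_S borel_S[OF assms], of b]) (auto simp: space_S)
qed

lemma LINT_V_cong: "(\<And>x. x \<in> K \<Longrightarrow> h x = h' x) \<Longrightarrow> (LINT x|V. h x) = (LINT x|V. h' x)"
  using \<Omega>_subset_K by (intro Bochner_Integration.integral_cong) (auto simp: space_V)

lemma LINT_S_cong: "(\<And>x. x \<in> K \<Longrightarrow> h x = h' x) \<Longrightarrow> (LINT x|S. h x) = (LINT x|S. h' x)"
  using sphere_subset_K by (intro Bochner_Integration.integral_cong) (auto simp: space_S)

lemma nn_integral_V_sq:
  fixes h :: "real^'n \<Rightarrow> 'b::euclidean_space"
  assumes "continuous_on K h"
  shows "(\<integral>\<^sup>+x. ennreal ((norm (h x))\<^sup>2) * indicator \<Omega> x \<partial>lborel) = ennreal (LINT x|V. (norm (h x))\<^sup>2)"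
proof -
  have "(\<integral>\<^sup>+x. ennreal ((norm (h x))\<^sup>2) * indicator \<Omega> x \<partial>lborel) = (\<integral>\<^sup>+x. ennreal ((norm (h x))\<^sup>2) \<partial>V)"
    by (rule nn_integral_restrict_space[symmetric]) simp
  also have "\<dots> = ennreal (LINT x|V. (norm (h x))\<^sup>2)"
    by (rule nn_integral_eq_integral[OF L2_integrable_sq[OF L2_V[OF assms]]]) simp
  finally show ?thesis .
qed

lemma nn_integral_S_sq:
  fixes f :: "real^'n \<Rightarrow> real"
  assumes c: "continuous_on K f" and [measurable]: "f \<in> borel_measurable borel"
  shows "(\<integral>\<^sup>+w. ennreal ((f (y + R2 *\<^sub>R w))\<^sup>2) \<partial>sph) = ennreal ((LINT x|S. (f x)\<^sup>2) / R2 ^ (CARD('n) - 1))"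
proof -
  have "ennreal (LINT x|S. (f x)\<^sup>2) = (\<integral>\<^sup>+x. ennreal ((f x)\<^sup>2) \<partial>S)"
    using L2_integrable_sq[OF L2_S[OF c]] by (intro nn_integral_eq_integral[symmetric]) auto
  also have "\<dots> = ennreal (R2 ^ (CARD('n) - 1)) * (\<integral>\<^sup>+w. ennreal ((f (y + R2 *\<^sub>R w))\<^sup>2) \<partial>sph)"
    by (rule nn_integral_sphere_measure) (use R2 in auto)
  finally have e: "ennreal (LINT x|S. (f x)\<^sup>2) = ennreal (R2 ^ (CARD('n) - 1)) * (\<integral>\<^sup>+w. ennreal ((f (y + R2 *\<^sub>R w))\<^sup>2) \<partial>sph)" .
  have nn: "0 \<le> (LINT x|S. (f x)\<^sup>2)" by (rule integral_nonneg_AE) simp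
  have "ennreal ((LINT x|S. (f x)\<^sup>2) / R2 ^ (CARD('n) - 1)) = ennreal (1 / R2 ^ (CARD('n) - 1)) * ennreal (LINT x|S. (f x)\<^sup>2)"
    using R2 nn by (subst ennreal_mult[symmetric]) auto
  also have "\<dots> = (ennreal (1 / R2 ^ (CARD('n) - 1)) * ennreal (R2 ^ (CARD('n) - 1))) * (\<integral>\<^sup>+w. ennreal ((f (y + R2 *\<^sub>R w))\<^sup>2) \<partial>sph)"
    by (simp only: e mult.assoc)
  also have "ennreal (1 / R2 ^ (CARD('n) - 1)) * ennreal (R2 ^ (CARD('n) - 1)) = 1"
    using R2 by (subst ennreal_mult[symmetric]) auto
  finally show ?thesis by simp
qed

lemma LINT_nonneg_sq: "0 \<le> (LINT x|M. (norm (h x))\<^sup>2)"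
  by (rule integral_nonneg_AE) simp

lemma C1_near_borel_LINT:
  assumes "C1_near K f g"
  obtains f0 g0 where "C1_near K f0 g0" "f0 \<in> borel_measurable borel" "g0 \<in> borel_measurable borel"
    "(LINT x|V. (f0 x)\<^sup>2) = (LINT x|V. (f x)\<^sup>2)" "(LINT x|V. (norm (g0 x))\<^sup>2) = (LINT x|V. (norm (g x))\<^sup>2)"
    "(LINT x|S. (f0 x)\<^sup>2) = (LINT x|S. (f x)\<^sup>2)" "(LINT x|S. f0 x) = (LINT x|S. f x)"
proof -
  obtain f0 g0 where C0: "C1_near K f0 g0" "f0 \<in> borel_measurable borel" "g0 \<in> borel_measurable borel"
    and eq: "\<And>x. x \<in> K \<Longrightarrow> f0 x = f x" "\<And>x. x \<in> K \<Longrightarrow> g0 x = g x"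
    using C1_near_borel[OF assms] by blast
  show ?thesis
  proof (rule that[OF C0])
    show "(LINT x|V. (f0 x)\<^sup>2) = (LINT x|V. (f x)\<^sup>2)" by (rule LINT_V_cong) (simp add: eq)
    show "(LINT x|V. (norm (g0 x))\<^sup>2) = (LINT x|V. (norm (g x))\<^sup>2)" by (rule LINT_V_cong) (simp add: eq)
    show "(LINT x|S. (f0 x)\<^sup>2) = (LINT x|S. (f x)\<^sup>2)" by (rule LINT_S_cong) (simp add: eq)
    show "(LINT x|S. f0 x) = (LINT x|S. f x)" by (rule LINT_S_cong) (simp add: eq)
  qed
qed

text \<open>
  The constant in front of the energy tends to zero with the thickness \<open>\<delta>\<close> of the collar. This is what
  makes the trace compact, and what keeps the limit of a minimising sequence from vanishing.
\<close>

lemma trace_inequality: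
  assumes \<delta>: "0 < \<delta>" "\<delta> \<le> R2 - a0" and C1: "C1_near K f g"
    and [measurable]: "f \<in> borel_measurable borel" "g \<in> borel_measurable borel"
  shows "ennreal (LINT x|S. (f x)\<^sup>2) \<le>
    ennreal (4 * R2 ^ (CARD('n) - 1) / a0 ^ (CARD('n) - 1) / \<delta>) * (\<integral>\<^sup>+x. ennreal ((f x)\<^sup>2) * indicator (ball y (R2 - \<delta> / 2) - cball y (R2 - \<delta>)) x \<partial>lborel)
    + ennreal (2 * R2 ^ (CARD('n) - 1) / a0 ^ (CARD('n) - 1) * \<delta> * (LINT x|V. (norm (g x))\<^sup>2))"
proof -
  let ?a = "R2 - \<delta>"
  have a: "0 < ?a" "?a < R2" "a0 \<le> ?a" using \<delta> a0 by auto
  let ?If = "\<integral>\<^sup>+x. ennreal ((f x)\<^sup>2) * indicator (ball y (R2 - \<delta> / 2) - cball y ?a) x \<partial>lborel"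
  let ?E = "LINT x|V. (norm (g x))\<^sup>2"
  have E: "0 \<le> ?E" by (rule LINT_nonneg_sq)
  have C1': "C1_near (cball y R2 - ball y ?a) f g"
    by (rule C1_near_subset[OF C1 collar_subset_K]) (use a in simp)
  have P: "ennreal (1 / ?a ^ (CARD('n) - 1)) \<le> ennreal (1 / a0 ^ (CARD('n) - 1))"
    using a a0 by (intro ennreal_leI divide_left_mono power_mono mult_pos_pos zero_less_power) auto
  have Eg: "(\<integral>\<^sup>+x. ennreal ((norm (g x))\<^sup>2) * indicator (ball y R2 - cball y ?a) x \<partial>lborel) \<le> ennreal ?E"
    unfolding nn_integral_V_sq[OF C1_near_continuous(2)[OF C1], symmetric]
    using collar_subset[of ?a] a by (intro nn_integral_mono mult_left_mono) (auto simp: indicator_def add.commute)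
  have m: "(?a + R2) / 2 = R2 - \<delta> / 2" by (simp add: field_simps)
  have "ennreal ((LINT x|S. (f x)\<^sup>2) / R2 ^ (CARD('n) - 1)) \<le>
     ennreal (4 / (R2 - ?a)) * (ennreal (1 / ?a ^ (CARD('n) - 1)) * ?If) + ennreal (2 * (R2 - ?a)) * (ennreal (1 / ?a ^ (CARD('n) - 1)) * (\<integral>\<^sup>+x. ennreal ((norm (g x))\<^sup>2) * indicator (ball y R2 - cball y ?a) x \<partial>lborel))"
    using shell_trace_inequality[OF a(1,2) C1'] nn_integral_S_sq[OF C1_near_continuous(1)[OF C1]] by (simp only: m) simp
  also have "\<dots> \<le> ennreal (4 / \<delta>) * (ennreal (1 / a0 ^ (CARD('n) - 1)) * ?If) + ennreal (2 * \<delta>) * (ennreal (1 / a0 ^ (CARD('n) - 1)) * ennreal ?E)"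
    by (intro add_mono mult_mono P Eg) auto
  finally have 1: "ennreal ((LINT x|S. (f x)\<^sup>2) / R2 ^ (CARD('n) - 1)) \<le> ennreal (4 / \<delta>) * (ennreal (1 / a0 ^ (CARD('n) - 1)) * ?If) + ennreal (2 * \<delta>) * (ennreal (1 / a0 ^ (CARD('n) - 1)) * ennreal ?E)" .
  have "ennreal (LINT x|S. (f x)\<^sup>2) = ennreal (R2 ^ (CARD('n) - 1)) * ennreal ((LINT x|S. (f x)\<^sup>2) / R2 ^ (CARD('n) - 1))"
    using R2 LINT_nonneg_sq[of S f] by (subst ennreal_mult[symmetric]) auto
  also have "\<dots> \<le> ennreal (R2 ^ (CARD('n) - 1)) * (ennreal (4 / \<delta>) * (ennreal (1 / a0 ^ (CARD('n) - 1)) * ?If) + ennreal (2 * \<delta>) * (ennreal (1 / a0 ^ (CARD('n) - 1)) * ennreal ?E))"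
    by (rule mult_left_mono[OF 1]) simp
  also have "\<dots> = (ennreal (R2 ^ (CARD('n) - 1)) * (ennreal (4 / \<delta>) * ennreal (1 / a0 ^ (CARD('n) - 1)))) * ?If + ennreal (R2 ^ (CARD('n) - 1)) * (ennreal (2 * \<delta>) * (ennreal (1 / a0 ^ (CARD('n) - 1)) * ennreal ?E))"
    by (simp only: distrib_left mult.assoc)
  also have "ennreal (R2 ^ (CARD('n) - 1)) * (ennreal (4 / \<delta>) * ennreal (1 / a0 ^ (CARD('n) - 1))) = ennreal (R2 ^ (CARD('n) - 1) * (4 / \<delta> * (1 / a0 ^ (CARD('n) - 1))))"
  proof -
    have "0 \<le> R2 ^ (CARD('n) - 1)" "0 \<le> 4 / \<delta>" "0 \<le> 1 / a0 ^ (CARD('n) - 1)" using R2 \<delta> a0 by auto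
    then show ?thesis by (simp only: ennreal_mult mult_nonneg_nonneg)
  qed
  also have "ennreal (R2 ^ (CARD('n) - 1)) * (ennreal (2 * \<delta>) * (ennreal (1 / a0 ^ (CARD('n) - 1)) * ennreal ?E)) = ennreal (R2 ^ (CARD('n) - 1) * (2 * \<delta> * (1 / a0 ^ (CARD('n) - 1) * ?E)))"
  proof -
    have "0 \<le> R2 ^ (CARD('n) - 1)" "0 \<le> 2 * \<delta>" "0 \<le> 1 / a0 ^ (CARD('n) - 1)" using R2 \<delta> a0 by auto
    then show ?thesis using E by (simp only: ennreal_mult mult_nonneg_nonneg)
  qed
  also have "R2 ^ (CARD('n) - 1) * (4 / \<delta> * (1 / a0 ^ (CARD('n) - 1))) = 4 * R2 ^ (CARD('n) - 1) / a0 ^ (CARD('n) - 1) / \<delta>" by (simp add: mult_ac)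
  also have "R2 ^ (CARD('n) - 1) * (2 * \<delta> * (1 / a0 ^ (CARD('n) - 1) * ?E)) = 2 * R2 ^ (CARD('n) - 1) / a0 ^ (CARD('n) - 1) * \<delta> * ?E" by (simp add: mult_ac)
  finally show ?thesis .
qed

lemma trace_le_L2_energy:
  assumes \<delta>: "0 < \<delta>" "\<delta> \<le> R2 - a0" and C1: "C1_near K f g"
  shows "(LINT x|S. (f x)\<^sup>2) \<le> 4 * R2 ^ (CARD('n) - 1) / a0 ^ (CARD('n) - 1) / \<delta> * (LINT x|V. (f x)\<^sup>2) + 2 * R2 ^ (CARD('n) - 1) / a0 ^ (CARD('n) - 1) * \<delta> * (LINT x|V. (norm (g x))\<^sup>2)"
proof -
  obtain f0 g0 where C0: "C1_near K f0 g0" and m[measurable]: "f0 \<in> borel_measurable borel" "g0 \<in> borel_measurable borel"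
    and eq: "(LINT x|V. (f0 x)\<^sup>2) = (LINT x|V. (f x)\<^sup>2)" "(LINT x|V. (norm (g0 x))\<^sup>2) = (LINT x|V. (norm (g x))\<^sup>2)"
      "(LINT x|S. (f0 x)\<^sup>2) = (LINT x|S. (f x)\<^sup>2)" "(LINT x|S. f0 x) = (LINT x|S. f x)"
    using C1_near_borel_LINT[OF C1] by blast
  let ?A = "ball y (R2 - \<delta> / 2) - cball y (R2 - \<delta>)"
  have "?A \<subseteq> \<Omega>"
    using collar_subset[of "R2 - \<delta>"] \<delta> by fastforce
  then have "(\<integral>\<^sup>+x. ennreal ((f0 x)\<^sup>2) * indicator ?A x \<partial>lborel) \<le> (\<integral>\<^sup>+x. ennreal ((f0 x)\<^sup>2) * indicator \<Omega> x \<partial>lborel)"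
    by (intro nn_integral_mono mult_left_mono) (auto simp: indicator_def)
  then have le: "(\<integral>\<^sup>+x. ennreal ((f0 x)\<^sup>2) * indicator ?A x \<partial>lborel) \<le> ennreal (LINT x|V. (f0 x)\<^sup>2)"
    using nn_integral_V_sq[OF C1_near_continuous(1)[OF C0]] by simp
  have c: "0 \<le> 4 * R2 ^ (CARD('n) - 1) / a0 ^ (CARD('n) - 1) / \<delta>" "0 \<le> 2 * R2 ^ (CARD('n) - 1) / a0 ^ (CARD('n) - 1) * \<delta>" using R2 a0 \<delta> by auto
  have X: "0 \<le> (LINT x|V. (f0 x)\<^sup>2)" using LINT_nonneg_sq[of V f0] by simp
  have "ennreal (LINT x|S. (f0 x)\<^sup>2) \<le> ennreal (4 * R2 ^ (CARD('n) - 1) / a0 ^ (CARD('n) - 1) / \<delta>) * ennreal (LINT x|V. (f0 x)\<^sup>2)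
    + ennreal (2 * R2 ^ (CARD('n) - 1) / a0 ^ (CARD('n) - 1) * \<delta> * (LINT x|V. (norm (g0 x))\<^sup>2))"
    by (rule order_trans[OF trace_inequality[OF \<delta> C0]]) (auto intro!: add_right_mono mult_left_mono le)
  also have "\<dots> = ennreal (4 * R2 ^ (CARD('n) - 1) / a0 ^ (CARD('n) - 1) / \<delta> * (LINT x|V. (f0 x)\<^sup>2) + 2 * R2 ^ (CARD('n) - 1) / a0 ^ (CARD('n) - 1) * \<delta> * (LINT x|V. (norm (g0 x))\<^sup>2))"
    using c X LINT_nonneg_sq[of V g0] by (simp only: ennreal_mult ennreal_plus mult_nonneg_nonneg)
  finally have "(LINT x|S. (f0 x)\<^sup>2) \<le> 4 * R2 ^ (CARD('n) - 1) / a0 ^ (CARD('n) - 1) / \<delta> * (LINT x|V. (f0 x)\<^sup>2) + 2 * R2 ^ (CARD('n) - 1) / a0 ^ (CARD('n) - 1) * \<delta> * (LINT x|V. (norm (g0 x))\<^sup>2)"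
    using add_nonneg_nonneg[OF mult_nonneg_nonneg[OF c(1) X] mult_nonneg_nonneg[OF c(2) LINT_nonneg_sq]]
    by (rule ennreal_le_iff[THEN iffD1, rotated])
  then show ?thesis
    by (simp add: eq)
qed

text \<open>
  From the domain to the collar along rays from the origin, and from the collar to the outer sphere
  along rays from \<open>y\<close>. The former do not meet the hole again, and the latter carry the surface measure
  of the outer sphere.
\<close>

lemma L2_le_boundary_energy:
  obtains C where "0 < C"
    "\<And>f g. C1_near K f g \<Longrightarrow> (LINT x|V. (f x)\<^sup>2) \<le> C * ((LINT x|S. (f x)\<^sup>2) + (LINT x|V. (norm (g x))\<^sup>2))"
proof -
  define \<delta> where "\<delta> = R2 - a0"
  have \<delta>: "0 < \<delta>" "\<delta> \<le> R2 - norm y - R1" "R2 - \<delta> = a0" using a0 by (auto simp: \<delta>_def)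
  define c1 where "c1 = (2 * R2) ^ CARD('n) * (2 / \<delta> * (1 / R1 ^ (CARD('n) - 1)))"
  define c2 where "c2 = (2 * R2) ^ CARD('n) * (4 * R2 * (1 / R1 ^ (CARD('n) - 1)))"
  define c3 where "c3 = R2 ^ (CARD('n) - 1) * \<delta> * 2 / R2 ^ (CARD('n) - 1)"
  define c4 where "c4 = R2 ^ (CARD('n) - 1) * \<delta> * (2 * \<delta> * (1 / a0 ^ (CARD('n) - 1)))"
  have pos: "0 < c1" "0 < c2" "0 < c3" "0 < c4"
    using R1 R2 \<delta> a0 by (auto simp: c1_def c2_def c3_def c4_def)
  have borel: "(LINT x|V. (f x)\<^sup>2) \<le> c1 * c3 * (LINT x|S. (f x)\<^sup>2) + (c1 * c4 + c2) * (LINT x|V. (norm (g x))\<^sup>2)"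
    if C1: "C1_near K f g" and [measurable]: "f \<in> borel_measurable borel" "g \<in> borel_measurable borel" for f g
  proof -
    let ?X = "LINT x|V. (f x)\<^sup>2" and ?E = "LINT x|V. (norm (g x))\<^sup>2" and ?B = "LINT x|S. (f x)\<^sup>2"
    have nn: "0 \<le> ?E" "0 \<le> ?B" using LINT_nonneg_sq[of V g] LINT_nonneg_sq[of S f] by auto
    let ?Y = "\<integral>\<^sup>+x. ennreal ((f x)\<^sup>2) * indicator (ball y R2 - cball y a0) x \<partial>lborel"
    let ?G = "\<integral>\<^sup>+x. ennreal ((norm (g x))\<^sup>2) * indicator (ball y R2 - cball y a0) x \<partial>lborel"
    have C1': "C1_near (cball y R2 - ball y a0) f g"
      by (rule C1_near_subset[OF C1 collar_subset_K]) simp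
    have G: "?G \<le> ennreal ?E"
      unfolding nn_integral_V_sq[OF C1_near_continuous(2)[OF C1], symmetric]
      using collar_subset[of a0] by (intro nn_integral_mono mult_left_mono) (auto simp: indicator_def add.commute)
    have "?Y \<le> ennreal (R2 ^ (CARD('n) - 1) * (R2 - a0)) * (ennreal 2 * ennreal (?B / R2 ^ (CARD('n) - 1)) + ennreal (2 * (R2 - a0)) * (ennreal (1 / a0 ^ (CARD('n) - 1)) * ?G))"
      using shell_L2_inequality[OF a0 C1'] nn_integral_S_sq[OF C1_near_continuous(1)[OF C1]] by simp
    also have "\<dots> \<le> ennreal (R2 ^ (CARD('n) - 1) * \<delta>) * (ennreal 2 * ennreal (?B / R2 ^ (CARD('n) - 1)) + ennreal (2 * \<delta>) * (ennreal (1 / a0 ^ (CARD('n) - 1)) * ennreal ?E))"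
      unfolding \<delta>_def by (intro mult_left_mono add_left_mono G) auto
    also have "\<dots> = ennreal (R2 ^ (CARD('n) - 1) * \<delta> * (2 * (?B / R2 ^ (CARD('n) - 1)) + 2 * \<delta> * (1 / a0 ^ (CARD('n) - 1) * ?E)))"
    proof -
      have "0 \<le> R2 ^ (CARD('n) - 1) * \<delta>" "0 \<le> ?B / R2 ^ (CARD('n) - 1)" "0 \<le> 2 * \<delta>" "0 \<le> 1 / a0 ^ (CARD('n) - 1)" using R2 \<delta> a0 nn by auto
      then show ?thesis using nn by (simp only: ennreal_mult ennreal_plus mult_nonneg_nonneg add_nonneg_nonneg zero_le_numeral)
    qed
    also have "R2 ^ (CARD('n) - 1) * \<delta> * (2 * (?B / R2 ^ (CARD('n) - 1)) + 2 * \<delta> * (1 / a0 ^ (CARD('n) - 1) * ?E)) = c3 * ?B + c4 * ?E"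
      by (simp add: c3_def c4_def algebra_simps)
    finally have Y: "?Y \<le> ennreal (c3 * ?B + c4 * ?E)" .
    have cY: "0 \<le> c3 * ?B + c4 * ?E" using pos nn by simp
    have "ennreal ?X = (\<integral>\<^sup>+x. ennreal ((f x)\<^sup>2) * indicator \<Omega> x \<partial>lborel)"
      using nn_integral_V_sq[OF C1_near_continuous(1)[OF C1]] by simp
    also have "\<dots> \<le> ennreal ((2 * R2) ^ CARD('n)) * (ennreal (2 / \<delta>) * (ennreal (1 / R1 ^ (CARD('n) - 1)) * ?Y) + ennreal (4 * R2) * (ennreal (1 / R1 ^ (CARD('n) - 1)) * ennreal ?E))"
      using L2_le_collar[OF \<delta>(1,2) C1] nn_integral_V_sq[OF C1_near_continuous(2)[OF C1]] \<delta>(3) by simp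
    also have "\<dots> \<le> ennreal ((2 * R2) ^ CARD('n)) * (ennreal (2 / \<delta>) * (ennreal (1 / R1 ^ (CARD('n) - 1)) * ennreal (c3 * ?B + c4 * ?E)) + ennreal (4 * R2) * (ennreal (1 / R1 ^ (CARD('n) - 1)) * ennreal ?E))"
      by (intro mult_left_mono add_right_mono Y) auto
    also have "\<dots> = ennreal ((2 * R2) ^ CARD('n) * (2 / \<delta> * (1 / R1 ^ (CARD('n) - 1) * (c3 * ?B + c4 * ?E)) + 4 * R2 * (1 / R1 ^ (CARD('n) - 1) * ?E)))"
    proof -
      have "0 \<le> (2 * R2) ^ CARD('n)" "0 \<le> 2 / \<delta>" "0 \<le> 1 / R1 ^ (CARD('n) - 1)" "0 \<le> 4 * R2" using R1 R2 \<delta> by auto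
      then show ?thesis using nn cY by (simp only: ennreal_mult ennreal_plus mult_nonneg_nonneg add_nonneg_nonneg)
    qed
    also have "(2 * R2) ^ CARD('n) * (2 / \<delta> * (1 / R1 ^ (CARD('n) - 1) * (c3 * ?B + c4 * ?E)) + 4 * R2 * (1 / R1 ^ (CARD('n) - 1) * ?E)) = c1 * (c3 * ?B + c4 * ?E) + c2 * ?E"
      by (simp add: c1_def c2_def distrib_left)
    finally have "?X \<le> c1 * (c3 * ?B + c4 * ?E) + c2 * ?E"
      using pos nn cY by (subst (asm) ennreal_le_iff) auto
    then show ?thesis by (simp add: algebra_simps)
  qed
  define C where "C = max (c1 * c3) (c1 * c4 + c2)"
  show ?thesis
  proof (rule that[of C])
    show "0 < C" using pos by (auto simp: C_def less_max_iff_disj)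
    fix f g assume C1: "C1_near K f g"
    obtain f0 g0 where C0: "C1_near K f0 g0" and m[measurable]: "f0 \<in> borel_measurable borel" "g0 \<in> borel_measurable borel"
      and eq: "(LINT x|V. (f0 x)\<^sup>2) = (LINT x|V. (f x)\<^sup>2)" "(LINT x|V. (norm (g0 x))\<^sup>2) = (LINT x|V. (norm (g x))\<^sup>2)"
        "(LINT x|S. (f0 x)\<^sup>2) = (LINT x|S. (f x)\<^sup>2)" "(LINT x|S. f0 x) = (LINT x|S. f x)"
      using C1_near_borel_LINT[OF C1] by blast
    have "(LINT x|V. (f0 x)\<^sup>2) \<le> c1 * c3 * (LINT x|S. (f0 x)\<^sup>2) + (c1 * c4 + c2) * (LINT x|V. (norm (g0 x))\<^sup>2)"
      by (rule borel[OF C0 m])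
    also have "\<dots> \<le> C * (LINT x|S. (f0 x)\<^sup>2) + C * (LINT x|V. (norm (g0 x))\<^sup>2)"
      using LINT_nonneg_sq[of V g0] LINT_nonneg_sq[of S f0] by (intro add_mono mult_right_mono) (auto simp: C_def)
    finally show "(LINT x|V. (f x)\<^sup>2) \<le> C * ((LINT x|S. (f x)\<^sup>2) + (LINT x|V. (norm (g x))\<^sup>2))"
      by (simp add: eq distrib_left)
  qed
qed

text \<open>
  The largest shell around \<open>y\<close> inside the domain already carries enough energy. For \<open>y = 0\<close> this shell
  is the whole domain, and the inequality is the sharp lower bound.
\<close>

lemma spectral_gap:
  assumes C1: "C1_near K f g" and mean: "(LINT x|S. f x) = 0"
  shows "steklov_weight a0 (CARD('n) - 2) R2 / R2 ^ (CARD('n) - 1) * (LINT x|S. (f x)\<^sup>2) \<le> (LINT x|V. (norm (g x))\<^sup>2)"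
proof -
  define B where "B = steklov_weight a0 (CARD('n) - 2) R2"
  obtain f0 g0 where C0: "C1_near K f0 g0" and m[measurable]: "f0 \<in> borel_measurable borel" "g0 \<in> borel_measurable borel"
    and eq: "(LINT x|V. (f0 x)\<^sup>2) = (LINT x|V. (f x)\<^sup>2)" "(LINT x|V. (norm (g0 x))\<^sup>2) = (LINT x|V. (norm (g x))\<^sup>2)"
      "(LINT x|S. (f0 x)\<^sup>2) = (LINT x|S. (f x)\<^sup>2)" "(LINT x|S. f0 x) = (LINT x|S. f x)"
    using C1_near_borel_LINT[OF C1] by blast
  have C1': "C1_near (cball y R2 - ball y a0) f0 g0"
    by (rule C1_near_subset[OF C0 collar_subset_K]) simp
  have "R2 ^ (CARD('n) - 1) * (LINT w|sph. f0 (y + R2 *\<^sub>R w)) = (LINT x|S. f0 x)"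
    by (rule integral_sphere_measure[symmetric]) (use R2 in auto)
  also have "\<dots> = 0" using mean by (simp add: eq)
  finally have mean0: "(LINT w|sph. f0 (y + R2 *\<^sub>R w)) = 0" using R2 by simp
  have "R2 ^ (CARD('n) - 1) * (LINT w|sph. (f0 (y + R2 *\<^sub>R w))\<^sup>2) = (LINT x|S. (f0 x)\<^sup>2)"
    by (rule integral_sphere_measure[symmetric]) (use R2 in auto)
  then have sq: "(LINT w|sph. (f0 (y + R2 *\<^sub>R w))\<^sup>2) = (LINT x|S. (f0 x)\<^sup>2) / R2 ^ (CARD('n) - 1)"
    using R2 by (simp add: field_simps)
  have "ennreal (B * ((LINT x|S. (f0 x)\<^sup>2) / R2 ^ (CARD('n) - 1))) \<le> (\<integral>\<^sup>+x. ennreal ((norm (g0 x))\<^sup>2) * indicator (ball y R2 - cball y a0) x \<partial>lborel)"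
    using shell_inequality[OF a0 dim C1' m mean0] by (simp only: sq B_def)
  also have "\<dots> \<le> ennreal (LINT x|V. (norm (g0 x))\<^sup>2)"
    unfolding nn_integral_V_sq[OF C1_near_continuous(2)[OF C0], symmetric]
    using collar_subset[of a0] by (intro nn_integral_mono mult_left_mono) (auto simp: indicator_def add.commute)
  finally have "B * ((LINT x|S. (f0 x)\<^sup>2) / R2 ^ (CARD('n) - 1)) \<le> (LINT x|V. (norm (g0 x))\<^sup>2)"
    using LINT_nonneg_sq[of V g0] by (subst (asm) ennreal_le_iff) auto
  then show ?thesis
    by (simp add: eq B_def)
qed

section \<open>Compactness of the trace\<close>

text \<open>
  The difference is the integral of the derivative over a segment; averaging over the starting point
  gives every point of the segment the full energy at most.
\<close>

lemma translation_difference: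
  assumes C1: "C1_near K f g" and [measurable]: "f \<in> borel_measurable borel" "g \<in> borel_measurable borel" "A \<in> sets borel"
    and A: "\<And>x s. x \<in> A \<Longrightarrow> 0 \<le> s \<Longrightarrow> s \<le> 1 \<Longrightarrow> x + s *\<^sub>R v \<in> \<Omega>"
  shows "(\<integral>\<^sup>+x. ennreal ((f (x + v) - f x)\<^sup>2) * indicator A x \<partial>lborel) \<le> ennreal ((norm v)\<^sup>2 * (LINT x|V. (norm (g x))\<^sup>2))"
proof -
  let ?E = "LINT x|V. (norm (g x))\<^sup>2"
  let ?h = "\<lambda>x. ennreal ((norm (g x))\<^sup>2) * indicator \<Omega> x"
  have "(\<integral>\<^sup>+x. ennreal ((f (x + v) - f x)\<^sup>2) * indicator A x \<partial>lborel) \<le>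
    (\<integral>\<^sup>+x. \<integral>\<^sup>+s. ennreal ((norm v)\<^sup>2) * (?h (x + s *\<^sub>R v) * indicator {0..1} s) \<partial>lborel \<partial>lborel)"
  proof (rule nn_integral_mono)
    fix x :: "real^'n"
    show "ennreal ((f (x + v) - f x)\<^sup>2) * indicator A x \<le> (\<integral>\<^sup>+s. ennreal ((norm v)\<^sup>2) * (?h (x + s *\<^sub>R v) * indicator {0..1} s) \<partial>lborel)"
    proof (cases "x \<in> A")
      case True
      have inO: "x + s *\<^sub>R v \<in> \<Omega>" if "0 \<le> s" "s \<le> 1" for s using A[OF True that] .
      have inK: "x + s *\<^sub>R v \<in> K" if "0 \<le> s" "s \<le> 1" for s using inO[OF that] \<Omega>_subset_K by blast
      have "ennreal ((f (x + 1 *\<^sub>R v) - f (x + 0 *\<^sub>R v))\<^sup>2) \<le> ennreal (1 - 0) * (\<integral>\<^sup>+s. ennreal ((g (x + s *\<^sub>R v) \<bullet> v)\<^sup>2) * indicator {0..1} s \<partial>lborel)"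
      proof (rule increment_sq_le)
        show "((\<lambda>s. f (x + s *\<^sub>R v)) has_real_derivative g (x + s *\<^sub>R v) \<bullet> v) (at s within {0..1})" if "0 \<le> s" "s \<le> 1" for s
          by (rule C1_near_line[OF C1 inK[OF that]])
        show "continuous_on {0..1} (\<lambda>s. g (x + s *\<^sub>R v) \<bullet> v)"
          by (intro continuous_intros continuous_on_compose2[OF C1_near_continuous(2)[OF C1]]) (use inK in auto)
      qed simp
      also have "\<dots> \<le> (\<integral>\<^sup>+s. ennreal ((norm v)\<^sup>2) * (?h (x + s *\<^sub>R v) * indicator {0..1} s) \<partial>lborel)"
        unfolding diff_zero ennreal_1 mult_1_left
      proof (rule nn_integral_mono)
        fix s :: real
        show "ennreal ((g (x + s *\<^sub>R v) \<bullet> v)\<^sup>2) * indicator {0..1} s \<le> ennreal ((norm v)\<^sup>2) * (?h (x + s *\<^sub>R v) * indicator {0..1} s)"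
        proof (cases "s \<in> {0..1}")
          case s: True
          have "(g (x + s *\<^sub>R v) \<bullet> v)\<^sup>2 \<le> (norm v)\<^sup>2 * (norm (g (x + s *\<^sub>R v)))\<^sup>2"
            using Cauchy_Schwarz_ineq[of "g (x + s *\<^sub>R v)" v] by (simp add: power2_norm_eq_inner mult.commute)
          then have "ennreal ((g (x + s *\<^sub>R v) \<bullet> v)\<^sup>2) \<le> ennreal ((norm v)\<^sup>2) * ennreal ((norm (g (x + s *\<^sub>R v)))\<^sup>2)"
            by (subst ennreal_mult[symmetric]) (auto intro: ennreal_leI)
          then show ?thesis using s inO[of s] by simp
        qed simp
      qed
      finally show ?thesis using True by simp
    qed simp
  qed
  also have "\<dots> = (\<integral>\<^sup>+s. \<integral>\<^sup>+x. ennreal ((norm v)\<^sup>2) * (?h (x + s *\<^sub>R v) * indicator {0..1} s) \<partial>lborel \<partial>lborel)"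
    by (rule lborel_pair.Fubini') measurable
  also have "\<dots> = (\<integral>\<^sup>+s. ennreal ((norm v)\<^sup>2) * (ennreal ?E * indicator {0..1::real} s) \<partial>lborel)"
  proof (rule nn_integral_cong)
    fix s :: real
    have "(\<integral>\<^sup>+x. ?h (x + s *\<^sub>R v) \<partial>lborel) = (\<integral>\<^sup>+x. ?h (s *\<^sub>R v + x) \<partial>lborel)"
      by (rule nn_integral_cong) (simp only: add.commute[of _ "s *\<^sub>R v"])
    also have "\<dots> = (\<integral>\<^sup>+x. ?h x \<partial>lborel)"
      by (rule nn_integral_lborel_translate) measurable
    also have "\<dots> = ennreal ?E" by (rule nn_integral_V_sq[OF C1_near_continuous(2)[OF C1]])
    finally have e: "(\<integral>\<^sup>+x. ?h (x + s *\<^sub>R v) \<partial>lborel) = ennreal ?E" .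
    have "(\<integral>\<^sup>+x. ennreal ((norm v)\<^sup>2) * (?h (x + s *\<^sub>R v) * indicator {0..1} s) \<partial>lborel)
      = ennreal ((norm v)\<^sup>2) * (\<integral>\<^sup>+x. ?h (x + s *\<^sub>R v) * indicator {0..1} s \<partial>lborel)"
      by (rule nn_integral_cmult) measurable
    also have "(\<integral>\<^sup>+x. ?h (x + s *\<^sub>R v) * indicator {0..1} s \<partial>lborel) = (\<integral>\<^sup>+x. ?h (x + s *\<^sub>R v) \<partial>lborel) * indicator {0..1} s"
      by (rule nn_integral_multc) measurable
    finally show "(\<integral>\<^sup>+x. ennreal ((norm v)\<^sup>2) * (?h (x + s *\<^sub>R v) * indicator {0..1} s) \<partial>lborel) = ennreal ((norm v)\<^sup>2) * (ennreal ?E * indicator {0..1::real} s)"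
      unfolding e .
  qed
  also have "\<dots> = ennreal ((norm v)\<^sup>2) * ennreal ?E"
    by (simp add: nn_integral_cmult)
  also have "\<dots> = ennreal ((norm v)\<^sup>2 * ?E)"
    by (rule ennreal_mult[symmetric]) (use LINT_nonneg_sq in auto)
  finally show ?thesis .
qed

end

context pierced_ball
begin

lemma LINT_diff_sq_le:
  assumes "L2 M a" "L2 M b"
  shows "(LINT x|M. (norm (a x - b x))\<^sup>2) \<le> 2 * (LINT x|M. (norm (a x))\<^sup>2) + 2 * (LINT x|M. (norm (b x))\<^sup>2)"
proof -
  have "0 \<le> (LINT x|M. (norm (a x + 1 *\<^sub>R b x))\<^sup>2)" by (rule LINT_nonneg_sq)
  moreover have "(LINT x|M. (norm (a x - b x))\<^sup>2) + (LINT x|M. (norm (a x + 1 *\<^sub>R b x))\<^sup>2) = 2 * (LINT x|M. (norm (a x))\<^sup>2) + 2 * (LINT x|M. (norm (b x))\<^sup>2)"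
    using L2_add_scaled(2)[OF assms, of "-1"] L2_add_scaled(2)[OF assms, of 1] by simp
  ultimately show ?thesis by linarith
qed

text \<open>
  A bounded sequence is averaged over small balls. The averages are equicontinuous and differ
  little from the functions, because the energy controls translations; so Arzela and Ascoli yield
  a subsequence that is almost Cauchy inside the collar, and hence, by the trace inequality, on
  the sphere.
\<close>

lemma trace_almost_Cauchy_subsequence:
  fixes f :: "nat \<Rightarrow> real^'n \<Rightarrow> real" and g :: "nat \<Rightarrow> real^'n \<Rightarrow> real^'n"
  assumes C1: "\<And>k. C1_near K (f k) (g k)"
    and mf[measurable]: "\<And>k. f k \<in> borel_measurable borel" and mg[measurable]: "\<And>k. g k \<in> borel_measurable borel"
    and bF: "\<And>k. (LINT x|V. (f k x)\<^sup>2) \<le> C" and bE: "\<And>k. (LINT x|V. (norm (g k x))\<^sup>2) \<le> C"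
    and \<epsilon>: "0 < \<epsilon>"
  shows "\<exists>r. strict_mono (r :: nat \<Rightarrow> nat) \<and> (\<exists>M. \<forall>i\<ge>M. \<forall>j\<ge>M. (LINT x|S. (f (r i) x - f (r j) x)\<^sup>2) \<le> \<epsilon>)"
proof -
  define D where "D = C + 1"
  have "0 \<le> C" using bE[of 0] LINT_nonneg_sq[of V "g 0"] by linarith
  then have D: "0 < D" "C \<le> D" by (auto simp: D_def)
  define c where "c = 4 * R2 ^ (CARD('n) - 1) / a0 ^ (CARD('n) - 1)"
  have c: "0 < c" using R2 a0 by (simp add: c_def)
  \<comment> \<open>The budget \<open>\<epsilon>\<close> is shared: half for the energy term of the trace inequality, which fixes the
    collar, a quarter for the distance to the averages, which fixes their radius \<open>h\<close>, and a quarter for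
    the uniform distance \<open>e\<close> of the averages.\<close>
  define \<delta> where "\<delta> = min ((R2 - a0) / 2) (\<epsilon> / (4 * c * D))"
  have "0 < \<epsilon> / (4 * c * D)" using \<epsilon> c D by simp
  then have \<delta>: "0 < \<delta>" "\<delta> \<le> (R2 - a0) / 2" "\<delta> \<le> \<epsilon> / (4 * c * D)" using a0 unfolding \<delta>_def by (simp_all only: min_less_iff_conj min.cobounded1 min.cobounded2) auto
  have \<delta>1: "\<delta> \<le> R2 - a0" using \<delta> a0 by simp
  have \<delta>2: "c / 2 * \<delta> * (4 * D) \<le> \<epsilon> / 2"
    using \<delta>(3) c D by (simp add: pos_le_divide_eq mult_ac)
  define A where "A = ball y (R2 - \<delta> / 2) - cball y (R2 - \<delta>)"
  define Q where "Q = cball y (R2 - \<delta> / 2) - ball y (R2 - \<delta>)"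
  have AQ: "A \<subseteq> Q" by (auto simp: A_def Q_def)
  have cQ: "compact Q" unfolding Q_def by (intro compact_diff) auto
  have [measurable]: "A \<in> sets borel" by (simp add: A_def)
  have finA: "emeasure lborel A < \<infinity>"
  proof -
    have "emeasure lborel A \<le> emeasure lborel (ball y (R2 - \<delta> / 2))"
      by (rule emeasure_mono) (auto simp: A_def)
    also have "\<dots> < \<infinity>" by (rule emeasure_lborel_ball_finite)
    finally show ?thesis .
  qed
  define v where "v = measure lborel A + 1"
  have v: "0 < v" "emeasure lborel A \<le> ennreal v"
    using finA by (auto simp: v_def emeasure_eq_ennreal_measure intro!: ennreal_leI add_nonneg_pos)
  define h where "h = min (\<delta> / 8) (sqrt (\<epsilon> * \<delta> / (32 * c * D)))"
  have "0 < sqrt (\<epsilon> * \<delta> / (32 * c * D))" using \<epsilon> \<delta> c D by simp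
  then have h: "0 < h" "h \<le> \<delta> / 8" "h \<le> sqrt (\<epsilon> * \<delta> / (32 * c * D))" using \<delta> unfolding h_def by auto
  have h2: "c / \<delta> * (8 * h\<^sup>2 * D) \<le> \<epsilon> / 4"
  proof -
    have "h\<^sup>2 \<le> (sqrt (\<epsilon> * \<delta> / (32 * c * D)))\<^sup>2" using h by (intro power_mono) auto
    also have "\<dots> = \<epsilon> * \<delta> / (32 * c * D)" using \<epsilon> \<delta> c D by simp
    finally have "h\<^sup>2 * (32 * c * D) \<le> \<epsilon> * \<delta>" using c D by (simp add: pos_le_divide_eq)
    then have "8 * h\<^sup>2 * D * c * 4 \<le> \<epsilon> * \<delta>" by (simp add: mult_ac)
    then show ?thesis using \<delta> by (simp add: field_simps)
  qed
  define e where "e = sqrt (\<epsilon> * \<delta> / (8 * c * v))"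
  have e: "0 < e" using \<epsilon> \<delta> c v by (simp add: e_def)
  have e2: "c / \<delta> * (2 * e\<^sup>2 * v) = \<epsilon> / 4"
  proof -
    have "e\<^sup>2 = \<epsilon> * \<delta> / (8 * c * v)" using \<epsilon> \<delta> c v by (simp add: e_def)
    then show ?thesis using \<delta> c v by (simp add: field_simps)
  qed
  define B where "B = ball (0 :: real^'n) h"
  define vol where "vol = measure lborel B"
  have B: "B \<in> sets borel" "emeasure lborel B < \<infinity>" "0 < measure lborel B"
    using h content_ball_pos[of h "0 :: real^'n"] emeasure_lborel_ball_finite[of "0 :: real^'n" h] by (auto simp: B_def)
  have [measurable]: "B \<in> sets borel" by (rule B)
  have vol: "0 < vol" using B by (simp add: vol_def)
  have near: "x + z \<in> \<Omega>" if x: "x \<in> Q" and z: "norm z < 2 * h" for x z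
  proof -
    have 1: "dist y (x + z) \<le> dist y x + norm z"
      using dist_triangle[of y "x + z" x] by (simp add: dist_norm)
    have 2: "dist y x \<le> dist y (x + z) + norm z"
      using dist_triangle[of y x "x + z"] by (simp add: dist_norm)
    have "dist y (x + z) < R2" using 1 x z h \<delta> by (simp add: Q_def)
    moreover have "a0 < dist y (x + z)"
      using 2 x z h \<delta> a0 by (simp add: Q_def field_simps)
    ultimately have "x + z \<in> ball y R2 - cball y a0" by simp
    then show ?thesis using collar_subset[of a0] by (auto simp: add.commute)
  qed
  have L2B: "L2 (volume_on B) (\<lambda>z. u (x + z))"
    if x: "x \<in> Q" and u[measurable]: "u \<in> borel_measurable borel" and cu: "continuous_on K u" for x and u :: "real^'n \<Rightarrow> real"
  proof -
    obtain b where b: "\<And>x. x \<in> K \<Longrightarrow> norm (u x) \<le> b" using bounded_K[OF cu] by blast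
    have fm: "finite_measure (volume_on B)"
      by (rule finite_measureI) (use B in \<open>simp add: emeasure_restrict_space space_restrict_space\<close>)
    show ?thesis
    proof (rule L2_bounded[OF fm])
      show "(\<lambda>z. u (x + z)) \<in> borel_measurable (volume_on B)"
        by (rule measurable_restrict_space1) measurable
      fix z assume "z \<in> space (volume_on B)"
      then have "norm z < 2 * h" using h by (simp add: B_def space_restrict_space)
      then show "norm (u (x + z)) \<le> b" using near[OF x] \<Omega>_subset_K by (intro b) blast
    qed
  qed
  define avg where "avg u x = (LINT z|volume_on B. u (x + z)) / vol" for u :: "real^'n \<Rightarrow> real" and x
  note cf = C1_near_continuous(1)[OF C1]
  have avg_bound: "\<bar>avg (f k) x\<bar> \<le> sqrt (D / vol)" if x: "x \<in> Q" for k x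
  proof -
    have "ennreal ((avg (f k) x)\<^sup>2) \<le> ennreal (1 / vol) * (\<integral>\<^sup>+z. ennreal ((f k (x + z))\<^sup>2) * indicator B z \<partial>lborel)"
      unfolding avg_def vol_def by (rule average_sq_le[OF L2B[OF x mf cf] B])
    also have "(\<integral>\<^sup>+z. ennreal ((f k (x + z))\<^sup>2) * indicator B z \<partial>lborel) \<le> (\<integral>\<^sup>+z. ennreal ((f k (x + z))\<^sup>2) * indicator \<Omega> (x + z) \<partial>lborel)"
      using near[OF x] h by (intro nn_integral_mono) (auto simp: B_def indicator_def)
    also have "\<dots> = (\<integral>\<^sup>+z. ennreal ((f k z)\<^sup>2) * indicator \<Omega> z \<partial>lborel)"
      by (rule nn_integral_lborel_translate[of "\<lambda>z. ennreal ((f k z)\<^sup>2) * indicator \<Omega> z"]) measurable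
    also have "\<dots> = ennreal (LINT x|V. (f k x)\<^sup>2)"
      using nn_integral_V_sq[OF cf[of k]] by simp
    also have "\<dots> \<le> ennreal D" using bF[of k] D by (intro ennreal_leI) simp
    finally have "ennreal ((avg (f k) x)\<^sup>2) \<le> ennreal (1 / vol) * ennreal D" by (simp add: mult_left_mono)
    also have "\<dots> = ennreal (D / vol)" using vol D by (subst ennreal_mult[symmetric]) auto
    finally have "(avg (f k) x)\<^sup>2 \<le> D / vol" using vol D by (subst (asm) ennreal_le_iff) auto
    then show ?thesis by (intro real_le_rsqrt) simp
  qed
  have avg_lip: "\<bar>avg (f k) x' - avg (f k) x\<bar> \<le> norm (x' - x) * sqrt (D / vol)"
    if x: "x \<in> Q" "x' \<in> Q" and xx: "norm (x' - x) < h" for k x x'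
  proof -
    let ?w = "x' - x"
    have Li: "L2 (volume_on B) (\<lambda>z. f k (x' + z) - f k (x + z))"
      by (rule L2_diff[OF L2B[OF x(2) mf cf] L2B[OF x(1) mf cf]])
    have int: "integrable (volume_on B) (\<lambda>z. f k (x' + z))" if "x' \<in> Q" for x'
    proof -
      have fm: "finite_measure (volume_on B)"
        by (rule finite_measureI) (use B in \<open>simp add: emeasure_restrict_space space_restrict_space\<close>)
      have "L2 (volume_on B) (\<lambda>_. 1 :: real)" by (rule L2_bounded[OF fm]) auto
      from L2_integrable_inner[OF L2B[OF that mf cf] this] show ?thesis by simp
    qed
    have "avg (f k) x' - avg (f k) x = (LINT z|volume_on B. f k (x' + z) - f k (x + z)) / vol"
      unfolding avg_def using int[OF x(1)] int[OF x(2)] by (simp add: diff_divide_distrib)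
    then have "ennreal ((avg (f k) x' - avg (f k) x)\<^sup>2) \<le> ennreal (1 / vol) * (\<integral>\<^sup>+z. ennreal ((f k (x' + z) - f k (x + z))\<^sup>2) * indicator B z \<partial>lborel)"
      unfolding vol_def using average_sq_le[OF Li B] by simp
    also have "(\<integral>\<^sup>+z. ennreal ((f k (x' + z) - f k (x + z))\<^sup>2) * indicator B z \<partial>lborel) =
       (\<integral>\<^sup>+z. ennreal ((f k ((x + z) + ?w) - f k (x + z))\<^sup>2) * indicator (ball x h) (x + z) \<partial>lborel)"
      by (intro nn_integral_cong) (auto simp: B_def indicator_def dist_norm add.commute)
    also have "\<dots> = (\<integral>\<^sup>+z. ennreal ((f k (z + ?w) - f k z)\<^sup>2) * indicator (ball x h) z \<partial>lborel)"
      by (rule nn_integral_lborel_translate[of "\<lambda>z. ennreal ((f k (z + ?w) - f k z)\<^sup>2) * indicator (ball x h) z"]) (measurable; simp)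
    also have "\<dots> \<le> ennreal ((norm ?w)\<^sup>2 * (LINT x|V. (norm (g k x))\<^sup>2))"
    proof (rule translation_difference[OF C1 mf mg])
      fix u s assume u: "u \<in> ball x h" and s: "0 \<le> s" "s \<le> (1::real)"
      have "norm ((u - x) + s *\<^sub>R ?w) \<le> norm (u - x) + s * norm ?w"
        using norm_triangle_ineq[of "u - x" "s *\<^sub>R ?w"] s by simp
      also have "s * norm ?w \<le> 1 * norm ?w" by (rule mult_right_mono) (use s in auto)
      finally have "norm ((u - x) + s *\<^sub>R ?w) < 2 * h" using u xx by (simp add: dist_norm norm_minus_commute)
      from near[OF x(1) this] show "u + s *\<^sub>R ?w \<in> \<Omega>" by simp
    qed simp
    also have "\<dots> \<le> ennreal ((norm ?w)\<^sup>2 * D)"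
      using bE[of k] D by (intro ennreal_leI mult_left_mono) auto
    finally have "ennreal ((avg (f k) x' - avg (f k) x)\<^sup>2) \<le> ennreal (1 / vol) * ennreal ((norm ?w)\<^sup>2 * D)" by (simp add: mult_left_mono)
    also have "\<dots> = ennreal ((norm ?w)\<^sup>2 * (D / vol))" using vol D by (subst ennreal_mult[symmetric]) auto
    finally have "(avg (f k) x' - avg (f k) x)\<^sup>2 \<le> (norm ?w)\<^sup>2 * (D / vol)" using vol D by (subst (asm) ennreal_le_iff) auto
    also have "\<dots> = (norm ?w * sqrt (D / vol))\<^sup>2" using vol D by (simp add: power_mult_distrib)
    finally show ?thesis using vol D by (intro power2_le_imp_le[of "\<bar>_\<bar>"]) auto
  qed
  obtain G r where r: "strict_mono (r :: nat \<Rightarrow> nat)"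
    and G: "\<And>d. 0 < d \<Longrightarrow> \<exists>M. \<forall>n x. n \<ge> M \<and> x \<in> Q \<longrightarrow> norm (avg (f (r n)) x - G x) < d"
  proof (rule Arzela_Ascoli[of Q "\<lambda>k. avg (f k)" "sqrt (D / vol)"])
    show "norm (avg (f k) x) \<le> sqrt (D / vol)" if "x \<in> Q" for k x using avg_bound[OF that] by simp
    show "\<exists>d. 0 < d \<and> (\<forall>n x'. x' \<in> Q \<and> norm (x - x') < d \<longrightarrow> norm (avg (f n) x - avg (f n) x') < d')"
      if x: "x \<in> Q" and d': "0 < d'" for x d'
    proof -
      define L where "L = sqrt (D / vol) + 1"
      have L: "0 < L" "sqrt (D / vol) \<le> L" using D vol by (auto simp: L_def intro!: add_nonneg_pos)
      show ?thesis
      proof (intro exI[of _ "min h (d' / L)"] conjI allI impI)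
        show "0 < min h (d' / L)" using h d' L by simp
        fix n x' assume x': "x' \<in> Q \<and> norm (x - x') < min h (d' / L)"
        then have "\<bar>avg (f n) x - avg (f n) x'\<bar> \<le> norm (x - x') * sqrt (D / vol)"
          by (intro avg_lip x) auto
        also have "\<dots> \<le> norm (x - x') * L" using L by (intro mult_left_mono) auto
        also have "\<dots> < d'" using x' L by (simp add: pos_less_divide_eq)
        finally show "norm (avg (f n) x - avg (f n) x') < d'" by simp
      qed
    qed
  qed (use cQ that in auto)
  obtain M where M: "\<And>n x. n \<ge> M \<Longrightarrow> x \<in> Q \<Longrightarrow> norm (avg (f (r n)) x - G x) < e / 2"
    using G[of "e / 2"] e by auto
  have "(LINT x|S. (f (r i) x - f (r j) x)\<^sup>2) \<le> \<epsilon>" if ij: "i \<ge> M" "j \<ge> M" for i j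
  proof -
    define d where "d x = 1 * f (r i) x + (-1) * f (r j) x" for x
    define dg where "dg x = 1 *\<^sub>R g (r i) x + (-1) *\<^sub>R g (r j) x" for x
    have Cd: "C1_near K d dg" unfolding d_def dg_def by (rule C1_near_lincomb[OF C1 C1])
    have md[measurable]: "d \<in> borel_measurable borel" and mdg[measurable]: "dg \<in> borel_measurable borel"
      unfolding d_def dg_def by measurable
    note cd = C1_near_continuous(1)[OF Cd]
    let ?E = "LINT x|V. (norm (dg x))\<^sup>2"
    have E0: "0 \<le> ?E" by (rule LINT_nonneg_sq)
    have "?E \<le> 2 * (LINT x|V. (norm (g (r i) x))\<^sup>2) + 2 * (LINT x|V. (norm (g (r j) x))\<^sup>2)"
      using LINT_diff_sq_le[OF L2_V[OF C1_near_continuous(2)[OF C1[of "r i"]]] L2_V[OF C1_near_continuous(2)[OF C1[of "r j"]]]]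
      by (simp add: dg_def)
    then have E: "?E \<le> 4 * D" using bE[of "r i"] bE[of "r j"] D by linarith
    have fm: "finite_measure (volume_on B)"
      by (rule finite_measureI) (use B in \<open>simp add: emeasure_restrict_space space_restrict_space\<close>)
    have L1: "L2 (volume_on B) (\<lambda>_. c :: real)" for c by (rule L2_bounded[OF fm, of _ "\<bar>c\<bar>"]) auto
    have intB: "integrable (volume_on B) (\<lambda>z. u (x + z))"
      if "x \<in> Q" and "u \<in> borel_measurable borel" and "continuous_on K u" for x and u :: "real^'n \<Rightarrow> real"
      using L2_integrable_inner[OF L2B[OF that] L1[of 1]] by simp
    have avg_d: "\<bar>avg d x\<bar> \<le> e" if x: "x \<in> Q" for x
    proof -
      have "avg d x = avg (f (r i)) x - avg (f (r j)) x"
        unfolding avg_def d_def using intB[OF x mf cf, of "r i"] intB[OF x mf cf, of "r j"] by (simp add: diff_divide_distrib)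
      then show ?thesis using M[OF ij(1) x] M[OF ij(2) x] by (simp only: real_norm_def)
    qed
    have pt: "ennreal ((d x)\<^sup>2) \<le> ennreal (2 / vol) * (\<integral>\<^sup>+z. ennreal ((d (x + z) - d x)\<^sup>2) * indicator B z \<partial>lborel) + ennreal (2 * e\<^sup>2)"
      if x: "x \<in> Q" for x
    proof -
      have Lu: "L2 (volume_on B) (\<lambda>z. d (x + z) - d x)"
        by (rule L2_diff[OF L2B[OF x md cd] L1])
      have "(LINT z|volume_on B. d (x + z) - d x) = (LINT z|volume_on B. d (x + z)) - d x * vol"
        using intB[OF x md cd] L2_integrable_inner[OF L1[of "d x"] L1[of 1]] B
        by (simp add: measure_restrict_space space_restrict_space vol_def)
      then have "(LINT z|volume_on B. d (x + z) - d x) / vol = avg d x - d x"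
        using vol by (simp add: avg_def diff_divide_distrib)
      then have 1: "ennreal ((avg d x - d x)\<^sup>2) \<le> ennreal (1 / vol) * (\<integral>\<^sup>+z. ennreal ((d (x + z) - d x)\<^sup>2) * indicator B z \<partial>lborel)"
        using average_sq_le[OF Lu B] by (simp add: vol_def)
      have "(avg d x)\<^sup>2 \<le> e\<^sup>2" using avg_d[OF x] e by (simp add: abs_le_square_iff[symmetric])
      moreover have "2 * (avg d x - d x)\<^sup>2 + 2 * (avg d x)\<^sup>2 - (d x)\<^sup>2 = (2 * avg d x - d x)\<^sup>2"
        by (simp add: power2_eq_square algebra_simps)
      ultimately have "(d x)\<^sup>2 \<le> 2 * (avg d x - d x)\<^sup>2 + 2 * e\<^sup>2"
        using zero_le_power2[of "2 * avg d x - d x"] by linarith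
      then have "ennreal ((d x)\<^sup>2) \<le> ennreal (2 * (avg d x - d x)\<^sup>2 + 2 * e\<^sup>2)" by (rule ennreal_leI)
      also have "\<dots> = ennreal 2 * ennreal ((avg d x - d x)\<^sup>2) + ennreal (2 * e\<^sup>2)"
        by (subst ennreal_plus) (auto simp: ennreal_mult)
      also have "\<dots> \<le> ennreal 2 * (ennreal (1 / vol) * (\<integral>\<^sup>+z. ennreal ((d (x + z) - d x)\<^sup>2) * indicator B z \<partial>lborel)) + ennreal (2 * e\<^sup>2)"
        by (intro add_right_mono mult_left_mono 1) simp
      also have "ennreal 2 * (ennreal (1 / vol) * (\<integral>\<^sup>+z. ennreal ((d (x + z) - d x)\<^sup>2) * indicator B z \<partial>lborel))
        = ennreal (2 / vol) * (\<integral>\<^sup>+z. ennreal ((d (x + z) - d x)\<^sup>2) * indicator B z \<partial>lborel)"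
        using vol by (subst mult.assoc[symmetric], subst ennreal_mult[symmetric]) auto
      finally show ?thesis .
    qed
    have "(\<integral>\<^sup>+x. ennreal ((d x)\<^sup>2) * indicator A x \<partial>lborel) \<le>
      (\<integral>\<^sup>+x. ennreal (2 / vol) * (\<integral>\<^sup>+z. ennreal ((d (x + z) - d x)\<^sup>2) * indicator B z * indicator A x \<partial>lborel) + ennreal (2 * e\<^sup>2) * indicator A x \<partial>lborel)"
    proof (rule nn_integral_mono)
      fix x
      show "ennreal ((d x)\<^sup>2) * indicator A x \<le> ennreal (2 / vol) * (\<integral>\<^sup>+z. ennreal ((d (x + z) - d x)\<^sup>2) * indicator B z * indicator A x \<partial>lborel) + ennreal (2 * e\<^sup>2) * indicator A x"
        using pt[of x] AQ by (cases "x \<in> A") auto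
    qed
    also have "\<dots> = ennreal (2 / vol) * (\<integral>\<^sup>+x. \<integral>\<^sup>+z. ennreal ((d (x + z) - d x)\<^sup>2) * indicator B z * indicator A x \<partial>lborel \<partial>lborel) + ennreal (2 * e\<^sup>2) * emeasure lborel A"
      by (subst nn_integral_add, measurable, subst nn_integral_cmult, measurable, subst nn_integral_cmult) auto
    also have "(\<integral>\<^sup>+x. \<integral>\<^sup>+z. ennreal ((d (x + z) - d x)\<^sup>2) * indicator B z * indicator A x \<partial>lborel \<partial>lborel)
      = (\<integral>\<^sup>+z. \<integral>\<^sup>+x. ennreal ((d (x + z) - d x)\<^sup>2) * indicator B z * indicator A x \<partial>lborel \<partial>lborel)"
      by (rule lborel_pair.Fubini') measurable
    finally have 1: "(\<integral>\<^sup>+x. ennreal ((d x)\<^sup>2) * indicator A x \<partial>lborel) \<le>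
      ennreal (2 / vol) * (\<integral>\<^sup>+z. \<integral>\<^sup>+x. ennreal ((d (x + z) - d x)\<^sup>2) * indicator B z * indicator A x \<partial>lborel \<partial>lborel) + ennreal (2 * e\<^sup>2) * emeasure lborel A" .
    have "(\<integral>\<^sup>+z. \<integral>\<^sup>+x. ennreal ((d (x + z) - d x)\<^sup>2) * indicator B z * indicator A x \<partial>lborel \<partial>lborel) \<le> (\<integral>\<^sup>+z. ennreal (h\<^sup>2 * ?E) * indicator B z \<partial>lborel)"
    proof (rule nn_integral_mono)
      fix z :: "real^'n"
      show "(\<integral>\<^sup>+x. ennreal ((d (x + z) - d x)\<^sup>2) * indicator B z * indicator A x \<partial>lborel) \<le> ennreal (h\<^sup>2 * ?E) * indicator B z"
      proof (cases "z \<in> B")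
        case True
        then have z: "norm z < h" by (simp add: B_def)
        have "(\<integral>\<^sup>+x. ennreal ((d (x + z) - d x)\<^sup>2) * indicator A x \<partial>lborel) \<le> ennreal ((norm z)\<^sup>2 * ?E)"
        proof (rule translation_difference[OF Cd md mdg])
          fix x s assume x: "x \<in> A" and s: "0 \<le> s" "s \<le> (1::real)"
          have "norm (s *\<^sub>R z) \<le> 1 * norm z" using s by (simp add: mult_left_le_one_le)
          then have "norm (s *\<^sub>R z) < 2 * h" using z h by simp
          then show "x + s *\<^sub>R z \<in> \<Omega>" using near x AQ by blast
        qed simp
        also have "\<dots> \<le> ennreal (h\<^sup>2 * ?E)"
          using z E0 by (intro ennreal_leI mult_right_mono power_mono) auto
        finally show ?thesis using True by simp
      qed simp
    qed
    also have "\<dots> = ennreal (h\<^sup>2 * ?E) * ennreal vol"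
      using B by (subst nn_integral_cmult) (auto simp: vol_def emeasure_eq_ennreal_measure)
    also have "\<dots> \<le> ennreal (h\<^sup>2 * (4 * D)) * ennreal vol"
      by (intro mult_right_mono ennreal_leI mult_left_mono E) auto
    finally have 2: "(\<integral>\<^sup>+z. \<integral>\<^sup>+x. ennreal ((d (x + z) - d x)\<^sup>2) * indicator B z * indicator A x \<partial>lborel \<partial>lborel) \<le> ennreal (h\<^sup>2 * (4 * D)) * ennreal vol" .
    have "(\<integral>\<^sup>+x. ennreal ((d x)\<^sup>2) * indicator A x \<partial>lborel) \<le> ennreal (2 / vol) * (ennreal (h\<^sup>2 * (4 * D)) * ennreal vol) + ennreal (2 * e\<^sup>2) * ennreal v"
      by (rule order_trans[OF 1]) (intro add_mono mult_left_mono 2 v; simp)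
    also have "\<dots> = ennreal (2 / vol * (h\<^sup>2 * (4 * D) * vol) + 2 * e\<^sup>2 * v)"
    proof -
      have "0 \<le> 2 / vol" "0 \<le> h\<^sup>2 * (4 * D)" "0 \<le> vol" "0 \<le> 2 * e\<^sup>2" "0 \<le> v" using vol D v by auto
      then show ?thesis by (simp only: ennreal_mult ennreal_plus mult_nonneg_nonneg)
    qed
    also have "2 / vol * (h\<^sup>2 * (4 * D) * vol) = 8 * h\<^sup>2 * D" using vol by simp
    finally have 3: "(\<integral>\<^sup>+x. ennreal ((d x)\<^sup>2) * indicator A x \<partial>lborel) \<le> ennreal (8 * h\<^sup>2 * D + 2 * e\<^sup>2 * v)" .
    have c': "4 * R2 ^ (CARD('n) - 1) / a0 ^ (CARD('n) - 1) / \<delta> = c / \<delta>" "2 * R2 ^ (CARD('n) - 1) / a0 ^ (CARD('n) - 1) * \<delta> = c / 2 * \<delta>"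
      by (simp_all add: c_def)
    have "ennreal (LINT x|S. (d x)\<^sup>2) \<le> ennreal (c / \<delta>) * (\<integral>\<^sup>+x. ennreal ((d x)\<^sup>2) * indicator A x \<partial>lborel) + ennreal (c / 2 * \<delta> * ?E)"
      using trace_inequality[OF \<delta>(1) \<delta>1 Cd md mdg] unfolding c' A_def[symmetric] .
    also have "\<dots> \<le> ennreal (c / \<delta>) * ennreal (8 * h\<^sup>2 * D + 2 * e\<^sup>2 * v) + ennreal (c / 2 * \<delta> * (4 * D))"
      using c \<delta> by (intro add_mono mult_left_mono 3 ennreal_leI E) auto
    also have "\<dots> = ennreal (c / \<delta> * (8 * h\<^sup>2 * D + 2 * e\<^sup>2 * v) + c / 2 * \<delta> * (4 * D))"
    proof -
      have "0 \<le> c / \<delta>" "0 \<le> 8 * h\<^sup>2 * D + 2 * e\<^sup>2 * v" "0 \<le> c / 2 * \<delta> * (4 * D)" using c \<delta> D v by auto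
      then show ?thesis by (simp only: ennreal_mult ennreal_plus mult_nonneg_nonneg)
    qed
    also have "\<dots> \<le> ennreal \<epsilon>"
    proof (rule ennreal_leI)
      have "c / \<delta> * (8 * h\<^sup>2 * D) + c / \<delta> * (2 * e\<^sup>2 * v) + c / 2 * \<delta> * (4 * D) \<le> \<epsilon> / 4 + \<epsilon> / 4 + \<epsilon> / 2"
        by (intro add_mono h2 \<delta>2 eq_refl[OF e2])
      then show "c / \<delta> * (8 * h\<^sup>2 * D + 2 * e\<^sup>2 * v) + c / 2 * \<delta> * (4 * D) \<le> \<epsilon>"
        unfolding distrib_left by linarith
    qed
    finally have "(LINT x|S. (d x)\<^sup>2) \<le> \<epsilon>" using \<epsilon> by (simp add: ennreal_le_iff)
    then show ?thesis by (simp add: d_def)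
  qed
  then show ?thesis using r by blast
qed

text \<open>
  A diagonal sequence makes the sequences of the preceding lemma, one for each precision, into a Cauchy
  sequence.
\<close>

lemma trace_compact:
  fixes f :: "nat \<Rightarrow> real^'n \<Rightarrow> real" and g :: "nat \<Rightarrow> real^'n \<Rightarrow> real^'n"
  assumes C1: "\<And>k. C1_near K (f k) (g k)"
    and mf: "\<And>k. f k \<in> borel_measurable borel" and mg: "\<And>k. g k \<in> borel_measurable borel"
    and bF: "\<And>k. (LINT x|V. (f k x)\<^sup>2) \<le> C" and bE: "\<And>k. (LINT x|V. (norm (g k x))\<^sup>2) \<le> C"
  obtains r where "strict_mono (r :: nat \<Rightarrow> nat)"
    "\<And>\<epsilon>. 0 < \<epsilon> \<Longrightarrow> \<exists>M. \<forall>i\<ge>M. \<forall>j\<ge>M. (LINT x|S. (f (r i) x - f (r j) x)\<^sup>2) \<le> \<epsilon>"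
proof -
  define P where "P n s \<longleftrightarrow> (\<exists>M. \<forall>i\<ge>M. \<forall>j\<ge>M. (LINT x|S. (f (s i) x - f (s j) x)\<^sup>2) \<le> 1 / real (Suc n))" for n and s :: "nat \<Rightarrow> nat"
  interpret subseqs P
  proof
    fix n :: nat and s :: "nat \<Rightarrow> nat"
    show "\<exists>r'. strict_mono r' \<and> P n (s \<circ> r')"
      using trace_almost_Cauchy_subsequence[of "\<lambda>k. f (s k)" "\<lambda>k. g (s k)" C "1 / real (Suc n)"] C1 mf mg bF bE
      by (simp add: P_def)
  qed
  have stable: "P n (s \<circ> r)" if r: "strict_mono r" and P: "P n s" for r s n
  proof -
    obtain M where M: "\<forall>i\<ge>M. \<forall>j\<ge>M. (LINT x|S. (f (s i) x - f (s j) x)\<^sup>2) \<le> 1 / real (Suc n)" using P unfolding P_def by blast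
    have "r i \<ge> M" if "i \<ge> M" for i using seq_suble[OF r, of i] that by simp
    then show ?thesis using M unfolding P_def by (intro exI[of _ M]) simp
  qed
  show ?thesis
  proof (rule that[OF subseq_diagseq])
    fix \<epsilon> :: real assume "0 < \<epsilon>"
    then obtain k where k: "1 / real (Suc k) < \<epsilon>" using nat_approx_posE by blast
    have "P k (diagseq \<circ> ((+) (Suc k)))" by (rule diagseq_holds[OF stable])
    then obtain M where M: "\<And>i j. i \<ge> M \<Longrightarrow> j \<ge> M \<Longrightarrow> (LINT x|S. (f (diagseq (Suc k + i)) x - f (diagseq (Suc k + j)) x)\<^sup>2) \<le> 1 / real (Suc k)"
      unfolding P_def by auto
    have "(LINT x|S. (f (diagseq i) x - f (diagseq j) x)\<^sup>2) \<le> \<epsilon>" if "i \<ge> Suc k + M" "j \<ge> Suc k + M" for i j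
    proof -
      have "(LINT x|S. (f (diagseq (Suc k + (i - Suc k))) x - f (diagseq (Suc k + (j - Suc k))) x)\<^sup>2) \<le> 1 / real (Suc k)"
        by (rule M) (use that in linarith)+
      moreover have "Suc k + (i - Suc k) = i" "Suc k + (j - Suc k) = j" using that by linarith+
      ultimately show ?thesis using k by simp
    qed
    then show "\<exists>M. \<forall>i\<ge>M. \<forall>j\<ge>M. (LINT x|S. (f (diagseq i) x - f (diagseq j) x)\<^sup>2) \<le> \<epsilon>" by blast
  qed
qed

end

section \<open>The first eigenvalue as a minimum\<close>

context pierced_ball
begin

definition admissible :: "(real^'n \<Rightarrow> real) \<Rightarrow> (real^'n \<Rightarrow> real^'n) \<Rightarrow> bool" where
  "admissible f g \<longleftrightarrow> C1_near K f g \<and> (LINT x|S. f x) = 0"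

text \<open>
  The infimum of the Rayleigh quotient, over smooth functions only: these are dense by the definition
  of the trace.
\<close>

definition rayleigh_inf :: real where
  "rayleigh_inf = Inf {LINT x|V. (norm (g x))\<^sup>2 | f g. admissible f g \<and> (LINT x|S. (f x)\<^sup>2) = 1}"

lemma C1_S: "C1_near K f g \<Longrightarrow> L2 S f"
  by (rule L2_S[OF C1_near_continuous(1)])

lemma C1_V: "C1_near K f g \<Longrightarrow> L2 V f" "C1_near K f g \<Longrightarrow> L2 V g"
  by (rule L2_V[OF C1_near_continuous(1)], assumption, rule L2_V[OF C1_near_continuous(2)], assumption)

lemma L2_one_S: "L2 S (\<lambda>_. 1 :: real)"
  by (rule L2_S) simp

lemma LINT_scaled:
  shows "(LINT x|M. (norm (a *\<^sub>R g x))\<^sup>2) = a\<^sup>2 * (LINT x|M. (norm (g x))\<^sup>2)"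
  by (simp add: power_mult_distrib)

lemma C1_near_coord:
  fixes c :: "real^'n"
  shows "C1_near A (\<lambda>x. (x - c) $ i) (\<lambda>_. axis i 1)"
proof -
  have "GDERIV (\<lambda>x. (x - c) $ i) x :> axis i 1" for x :: "real^'n"
    unfolding gderiv_def
    by (rule has_derivative_eq_rhs, rule bounded_linear.has_derivative[OF bounded_linear_vec_nth], rule has_derivative_diff, rule has_derivative_ident, rule has_derivative_const)
      (simp add: inner_axis)
  then show ?thesis unfolding C1_near_def by (intro exI[of _ UNIV]) auto
qed

lemma admissible_normalised:
  assumes a: "admissible f g" and N: "0 < (LINT x|S. (f x)\<^sup>2)"
  obtains f' g' where "admissible f' g'" "(LINT x|S. (f' x)\<^sup>2) = 1"
    "(LINT x|V. (norm (g' x))\<^sup>2) = (LINT x|V. (norm (g x))\<^sup>2) / (LINT x|S. (f x)\<^sup>2)"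
proof -
  let ?N = "LINT x|S. (f x)\<^sup>2"
  define s where "s = 1 / sqrt ?N"
  have s: "s\<^sup>2 = 1 / ?N" using N by (simp add: s_def power_divide)
  show ?thesis
  proof (rule that[of "\<lambda>x. s * f x" "\<lambda>x. s *\<^sub>R g x"])
    show "admissible (\<lambda>x. s * f x) (\<lambda>x. s *\<^sub>R g x)"
      using a C1_near_lincomb[of K f g f g s 0] by (simp add: admissible_def)
    show "(LINT x|S. (s * f x)\<^sup>2) = 1"
      using LINT_scaled[of S s f] s N by simp
    show "(LINT x|V. (norm (s *\<^sub>R g x))\<^sup>2) = (LINT x|V. (norm (g x))\<^sup>2) / ?N"
      unfolding LINT_scaled s by simp
  qed
qed

lemma normalised_admissible_exists:
  obtains f g where "admissible f g" "(LINT x|S. (f x)\<^sup>2) = 1"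
proof -
  obtain i :: 'n where True by blast
  let ?f = "\<lambda>x. (x - y) $ i"
  have [measurable]: "?f \<in> borel_measurable borel" by (intro borel_measurable_continuous_onI continuous_intros)
  have "(LINT x|S. ?f x) = R2 ^ (CARD('n) - 1) * (LINT w|sph. ((y + R2 *\<^sub>R w) - y) $ i)"
    by (rule integral_sphere_measure) (use R2 in auto)
  also have "\<dots> = 0" using integral_sph_coord[of i] by simp
  finally have "admissible ?f (\<lambda>_. axis i 1)" unfolding admissible_def using C1_near_coord by blast
  moreover have "0 < (LINT x|S. (?f x)\<^sup>2)"
  proof -
    have "(LINT x|S. (?f x)\<^sup>2) = R2 ^ (CARD('n) - 1) * (LINT w|sph. (((y + R2 *\<^sub>R w) - y) $ i)\<^sup>2)"
      by (rule integral_sphere_measure) (use R2 in auto)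
    also have "\<dots> = R2 ^ (CARD('n) - 1) * (R2\<^sup>2 * (LINT w|sph. (w :: real^'n) $ i * w $ i))"
      by (simp add: power_mult_distrib power2_eq_square[of "_ $ _"])
    also have "\<dots> > 0" unfolding integral_sph_coord_coord using R2 sph_area_pos[where 'n='n] by simp
    finally show ?thesis .
  qed
  ultimately show ?thesis by (rule admissible_normalised) (rule that)
qed

lemma energies_nonempty: "{LINT x|V. (norm (g x))\<^sup>2 |f g. admissible f g \<and> (LINT x|S. (f x)\<^sup>2) = 1} \<noteq> {}"
proof -
  obtain f g where "admissible f g" "(LINT x|S. (f x)\<^sup>2) = 1" by (rule normalised_admissible_exists)
  then have "(LINT x|V. (norm (g x))\<^sup>2) \<in> {LINT x|V. (norm (g x))\<^sup>2 |f g. admissible f g \<and> (LINT x|S. (f x)\<^sup>2) = 1}"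
    by blast
  then show ?thesis by (metis emptyE)
qed

lemma rayleigh_inf_le:
  assumes "admissible f g"
  shows "rayleigh_inf * (LINT x|S. (f x)\<^sup>2) \<le> (LINT x|V. (norm (g x))\<^sup>2)"
proof (cases "(LINT x|S. (f x)\<^sup>2) = 0")
  case True
  then show ?thesis using LINT_nonneg_sq[of V g] by simp
next
  case False
  then have N: "0 < (LINT x|S. (f x)\<^sup>2)" using LINT_nonneg_sq[of S f] by (intro less_le[THEN iffD2] conjI) auto
  obtain f' g' where n: "admissible f' g'" "(LINT x|S. (f' x)\<^sup>2) = 1"
    "(LINT x|V. (norm (g' x))\<^sup>2) = (LINT x|V. (norm (g x))\<^sup>2) / (LINT x|S. (f x)\<^sup>2)"
    using admissible_normalised[OF assms N] by blast
  have "rayleigh_inf \<le> (LINT x|V. (norm (g' x))\<^sup>2)"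
    unfolding rayleigh_inf_def
  proof (rule cInf_lower)
    show "(LINT x|V. (norm (g' x))\<^sup>2) \<in> {LINT x|V. (norm (g x))\<^sup>2 |f g. admissible f g \<and> (LINT x|S. (f x)\<^sup>2) = 1}"
      using n(1,2) by blast
    show "bdd_below {LINT x|V. (norm (g x))\<^sup>2 |f g. admissible f g \<and> (LINT x|S. (f x)\<^sup>2) = 1}"
      by (rule bdd_belowI[of _ 0]) (auto intro: LINT_nonneg_sq)
  qed
  then show ?thesis using n(3) N by (simp add: pos_le_divide_eq)
qed

lemma le_rayleigh_inf:
  assumes "\<And>f g. admissible f g \<Longrightarrow> c * (LINT x|S. (f x)\<^sup>2) \<le> (LINT x|V. (norm (g x))\<^sup>2)"
  shows "c \<le> rayleigh_inf"
  unfolding rayleigh_inf_def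
proof (rule cInf_greatest)
  show "{LINT x|V. (norm (g x))\<^sup>2 |f g. admissible f g \<and> (LINT x|S. (f x)\<^sup>2) = 1} \<noteq> {}"
    by (rule energies_nonempty)
  fix e assume "e \<in> {LINT x|V. (norm (g x))\<^sup>2 |f g. admissible f g \<and> (LINT x|S. (f x)\<^sup>2) = 1}"
  then obtain f g where "e = (LINT x|V. (norm (g x))\<^sup>2)" "admissible f g" "(LINT x|S. (f x)\<^sup>2) = 1" by blast
  then show "c \<le> e" using assms[of f g] by simp
qed

lemma rayleigh_inf_pos: "0 < rayleigh_inf"
proof -
  have "0 < steklov_weight a0 (CARD('n) - 2) R2 / R2 ^ (CARD('n) - 1)"
    by (intro divide_pos_pos steklov_weight_pos a0 zero_less_power R2)
  also have "\<dots> \<le> rayleigh_inf"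
  proof (rule le_rayleigh_inf)
    fix f g assume "admissible f g"
    then have "C1_near K f g" "(LINT x|S. f x) = 0" unfolding admissible_def by blast+
    then show "steklov_weight a0 (CARD('n) - 2) R2 / R2 ^ (CARD('n) - 1) * (LINT x|S. (f x)\<^sup>2) \<le> (LINT x|V. (norm (g x))\<^sup>2)"
      by (rule spectral_gap)
  qed
  finally show ?thesis .
qed

lemma minimising_sequence:
  obtains f g where "\<And>k. admissible (f k) (g k)" "\<And>k. f k \<in> borel_measurable borel" "\<And>k. g k \<in> borel_measurable borel"
    "\<And>k. (LINT x|S. (f k x)\<^sup>2) = 1" "\<And>k. (LINT x|V. (norm (g k x))\<^sup>2) < rayleigh_inf + 1 / real (Suc k)"
proof -
  have "\<exists>p. admissible (fst p) (snd p) \<and> fst p \<in> borel_measurable borel \<and> snd p \<in> borel_measurable borel \<and>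
    (LINT x|S. (fst p x)\<^sup>2) = 1 \<and> (LINT x|V. (norm (snd p x))\<^sup>2) < rayleigh_inf + 1 / real (Suc k)" for k
  proof -
    let ?A = "{LINT x|V. (norm (g x))\<^sup>2 |f g. admissible f g \<and> (LINT x|S. (f x)\<^sup>2) = 1}"
    have "Inf ?A < rayleigh_inf + 1 / real (Suc k)" unfolding rayleigh_inf_def[symmetric] by simp
    with energies_nonempty have "\<exists>e\<in>?A. e < rayleigh_inf + 1 / real (Suc k)"
      by (rule cInf_lessD)
    then obtain f g where f: "admissible f g" "(LINT x|S. (f x)\<^sup>2) = 1" "(LINT x|V. (norm (g x))\<^sup>2) < rayleigh_inf + 1 / real (Suc k)" by blast
    then have "C1_near K f g" by (simp add: admissible_def)
    then obtain f0 g0 where f0: "C1_near K f0 g0" "f0 \<in> borel_measurable borel" "g0 \<in> borel_measurable borel"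
      "(LINT x|V. (f0 x)\<^sup>2) = (LINT x|V. (f x)\<^sup>2)" "(LINT x|V. (norm (g0 x))\<^sup>2) = (LINT x|V. (norm (g x))\<^sup>2)"
      "(LINT x|S. (f0 x)\<^sup>2) = (LINT x|S. (f x)\<^sup>2)" "(LINT x|S. f0 x) = (LINT x|S. f x)"
      using C1_near_borel_LINT by blast
    show ?thesis using f f0 unfolding admissible_def by (intro exI[of _ "(f0, g0)"]) simp
  qed
  then obtain p where p: "\<And>k. admissible (fst (p k)) (snd (p k)) \<and> fst (p k) \<in> borel_measurable borel \<and> snd (p k) \<in> borel_measurable borel \<and>
    (LINT x|S. (fst (p k) x)\<^sup>2) = 1 \<and> (LINT x|V. (norm (snd (p k) x))\<^sup>2) < rayleigh_inf + 1 / real (Suc k)"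
    by metis
  show ?thesis using p by (intro that[of "\<lambda>k. fst (p k)" "\<lambda>k. snd (p k)"]) blast+
qed

lemma minimiser_limit:
  obtains f g u G t where "\<And>k. admissible (f k) (g k)" "\<And>k. (LINT x|S. (f k x)\<^sup>2) = 1"
    "(\<lambda>k. LINT x|V. (norm (g k x))\<^sup>2) \<longlonglongrightarrow> rayleigh_inf"
    "L2_tendsto V f u" "L2_tendsto V g G" "L2_tendsto S f t"
proof -
  let ?l = rayleigh_inf
  obtain f g where adm: "\<And>k. admissible (f k) (g k)" and mf: "\<And>k. f k \<in> borel_measurable borel" and mg: "\<And>k. g k \<in> borel_measurable borel"
    and N: "\<And>k. (LINT x|S. (f k x)\<^sup>2) = 1" and E: "\<And>k. (LINT x|V. (norm (g k x))\<^sup>2) < ?l + 1 / real (Suc k)"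
    using minimising_sequence by blast
  have C1: "C1_near K (f k) (g k)" for k using adm by (simp add: admissible_def)
  obtain C where C: "0 < C" and L: "\<And>f g. C1_near K f g \<Longrightarrow> (LINT x|V. (f x)\<^sup>2) \<le> C * ((LINT x|S. (f x)\<^sup>2) + (LINT x|V. (norm (g x))\<^sup>2))"
    using L2_le_boundary_energy by blast
  \<comment> \<open>All energies are below \<open>?l + 1\<close>, and the boundary and energy terms together bound the
    \<open>L\<^sup>2\<close> norm.\<close>
  define D where "D = max (C * (1 + (?l + 1))) (?l + 1)"
  have E1: "(LINT x|V. (norm (g k x))\<^sup>2) \<le> ?l + 1" for k
  proof -
    have "1 / real (Suc k) \<le> 1" by simp
    then show ?thesis using E[of k] by linarith
  qed
  have bF: "(LINT x|V. (f k x)\<^sup>2) \<le> D" for k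
  proof -
    have "(LINT x|V. (f k x)\<^sup>2) \<le> C * (1 + (LINT x|V. (norm (g k x))\<^sup>2))" using L[OF C1, of k] N[of k] by simp
    also have "\<dots> \<le> C * (1 + (?l + 1))" using E1[of k] C by (intro mult_left_mono add_left_mono) auto
    also have "\<dots> \<le> D" by (simp add: D_def)
    finally show ?thesis .
  qed
  have bE: "(LINT x|V. (norm (g k x))\<^sup>2) \<le> D" for k
    by (rule order_trans[OF E1]) (simp add: D_def)
  obtain r where r: "strict_mono (r :: nat \<Rightarrow> nat)"
    and S_Cauchy: "\<And>\<epsilon>. 0 < \<epsilon> \<Longrightarrow> \<exists>M. \<forall>i\<ge>M. \<forall>j\<ge>M. (LINT x|S. (f (r i) x - f (r j) x)\<^sup>2) \<le> \<epsilon>"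
    by (rule trace_compact[of f g D, OF C1 mf mg bF bE]) (rule that)
  have E_near: "(LINT x|V. (norm (g (r k) x))\<^sup>2) < ?l + 1 / real (Suc k)" for k
  proof -
    have "1 / real (Suc (r k)) \<le> 1 / real (Suc k)" using seq_suble[OF r, of k] by (intro divide_left_mono) auto
    then show ?thesis using E[of "r k"] by linarith
  qed
  have E_ge: "?l \<le> (LINT x|V. (norm (g k x))\<^sup>2)" for k
    using rayleigh_inf_le[OF adm, of k] N[of k] by simp
  \<comment> \<open>By the parallelogram law two almost minimisers with nearby traces have nearby gradients,
    since their sum does not fall below the infimum either.\<close>
  have par: "(LINT x|V. (norm (g i x - g j x))\<^sup>2) \<le> 2 * ((LINT x|V. (norm (g i x))\<^sup>2) - ?l) + 2 * ((LINT x|V. (norm (g j x))\<^sup>2) - ?l)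
      + ?l * (LINT x|S. (f i x - f j x)\<^sup>2)" for i j
  proof -
    have "admissible (\<lambda>x. 1 * f i x + 1 * f j x) (\<lambda>x. 1 *\<^sub>R g i x + 1 *\<^sub>R g j x)"
      using adm[of i] adm[of j] L2_integrable_inner[OF C1_S[OF C1[of i]] L2_one_S] L2_integrable_inner[OF C1_S[OF C1[of j]] L2_one_S]
      unfolding admissible_def by (intro conjI C1_near_lincomb C1) simp
    then have 1: "?l * (LINT x|S. (f i x + f j x)\<^sup>2) \<le> (LINT x|V. (norm (g i x + g j x))\<^sup>2)"
      using rayleigh_inf_le by fastforce
    have 2: "(LINT x|V. (norm (g i x - g j x))\<^sup>2) + (LINT x|V. (norm (g i x + g j x))\<^sup>2) = 2 * (LINT x|V. (norm (g i x))\<^sup>2) + 2 * (LINT x|V. (norm (g j x))\<^sup>2)"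
      using L2_add_scaled(2)[OF C1_V(2)[OF C1[of i]] C1_V(2)[OF C1[of j]], of "-1"] L2_add_scaled(2)[OF C1_V(2)[OF C1[of i]] C1_V(2)[OF C1[of j]], of 1] by simp
    have "(LINT x|S. (f i x - f j x)\<^sup>2) + (LINT x|S. (f i x + f j x)\<^sup>2) = 2 * (LINT x|S. (f i x)\<^sup>2) + 2 * (LINT x|S. (f j x)\<^sup>2)"
      using L2_add_scaled(2)[OF C1_S[OF C1[of i]] C1_S[OF C1[of j]], of "-1"] L2_add_scaled(2)[OF C1_S[OF C1[of i]] C1_S[OF C1[of j]], of 1] by simp
    then have "(LINT x|S. (f i x + f j x)\<^sup>2) = 4 - (LINT x|S. (f i x - f j x)\<^sup>2)" by (simp add: N)
    then have "?l * (4 - (LINT x|S. (f i x - f j x)\<^sup>2)) \<le> (LINT x|V. (norm (g i x + g j x))\<^sup>2)" using 1 by simp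
    then show ?thesis using 2 by (simp add: right_diff_distrib)
  qed
  have V_Cauchy: "\<exists>M. \<forall>i\<ge>M. \<forall>j\<ge>M. (LINT x|V. (norm (g (r i) x - g (r j) x))\<^sup>2) < e" if "0 < e" for e
  proof -
    have "0 < e / (2 * ?l)" using that rayleigh_inf_pos by simp
    then obtain M where M: "\<And>i j. i \<ge> M \<Longrightarrow> j \<ge> M \<Longrightarrow> (LINT x|S. (f (r i) x - f (r j) x)\<^sup>2) \<le> e / (2 * ?l)"
      using S_Cauchy by meson
    have "0 < e / 8" using that by simp
    then obtain m where m: "1 / real (Suc m) < e / 8" using nat_approx_posE by blast
    have small: "(LINT x|V. (norm (g (r i) x))\<^sup>2) - ?l < e / 8" if "i \<ge> m" for i
    proof -
      have "1 / real (Suc i) \<le> 1 / real (Suc m)" using that by (intro divide_left_mono) auto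
      then show ?thesis using E_near[of i] m by linarith
    qed
    have "(LINT x|V. (norm (g (r i) x - g (r j) x))\<^sup>2) < e" if ij: "i \<ge> max M m" "j \<ge> max M m" for i j
    proof -
      have "?l * (LINT x|S. (f (r i) x - f (r j) x)\<^sup>2) \<le> ?l * (e / (2 * ?l))"
        using M[of i j] ij rayleigh_inf_pos by (intro mult_left_mono) auto
      also have "\<dots> = e / 2" using rayleigh_inf_pos by simp
      finally show ?thesis using par[of "r i" "r j"] small[of i] small[of j] ij by simp
    qed
    then show ?thesis by blast
  qed
  have F_Cauchy: "\<exists>M. \<forall>i\<ge>M. \<forall>j\<ge>M. (LINT x|V. (norm (f (r i) x - f (r j) x))\<^sup>2) < e" if "0 < e" for e
  proof -
    have e: "0 < e / (4 * C)" using that C by simp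
    obtain M where M: "\<And>i j. i \<ge> M \<Longrightarrow> j \<ge> M \<Longrightarrow> (LINT x|S. (f (r i) x - f (r j) x)\<^sup>2) \<le> e / (4 * C)"
      using S_Cauchy[OF e] by meson
    obtain m where m: "\<And>i j. i \<ge> m \<Longrightarrow> j \<ge> m \<Longrightarrow> (LINT x|V. (norm (g (r i) x - g (r j) x))\<^sup>2) < e / (4 * C)"
      using V_Cauchy[OF e] by meson
    have "(LINT x|V. (norm (f (r i) x - f (r j) x))\<^sup>2) < e" if ij: "i \<ge> max M m" "j \<ge> max M m" for i j
    proof -
      have "C1_near K (\<lambda>x. 1 * f (r i) x + (-1) * f (r j) x) (\<lambda>x. 1 *\<^sub>R g (r i) x + (-1) *\<^sub>R g (r j) x)"
        by (rule C1_near_lincomb[OF C1 C1])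
      then have "(LINT x|V. (f (r i) x - f (r j) x)\<^sup>2) \<le> C * ((LINT x|S. (f (r i) x - f (r j) x)\<^sup>2) + (LINT x|V. (norm (g (r i) x - g (r j) x))\<^sup>2))"
        using L by fastforce
      also have "\<dots> \<le> C * (e / (4 * C) + e / (4 * C))"
        using M[of i j] m[of i j] ij C by (intro mult_left_mono add_mono) auto
      also have "\<dots> = e / 2" using C by simp
      also have "\<dots> < e" using e C by (simp add: zero_less_divide_iff)
      finally show ?thesis by simp
    qed
    then show ?thesis by blast
  qed
  obtain u where u: "L2_tendsto V (\<lambda>k. f (r k)) u"
    using L2_complete[of V "\<lambda>k. f (r k)"] C1_V(1)[OF C1] F_Cauchy by blast
  obtain G where G: "L2_tendsto V (\<lambda>k. g (r k)) G"
    using L2_complete[of V "\<lambda>k. g (r k)"] C1_V(2)[OF C1] V_Cauchy by blast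
  have "\<exists>M. \<forall>i\<ge>M. \<forall>j\<ge>M. (LINT x|S. (norm (f (r i) x - f (r j) x))\<^sup>2) < e" if "0 < e" for e
  proof -
    have "0 < e / 2" using that by simp
    then obtain M where M: "\<And>i j. i \<ge> M \<Longrightarrow> j \<ge> M \<Longrightarrow> (LINT x|S. (f (r i) x - f (r j) x)\<^sup>2) \<le> e / 2"
      using S_Cauchy by meson
    have "(LINT x|S. (norm (f (r i) x - f (r j) x))\<^sup>2) < e" if "i \<ge> M" "j \<ge> M" for i j
      using M[OF that] \<open>0 < e\<close> by simp
    then show ?thesis by blast
  qed
  then obtain t where t: "L2_tendsto S (\<lambda>k. f (r k)) t"
    using L2_complete[of S "\<lambda>k. f (r k)"] C1_S[OF C1] by blast
  have "(\<lambda>k. LINT x|V. (norm (g (r k) x))\<^sup>2) \<longlonglongrightarrow> ?l"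
  proof (rule tendsto_sandwich)
    show "\<forall>\<^sub>F k in sequentially. ?l \<le> (LINT x|V. (norm (g (r k) x))\<^sup>2)" using E_ge by simp
    show "\<forall>\<^sub>F k in sequentially. (LINT x|V. (norm (g (r k) x))\<^sup>2) \<le> ?l + 1 / real (Suc k)"
      using E_near by (intro always_eventually allI less_imp_le)
    show "(\<lambda>k. ?l) \<longlonglongrightarrow> ?l" by simp
    have "(\<lambda>k. ?l + 1 / real (Suc k)) \<longlonglongrightarrow> ?l + 0"
      using LIMSEQ_inverse_real_of_nat by (intro tendsto_add tendsto_const) (simp add: inverse_eq_divide)
    then show "(\<lambda>k. ?l + 1 / real (Suc k)) \<longlonglongrightarrow> ?l" by simp
  qed
  then show ?thesis using that[of "\<lambda>k. f (r k)" "\<lambda>k. g (r k)"] adm N u G t by blast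
qed

lemma L2_integrable_scaleR:
  fixes a :: "'a \<Rightarrow> real" and b :: "'a \<Rightarrow> 'b::euclidean_space"
  assumes a: "L2 M a" and b: "L2 M b"
  shows "integrable M (\<lambda>x. a x *\<^sub>R b x)"
proof (rule Bochner_Integration.integrable_bound)
  show "integrable M (\<lambda>x. (norm (a x))\<^sup>2 + (norm (b x))\<^sup>2)"
    using assms by (intro Bochner_Integration.integrable_add L2_integrable_sq)
  show "(\<lambda>x. a x *\<^sub>R b x) \<in> borel_measurable M"
    using assms by (intro borel_measurable_scaleR L2_borel)
  show "AE x in M. norm (a x *\<^sub>R b x) \<le> norm ((norm (a x))\<^sup>2 + (norm (b x))\<^sup>2)"
  proof (rule AE_I2)
    fix x
    have "2 * (norm (a x) * norm (b x)) \<le> (norm (a x))\<^sup>2 + (norm (b x))\<^sup>2"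
      using sum_squares_bound[of "norm (a x)" "norm (b x)"] by simp
    moreover have "0 \<le> norm (a x) * norm (b x)" by simp
    ultimately have "norm (a x) * norm (b x) \<le> (norm (a x))\<^sup>2 + (norm (b x))\<^sup>2" by linarith
    then show "norm (a x *\<^sub>R b x) \<le> norm ((norm (a x))\<^sup>2 + (norm (b x))\<^sup>2)" by simp
  qed
qed

text \<open>
  Both sides of the integration by parts formula are inner products with a fixed function, and these
  are continuous in \<open>L\<^sup>2\<close>; hence weak gradients survive the limit.
\<close>

lemma H1_trace_limit:
  assumes C1: "\<And>k. C1_near K (f k) (g k)"
    and u: "L2_tendsto V f u" and G: "L2_tendsto V g G" and t: "L2_tendsto S f t"
  shows "H1_trace \<Omega> S u G t"
proof -
  have Lu: "L2 V u" and LG: "L2 V G" using u G by (simp_all add: L2_tendsto_def)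
  have "weak_gradient \<Omega> u G"
    unfolding weak_gradient_def
  proof (intro allI impI)
    fix \<phi> :: "real^'n \<Rightarrow> real" and h and A
    assume \<phi>: "C1_near UNIV \<phi> h" and A: "compact A" "A \<subseteq> \<Omega>" "\<forall>x. x \<notin> A \<longrightarrow> \<phi> x = 0"
    have \<phi>K: "C1_near K \<phi> h" by (rule C1_near_subset[OF \<phi>]) simp
    note L\<phi> = C1_V(1)[OF \<phi>K] and Lh = C1_V(2)[OF \<phi>K]
    have "(LINT x|V. u x *\<^sub>R h x) \<bullet> b = - (LINT x|V. \<phi> x *\<^sub>R G x) \<bullet> b" for b
    proof -
      have cont: "continuous_on K (\<lambda>x. h x \<bullet> b)" "continuous_on K (\<lambda>x. \<phi> x *\<^sub>R b)"
        using C1_near_continuous[OF \<phi>K] by (auto intro!: continuous_intros)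
      have "(\<lambda>k. LINT x|V. f k x \<bullet> (h x \<bullet> b)) \<longlonglongrightarrow> (LINT x|V. u x \<bullet> (h x \<bullet> b))"
        by (rule L2_tendsto_inner[OF u L2_tendsto_const[OF L2_V[OF cont(1)]]])
      also have "(LINT x|V. u x \<bullet> (h x \<bullet> b)) = (LINT x|V. (u x *\<^sub>R h x) \<bullet> b)" by simp
      also have "\<dots> = (LINT x|V. u x *\<^sub>R h x) \<bullet> b"
        by (rule integral_inner_left) (rule L2_integrable_scaleR[OF Lu Lh])
      finally have 1: "(\<lambda>k. LINT x|V. f k x \<bullet> (h x \<bullet> b)) \<longlonglongrightarrow> (LINT x|V. u x *\<^sub>R h x) \<bullet> b" .
      have "(\<lambda>k. LINT x|V. g k x \<bullet> (\<phi> x *\<^sub>R b)) \<longlonglongrightarrow> (LINT x|V. G x \<bullet> (\<phi> x *\<^sub>R b))"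
        by (rule L2_tendsto_inner[OF G L2_tendsto_const[OF L2_V[OF cont(2)]]])
      also have "(LINT x|V. G x \<bullet> (\<phi> x *\<^sub>R b)) = (LINT x|V. (\<phi> x *\<^sub>R G x) \<bullet> b)" by simp
      also have "\<dots> = (LINT x|V. \<phi> x *\<^sub>R G x) \<bullet> b"
        by (rule integral_inner_left) (rule L2_integrable_scaleR[OF L\<phi> LG])
      finally have 2: "(\<lambda>k. - (LINT x|V. g k x \<bullet> (\<phi> x *\<^sub>R b))) \<longlonglongrightarrow> - ((LINT x|V. \<phi> x *\<^sub>R G x) \<bullet> b)"
        by (rule tendsto_minus)
      have "(LINT x|V. f k x \<bullet> (h x \<bullet> b)) = - (LINT x|V. g k x \<bullet> (\<phi> x *\<^sub>R b))" for k
      proof -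
        have "weak_gradient \<Omega> (f k) (g k)" by (rule weak_gradient_C1[OF C1_near_subset[OF C1 \<Omega>_subset_K] open_\<Omega>])
        then have w: "(LINT x|V. f k x *\<^sub>R h x) = - (LINT x|V. \<phi> x *\<^sub>R g k x)"
          using \<phi> A unfolding weak_gradient_def by blast
        have "(LINT x|V. f k x \<bullet> (h x \<bullet> b)) = (LINT x|V. (f k x *\<^sub>R h x) \<bullet> b)" by simp
        also have "\<dots> = (LINT x|V. f k x *\<^sub>R h x) \<bullet> b"
          by (rule integral_inner_left) (rule L2_integrable_scaleR[OF C1_V(1)[OF C1] Lh])
        also have "\<dots> = - ((LINT x|V. \<phi> x *\<^sub>R g k x) \<bullet> b)" unfolding w by simp
        also have "(LINT x|V. \<phi> x *\<^sub>R g k x) \<bullet> b = (LINT x|V. (\<phi> x *\<^sub>R g k x) \<bullet> b)"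
          by (rule integral_inner_left[symmetric]) (rule L2_integrable_scaleR[OF L\<phi> C1_V(2)[OF C1]])
        also have "\<dots> = (LINT x|V. g k x \<bullet> (\<phi> x *\<^sub>R b))" by simp
        finally show ?thesis .
      qed
      then have "(LINT x|V. u x *\<^sub>R h x) \<bullet> b = - ((LINT x|V. \<phi> x *\<^sub>R G x) \<bullet> b)"
        using LIMSEQ_unique[OF 1] 2 by simp
      then show ?thesis by simp
    qed
    then show "(LINT x|V. u x *\<^sub>R h x) = - (LINT x|V. \<phi> x *\<^sub>R G x)"
      by (rule euclidean_eqI)
  qed
  then show ?thesis
    unfolding H1_trace_def H1_def closure_\<Omega> using Lu LG C1 u G t by blast
qed

lemma H1_trace_approx:
  assumes "H1_trace \<Omega> S u G t"
  obtains f g where "\<And>k. C1_near K (f k) (g k)" "L2_tendsto V f u" "L2_tendsto V g G" "L2_tendsto S f t"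
  using assms unfolding H1_trace_def closure_\<Omega> by blast

lemma H1_trace_C1: "C1_near K v h \<Longrightarrow> H1_trace \<Omega> S v h v"
  by (rule H1_trace_limit[of "\<lambda>_. v" "\<lambda>_. h"]) (auto intro: L2_tendsto_const C1_V C1_S)

lemma L2_tendsto_add_scaled:
  assumes f: "L2_tendsto M f u" and h: "L2_tendsto M h v"
  shows "L2_tendsto M (\<lambda>k x. f k x + s *\<^sub>R h k x) (\<lambda>x. u x + s *\<^sub>R v x)"
  unfolding L2_tendsto_def
proof (intro conjI allI)
  have L: "\<And>k. L2 M (f k)" "L2 M u" "\<And>k. L2 M (h k)" "L2 M v"
    and lim: "(\<lambda>k. LINT x|M. (norm (f k x - u x))\<^sup>2) \<longlonglongrightarrow> 0" "(\<lambda>k. LINT x|M. (norm (h k x - v x))\<^sup>2) \<longlonglongrightarrow> 0"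
    using f h by (auto simp: L2_tendsto_def)
  show "L2 M (\<lambda>x. f k x + s *\<^sub>R h k x)" for k by (rule L2_add_scaled(1)[OF L(1,3)])
  show "L2 M (\<lambda>x. u x + s *\<^sub>R v x)" by (rule L2_add_scaled(1)[OF L(2,4)])
  show "(\<lambda>k. LINT x|M. (norm (f k x + s *\<^sub>R h k x - (u x + s *\<^sub>R v x)))\<^sup>2) \<longlonglongrightarrow> 0"
  proof (rule tendsto_sandwich)
    show "\<forall>\<^sub>F k in sequentially. 0 \<le> (LINT x|M. (norm (f k x + s *\<^sub>R h k x - (u x + s *\<^sub>R v x)))\<^sup>2)"
      by (simp add: LINT_nonneg_sq)
    show "\<forall>\<^sub>F k in sequentially. (LINT x|M. (norm (f k x + s *\<^sub>R h k x - (u x + s *\<^sub>R v x)))\<^sup>2)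
      \<le> 2 * (LINT x|M. (norm (f k x - u x))\<^sup>2) + 2 * (s\<^sup>2 * (LINT x|M. (norm (h k x - v x))\<^sup>2))"
    proof (intro always_eventually allI)
      fix k
      have L0: "L2 M (\<lambda>x. s *\<^sub>R v x - s *\<^sub>R h k x)"
        using L2_add_scaled(1)[OF L2_diff[OF L(3,3), of k k] L2_diff[OF L(3,4), of k], of "- s"] by (simp add: algebra_simps)
      have "(LINT x|M. (norm ((f k x - u x) - (s *\<^sub>R v x - s *\<^sub>R h k x)))\<^sup>2)
        \<le> 2 * (LINT x|M. (norm (f k x - u x))\<^sup>2) + 2 * (LINT x|M. (norm (s *\<^sub>R v x - s *\<^sub>R h k x))\<^sup>2)"
        by (rule LINT_diff_sq_le[OF L2_diff[OF L(1,2)] L0])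
      moreover have "(f k x - u x) - (s *\<^sub>R v x - s *\<^sub>R h k x) = f k x + s *\<^sub>R h k x - (u x + s *\<^sub>R v x)" for x
        by (simp add: algebra_simps)
      moreover have "(LINT x|M. (norm (s *\<^sub>R v x - s *\<^sub>R h k x))\<^sup>2) = s\<^sup>2 * (LINT x|M. (norm (h k x - v x))\<^sup>2)"
        unfolding LINT_scaled[of M s "\<lambda>x. h k x - v x", symmetric]
        by (simp add: scaleR_diff_right norm_minus_commute)
      ultimately show "(LINT x|M. (norm (f k x + s *\<^sub>R h k x - (u x + s *\<^sub>R v x)))\<^sup>2)
        \<le> 2 * (LINT x|M. (norm (f k x - u x))\<^sup>2) + 2 * (s\<^sup>2 * (LINT x|M. (norm (h k x - v x))\<^sup>2))" by simp
    qed
    show "(\<lambda>k. 2 * (LINT x|M. (norm (f k x - u x))\<^sup>2) + 2 * (s\<^sup>2 * (LINT x|M. (norm (h k x - v x))\<^sup>2))) \<longlonglongrightarrow> 0"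
      using tendsto_add[OF tendsto_mult_left[OF lim(1), of 2] tendsto_mult_left[OF tendsto_mult_left[OF lim(2), of "s\<^sup>2"], of 2]] by simp
  qed simp
qed

lemma H1_trace_add_scaled:
  assumes u: "H1_trace \<Omega> S u G t" and v: "H1_trace \<Omega> S v H s"
  shows "H1_trace \<Omega> S (\<lambda>x. u x + c *\<^sub>R v x) (\<lambda>x. G x + c *\<^sub>R H x) (\<lambda>x. t x + c *\<^sub>R s x)"
proof -
  obtain f g where f: "\<And>k. C1_near K (f k) (g k)" "L2_tendsto V f u" "L2_tendsto V g G" "L2_tendsto S f t"
    using H1_trace_approx[OF u] by blast
  obtain p q where p: "\<And>k. C1_near K (p k) (q k)" "L2_tendsto V p v" "L2_tendsto V q H" "L2_tendsto S p s"
    using H1_trace_approx[OF v] by blast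
  have "C1_near K (\<lambda>x. f k x + c *\<^sub>R p k x) (\<lambda>x. g k x + c *\<^sub>R q k x)" for k
    using C1_near_lincomb[OF f(1) p(1), of 1 k c k] by simp
  then show ?thesis
    by (rule H1_trace_limit[OF _ L2_tendsto_add_scaled[OF f(2) p(2)] L2_tendsto_add_scaled[OF f(3) p(3)] L2_tendsto_add_scaled[OF f(4) p(4)]])
qed

lemma H1_trace_L2:
  assumes "H1_trace \<Omega> S u G t"
  shows "L2 V u" "L2 V G" "L2 S t"
  using assms by (auto simp: H1_trace_def H1_def L2_tendsto_def)

abbreviation "surf \<equiv> LINT x|S. 1 :: real"

lemma surf_pos: "0 < surf"
proof -
  have "surf = R2 ^ (CARD('n) - 1) * (LINT w|(sph :: (real^'n) measure). 1)"
    by (rule integral_sphere_measure) (use R2 in auto)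
  also have "(LINT w|(sph :: (real^'n) measure). 1 :: real) = sph_area TYPE('n)"
    by (simp add: sph_area_def space_sph)
  finally show ?thesis using R2 sph_area_pos[where 'n='n] by simp
qed

text \<open>
  Replacing a function by its deviation from the boundary mean leaves the energy unchanged. In this form
  the inequality holds without a constraint, and so it can be varied freely.
\<close>

lemma rayleigh_C1:
  assumes C1: "C1_near K f g"
  shows "rayleigh_inf * ((LINT x|S. (f x)\<^sup>2) - (LINT x|S. f x)\<^sup>2 / surf) \<le> (LINT x|V. (norm (g x))\<^sup>2)"
proof -
  define m where "m = (LINT x|S. f x) / surf"
  have int: "integrable S f" "integrable S (\<lambda>_. c)" for c :: real
    using L2_integrable_inner[OF C1_S[OF C1] L2_one_S] finite_measure.integrable_const[OF finite_S] by simp_all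
  have "(LINT x|S. f x + (- m) * 1) = (LINT x|S. f x) + (- m) * surf"
    using int by (subst Bochner_Integration.integral_add) auto
  also have "\<dots> = 0" using surf_pos by (simp add: m_def)
  finally have "admissible (\<lambda>x. 1 * f x + (- m) * 1) (\<lambda>x. 1 *\<^sub>R g x + (- m) *\<^sub>R 0)"
    unfolding admissible_def by (intro conjI C1_near_lincomb C1 C1_near_const) simp
  from rayleigh_inf_le[OF this]
  have "rayleigh_inf * (LINT x|S. (f x + (- m) *\<^sub>R 1)\<^sup>2) \<le> (LINT x|V. (norm (g x))\<^sup>2)" by simp
  moreover have "(LINT x|S. (f x + (- m) *\<^sub>R 1)\<^sup>2) = (LINT x|S. (f x)\<^sup>2) - (LINT x|S. f x)\<^sup>2 / surf"
  proof -
    have "(LINT x|S. (f x + (- m) *\<^sub>R 1)\<^sup>2) = (LINT x|S. (f x)\<^sup>2) + 2 * (- m) * (LINT x|S. f x) + m\<^sup>2 * surf"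
      using L2_add_scaled(2)[OF C1_S[OF C1] L2_one_S, of "- m"] by simp
    also have "\<dots> = (LINT x|S. (f x)\<^sup>2) - (LINT x|S. f x)\<^sup>2 / surf"
      using surf_pos by (simp add: m_def power2_eq_square field_simps)
    finally show ?thesis .
  qed
  ultimately show ?thesis by simp
qed

lemma LINT_tendsto:
  fixes f :: "nat \<Rightarrow> real^'n \<Rightarrow> real"
  shows "L2_tendsto S f t \<Longrightarrow> (\<lambda>k. LINT x|S. f k x) \<longlonglongrightarrow> (LINT x|S. t x)"
  using L2_tendsto_inner[OF _ L2_tendsto_const[OF L2_one_S], of f t] by simp

lemma LINT_sq_tendsto:
  fixes f :: "nat \<Rightarrow> 'a \<Rightarrow> real"
  shows "L2_tendsto M f t \<Longrightarrow> (\<lambda>k. LINT x|M. (f k x)\<^sup>2) \<longlonglongrightarrow> (LINT x|M. (t x)\<^sup>2)"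
  using L2_tendsto_sq[of M f t] by simp

lemma rayleigh_H1:
  assumes "H1_trace \<Omega> S u G t"
  shows "rayleigh_inf * ((LINT x|S. (t x)\<^sup>2) - (LINT x|S. t x)\<^sup>2 / surf) \<le> (LINT x|V. (norm (G x))\<^sup>2)"
proof -
  obtain f g where f: "\<And>k. C1_near K (f k) (g k)" "L2_tendsto V f u" "L2_tendsto V g G" "L2_tendsto S f t"
    using H1_trace_approx[OF assms] by blast
  have "(\<lambda>k. rayleigh_inf * ((LINT x|S. (f k x)\<^sup>2) - (LINT x|S. f k x)\<^sup>2 / surf)) \<longlonglongrightarrow> rayleigh_inf * ((LINT x|S. (t x)\<^sup>2) - (LINT x|S. t x)\<^sup>2 / surf)"
    using surf_pos by (intro tendsto_intros LINT_tendsto LINT_sq_tendsto f) simp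
  then show ?thesis
    by (rule LIMSEQ_le[OF _ L2_tendsto_sq[OF f(3)]]) (use rayleigh_C1[OF f(1)] in auto)
qed

lemma solution_iff:
  "steklov_neumann_solution R1 R2 y \<mu> u G t \<longleftrightarrow> H1_trace \<Omega> S u G t \<and>
    (\<forall>v H s. H1_trace \<Omega> S v H s \<longrightarrow> (LINT x|V. G x \<bullet> H x) = \<mu> * (LINT x|S. t x * s x))"
  by (simp add: steklov_neumann_solution_def Let_def)

text \<open>
  The minimiser turns the inequality of \<open>rayleigh_H1\<close> into an equality, and the quadratic polynomial
  obtained by varying it in the direction of an arbitrary test function is nonnegative with value zero at
  zero. Its linear coefficient, which vanishes, is the defect of the weak equation.
\<close>

lemma rayleigh_inf_eigenvalue: "steklov_neumann_eigenvalue R1 R2 y rayleigh_inf"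
proof -
  let ?l = rayleigh_inf
  obtain f g u G t where adm: "\<And>k. admissible (f k) (g k)" and N: "\<And>k. (LINT x|S. (f k x)\<^sup>2) = 1"
    and E: "(\<lambda>k. LINT x|V. (norm (g k x))\<^sup>2) \<longlonglongrightarrow> ?l"
    and u: "L2_tendsto V f u" and G: "L2_tendsto V g G" and t: "L2_tendsto S f t"
    using minimiser_limit by blast
  have C1: "C1_near K (f k) (g k)" and M: "(LINT x|S. f k x) = 0" for k using adm by (simp_all add: admissible_def)
  have H: "H1_trace \<Omega> S u G t" by (rule H1_trace_limit[OF C1 u G t])
  have t0: "(LINT x|S. t x) = 0" using LIMSEQ_unique[OF LINT_tendsto[OF t]] by (simp add: M)
  have t1: "(LINT x|S. (t x)\<^sup>2) = 1" using LIMSEQ_unique[OF LINT_sq_tendsto[OF t]] by (simp add: N)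
  have EG: "(LINT x|V. (norm (G x))\<^sup>2) = ?l" by (rule LIMSEQ_unique[OF L2_tendsto_sq[OF G] E])
  have "(LINT x|V. G x \<bullet> W x) = ?l * (LINT x|S. t x * s x)" if v: "H1_trace \<Omega> S v W s" for v W s
  proof -
    define b where "b = (LINT x|V. G x \<bullet> W x) - ?l * (LINT x|S. t x * s x)"
    define a where "a = (LINT x|V. (norm (W x))\<^sup>2) - ?l * ((LINT x|S. (s x)\<^sup>2) - (LINT x|S. s x)\<^sup>2 / surf)"
    have q: "0 \<le> 2 * c * b + c\<^sup>2 * a" for c
    proof -
      have 1: "?l * ((LINT x|S. (t x + c *\<^sub>R s x)\<^sup>2) - (LINT x|S. t x + c *\<^sub>R s x)\<^sup>2 / surf) \<le> (LINT x|V. (norm (G x + c *\<^sub>R W x))\<^sup>2)"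
        by (rule rayleigh_H1[OF H1_trace_add_scaled[OF H v]])
      have 2: "(LINT x|V. (norm (G x + c *\<^sub>R W x))\<^sup>2) = ?l + 2 * c * (LINT x|V. G x \<bullet> W x) + c\<^sup>2 * (LINT x|V. (norm (W x))\<^sup>2)"
        using L2_add_scaled(2)[OF H1_trace_L2(2)[OF H] H1_trace_L2(2)[OF v], of c] EG by simp
      have 3: "(LINT x|S. (t x + c *\<^sub>R s x)\<^sup>2) = 1 + 2 * c * (LINT x|S. t x * s x) + c\<^sup>2 * (LINT x|S. (s x)\<^sup>2)"
        using L2_add_scaled(2)[OF H1_trace_L2(3)[OF H] H1_trace_L2(3)[OF v], of c] t1 by simp
      have "integrable S t" "integrable S s"
        using L2_integrable_inner[OF H1_trace_L2(3)[OF H] L2_one_S] L2_integrable_inner[OF H1_trace_L2(3)[OF v] L2_one_S] by simp_all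
      then have 4: "(LINT x|S. t x + c *\<^sub>R s x) = c * (LINT x|S. s x)" using t0 by simp
      show ?thesis using 1 unfolding 2 3 4 by (simp add: a_def b_def algebra_simps power_mult_distrib)
    qed
    have "b\<^sup>2 \<le> 0 * a"
    proof (rule quadratic_nonneg_discriminant)
      show "0 \<le> 0 + 2 * c * b + c\<^sup>2 * a" for c using q[of c] by simp
    qed
    then have "b = 0" by simp
    then show ?thesis by (simp add: b_def)
  qed
  then have sol: "steklov_neumann_solution R1 R2 y ?l u G t" using H unfolding solution_iff by blast
  have "\<not> (AE x in V. u x = 0)"
  proof
    assume "AE x in V. u x = 0"
    then have u0: "(LINT x|V. (u x)\<^sup>2) = 0"
      by (subst integral_eq_zero_AE) auto
    \<comment> \<open>If \<open>u\<close> vanished, the trace inequality would bound the unit boundary norm by the energy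
      times an arbitrarily small constant.\<close>
    define c where "c = 2 * R2 ^ (CARD('n) - 1) / a0 ^ (CARD('n) - 1)"
    have c: "0 < c" using R2 a0 by (simp add: c_def)
    define \<delta> where "\<delta> = min (R2 - a0) (1 / (2 * c * ?l))"
    have "0 < 1 / (2 * c * ?l)" using c rayleigh_inf_pos by simp
    then have \<delta>: "0 < \<delta>" "\<delta> \<le> R2 - a0" "\<delta> \<le> 1 / (2 * c * ?l)" using a0 unfolding \<delta>_def by (simp_all only: min_less_iff_conj min.cobounded1 min.cobounded2) auto
    have "1 \<le> 4 * R2 ^ (CARD('n) - 1) / a0 ^ (CARD('n) - 1) / \<delta> * 0 + 2 * R2 ^ (CARD('n) - 1) / a0 ^ (CARD('n) - 1) * \<delta> * ?l"
    proof (rule LIMSEQ_le)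
      show "(\<lambda>k. 1) \<longlonglongrightarrow> (1 :: real)" by simp
      show "(\<lambda>k. 4 * R2 ^ (CARD('n) - 1) / a0 ^ (CARD('n) - 1) / \<delta> * (LINT x|V. (f k x)\<^sup>2) + 2 * R2 ^ (CARD('n) - 1) / a0 ^ (CARD('n) - 1) * \<delta> * (LINT x|V. (norm (g k x))\<^sup>2))
        \<longlonglongrightarrow> 4 * R2 ^ (CARD('n) - 1) / a0 ^ (CARD('n) - 1) / \<delta> * 0 + 2 * R2 ^ (CARD('n) - 1) / a0 ^ (CARD('n) - 1) * \<delta> * ?l"
        using LINT_sq_tendsto[OF u] u0 by (intro tendsto_add tendsto_mult_left E) simp
      show "\<exists>N. \<forall>k\<ge>N. 1 \<le> 4 * R2 ^ (CARD('n) - 1) / a0 ^ (CARD('n) - 1) / \<delta> * (LINT x|V. (f k x)\<^sup>2) + 2 * R2 ^ (CARD('n) - 1) / a0 ^ (CARD('n) - 1) * \<delta> * (LINT x|V. (norm (g k x))\<^sup>2)"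
        using trace_le_L2_energy[OF \<delta>(1,2) C1] unfolding N by blast
    qed
    then have "1 \<le> c * \<delta> * ?l" by (simp add: c_def)
    moreover have "\<delta> * (2 * c * ?l) \<le> 1" using \<delta>(3) c rayleigh_inf_pos by (simp add: pos_le_divide_eq)
    ultimately show False by (simp add: mult_ac)
  qed
  then show ?thesis unfolding steklov_neumann_eigenvalue_def using sol by blast
qed

text \<open>
  Testing with a constant shows that the trace has mean zero, and testing with the solution itself
  identifies the eigenvalue as its Rayleigh quotient. The quotient makes sense because a solution with
  vanishing trace has vanishing energy and is therefore zero.
\<close>

lemma rayleigh_inf_le_eigenvalue:
  assumes \<mu>: "0 < \<mu>" and ev: "steklov_neumann_eigenvalue R1 R2 y \<mu>"
  shows "rayleigh_inf \<le> \<mu>"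
proof -
  obtain u G t where H: "H1_trace \<Omega> S u G t"
    and weak: "\<And>v W s. H1_trace \<Omega> S v W s \<Longrightarrow> (LINT x|V. G x \<bullet> W x) = \<mu> * (LINT x|S. t x * s x)"
    and nz: "\<not> (AE x in V. u x = 0)"
    using ev unfolding steklov_neumann_eigenvalue_def solution_iff by blast
  have "\<mu> * (LINT x|S. t x * 1) = 0"
    using weak[OF H1_trace_C1[OF C1_near_const[of K 1]]] by simp
  then have t0: "(LINT x|S. t x) = 0" using \<mu> by simp
  have E: "(LINT x|V. (norm (G x))\<^sup>2) = \<mu> * (LINT x|S. (t x)\<^sup>2)"
    using weak[OF H] by (simp only: power2_norm_eq_inner[symmetric] power2_eq_square[symmetric])
  have N: "(LINT x|S. (t x)\<^sup>2) \<noteq> 0"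
  proof
    assume t: "(LINT x|S. (t x)\<^sup>2) = 0"
    obtain C where "0 < C" and L: "\<And>f g. C1_near K f g \<Longrightarrow> (LINT x|V. (f x)\<^sup>2) \<le> C * ((LINT x|S. (f x)\<^sup>2) + (LINT x|V. (norm (g x))\<^sup>2))"
      by (rule L2_le_boundary_energy) (rule that)
    obtain f g where f: "\<And>k. C1_near K (f k) (g k)" "L2_tendsto V f u" "L2_tendsto V g G" "L2_tendsto S f t"
      using H1_trace_approx[OF H] by blast
    have "(LINT x|V. (u x)\<^sup>2) \<le> C * ((LINT x|S. (t x)\<^sup>2) + (LINT x|V. (norm (G x))\<^sup>2))"
    proof (rule LIMSEQ_le[OF LINT_sq_tendsto[OF f(2)]])
      show "(\<lambda>k. C * ((LINT x|S. (f k x)\<^sup>2) + (LINT x|V. (norm (g k x))\<^sup>2))) \<longlonglongrightarrow> C * ((LINT x|S. (t x)\<^sup>2) + (LINT x|V. (norm (G x))\<^sup>2))"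
        by (intro tendsto_mult_left tendsto_add LINT_sq_tendsto L2_tendsto_sq f)
    qed (use L[OF f(1)] in blast)
    then have "(LINT x|V. (u x)\<^sup>2) \<le> 0" by (simp add: E t)
    moreover have "0 \<le> (LINT x|V. (u x)\<^sup>2)" using LINT_nonneg_sq[of V u] by simp
    ultimately have "(LINT x|V. (u x)\<^sup>2) = 0" by (rule antisym)
    moreover have "integrable V (\<lambda>x. (u x)\<^sup>2)" using L2_integrable_sq[OF H1_trace_L2(1)[OF H]] by simp
    ultimately have "AE x in V. (u x)\<^sup>2 = 0"
      using integral_nonneg_eq_0_iff_AE[of V "\<lambda>x. (u x)\<^sup>2"] by simp
    then show False using nz by simp
  qed
  then have "0 < (LINT x|S. (t x)\<^sup>2)" using LINT_nonneg_sq[of S t] by (intro less_le[THEN iffD2] conjI) auto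
  moreover have "rayleigh_inf * (LINT x|S. (t x)\<^sup>2) \<le> \<mu> * (LINT x|S. (t x)\<^sup>2)"
    using rayleigh_H1[OF H] t0 E by simp
  ultimately show ?thesis by simp
qed

theorem mu1_eq_rayleigh_inf: "mu1 R1 R2 y = rayleigh_inf"
  unfolding mu1_def
  by (rule Least_equality) (use rayleigh_inf_pos rayleigh_inf_eigenvalue rayleigh_inf_le_eigenvalue in blast)+

end

section \<open>A Gauss law\<close>

lemma DERIV_max_0_sq: "((\<lambda>s. (max 0 s)\<^sup>2) has_real_derivative 2 * max 0 s) (at (s :: real))"
proof -
  consider "s < 0" | "s = 0" | "0 < s" by linarith
  then show ?thesis
  proof cases
    case 1
    have "((\<lambda>s. 0) has_real_derivative 0) (at s)" by simp
    then have "((\<lambda>s. (max 0 s)\<^sup>2) has_real_derivative 0) (at s)"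
      by (rule has_field_derivative_transform_within_open[where S = "{..<0}"]) (use 1 in auto)
    then show ?thesis using 1 by simp
  next
    case 2
    have "((\<lambda>h. ((max 0 h)\<^sup>2) / h) \<longlongrightarrow> 0) (at (0 :: real))"
    proof (rule Lim_null_comparison)
      have "norm ((max 0 h)\<^sup>2 / h) \<le> \<bar>h\<bar>" for h :: real
        by (cases "h \<le> 0") (auto simp: max_def power2_eq_square)
      then show "\<forall>\<^sub>F h in at 0. norm ((max 0 h)\<^sup>2 / h) \<le> \<bar>h\<bar>" by simp
      show "((\<lambda>h. \<bar>h\<bar>) \<longlongrightarrow> 0) (at (0 :: real))" by (rule tendsto_rabs_zero) simp
    qed
    then show ?thesis unfolding 2 DERIV_def by simp
  next
    case 3
    have "((\<lambda>s. s\<^sup>2) has_real_derivative 2 * s) (at s)" by (auto intro!: derivative_eq_intros)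
    then have "((\<lambda>s. (max 0 s)\<^sup>2) has_real_derivative 2 * s) (at s)"
      by (rule has_field_derivative_transform_within_open[where S = "{0<..}"]) (use 3 in auto)
    then show ?thesis using 3 by simp
  qed
qed

text \<open>
  Squares of positive parts have a continuous derivative, which makes their quotient a step function of
  class \<open>C\<^sup>1\<close>.
\<close>

lemma smooth_step_exists:
  assumes "A < (B :: real)"
  obtains H \<kappa> where "\<And>s. (H has_real_derivative \<kappa> s) (at s)" "continuous_on UNIV \<kappa>" "\<And>s. 0 \<le> \<kappa> s"
    "\<And>s. s \<le> A \<Longrightarrow> H s = 0 \<and> \<kappa> s = 0" "\<And>s. B \<le> s \<Longrightarrow> H s = (1 :: real) \<and> \<kappa> s = 0"
proof
  let ?p = "\<lambda>s. max 0 (s - A)" and ?q = "\<lambda>s. max 0 (B - s)"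
  let ?\<kappa> = "\<lambda>s. 2 * ?p s * ?q s * (?p s + ?q s) / ((?p s)\<^sup>2 + (?q s)\<^sup>2)\<^sup>2"
  have pos: "0 < (?p s)\<^sup>2 + (?q s)\<^sup>2" for s
  proof (cases "A < s")
    case True
    then have "0 < (?p s)\<^sup>2" by simp
    then show ?thesis by (rule add_pos_nonneg) simp
  next
    case False
    then have "0 < (?q s)\<^sup>2" using assms by simp
    then show ?thesis by (rule add_nonneg_pos[rotated]) simp
  qed
  show "((\<lambda>s. (?p s)\<^sup>2 / ((?p s)\<^sup>2 + (?q s)\<^sup>2)) has_real_derivative ?\<kappa> s) (at s)" for s
  proof -
    have p: "((\<lambda>s. (?p s)\<^sup>2) has_real_derivative 2 * ?p s * 1) (at s)"
      by (rule DERIV_chain2[OF DERIV_max_0_sq]) (auto intro!: derivative_eq_intros)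
    have q: "((\<lambda>s. (?q s)\<^sup>2) has_real_derivative 2 * ?q s * - 1) (at s)"
      by (rule DERIV_chain2[OF DERIV_max_0_sq]) (auto intro!: derivative_eq_intros)
    show ?thesis
    proof (rule DERIV_cong[OF DERIV_divide[OF p DERIV_add[OF p q]]])
      show "(?p s)\<^sup>2 + (?q s)\<^sup>2 \<noteq> 0" using less_imp_neq[OF pos[of s]] by (rule not_sym)
      show "(2 * ?p s * 1 * ((?p s)\<^sup>2 + (?q s)\<^sup>2) - (?p s)\<^sup>2 * (2 * ?p s * 1 + 2 * ?q s * - 1)) / (((?p s)\<^sup>2 + (?q s)\<^sup>2) * ((?p s)\<^sup>2 + (?q s)\<^sup>2)) = ?\<kappa> s"
        unfolding power2_eq_square[of "(?p s)\<^sup>2 + (?q s)\<^sup>2"]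
        by (rule arg_cong2[where f = "(/)"]) (simp_all add: power2_eq_square algebra_simps)
    qed
  qed
  show "continuous_on UNIV ?\<kappa>"
    using pos by (intro continuous_intros) (simp add: less_le)
  show "0 \<le> ?\<kappa> s" for s by (intro divide_nonneg_nonneg mult_nonneg_nonneg add_nonneg_nonneg) auto
  show "s \<le> A \<Longrightarrow> (?p s)\<^sup>2 / ((?p s)\<^sup>2 + (?q s)\<^sup>2) = 0 \<and> ?\<kappa> s = 0" for s by simp
  show "B \<le> s \<Longrightarrow> (?p s)\<^sup>2 / ((?p s)\<^sup>2 + (?q s)\<^sup>2) = 1 \<and> ?\<kappa> s = 0" for s using assms by simp
qed

text \<open>
  The integrand is the derivative of \<open>H\<close> along the ray, which starts where \<open>H\<close> is zero and ends where \<open>H\<close>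
  is one. It is nonnegative: once the ray is farther from \<open>y\<close> than its starting point, it moves away
  from \<open>y\<close>.
\<close>

lemma nn_integral_ray_step:
  fixes y w :: "'a::euclidean_space"
  assumes H: "\<And>s. (H has_real_derivative \<kappa> s) (at s)" and c\<kappa>: "continuous_on UNIV \<kappa>" and \<kappa>0: "\<And>s. 0 \<le> \<kappa> s"
    and A: "\<And>s. s \<le> A \<Longrightarrow> H s = 0 \<and> \<kappa> s = 0" and B: "\<And>s. B \<le> s \<Longrightarrow> H s = (1 :: real) \<and> \<kappa> s = 0"
    and w: "norm w = 1" and y: "(norm y)\<^sup>2 < A" and "A < B"
  shows "(\<integral>\<^sup>+r. ennreal (\<kappa> ((norm (r *\<^sub>R w - y))\<^sup>2) * (2 * ((r *\<^sub>R w - y) \<bullet> w))) * indicator {0<..} r \<partial>lborel) = 1"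
proof -
  define p where "p r = r\<^sup>2 - 2 * r * (w \<bullet> y) + (norm y)\<^sup>2" for r
  have ww: "w \<bullet> w = 1" using w by (simp add: norm_eq_1)
  have p: "(norm (r *\<^sub>R w - y))\<^sup>2 = p r" for r
    unfolding p_def power2_norm_eq_inner
    by (simp add: inner_diff_left inner_diff_right ww inner_commute[of y w] power2_eq_square algebra_simps)
  have d: "(r *\<^sub>R w - y) \<bullet> w = r - w \<bullet> y" for r
    by (simp add: inner_diff_left ww inner_commute[of y w])
  have ge: "0 \<le> \<kappa> (p r) * (2 * (r - w \<bullet> y))" if r: "0 \<le> r" for r
  proof (cases "p r \<le> A")
    case True
    then show ?thesis using A by simp
  next
    case False
    then have "0 < r * (r - 2 * (w \<bullet> y))" using y by (simp add: p_def power2_eq_square algebra_simps)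
    then have "0 < r - 2 * (w \<bullet> y)" using r by (simp add: zero_less_mult_iff)
    then have "0 \<le> r - w \<bullet> y" using r by (cases "0 \<le> w \<bullet> y") auto
    then show ?thesis using \<kappa>0 by simp
  qed
  have "(\<integral>\<^sup>+r. ennreal (\<kappa> (p r) * (2 * (r - w \<bullet> y))) * indicator {0..} r \<partial>lborel) = ennreal (1 - H (p 0))"
  proof (rule nn_integral_FTC_atLeast[where F = "\<lambda>r. H (p r)"])
    have "continuous_on UNIV (\<lambda>r. \<kappa> (p r) * (2 * (r - w \<bullet> y)))"
      unfolding p_def by (intro continuous_intros continuous_on_compose2[OF c\<kappa>]) auto
    then show "(\<lambda>r. \<kappa> (p r) * (2 * (r - w \<bullet> y))) \<in> borel_measurable borel" by (rule borel_measurable_continuous_onI)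
    show "((\<lambda>r. H (p r)) has_real_derivative \<kappa> (p r) * (2 * (r - w \<bullet> y))) (at r)" for r
    proof (rule DERIV_chain2[OF H])
      show "(p has_real_derivative 2 * (r - w \<bullet> y)) (at r)"
        unfolding p_def[abs_def] by (auto intro!: derivative_eq_intros simp: algebra_simps)
    qed
    show "((\<lambda>r. H (p r)) \<longlongrightarrow> 1) at_top"
    proof (rule tendsto_eventually)
      show "\<forall>\<^sub>F r in at_top. H (p r) = 1"
        using eventually_ge_at_top[of "norm y + sqrt \<bar>B\<bar>"]
      proof eventually_elim
        case (elim r)
        have "0 \<le> norm y + sqrt \<bar>B\<bar>" by (intro add_nonneg_nonneg) simp_all
        then have "0 \<le> r" using elim by linarith
        then have "norm (r *\<^sub>R w) = r" using w by simp
        then have "sqrt \<bar>B\<bar> \<le> norm (r *\<^sub>R w - y)" using norm_triangle_ineq2[of "r *\<^sub>R w" y] elim by linarith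
        then have "(sqrt \<bar>B\<bar>)\<^sup>2 \<le> (norm (r *\<^sub>R w - y))\<^sup>2" by (intro power_mono) simp_all
        then have "B \<le> p r" unfolding p by simp
        then show ?case using B by simp
      qed
    qed
  qed (rule ge)
  also have "H (p 0) = 0" using A[of "p 0"] y by (simp add: p_def)
  finally have 1: "(\<integral>\<^sup>+r. ennreal (\<kappa> (p r) * (2 * (r - w \<bullet> y))) * indicator {0..} r \<partial>lborel) = 1" by simp
  have "(\<integral>\<^sup>+r. ennreal (\<kappa> (p r) * (2 * (r - w \<bullet> y))) * indicator {0<..} r \<partial>lborel) = 1"
    unfolding 1[symmetric]
  proof (rule nn_integral_cong_AE)
    show "AE r in lborel. ennreal (\<kappa> (p r) * (2 * (r - w \<bullet> y))) * indicator {0<..} r = ennreal (\<kappa> (p r) * (2 * (r - w \<bullet> y))) * indicator {0..} r"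
      using AE_lborel_singleton[of "0 :: real"] by eventually_elim (auto simp: indicator_def)
  qed
  then show ?thesis unfolding p d .
qed

text \<open>
  The flux of the field \<open>x / norm x ^ n\<close> through the sphere around \<open>y\<close> is the area of the unit sphere,
  by Gauss's law; the statement is the lower bound. The field is integrated against the gradient of a step function
  \<open>H ((norm (x - y))^2)\<close> that rises in a thin shell around the sphere. In polar coordinates at the origin
  the singularity disappears and every ray contributes one. In polar coordinates at \<open>y\<close> the integral is
  an average of the fluxes through the spheres in the shell, which differ little from the flux at radius
  \<open>R\<close> by uniform continuity.
\<close>

lemma Gauss_law:
  fixes y :: "real^'n"
  assumes y: "norm y < R"
  shows "sph_area TYPE('n) \<le> (LINT w|sph. R ^ (CARD('n) - 1) * (w \<bullet> (y + R *\<^sub>R w) / norm (y + R *\<^sub>R w) ^ CARD('n)))"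
    and "integrable sph (\<lambda>w. R ^ (CARD('n) - 1) * (w \<bullet> (y + R *\<^sub>R w) / norm (y + R *\<^sub>R w) ^ CARD('n)))"
proof -
  define k where "k \<rho> w = \<rho> ^ (CARD('n) - 1) * (w \<bullet> (y + \<rho> *\<^sub>R w) / norm (y + \<rho> *\<^sub>R w) ^ CARD('n))" for \<rho> and w :: "real^'n"
  have mk[measurable]: "k \<rho> \<in> borel_measurable borel" for \<rho> unfolding k_def by measurable
  have R: "0 < R" using y norm_ge_zero[of y] by linarith
  define r0 where "r0 = (norm y + R) / 2"
  have r0: "norm y < r0" "r0 < R" using y by (auto simp: r0_def)
  let ?C = "{r0..R + 1} \<times> sphere (0 :: real^'n) 1"
  have nz: "y + \<rho> *\<^sub>R w \<noteq> 0" if "norm w = 1" "norm y < \<rho>" for \<rho> w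
  proof
    assume "y + \<rho> *\<^sub>R w = 0"
    then have "y = - (\<rho> *\<^sub>R w)" by (simp add: eq_neg_iff_add_eq_0)
    then have "norm y = \<bar>\<rho>\<bar>" using that(1) by simp
    then show False using that(2) by simp
  qed
  have ck: "continuous_on ?C (\<lambda>(\<rho>, w). k \<rho> w)"
    unfolding k_def case_prod_beta using nz r0 by (intro continuous_intros) auto
  have cC: "compact ?C" by (intro compact_Times) auto
  obtain b where b: "\<And>z. z \<in> ?C \<Longrightarrow> \<bar>case z of (\<rho>, w) \<Rightarrow> k \<rho> w\<bar> \<le> b"
  proof -
    have "bounded ((\<lambda>(\<rho>, w). k \<rho> w) ` ?C)" by (rule compact_imp_bounded[OF compact_continuous_image[OF ck cC]])
    then show ?thesis using that unfolding bounded_iff by (metis imageI real_norm_def)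
  qed
  have ik: "integrable sph (k R)"
    by (rule integrable_sph_bounded[OF mk, of R b]) (use b[of "(R, _)"] r0 in auto)
  have kpos: "0 \<le> k \<rho> w" if "norm w = 1" "norm y < \<rho>" for \<rho> w
  proof -
    have "\<bar>w \<bullet> y\<bar> \<le> norm y" using Cauchy_Schwarz_ineq2[of w y] that by simp
    then have "0 \<le> w \<bullet> (y + \<rho> *\<^sub>R w)" using that by (simp add: inner_add_right norm_eq_1)
    moreover have "0 \<le> \<rho>" using that norm_ge_zero[of y] by linarith
    ultimately show ?thesis unfolding k_def by (intro mult_nonneg_nonneg divide_nonneg_nonneg) auto
  qed
  have "sph_area TYPE('n) \<le> (LINT w|sph. k R w) + e * sph_area TYPE('n)" if e: "0 < e" for e
  proof -
    obtain d where d: "0 < d" and unif: "\<And>z z'. z \<in> ?C \<Longrightarrow> z' \<in> ?C \<Longrightarrow> dist z' z < d \<Longrightarrow> dist (case z' of (\<rho>, w) \<Rightarrow> k \<rho> w) (case z of (\<rho>, w) \<Rightarrow> k \<rho> w) < e"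
      using compact_uniformly_continuous[OF ck cC] e unfolding uniformly_continuous_on_def by metis
    define a where "a = max r0 (R - d)"
    define b1 where "b1 = R + min 1 d / 2"
    have ab: "r0 \<le> a" "R - d \<le> a" "a < R" "R < b1" "b1 < R + d" "b1 \<le> R + 1" using r0 d by (auto simp: a_def b1_def)
    have a0: "0 \<le> a" "norm y < a" using r0 ab norm_ge_zero[of y] by linarith+
    have sq: "(norm y)\<^sup>2 < a\<^sup>2" "a\<^sup>2 < b1\<^sup>2" using a0 ab by (intro power_strict_mono; simp)+
    obtain H \<kappa> where H: "\<And>s. (H has_real_derivative \<kappa> s) (at s)" and c\<kappa>: "continuous_on UNIV \<kappa>" and \<kappa>0: "\<And>s. 0 \<le> \<kappa> s"
      and A: "\<And>s. s \<le> a\<^sup>2 \<Longrightarrow> H s = 0 \<and> \<kappa> s = 0" and B: "\<And>s. b1\<^sup>2 \<le> s \<Longrightarrow> H s = (1 :: real) \<and> \<kappa> s = 0"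
      using smooth_step_exists[OF sq(2)] by blast
    have [measurable]: "\<kappa> \<in> borel_measurable borel" by (rule borel_measurable_continuous_onI[OF c\<kappa>])
    have ray: "(\<integral>\<^sup>+r. ennreal (\<kappa> ((norm (r *\<^sub>R w - z))\<^sup>2) * (2 * ((r *\<^sub>R w - z) \<bullet> w))) * indicator {0<..} r \<partial>lborel) = 1"
      if "norm w = 1" "(norm z)\<^sup>2 < a\<^sup>2" for w z :: "real^'n"
      by (rule nn_integral_ray_step[where A = "a\<^sup>2" and B = "b1\<^sup>2" and H = H, OF H c\<kappa> \<kappa>0]) (use A B that sq(2) in blast)+
    define F where "F x = ennreal (\<kappa> ((norm (x - y))\<^sup>2) * (2 * ((x - y) \<bullet> x) / norm x ^ CARD('n)))" for x :: "real^'n"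
    have mF[measurable]: "F \<in> borel_measurable borel" unfolding F_def by measurable
    have n1: "CARD('n) = Suc (CARD('n) - 1)" by simp
    have "(\<integral>\<^sup>+x. F x \<partial>lborel) = (\<integral>\<^sup>+w. \<integral>\<^sup>+r. F (0 + r *\<^sub>R w) * ennreal (r ^ (CARD('n) - 1)) * indicator {0<..} r \<partial>lborel \<partial>sph)"
      by (rule nn_integral_polar_rays) measurable
    also have "\<dots> = (\<integral>\<^sup>+w. 1 \<partial>(sph :: (real^'n) measure))"
    proof (rule nn_integral_cong_AE)
      show "AE w in (sph :: (real^'n) measure). (\<integral>\<^sup>+r. F (0 + r *\<^sub>R w) * ennreal (r ^ (CARD('n) - 1)) * indicator {0<..} r \<partial>lborel) = 1"
        using AE_sph_norm
      proof eventually_elim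
        case (elim w)
        have "(\<integral>\<^sup>+r. F (0 + r *\<^sub>R w) * ennreal (r ^ (CARD('n) - 1)) * indicator {0<..} r \<partial>lborel)
          = (\<integral>\<^sup>+r. ennreal (\<kappa> ((norm (r *\<^sub>R w - y))\<^sup>2) * (2 * ((r *\<^sub>R w - y) \<bullet> w))) * indicator {0<..} r \<partial>lborel)"
        proof (rule nn_integral_cong)
          fix r :: real
          show "F (0 + r *\<^sub>R w) * ennreal (r ^ (CARD('n) - 1)) * indicator {0<..} r = ennreal (\<kappa> ((norm (r *\<^sub>R w - y))\<^sup>2) * (2 * ((r *\<^sub>R w - y) \<bullet> w))) * indicator {0<..} r"
          proof (cases "0 < r")
            case True
            have pw: "r ^ CARD('n) = r * r ^ (CARD('n) - 1)" by (subst n1) (simp only: power_Suc)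
            have "\<kappa> ((norm (r *\<^sub>R w - y))\<^sup>2) * (2 * ((r *\<^sub>R w - y) \<bullet> (r *\<^sub>R w)) / norm (r *\<^sub>R w) ^ CARD('n)) * r ^ (CARD('n) - 1)
              = \<kappa> ((norm (r *\<^sub>R w - y))\<^sup>2) * (2 * ((r *\<^sub>R w - y) \<bullet> w))"
              using True elim unfolding norm_scaleR inner_scaleR_right by (simp add: pw)
            then show ?thesis using True by (simp add: F_def ennreal_mult''[symmetric])
          qed simp
        qed
        also have "\<dots> = 1" by (rule ray[OF elim sq(1)])
        finally show ?case .
      qed
    qed
    also have "\<dots> = ennreal (sph_area TYPE('n))"
      by (simp add: sph_area_def sph.emeasure_eq_measure)
    finally have I1: "(\<integral>\<^sup>+x. F x \<partial>lborel) = ennreal (sph_area TYPE('n))" .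
    let ?J = "\<integral>\<^sup>+w. ennreal (k R w + e) \<partial>sph"
    have "(\<integral>\<^sup>+x. F x \<partial>lborel) = (\<integral>\<^sup>+r. (\<integral>\<^sup>+w. F (y + r *\<^sub>R w) \<partial>sph) * ennreal (r ^ (CARD('n) - 1)) * indicator {0<..} r \<partial>lborel)"
      by (rule nn_integral_polar) measurable
    also have "\<dots> \<le> (\<integral>\<^sup>+r. ?J * (ennreal (\<kappa> (r\<^sup>2) * (2 * r)) * indicator {0<..} r) \<partial>lborel)"
    proof (rule nn_integral_mono)
      fix r :: real
      show "(\<integral>\<^sup>+w. F (y + r *\<^sub>R w) \<partial>sph) * ennreal (r ^ (CARD('n) - 1)) * indicator {0<..} r \<le> ?J * (ennreal (\<kappa> (r\<^sup>2) * (2 * r)) * indicator {0<..} r)"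
      proof (cases "0 < r")
        case r: True
        have "(\<integral>\<^sup>+w. F (y + r *\<^sub>R w) \<partial>sph) * ennreal (r ^ (CARD('n) - 1)) = (\<integral>\<^sup>+w. F (y + r *\<^sub>R w) * ennreal (r ^ (CARD('n) - 1)) \<partial>sph)"
          by (rule nn_integral_multc[symmetric]) measurable
        also have "\<dots> \<le> (\<integral>\<^sup>+w. ennreal (k R w + e) * ennreal (\<kappa> (r\<^sup>2) * (2 * r)) \<partial>sph)"
        proof (rule nn_integral_mono_AE)
          show "AE w in sph. F (y + r *\<^sub>R w) * ennreal (r ^ (CARD('n) - 1)) \<le> ennreal (k R w + e) * ennreal (\<kappa> (r\<^sup>2) * (2 * r))"
            using AE_sph_norm
          proof eventually_elim
            case (elim w)
            have nr: "norm (r *\<^sub>R w) = r" using r elim by simp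
            have e1: "F (y + r *\<^sub>R w) * ennreal (r ^ (CARD('n) - 1)) = ennreal (\<kappa> (r\<^sup>2) * (2 * r) * k r w)"
            proof -
              have "F (y + r *\<^sub>R w) * ennreal (r ^ (CARD('n) - 1)) = ennreal (\<kappa> ((norm (r *\<^sub>R w))\<^sup>2) * (2 * ((r *\<^sub>R w) \<bullet> (y + r *\<^sub>R w)) / norm (y + r *\<^sub>R w) ^ CARD('n)) * r ^ (CARD('n) - 1))"
                using r by (simp add: F_def ennreal_mult''[symmetric])
              also have "\<kappa> ((norm (r *\<^sub>R w))\<^sup>2) * (2 * ((r *\<^sub>R w) \<bullet> (y + r *\<^sub>R w)) / norm (y + r *\<^sub>R w) ^ CARD('n)) * r ^ (CARD('n) - 1) = \<kappa> (r\<^sup>2) * (2 * r) * k r w"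
                unfolding nr inner_scaleR_left by (simp add: k_def)
              finally show ?thesis .
            qed
            show ?case
            proof (cases "a < r \<and> r < b1")
              case True
              have "\<bar>r - R\<bar> < d" using True ab by linarith
              then have "dist (k r w) (k R w) < e"
                using unif[of "(R, w)" "(r, w)"] True ab r0 elim d by (simp add: dist_prod_def dist_real_def)
              then have le: "k r w \<le> k R w + e" by (simp add: dist_real_def)
              have nn: "0 \<le> k R w + e" "0 \<le> \<kappa> (r\<^sup>2) * (2 * r)" using kpos[OF elim y] e \<kappa>0[of "r\<^sup>2"] r by simp_all
              have "\<kappa> (r\<^sup>2) * (2 * r) * k r w \<le> (k R w + e) * (\<kappa> (r\<^sup>2) * (2 * r))"
                unfolding mult.commute[of "\<kappa> (r\<^sup>2) * (2 * r)" "k r w"] by (rule mult_right_mono[OF le nn(2)])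
              then show ?thesis
                unfolding e1 ennreal_mult[OF nn, symmetric] by (rule ennreal_leI)
            next
              case False
              then have "r\<^sup>2 \<le> a\<^sup>2 \<or> b1\<^sup>2 \<le> r\<^sup>2" using r a0 ab by (auto intro!: power_mono)
              then have "\<kappa> (r\<^sup>2) = 0" using A B by blast
              then show ?thesis unfolding e1 by simp
            qed
          qed
        qed
        also have "\<dots> = ?J * ennreal (\<kappa> (r\<^sup>2) * (2 * r))" by (rule nn_integral_multc) measurable
        finally show ?thesis using r by simp
      qed simp
    qed
    also have "\<dots> = ?J * (\<integral>\<^sup>+r. ennreal (\<kappa> (r\<^sup>2) * (2 * r)) * indicator {0<..} r \<partial>lborel)"
      by (rule nn_integral_cmult) measurable
    also have "(\<integral>\<^sup>+r. ennreal (\<kappa> (r\<^sup>2) * (2 * r)) * indicator {0<..} r \<partial>lborel) = 1"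
    proof -
      obtain w :: "real^'n" where w: "norm w = 1" using vector_choose_size[of 1] by auto
      have "0 < a" using a0 norm_ge_zero[of y] by linarith
      then have "(norm (0 :: real^'n))\<^sup>2 < a\<^sup>2" by simp
      from ray[OF w this] show ?thesis using w by (simp add: power_mult_distrib norm_eq_1)
    qed
    also have "?J * 1 = ennreal (LINT w|sph. k R w + e)"
    proof -
      have "AE w in (sph :: (real^'n) measure). 0 \<le> k R w + e" using AE_sph_norm by eventually_elim (use kpos y e in \<open>simp add: add_nonneg_nonneg\<close>)
      then show ?thesis using ik by (simp add: nn_integral_eq_integral)
    qed
    also have "(LINT w|(sph :: (real^'n) measure). k R w + e) = (LINT w|sph. k R w) + e * sph_area TYPE('n)"
      using ik by (simp add: sph_area_def)
    finally have le: "ennreal (sph_area TYPE('n)) \<le> ennreal ((LINT w|sph. k R w) + e * sph_area TYPE('n))" unfolding I1 .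
    have "0 \<le> (LINT w|sph. k R w)" by (rule integral_nonneg_AE) (use AE_sph_norm in eventually_elim, use kpos y in simp)
    then show ?thesis using le e sph_area_pos[where 'n='n] by (subst (asm) ennreal_le_iff) auto
  qed
  then have "sph_area TYPE('n) \<le> (LINT w|sph. k R w) + e" if "0 < e" for e
    using that sph_area_pos[where 'n='n] by (metis divide_pos_pos nonzero_eq_divide_eq order_less_irrefl)
  then have "sph_area TYPE('n) \<le> (LINT w|sph. k R w)" by (rule field_le_epsilon)
  then show "sph_area TYPE('n) \<le> (LINT w|sph. R ^ (CARD('n) - 1) * (w \<bullet> (y + R *\<^sub>R w) / norm (y + R *\<^sub>R w) ^ CARD('n)))"
    unfolding k_def .
  show "integrable sph (\<lambda>w. R ^ (CARD('n) - 1) * (w \<bullet> (y + R *\<^sub>R w) / norm (y + R *\<^sub>R w) ^ CARD('n)))"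
    using ik unfolding k_def .
qed

section \<open>The test functions\<close>

context pierced_ball
begin

text \<open>
  The coefficient of the dipole for which \<open>x_i + coupling * x_i / norm x ^ n\<close> has vanishing normal
  derivative on the sphere of radius \<open>R1\<close>.
\<close>

definition coupling :: real where
  "coupling = R1 ^ CARD('n) / (real CARD('n) - 1)"

definition test_fun :: "'n \<Rightarrow> real^'n \<Rightarrow> real" where
  "test_fun i x = (x - y) $ i + coupling * (x $ i / norm x ^ CARD('n))"

definition test_grad :: "'n \<Rightarrow> real^'n \<Rightarrow> real^'n" where
  "test_grad i x = (1 + coupling / norm x ^ CARD('n)) *\<^sub>R axis i 1 - (CARD('n) * coupling * x $ i / norm x ^ (CARD('n) + 2)) *\<^sub>R x"

lemma coupling_pos: "0 < coupling"
  using R1 dim by (simp add: coupling_def)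

lemma measurable_coord [measurable]:
  "(\<lambda>x :: real^'n. x $ i) \<in> borel_measurable borel" "(\<lambda>x :: real^'n. (x - c) $ i) \<in> borel_measurable borel"
  by (intro borel_measurable_continuous_onI continuous_intros)+

lemma test_fun_measurable [measurable]: "test_fun i \<in> borel_measurable borel"
  unfolding test_fun_def by measurable

lemma test_grad_measurable [measurable]: "test_grad i \<in> borel_measurable borel"
  unfolding test_grad_def by measurable

lemma C1_test_fun: "C1_near K (test_fun i) (test_grad i)"
  unfolding C1_near_def
proof (intro exI[of _ "- {0}"] conjI ballI)
  show "K \<subseteq> - {0}" using R1 by auto
  show "continuous_on (- {0}) (test_grad i)"
    unfolding test_grad_def by (intro continuous_intros) auto
  fix x :: "real^'n" assume "x \<in> - {0}"
  then have x: "x \<noteq> 0" by simp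
  have D: "((\<lambda>r. 1 / r ^ CARD('n)) has_real_derivative - (real CARD('n) / norm x ^ (CARD('n) + 1))) (at (norm x))"
  proof -
    have n1: "CARD('n) = Suc (CARD('n) - 1)" by simp
    have "((\<lambda>r. 1 / r ^ CARD('n)) has_real_derivative (0 * norm x ^ CARD('n) - 1 * (real CARD('n) * norm x ^ (CARD('n) - 1))) / (norm x ^ CARD('n) * norm x ^ CARD('n))) (at (norm x))"
    proof (rule DERIV_divide)
      show "((\<lambda>r. r ^ CARD('n)) has_real_derivative real CARD('n) * norm x ^ (CARD('n) - 1)) (at (norm x))"
        by (auto intro!: derivative_eq_intros)
    qed (use x in auto)
    also have "(0 * norm x ^ CARD('n) - 1 * (real CARD('n) * norm x ^ (CARD('n) - 1))) / (norm x ^ CARD('n) * norm x ^ CARD('n)) = - (real CARD('n) / norm x ^ (CARD('n) + 1))"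
    proof -
      have "norm x ^ CARD('n) = norm x * norm x ^ (CARD('n) - 1)" by (subst n1) (simp only: power_Suc)
      then show ?thesis using x by (simp add: field_simps)
    qed
    finally show ?thesis .
  qed
  have Gq: "GDERIV (\<lambda>x. 1 / norm x ^ CARD('n)) x :> (- (real CARD('n) / norm x ^ (CARD('n) + 1))) *\<^sub>R sgn x"
    by (rule GDERIV_DERIV_compose[OF GDERIV_norm[OF x] D])
  have Gx: "GDERIV (\<lambda>x. (x - c) $ i) x :> axis i 1" for c :: "real^'n"
    using C1_near_coord[of UNIV c i] unfolding C1_near_def by blast
  have Gm: "GDERIV (\<lambda>x. coupling * (x $ i * (1 / norm x ^ CARD('n)))) x :>
      coupling *\<^sub>R (x $ i *\<^sub>R ((- (real CARD('n) / norm x ^ (CARD('n) + 1))) *\<^sub>R sgn x) + (1 / norm x ^ CARD('n)) *\<^sub>R axis i 1) + (x $ i * (1 / norm x ^ CARD('n))) *\<^sub>R 0"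
    by (rule GDERIV_mult[OF GDERIV_const GDERIV_mult[OF _ Gq]]) (use Gx[of 0] in simp)
  have "GDERIV (\<lambda>x. (x - y) $ i + coupling * (x $ i * (1 / norm x ^ CARD('n)))) x :>
    axis i 1 + (coupling *\<^sub>R (x $ i *\<^sub>R ((- (real CARD('n) / norm x ^ (CARD('n) + 1))) *\<^sub>R sgn x) + (1 / norm x ^ CARD('n)) *\<^sub>R axis i 1) + (x $ i * (1 / norm x ^ CARD('n))) *\<^sub>R 0)"
    by (rule GDERIV_add[OF Gx Gm])
  also have "axis i 1 + (coupling *\<^sub>R (x $ i *\<^sub>R ((- (real CARD('n) / norm x ^ (CARD('n) + 1))) *\<^sub>R sgn x) + (1 / norm x ^ CARD('n)) *\<^sub>R axis i 1) + (x $ i * (1 / norm x ^ CARD('n))) *\<^sub>R 0) = test_grad i x"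
    unfolding test_grad_def sgn_div_norm
    by (simp add: scaleR_add_left scaleR_diff_right divide_inverse mult_ac)
  finally show "GDERIV (test_fun i) x :> test_grad i x" unfolding test_fun_def[abs_def] by simp
qed auto

text \<open>
  Only the sum over all coordinates is a function of \<open>norm x\<close>; this is why all \<open>n\<close> test functions are used
  at once.
\<close>

lemma sum_sq_test_grad:
  assumes "x \<noteq> 0"
  shows "(\<Sum>i\<in>UNIV. (norm (test_grad i x))\<^sup>2) = real CARD('n) + real CARD('n) * (real CARD('n) - 1) * coupling\<^sup>2 / (norm x ^ CARD('n))\<^sup>2"
proof -
  define q where "q = coupling / norm x ^ CARD('n)"
  define b where "b = CARD('n) * coupling / norm x ^ (CARD('n) + 2)"
  have bq: "b * (norm x)\<^sup>2 = CARD('n) * q"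
    using assms by (simp add: b_def q_def power_add power2_eq_square)
  have "(norm (test_grad i x))\<^sup>2 = (1 + q)\<^sup>2 - 2 * (1 + q) * b * (x $ i)\<^sup>2 + b\<^sup>2 * (norm x)\<^sup>2 * (x $ i)\<^sup>2" for i
  proof -
    have e: "test_grad i x = (1 + q) *\<^sub>R axis i 1 - (b * x $ i) *\<^sub>R x" by (simp add: test_grad_def q_def b_def)
    show ?thesis
      unfolding e power2_norm_eq_inner
      by (simp add: inner_diff_left inner_diff_right inner_axis inner_axis_axis inner_commute[of "axis _ _"] power2_eq_square algebra_simps)
  qed
  then have "(\<Sum>i\<in>UNIV. (norm (test_grad i x))\<^sup>2) = real CARD('n) * (1 + q)\<^sup>2 - 2 * (1 + q) * b * (\<Sum>i\<in>UNIV. (x $ i)\<^sup>2) + b\<^sup>2 * (norm x)\<^sup>2 * (\<Sum>i\<in>UNIV. (x $ i)\<^sup>2)"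
    by (simp add: sum.distrib sum_subtractf sum_distrib_left)
  also have "(\<Sum>i\<in>UNIV. (x $ i)\<^sup>2) = (norm x)\<^sup>2"
    unfolding norm_vec_def L2_set_def by (simp add: sum_nonneg)
  also have "real CARD('n) * (1 + q)\<^sup>2 - 2 * (1 + q) * b * (norm x)\<^sup>2 + b\<^sup>2 * (norm x)\<^sup>2 * (norm x)\<^sup>2
    = real CARD('n) * (1 + q)\<^sup>2 - 2 * (1 + q) * (b * (norm x)\<^sup>2) + (b * (norm x)\<^sup>2)\<^sup>2"
    by (simp add: power2_eq_square mult_ac)
  also have "\<dots> = real CARD('n) + real CARD('n) * (real CARD('n) - 1) * q\<^sup>2"
    unfolding bq by (simp add: power2_eq_square algebra_simps)
  finally show ?thesis by (simp add: q_def power_divide)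
qed

text \<open>
  The eccentric and the concentric domain have the same volume. The former has additional points only
  outside the ball of radius \<open>R2\<close> around the origin and the latter only inside, where the energy density
  is smaller and larger, respectively. The energy of the concentric domain is then an elementary radial integral.
\<close>

lemma energy_test_functions:
  "(\<Sum>i\<in>UNIV. LINT x|V. (norm (test_grad i x))\<^sup>2) \<le>
    sph_area TYPE('n) * (R2 ^ CARD('n) * (1 + coupling / R2 ^ CARD('n)) * (1 - (real CARD('n) - 1) * (coupling / R2 ^ CARD('n))))"
proof -
  define \<eta> where "\<eta> r = real CARD('n) + real CARD('n) * (real CARD('n) - 1) * coupling\<^sup>2 / (r ^ CARD('n))\<^sup>2" for r :: real
  have dim0: "0 \<le> real CARD('n) - 1" using dim by simp
  have \<eta>_nonneg: "0 \<le> \<eta> r" for r using dim0 by (simp add: \<eta>_def)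
  have \<eta>_antimono: "\<eta> s \<le> \<eta> r" if "0 < r" "r \<le> s" for r s
    unfolding \<eta>_def using that dim0 by (intro add_left_mono divide_left_mono power_mono mult_nonneg_nonneg mult_pos_pos zero_less_power) auto
  define \<Omega>0 where "\<Omega>0 = ball (0 :: real^'n) R2 - cball 0 R1"
  have [measurable]: "\<Omega>0 \<in> sets borel" by (simp add: \<Omega>0_def)
  have [measurable]: "\<eta> \<in> borel_measurable borel" unfolding \<eta>_def by measurable
  let ?e = "\<lambda>x :: real^'n. ennreal (\<eta> (norm x))"
  \<comment> \<open>The density decreases in \<open>norm x\<close>, so it exceeds its value at the radius \<open>R2\<close> exactly where
    the concentric domain can contain points that the other one lacks.\<close>
  have "(\<integral>\<^sup>+x. ?e x * indicator \<Omega> x \<partial>lborel) + ennreal (\<eta> R2) * emeasure lborel \<Omega>0 = (\<integral>\<^sup>+x. ?e x * indicator \<Omega> x + ennreal (\<eta> R2) * indicator \<Omega>0 x \<partial>lborel)"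
    by (subst nn_integral_add) (simp_all add: nn_integral_cmult)
  also have "\<dots> \<le> (\<integral>\<^sup>+x. ?e x * indicator \<Omega>0 x + ennreal (\<eta> R2) * indicator \<Omega> x \<partial>lborel)"
  proof (rule nn_integral_mono)
    fix x :: "real^'n"
    consider "x \<in> \<Omega> \<longleftrightarrow> x \<in> \<Omega>0" | "x \<in> \<Omega>" "x \<notin> \<Omega>0" | "x \<notin> \<Omega>" "x \<in> \<Omega>0" by blast
    then show "?e x * indicator \<Omega> x + ennreal (\<eta> R2) * indicator \<Omega>0 x \<le> ?e x * indicator \<Omega>0 x + ennreal (\<eta> R2) * indicator \<Omega> x"
    proof cases
      case 1
      then show ?thesis by (simp add: indicator_def)
    next
      case 2
      then have "R2 \<le> norm x" by (auto simp: \<Omega>0_def annular_domain_def)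
      then have "\<eta> (norm x) \<le> \<eta> R2" using R2 by (intro \<eta>_antimono) auto
      then show ?thesis using 2 by (simp add: ennreal_leI)
    next
      case 3
      then have "norm x \<le> R2" "0 < norm x" using R1 by (auto simp: \<Omega>0_def)
      then have "\<eta> R2 \<le> \<eta> (norm x)" by (intro \<eta>_antimono) auto
      then show ?thesis using 3 by (simp add: ennreal_leI)
    qed
  qed
  also have "\<dots> = (\<integral>\<^sup>+x. ?e x * indicator \<Omega>0 x \<partial>lborel) + ennreal (\<eta> R2) * emeasure lborel \<Omega>"
    by (subst nn_integral_add) (simp_all add: nn_integral_cmult)
  also have "emeasure lborel \<Omega> = emeasure lborel \<Omega>0"
  proof -
    have fin: "emeasure lborel (cball (0 :: real^'n) R1) \<noteq> \<infinity>" using emeasure_lborel_cball_finite[of "0 :: real^'n" R1] by simp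
    have sub: "cball 0 R1 \<subseteq> ball y R2"
    proof
      fix x :: "real^'n" assume "x \<in> cball 0 R1"
      then show "x \<in> ball y R2" using norm_triangle_ineq4[of y x] inside by (simp add: dist_norm)
    qed
    have "R1 < R2" using inside norm_ge_zero[of y] by linarith
    then have "cball 0 R1 \<subseteq> ball (0 :: real^'n) R2" by auto
    then have "emeasure lborel \<Omega>0 = emeasure lborel (ball (0 :: real^'n) R2) - emeasure lborel (cball (0 :: real^'n) R1)"
      unfolding \<Omega>0_def using fin by (intro emeasure_Diff) auto
    also have "emeasure lborel (ball (0 :: real^'n) R2) = emeasure lborel (ball y R2)"
      using R2 by (simp add: emeasure_ball)
    also have "\<dots> - emeasure lborel (cball (0 :: real^'n) R1) = emeasure lborel \<Omega>"
      unfolding annular_domain_def using fin sub by (intro emeasure_Diff[symmetric]) auto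
    finally show ?thesis by simp
  qed
  finally have "(\<integral>\<^sup>+x. ?e x * indicator \<Omega> x \<partial>lborel) + ennreal (\<eta> R2) * emeasure lborel \<Omega>0 \<le> (\<integral>\<^sup>+x. ?e x * indicator \<Omega>0 x \<partial>lborel) + ennreal (\<eta> R2) * emeasure lborel \<Omega>0" .
  moreover have "ennreal (\<eta> R2) * emeasure lborel \<Omega>0 \<noteq> \<infinity>"
  proof -
    have "emeasure lborel \<Omega>0 \<le> emeasure lborel (ball (0 :: real^'n) R2)" by (rule emeasure_mono) (auto simp: \<Omega>0_def)
    also have "\<dots> < \<infinity>" by (rule emeasure_lborel_ball_finite)
    finally show ?thesis by (simp add: ennreal_mult_eq_top_iff)
  qed
  ultimately have le: "(\<integral>\<^sup>+x. ?e x * indicator \<Omega> x \<partial>lborel) \<le> (\<integral>\<^sup>+x. ?e x * indicator \<Omega>0 x \<partial>lborel)"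
    unfolding add.commute[of _ "ennreal (\<eta> R2) * emeasure lborel \<Omega>0"] ennreal_add_left_cancel_le by blast
  define P where "P r = r ^ CARD('n) - (real CARD('n) - 1) * coupling\<^sup>2 / r ^ CARD('n)" for r :: real
  have R12: "R1 \<le> R2" using inside norm_ge_zero[of y] by linarith
  have PI: "(\<integral>\<^sup>+r. ennreal (\<eta> r * r ^ (CARD('n) - 1)) * indicator {R1..R2} r \<partial>lborel) = ennreal (P R2 - P R1)"
  proof (rule nn_integral_FTC_Icc)
    fix r assume "r \<in> {R1..R2}"
    then have r: "0 < r" using R1 by simp
    have d1: "((\<lambda>r. r ^ CARD('n)) has_real_derivative real CARD('n) * r ^ (CARD('n) - 1)) (at r)"
      by (auto intro!: derivative_eq_intros)
    have "(P has_real_derivative real CARD('n) * r ^ (CARD('n) - 1) -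
        (0 * r ^ CARD('n) - (real CARD('n) - 1) * coupling\<^sup>2 * (real CARD('n) * r ^ (CARD('n) - 1))) / (r ^ CARD('n) * r ^ CARD('n))) (at r)"
      unfolding P_def[abs_def] by (rule DERIV_diff[OF d1 DERIV_divide[OF DERIV_const d1]]) (use r in simp)
    also have "real CARD('n) * r ^ (CARD('n) - 1) -
        (0 * r ^ CARD('n) - (real CARD('n) - 1) * coupling\<^sup>2 * (real CARD('n) * r ^ (CARD('n) - 1))) / (r ^ CARD('n) * r ^ CARD('n)) = \<eta> r * r ^ (CARD('n) - 1)"
      unfolding \<eta>_def power2_eq_square[of "r ^ CARD('n)"] by (simp add: distrib_left distrib_right mult_ac)
    finally show "(P has_real_derivative \<eta> r * r ^ (CARD('n) - 1)) (at r)" .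
    show "0 \<le> \<eta> r * r ^ (CARD('n) - 1)" using \<eta>_nonneg r by simp
  qed (use R12 in \<open>simp_all\<close>)
  have "(\<integral>\<^sup>+x. ?e x * indicator \<Omega>0 x \<partial>lborel) = (\<integral>\<^sup>+r. (\<integral>\<^sup>+w. ?e (0 + r *\<^sub>R w) * indicator \<Omega>0 (0 + r *\<^sub>R w) \<partial>sph) * ennreal (r ^ (CARD('n) - 1)) * indicator {0<..} r \<partial>lborel)"
    by (rule nn_integral_polar) measurable
  also have "\<dots> \<le> (\<integral>\<^sup>+r. ennreal (sph_area TYPE('n)) * (ennreal (\<eta> r * r ^ (CARD('n) - 1)) * indicator {R1..R2} r) \<partial>lborel)"
  proof (rule nn_integral_mono)
    fix r :: real
    show "(\<integral>\<^sup>+w. ?e (0 + r *\<^sub>R w) * indicator \<Omega>0 (0 + r *\<^sub>R w) \<partial>sph) * ennreal (r ^ (CARD('n) - 1)) * indicator {0<..} r \<le> ennreal (sph_area TYPE('n)) * (ennreal (\<eta> r * r ^ (CARD('n) - 1)) * indicator {R1..R2} r)"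
    proof (cases "0 < r")
      case r: True
      have "(\<integral>\<^sup>+w. ?e (0 + r *\<^sub>R w) * indicator \<Omega>0 (0 + r *\<^sub>R w) \<partial>sph) \<le> (\<integral>\<^sup>+w. ennreal (\<eta> r) * indicator {R1..R2} r \<partial>(sph :: (real^'n) measure))"
      proof (rule nn_integral_mono_AE)
        show "AE w in sph. ?e (0 + r *\<^sub>R w) * indicator \<Omega>0 (0 + r *\<^sub>R w) \<le> ennreal (\<eta> r) * indicator {R1..R2} r"
          using AE_sph_norm by eventually_elim (use r in \<open>auto simp: indicator_def \<Omega>0_def\<close>)
      qed
      also have "\<dots> = ennreal (sph_area TYPE('n)) * (ennreal (\<eta> r) * indicator {R1..R2} r)"
        by (simp add: sph_area_def sph.emeasure_eq_measure mult.commute)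
      finally have "(\<integral>\<^sup>+w. ?e (0 + r *\<^sub>R w) * indicator \<Omega>0 (0 + r *\<^sub>R w) \<partial>sph) * ennreal (r ^ (CARD('n) - 1)) \<le> ennreal (sph_area TYPE('n)) * (ennreal (\<eta> r) * indicator {R1..R2} r) * ennreal (r ^ (CARD('n) - 1))"
        by (rule mult_right_mono) simp
      also have "\<dots> = ennreal (sph_area TYPE('n)) * ((ennreal (\<eta> r) * ennreal (r ^ (CARD('n) - 1))) * indicator {R1..R2} r)"
        by (simp only: mult_ac)
      also have "ennreal (\<eta> r) * ennreal (r ^ (CARD('n) - 1)) = ennreal (\<eta> r * r ^ (CARD('n) - 1))"
        by (rule ennreal_mult[symmetric]) (use r \<eta>_nonneg in auto)
      finally show ?thesis using r by simp
    qed simp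
  qed
  also have "\<dots> = ennreal (sph_area TYPE('n)) * (\<integral>\<^sup>+r. ennreal (\<eta> r * r ^ (CARD('n) - 1)) * indicator {R1..R2} r \<partial>lborel)"
    by (rule nn_integral_cmult) measurable
  also have "\<dots> = ennreal (sph_area TYPE('n)) * ennreal (P R2 - P R1)" unfolding PI ..
  finally have I: "(\<integral>\<^sup>+x. ?e x * indicator \<Omega> x \<partial>lborel) \<le> ennreal (sph_area TYPE('n)) * ennreal (P R2 - P R1)"
    using le by (rule order_trans[rotated])
  have P0: "0 \<le> P R2 - P R1"
  proof -
    have "R1 ^ CARD('n) \<le> R2 ^ CARD('n)" using R1 R12 by (intro power_mono) auto
    moreover have "(real CARD('n) - 1) * coupling\<^sup>2 / R2 ^ CARD('n) \<le> (real CARD('n) - 1) * coupling\<^sup>2 / R1 ^ CARD('n)"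
      using R1 R2 R12 dim0 by (intro divide_left_mono power_mono mult_nonneg_nonneg mult_pos_pos zero_less_power) auto
    ultimately show ?thesis by (simp add: P_def)
  qed
  have "ennreal (\<Sum>i\<in>UNIV. LINT x|V. (norm (test_grad i x))\<^sup>2) = (\<Sum>i\<in>UNIV. ennreal (LINT x|V. (norm (test_grad i x))\<^sup>2))"
    by (rule sum_ennreal[symmetric]) (rule LINT_nonneg_sq)
  also have "\<dots> = (\<Sum>i\<in>UNIV. \<integral>\<^sup>+x. ennreal ((norm (test_grad i x))\<^sup>2) * indicator \<Omega> x \<partial>lborel)"
    by (rule sum.cong[OF refl]) (rule nn_integral_V_sq[OF C1_near_continuous(2)[OF C1_test_fun], symmetric])
  also have "\<dots> = (\<integral>\<^sup>+x. (\<Sum>i\<in>UNIV. ennreal ((norm (test_grad i x))\<^sup>2) * indicator \<Omega> x) \<partial>lborel)"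
    by (rule nn_integral_sum[symmetric]) measurable
  also have "\<dots> = (\<integral>\<^sup>+x. ?e x * indicator \<Omega> x \<partial>lborel)"
  proof (rule nn_integral_cong)
    fix x :: "real^'n"
    show "(\<Sum>i\<in>UNIV. ennreal ((norm (test_grad i x))\<^sup>2) * indicator \<Omega> x) = ?e x * indicator \<Omega> x"
    proof (cases "x \<in> \<Omega>")
      case True
      then have "x \<noteq> 0" using R1 by (auto simp: annular_domain_def)
      then show ?thesis using True by (simp add: sum_ennreal sum_sq_test_grad \<eta>_def)
    qed simp
  qed
  also have "\<dots> \<le> ennreal (sph_area TYPE('n) * (P R2 - P R1))"
    using I sph_area_pos[where 'n='n] P0 by (simp add: ennreal_mult)
  finally have "(\<Sum>i\<in>UNIV. LINT x|V. (norm (test_grad i x))\<^sup>2) \<le> sph_area TYPE('n) * (P R2 - P R1)"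
    using sph_area_pos[where 'n='n] P0 by (subst (asm) ennreal_le_iff) auto
  also have "P R2 - P R1 = R2 ^ CARD('n) * (1 + coupling / R2 ^ CARD('n)) * (1 - (real CARD('n) - 1) * (coupling / R2 ^ CARD('n)))"
  proof -
    have nz: "real CARD('n) - 1 \<noteq> 0" using dim by simp
    have R1n: "R1 ^ CARD('n) = (real CARD('n) - 1) * coupling" using nz by (simp add: coupling_def)
    have e1: "P R1 = (real CARD('n) - 1) * coupling - coupling"
      unfolding P_def R1n using nz coupling_pos by (simp add: power2_eq_square)
    have e2: "P R2 = R2 ^ CARD('n) - (real CARD('n) - 1) * coupling * (coupling / R2 ^ CARD('n))"
      by (simp add: P_def power2_eq_square)
    have e3: "R2 ^ CARD('n) * (1 + coupling / R2 ^ CARD('n)) = R2 ^ CARD('n) + coupling"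
      using R2 by (simp add: distrib_left)
    have expand: "(T + c) * (1 - M * (c / T)) = T + c - M * c - M * c * (c / T)" if "T \<noteq> 0" for T c M :: real
      using that by (simp add: field_simps)
    have e4: "(R2 ^ CARD('n) + coupling) * (1 - (real CARD('n) - 1) * (coupling / R2 ^ CARD('n)))
      = R2 ^ CARD('n) + coupling - (real CARD('n) - 1) * coupling - (real CARD('n) - 1) * coupling * (coupling / R2 ^ CARD('n))"
      by (rule expand) (use R2 in simp)
    show ?thesis unfolding e1 e2 e3 e4 by simp
  qed
  finally show ?thesis .
qed

lemma LINT_S_sph:
  assumes [measurable]: "F \<in> borel_measurable borel"
  shows "(LINT x|S. F x) = R2 ^ (CARD('n) - 1) * (LINT w|sph. F (y + R2 *\<^sub>R w))"
  by (rule integral_sphere_measure) (use R2 in auto)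

lemma surf_eq: "surf = R2 ^ (CARD('n) - 1) * sph_area TYPE('n)"
  by (subst LINT_S_sph) (simp_all add: sph_area_def)

lemma LINT_coord: "(LINT x|S. (x - y) $ i) = 0"
  by (subst LINT_S_sph) (simp_all add: integral_sph_coord)

lemma LINT_coord_sq: "(LINT x|S. ((x - y) $ i)\<^sup>2) = R2\<^sup>2 * surf / real CARD('n)"
proof -
  have "(LINT x|S. ((x - y) $ i)\<^sup>2) = R2 ^ (CARD('n) - 1) * (LINT w|sph. (((y + R2 *\<^sub>R w) - y) $ i)\<^sup>2)"
    by (rule LINT_S_sph) measurable
  also have "(LINT w|sph. (((y + R2 *\<^sub>R w) - y) $ i)\<^sup>2) = R2\<^sup>2 * (LINT w|sph. (w :: real^'n) $ i * w $ i)"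
    by (simp add: power_mult_distrib power2_eq_square[of "_ $ _"])
  also have "\<dots> = R2\<^sup>2 * (sph_area TYPE('n) / real CARD('n))" by (subst integral_sph_coord_coord) simp
  finally show ?thesis unfolding surf_eq by simp
qed

text \<open>
  The square of the centred function minus \<open>\<theta> h\<close> has a nonnegative integral. In the concentric case
  \<open>f = \<theta> h\<close> on the sphere, so nothing is lost there.
\<close>

lemma centred_sq_ge:
  assumes f: "L2 S f" and h: "L2 S h" and h0: "(LINT x|S. h x) = 0"
  shows "2 * \<theta> * (LINT x|S. f x * h x) - \<theta>\<^sup>2 * (LINT x|S. (h x :: real)\<^sup>2) \<le> (LINT x|S. (f x)\<^sup>2) - (LINT x|S. f x)\<^sup>2 / surf"
proof -
  define m where "m = (LINT x|S. f x) / surf"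
  define p where "p x = f x + (- m) *\<^sub>R 1" for x
  have Lp: "L2 S p" unfolding p_def by (rule L2_add_scaled(1)[OF f L2_one_S])
  have int: "integrable S (\<lambda>x. f x * h x)" "integrable S h"
    using L2_integrable_inner[OF f h] L2_integrable_inner[OF h L2_one_S] by simp_all
  have "(LINT x|S. (p x)\<^sup>2) = (LINT x|S. (f x)\<^sup>2) + 2 * (- m) * (LINT x|S. f x) + m\<^sup>2 * surf"
    using L2_add_scaled(2)[OF f L2_one_S, of "- m"] by (simp add: p_def)
  also have "\<dots> = (LINT x|S. (f x)\<^sup>2) - (LINT x|S. f x)\<^sup>2 / surf"
    using surf_pos by (simp add: m_def power2_eq_square field_simps)
  finally have 1: "(LINT x|S. (p x)\<^sup>2) = (LINT x|S. (f x)\<^sup>2) - (LINT x|S. f x)\<^sup>2 / surf" .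
  have "(LINT x|S. p x * h x) = (LINT x|S. f x * h x + (- m) * h x)"
    by (simp add: p_def algebra_simps)
  also have "\<dots> = (LINT x|S. f x * h x) + (- m) * (LINT x|S. h x)"
    using int by (subst Bochner_Integration.integral_add) auto
  finally have 2: "(LINT x|S. p x * h x) = (LINT x|S. f x * h x)" using h0 by simp
  have "0 \<le> (LINT x|S. (norm (p x + (- \<theta>) *\<^sub>R h x))\<^sup>2)" by (rule LINT_nonneg_sq)
  also have "\<dots> = (LINT x|S. (p x)\<^sup>2) + 2 * (- \<theta>) * (LINT x|S. p x * h x) + \<theta>\<^sup>2 * (LINT x|S. (h x)\<^sup>2)"
    using L2_add_scaled(2)[OF Lp h, of "- \<theta>"] by simp
  finally show ?thesis unfolding 1 2 by simp
qed

lemma sum_test_fun_coord: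
  "R2 ^ (CARD('n) + 1) * (1 + coupling / R2 ^ CARD('n)) * sph_area TYPE('n) \<le> (\<Sum>i\<in>UNIV. LINT x|S. test_fun i x * (x - y) $ i)"
proof -
  let ?k = "\<lambda>w. R2 ^ (CARD('n) - 1) * (w \<bullet> (y + R2 *\<^sub>R w) / norm (y + R2 *\<^sub>R w) ^ CARD('n))"
  have y: "norm y < R2" using inside R1 by simp
  have n1: "CARD('n) = Suc (CARD('n) - 1)" by simp
  have pw: "R2 ^ CARD('n) = R2 * R2 ^ (CARD('n) - 1)" by (subst n1) (simp only: power_Suc)
  have cC: "continuous_on K (\<lambda>x. (x - y) $ i)" for i by (intro continuous_intros)
  have "(\<Sum>i\<in>UNIV. LINT x|S. test_fun i x * (x - y) $ i) = (LINT x|S. (\<Sum>i\<in>UNIV. test_fun i x * (x - y) $ i))"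
    using L2_integrable_inner[OF C1_S[OF C1_test_fun] L2_S[OF cC]] by (intro Bochner_Integration.integral_sum[symmetric]) simp
  also have "\<dots> = R2 ^ (CARD('n) - 1) * (LINT w|sph. (\<Sum>i\<in>UNIV. test_fun i (y + R2 *\<^sub>R w) * (y + R2 *\<^sub>R w - y) $ i))"
    by (rule LINT_S_sph) measurable
  also have "(LINT w|sph. (\<Sum>i\<in>UNIV. test_fun i (y + R2 *\<^sub>R w) * (y + R2 *\<^sub>R w - y) $ i))
    = (LINT w|sph. R2\<^sup>2 + coupling * R2 / R2 ^ (CARD('n) - 1) * ?k w)"
  proof (rule integral_cong_AE)
    show "AE w in sph. (\<Sum>i\<in>UNIV. test_fun i (y + R2 *\<^sub>R w) * (y + R2 *\<^sub>R w - y) $ i) = R2\<^sup>2 + coupling * R2 / R2 ^ (CARD('n) - 1) * ?k w"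
      using AE_sph_norm
    proof eventually_elim
      case (elim w)
      let ?x = "y + R2 *\<^sub>R w"
      have "(\<Sum>i\<in>UNIV. test_fun i ?x * (?x - y) $ i) = (\<Sum>i\<in>UNIV. R2\<^sup>2 * (w $ i * w $ i) + coupling * R2 / norm ?x ^ CARD('n) * (w $ i * ?x $ i))"
        by (rule sum.cong[OF refl]) (simp add: test_fun_def power2_eq_square add_divide_distrib algebra_simps)
      also have "\<dots> = R2\<^sup>2 * (\<Sum>i\<in>UNIV. w $ i * w $ i) + coupling * R2 / norm ?x ^ CARD('n) * (\<Sum>i\<in>UNIV. w $ i * ?x $ i)"
        by (simp only: sum.distrib sum_distrib_left)
      also have "\<dots> = R2\<^sup>2 * (w \<bullet> w) + coupling * R2 / norm ?x ^ CARD('n) * (w \<bullet> ?x)"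
        by (simp only: inner_vec_def inner_real_def)
      also have "\<dots> = R2\<^sup>2 + coupling * R2 / R2 ^ (CARD('n) - 1) * ?k w"
        using elim R2 by (simp add: norm_eq_1)
      finally show ?case .
    qed
  qed measurable
  also have "\<dots> = R2\<^sup>2 * sph_area TYPE('n) + coupling * R2 / R2 ^ (CARD('n) - 1) * (LINT w|sph. ?k w)"
  proof -
    have "(LINT w|sph. R2\<^sup>2 + coupling * R2 / R2 ^ (CARD('n) - 1) * ?k w) = (LINT w|(sph :: (real^'n) measure). R2\<^sup>2) + (LINT w|sph. coupling * R2 / R2 ^ (CARD('n) - 1) * ?k w)"
      by (rule Bochner_Integration.integral_add[OF sph.integrable_const integrable_mult_right[OF Gauss_law(2)[OF y]]])
    also have "(LINT w|sph. coupling * R2 / R2 ^ (CARD('n) - 1) * ?k w) = coupling * R2 / R2 ^ (CARD('n) - 1) * (LINT w|sph. ?k w)"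
      by (rule integral_mult_right_zero)
    finally show ?thesis by (simp only: lebesgue_integral_const space_sph sph_area_def real_scaleR_def mult.commute[of "R2\<^sup>2"])
  qed
  also have "R2 ^ (CARD('n) - 1) * \<dots> = R2 ^ (CARD('n) - 1) * R2\<^sup>2 * sph_area TYPE('n) + coupling * R2 * (LINT w|sph. ?k w)"
    using R2 by (simp add: distrib_left)
  also have "\<dots> \<ge> R2 ^ (CARD('n) - 1) * R2\<^sup>2 * sph_area TYPE('n) + coupling * R2 * sph_area TYPE('n)"
    using Gauss_law(1)[OF y] coupling_pos R2 by (intro add_left_mono mult_left_mono) auto
  also have "R2 ^ (CARD('n) - 1) * R2\<^sup>2 * sph_area TYPE('n) + coupling * R2 * sph_area TYPE('n) = R2 ^ (CARD('n) + 1) * (1 + coupling / R2 ^ CARD('n)) * sph_area TYPE('n)"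
  proof -
    have "R2 ^ (CARD('n) + 1) = R2 * R2 ^ CARD('n)" by simp
    moreover have "R2 * R2 ^ CARD('n) * (1 + coupling / R2 ^ CARD('n)) = R2 * R2 ^ CARD('n) + R2 * coupling"
      using R2 by (simp add: distrib_left)
    ultimately show ?thesis by (simp add: pw power2_eq_square algebra_simps)
  qed
  finally show ?thesis .
qed

text \<open>
  The choice \<open>\<theta> = 1 + c / R2^n\<close>, which is the boundary value of the concentric eigenfunction divided by
  the coordinate, makes the bound of the boundary term a multiple of \<open>\<theta>^2\<close>. One factor \<open>\<theta>\<close> cancels
  against the energy.
\<close>

lemma rayleigh_inf_le_concentric:
  "rayleigh_inf \<le> steklov_weight R1 (CARD('n) - 2) R2 / R2 ^ (CARD('n) - 1)"
proof -
  define q where "q = coupling / R2 ^ CARD('n)"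
  define \<theta> where "\<theta> = 1 + q"
  define D where "D = R2 ^ (CARD('n) + 1) * sph_area TYPE('n)"
  have q: "0 < q" using coupling_pos R2 by (simp add: q_def)
  have \<theta>: "0 < \<theta>" using q by (simp add: \<theta>_def)
  have D: "0 < D" using R2 sph_area_pos[where 'n='n] by (simp add: D_def)
  have n1: "CARD('n) = Suc (CARD('n) - 1)" by simp
  have pw: "R2 ^ CARD('n) = R2 * R2 ^ (CARD('n) - 1)" by (subst n1) (simp only: power_Suc)
  have cC: "continuous_on K (\<lambda>x. (x - y) $ i)" for i by (intro continuous_intros)
  let ?N = "\<lambda>i. (LINT x|S. (test_fun i x)\<^sup>2) - (LINT x|S. test_fun i x)\<^sup>2 / surf"
  have "(\<Sum>i\<in>UNIV. 2 * \<theta> * (LINT x|S. test_fun i x * (x - y) $ i) - \<theta>\<^sup>2 * (LINT x|S. ((x - y) $ i)\<^sup>2)) \<le> (\<Sum>i\<in>UNIV. ?N i)"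
    by (intro sum_mono centred_sq_ge C1_S[OF C1_test_fun] L2_S[OF cC] LINT_coord)
  moreover have "(\<Sum>i\<in>UNIV. 2 * \<theta> * (LINT x|S. test_fun i x * (x - y) $ i) - \<theta>\<^sup>2 * (LINT x|S. ((x - y) $ i)\<^sup>2))
    = 2 * \<theta> * (\<Sum>i\<in>UNIV. LINT x|S. test_fun i x * (x - y) $ i) - \<theta>\<^sup>2 * D"
  proof -
    have "(\<Sum>i\<in>(UNIV :: 'n set). \<theta>\<^sup>2 * (LINT x|S. ((x - y) $ i)\<^sup>2)) = \<theta>\<^sup>2 * D"
      unfolding LINT_coord_sq surf_eq D_def by (simp add: pw power2_eq_square)
    then show ?thesis by (simp only: sum_subtractf sum_distrib_left)
  qed
  moreover have "2 * \<theta> * (\<theta> * D) \<le> 2 * \<theta> * (\<Sum>i\<in>UNIV. LINT x|S. test_fun i x * (x - y) $ i)"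
    using sum_test_fun_coord \<theta> by (intro mult_left_mono) (simp_all add: D_def \<theta>_def q_def mult_ac)
  ultimately have N: "\<theta>\<^sup>2 * D \<le> (\<Sum>i\<in>UNIV. ?N i)" by (simp add: power2_eq_square)
  have "rayleigh_inf * (\<theta>\<^sup>2 * D) \<le> rayleigh_inf * (\<Sum>i\<in>UNIV. ?N i)"
    using N rayleigh_inf_pos by (intro mult_left_mono) auto
  also have "\<dots> = (\<Sum>i\<in>UNIV. rayleigh_inf * ?N i)" by (rule sum_distrib_left)
  also have "\<dots> \<le> (\<Sum>i\<in>UNIV. LINT x|V. (norm (test_grad i x))\<^sup>2)"
    by (intro sum_mono rayleigh_C1 C1_test_fun)
  also have "\<dots> \<le> sph_area TYPE('n) * (R2 ^ CARD('n) * \<theta> * (1 - (real CARD('n) - 1) * q))"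
    using energy_test_functions by (simp add: \<theta>_def q_def)
  also have "\<dots> = ((1 - (real CARD('n) - 1) * q) / (R2 * \<theta>)) * (\<theta>\<^sup>2 * D)"
    using R2 \<theta> by (simp add: D_def power2_eq_square field_simps)
  finally have "rayleigh_inf \<le> (1 - (real CARD('n) - 1) * q) / (R2 * \<theta>)"
    using \<theta> D by (simp only: mult_le_cancel_right) auto
  also have "\<dots> = steklov_weight R1 (CARD('n) - 2) R2 / R2 ^ (CARD('n) - 1)"
  proof -
    obtain m where m: "CARD('n) = m + 2" using dim by (metis add.commute le_Suc_ex)
    define M where "M = real (m + 1)"
    define s where "s = R1 ^ (m + 2)"
    define t where "t = R2 ^ (m + 2)"
    have pos: "0 < s" "0 < t" "0 < M" using R1 R2 by (auto simp: s_def t_def M_def)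
    have M: "real CARD('n) - 1 = M" by (simp add: m M_def)
    have q': "q = s / (M * t)" unfolding q_def coupling_def M by (simp add: m s_def t_def)
    have 1: "1 - M * q = (t - s) / t"
      unfolding q' using pos by (simp add: diff_divide_distrib)
    have 2: "\<theta> = (M * t + s) / (M * t)"
      unfolding \<theta>_def q' using pos by (simp add: add_divide_distrib)
    have den: "0 < M * t + s" using pos by (intro add_pos_pos mult_pos_pos) auto
    have "(1 - M * q) / (R2 * \<theta>) = M * (t - s) / (R2 * (M * t + s))"
      unfolding 1 2 using pos den R2 by (simp add: divide_simps)
    also have "\<dots> = (M * R2 ^ m * (t - s) / (M * t + s)) / R2 ^ (m + 1)"
      using R2 den by (simp add: divide_simps)
    also have "\<dots> = steklov_weight R1 (CARD('n) - 2) R2 / R2 ^ (CARD('n) - 1)"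
      unfolding steklov_weight_def by (simp add: m M_def s_def t_def)
    finally show ?thesis unfolding M .
  qed
  finally show ?thesis .
qed

end

theorem theorem1p1:
  fixes R1 R2 d :: real and k :: "'n::finite"
  assumes "CARD('n) \<ge> 2"
    and "0 < R1" and "R1 < R2" and "d \<ge> 0"
    and "closure (ball 0 R1) \<subseteq> ball (d *\<^sub>R axis k 1 :: real^'n) R2"
  shows "mu1 R1 R2 (d *\<^sub>R axis k 1 :: real^'n) \<le> mu1 R1 R2 (0 :: real^'n)"
proof -
  let ?e = "axis k 1 :: real^'n"
  have e: "norm ?e = 1" by (simp add: norm_axis_1)
  \<comment> \<open>The point of the hole that is farthest from the centre of the outer ball.\<close>
  have "- R1 *\<^sub>R ?e \<in> closure (ball 0 R1)" using assms(2) e by (simp add: closure_ball)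
  then have "dist (d *\<^sub>R ?e) (- R1 *\<^sub>R ?e) < R2" using assms(5) by auto
  moreover have "dist (d *\<^sub>R ?e) (- R1 *\<^sub>R ?e) = d + R1"
  proof -
    have "d *\<^sub>R ?e - (- R1 *\<^sub>R ?e) = (d + R1) *\<^sub>R ?e" by (simp add: scaleR_add_left)
    then show ?thesis using assms(2,4) e by (simp add: dist_norm)
  qed
  ultimately have "norm (d *\<^sub>R ?e) + R1 < R2" using assms(4) e by simp
  then interpret moved: pierced_ball R1 R2 "d *\<^sub>R ?e"
    using assms by unfold_locales auto
  interpret concentric: pierced_ball R1 R2 "0 :: real^'n"
    using assms by unfold_locales auto
  have "moved.rayleigh_inf \<le> steklov_weight R1 (CARD('n) - 2) R2 / R2 ^ (CARD('n) - 1)"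
    by (rule moved.rayleigh_inf_le_concentric)
  also have "\<dots> \<le> concentric.rayleigh_inf"
  proof (rule concentric.le_rayleigh_inf)
    fix f g assume "concentric.admissible f g"
    then show "steklov_weight R1 (CARD('n) - 2) R2 / R2 ^ (CARD('n) - 1) * (LINT x|sphere_measure (0 :: real^'n) R2. (f x)\<^sup>2)
      \<le> (LINT x|volume_on (annular_domain R1 R2 0). (norm (g x))\<^sup>2)"
      using concentric.spectral_gap[of f g] unfolding concentric.admissible_def norm_zero add_0 by blast
  qed
  finally show ?thesis
    unfolding moved.mu1_eq_rayleigh_inf concentric.mu1_eq_rayleigh_inf .
qed

end
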